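(* Let $\rho=\{\rho_N\}$ be an appropriate sequence of probability measures ($\rho_N$ on $\mathbb{GT}_N$) with limit functions $F_\rho,Q_\rho$. Fix reals $0<a_1\le a_2\le\dots\le a_n=1$. For signatures $\lambda\in\mathbb{GT}_{k_1}$, $\mu\in\mathbb{GT}_{k_2}$, $k_1\ge k_2$, define nonnegative coefficients $\mathrm{pr}_{k_1\to k_2}(\lambda\to\mu)$ by $$\frac{s_\lambda(x_1,\dots,x_{k_2},1^{k_1-k_2})}{s_\lambda(1^{k_1})}=\sum_{\mu\in\mathbb{GT}_{k_2}}\mathrm{pr}_{k_1\to k_2}(\lambda\to\mu)\frac{s_\mu(x_1,\dots,x_{k_2})}{s_\mu(1^{k_2})}.$$ Consider the random tuple $(\lambda^{(1)},\dots,\lambda^{(n)})\in\mathbb{GT}_{[a_1N]}\times\dots\times\mathbb{GT}_{[a_nN]}$ with $$\mathrm{Prob}(\lambda^{(1)},\dots,\lambda^{(n)})=\rho_N(\lambda^{(n)})\prod_{i=1}^{n-1}\mathrm{pr}_{[a_{i+1}N]\to[a_iN]}(\lambda^{(i+1)}\to\lambda^{(i)}),$$ and set $p_k^{[a_tN]}=\sum_{i=1}^{[a_tN]}(\lambda^{(t)}_i+[a_tN]-i)^k$. Then the collection $\{N^{-k}(p_k^{[a_tN]}-\mathbf E p_k^{[a_tN]})\}_{t=1,\dots,n;\,k\ge1}$ converges, as $N\to\infty$, in the sense of moments to a centered Gaussian vector with covariance, for $1\le t_1\le t_2\le n$, $$\lim_{N\to\infty}\frac{\mathrm{cov}(p_{k_1}^{[a_{t_1}N]},p_{k_2}^{[a_{t_2}N]})}{N^{k_1+k_2}}=\frac{a_{t_1}^{k_1}a_{t_2}^{k_2}}{(2\pi\mathbf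 i)^2}\oint_{|z|=\epsilon}\oint_{|w|=2\epsilon}\Big(\frac1z+1+\frac{(1+z)F_\rho(1+z)}{a_{t_1}}\Big)^{k_1}\Big(\frac1w+1+\frac{(1+w)F_\rho(1+w)}{a_{t_2}}\Big)^{k_2}Q_\rho(z,w)\,dz\,dw,$$ with counter-clockwise contours and $\epsilon>0$ small.
   Context: A signature of length $N$ is $\lambda=(\lambda_1\ge\dots\ge\lambda_N)\in\mathbb Z^N$; $\mathbb{GT}_N$ is the set of these; $s_\lambda$ denotes the Schur function $\det[x_i^{\lambda_j+N-j}]/\prod_{i<j}(x_i-x_j)$; $[\cdot]$ is the integer part. Schur generating function of a probability measure $\rho$ on $\mathbb{GT}_N$: $S_\rho(x)=\sum_\lambda\rho(\lambda)s_\lambda(x)/s_\lambda(1^N)$, assumed uniformly convergent near $(1^N)$. A sequence of symmetric functions $\{F_N\}$ is appropriate if there are reals $c_k,d_{k,l}$ with: $\log F_N$ holomorphic near $(1^N)$; $\lim N^{-1}\partial_i^k\log F_N|_{(1^N)}=c_k$ for fixed $i$; $\lim\partial_i^k\partial_j^l\log F_N|_{(1^N)}=d_{k,l}$ for fixed distinct $i,j$; $\lim\partial_{i_1}\cdots\partial_{i_s}\log F_N|_{(1^N)}=0$ whenever the fixed indices $i_1,\dots,i_s$ contain at least three distinct values; and $\sum_k\frac{c_k}{(k-1)!}(x-1)^{k-1}$, $\sum_{k,l}\frac{d_{k,l}}{(k-1)!(l-1)!}(x-1)^{k-1}(y-1)^{l-1}$ converge near $1$, $(1,1)$. A sequence of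 measures is appropriate if its Schur generating functions are; then $F_\rho(x)=\sum_k\frac{c_k}{(k-1)!}(x-1)^{k-1}$, $G_\rho(x,y)=\sum_{k,l}\frac{d_{k,l}}{(k-1)!(l-1)!}(x-1)^{k-1}(y-1)^{l-1}$, $Q_\rho(x,y)=G_\rho(1+x,1+y)+(x-y)^{-2}$. *)

theory Defs
  imports "HOL-Analysis.Analysis"
begin

text \<open>A signature of length N is a non-increasing list of N integers
  (lambda_1 >= ... >= lambda_N); list index i corresponds to lambda_(i+1).\<close>
definition GT :: "nat \<Rightarrow> int list set" where
  "GT N = {lam. length lam = N \<and> (\<forall>i j. i \<le> j \<and> j < N \<longrightarrow> lam ! j \<le> lam ! i)}"

text \<open>Points of C^N are represented as functions nat => complex; only the
  coordinates 0..N-1 matter.\<close>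
definition ones :: "nat \<Rightarrow> complex" where
  "ones = (\<lambda>_. 1)"

definition detN :: "nat \<Rightarrow> (nat \<Rightarrow> nat \<Rightarrow> complex) \<Rightarrow> complex" where
  "detN N M = (\<Sum>p | p permutes {..<N}. of_int (sign p) * (\<Prod>i<N. M i (p i)))"

definition schur_ratio :: "nat \<Rightarrow> int list \<Rightarrow> (nat \<Rightarrow> complex) \<Rightarrow> complex" where
  "schur_ratio N lam x =
     detN N (\<lambda>i j. x i powi (lam ! j + int N - 1 - int j)) /
     (\<Prod>i<N. \<Prod>j\<in>{i<..<N}. (x i - x j))"

definition generic_pts :: "nat \<Rightarrow> (nat \<Rightarrow> complex) set" where
  "generic_pts N = {y. \<forall>i<N. y i \<noteq> 0 \<and> (\<forall>j<N. i \<noteq> j \<longrightarrow> y i \<noteq> y j)}"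

text \<open>The Schur function: the ratio above at points with pairwise distinct
  nonzero coordinates, extended by continuity (the ratio is a Laurent polynomial)
  to all points with nonzero coordinates.\<close>
definition schur :: "nat \<Rightarrow> int list \<Rightarrow> (nat \<Rightarrow> complex) \<Rightarrow> complex" where
  "schur N lam x =
     (if x \<in> generic_pts N then schur_ratio N lam x
      else Lim (at x within generic_pts N) (schur_ratio N lam))"

definition prob_on_GT :: "nat \<Rightarrow> (int list \<Rightarrow> real) \<Rightarrow> bool" where
  "prob_on_GT N p \<longleftrightarrow> (\<forall>lam. 0 \<le> p lam) \<and> (\<forall>lam. lam \<notin> GT N \<longrightarrow> p lam = 0)
      \<and> (p has_sum 1) (GT N)"

definition sgf_term :: "nat \<Rightarrow> (int list \<Rightarrow> real) \<Rightarrow> int list \<Rightarrow> (nat \<Rightarrow> complex) \<Rightarrow> complex" where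
  "sgf_term N p lam x = of_real (p lam) * (schur N lam x / schur N lam ones)"

definition sgf :: "nat \<Rightarrow> (int list \<Rightarrow> real) \<Rightarrow> (nat \<Rightarrow> complex) \<Rightarrow> complex" where
  "sgf N p x = (\<Sum>\<^sub>\<infinity>lam\<in>GT N. sgf_term N p lam x)"

definition polydisc :: "nat \<Rightarrow> real \<Rightarrow> (nat \<Rightarrow> complex) set" where
  "polydisc N e = {x. \<forall>i<N. cmod (x i - 1) < e}"

definition sgf_unif_conv :: "nat \<Rightarrow> (int list \<Rightarrow> real) \<Rightarrow> bool" where
  "sgf_unif_conv N p \<longleftrightarrow> (\<exists>e>0.
     uniform_limit (polydisc N e) (\<lambda>A x. \<Sum>lam\<in>A. sgf_term N p lam x) (sgf N p)
        (finite_subsets_at_top (GT N)))"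

definition pderiv_at :: "nat \<Rightarrow> ((nat \<Rightarrow> complex) \<Rightarrow> complex) \<Rightarrow> (nat \<Rightarrow> complex) \<Rightarrow> complex" where
  "pderiv_at i f = (\<lambda>x. deriv (\<lambda>t. f (x(i := t))) (x i))"

fun pderivs :: "nat list \<Rightarrow> ((nat \<Rightarrow> complex) \<Rightarrow> complex) \<Rightarrow> (nat \<Rightarrow> complex) \<Rightarrow> complex" where
  "pderivs [] f = f"
| "pderivs (i # is) f = pderiv_at i (pderivs is f)"

text \<open>log F_N is holomorphic near (1^N): on some polydisc F_N has a logarithm L_N
  which is holomorphic there (holomorphic in each variable separately, which by
  Hartogs' theorem is the same as holomorphic).\<close>
definition holo_log :: "nat \<Rightarrow> ((nat \<Rightarrow> complex) \<Rightarrow> complex) \<Rightarrow> ((nat \<Rightarrow> complex) \<Rightarrow> complex) \<Rightarrow> bool" where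
  "holo_log N F L \<longleftrightarrow> (\<exists>e>0. \<forall>x\<in>polydisc N e. exp (L x) = F x \<and>
       (\<forall>i<N. (\<lambda>t. L (x(i := t))) field_differentiable at (x i)))"

definition appropriate :: "(nat \<Rightarrow> (nat \<Rightarrow> complex) \<Rightarrow> complex) \<Rightarrow> (nat \<Rightarrow> real) \<Rightarrow> (nat \<Rightarrow> nat \<Rightarrow> real) \<Rightarrow> bool" where
  "appropriate F c d \<longleftrightarrow> (\<exists>L. (\<forall>N. holo_log N (F N) (L N))
     \<and> (\<forall>i k. k \<ge> 1 \<longrightarrow>
          (\<lambda>N. pderivs (replicate k i) (L N) ones / of_nat N) \<longlonglongrightarrow> of_real (c k))
     \<and> (\<forall>i j k l. i \<noteq> j \<longrightarrow> k \<ge> 1 \<longrightarrow> l \<ge> 1 \<longrightarrow>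
          (\<lambda>N. pderivs (replicate k i @ replicate l j) (L N) ones) \<longlonglongrightarrow> of_real (d k l))
     \<and> (\<forall>is. card (set is) \<ge> 3 \<longrightarrow> (\<lambda>N. pderivs is (L N) ones) \<longlonglongrightarrow> 0)
     \<and> (\<exists>r>0. \<forall>x::complex. cmod (x - 1) < r \<longrightarrow>
          summable (\<lambda>k. of_real (c (k + 1) / fact k) * (x - 1) ^ k))
     \<and> (\<exists>r>0. \<forall>x y::complex. cmod (x - 1) < r \<longrightarrow> cmod (y - 1) < r \<longrightarrow>
          (\<lambda>(k, l). of_real (d (k + 1) (l + 1) / (fact k * fact l)) * (x - 1) ^ k * (y - 1) ^ l)
             summable_on UNIV))"

definition F_lim :: "(nat \<Rightarrow> real) \<Rightarrow> complex \<Rightarrow> complex" where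
  "F_lim c x = (\<Sum>k. of_real (c (k + 1) / fact k) * (x - 1) ^ k)"

definition G_lim :: "(nat \<Rightarrow> nat \<Rightarrow> real) \<Rightarrow> complex \<Rightarrow> complex \<Rightarrow> complex" where
  "G_lim d x y = (\<Sum>\<^sub>\<infinity>(k, l)\<in>UNIV.
      of_real (d (k + 1) (l + 1) / (fact k * fact l)) * (x - 1) ^ k * (y - 1) ^ l)"

definition Q_lim :: "(nat \<Rightarrow> nat \<Rightarrow> real) \<Rightarrow> complex \<Rightarrow> complex \<Rightarrow> complex" where
  "Q_lim d x y = G_lim d (1 + x) (1 + y) + 1 / (x - y) ^ 2"

definition prc :: "nat \<Rightarrow> nat \<Rightarrow> int list \<Rightarrow> int list \<Rightarrow> real" where
  "prc k1 k2 lam = (THE c. (\<forall>mu. 0 \<le> c mu) \<and> (\<forall>mu. c mu \<noteq> 0 \<longrightarrow> mu \<in> GT k2)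
      \<and> finite {mu. c mu \<noteq> 0}
      \<and> (\<forall>x::nat \<Rightarrow> complex. (\<forall>i<k2. x i \<noteq> 0) \<longrightarrow>
           schur k1 lam (\<lambda>i. if i < k2 then x i else 1) / schur k1 lam ones
           = (\<Sum>mu\<in>{mu. c mu \<noteq> 0}. of_real (c mu) * (schur k2 mu x / schur k2 mu ones))))"

definition lvl :: "(nat \<Rightarrow> real) \<Rightarrow> nat \<Rightarrow> nat \<Rightarrow> nat" where
  "lvl a N t = nat \<lfloor>a t * real N\<rfloor>"

definition tuples :: "nat \<Rightarrow> (nat \<Rightarrow> real) \<Rightarrow> nat \<Rightarrow> int list list set" where
  "tuples n a N = {Lam. length Lam = n \<and> (\<forall>t\<in>{1..n}. Lam ! (t - 1) \<in> GT (lvl a N t))}"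

definition tuple_prob :: "(nat \<Rightarrow> int list \<Rightarrow> real) \<Rightarrow> nat \<Rightarrow> (nat \<Rightarrow> real) \<Rightarrow> nat \<Rightarrow> int list list \<Rightarrow> real" where
  "tuple_prob rho n a N Lam = rho N (Lam ! (n - 1)) *
     (\<Prod>i\<in>{1..<n}. prc (lvl a N (i + 1)) (lvl a N i) (Lam ! i) (Lam ! (i - 1)))"

definition expect :: "(nat \<Rightarrow> int list \<Rightarrow> real) \<Rightarrow> nat \<Rightarrow> (nat \<Rightarrow> real) \<Rightarrow> nat \<Rightarrow> (int list list \<Rightarrow> real) \<Rightarrow> real" where
  "expect rho n a N f = (\<Sum>\<^sub>\<infinity>Lam\<in>tuples n a N. tuple_prob rho n a N Lam * f Lam)"

definition pk :: "(nat \<Rightarrow> real) \<Rightarrow> nat \<Rightarrow> nat \<Rightarrow> nat \<Rightarrow> int list list \<Rightarrow> real" where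
  "pk a N t k Lam = (let m = lvl a N t in
     (\<Sum>i<m. real_of_int (Lam ! (t - 1) ! i + int m - 1 - int i) ^ k))"

definition Xvar :: "(nat \<Rightarrow> int list \<Rightarrow> real) \<Rightarrow> nat \<Rightarrow> (nat \<Rightarrow> real) \<Rightarrow> nat \<Rightarrow> nat \<times> nat \<Rightarrow> int list list \<Rightarrow> real" where
  "Xvar rho n a N tk Lam = (pk a N (fst tk) (snd tk) Lam
       - expect rho n a N (pk a N (fst tk) (snd tk))) / real N ^ snd tk"

text \<open>Moments of a centered Gaussian vector with covariance C:
  E[xi_1 ... xi_m] = sum over perfect matchings of prod C.\<close>
fun wick :: "('i \<Rightarrow> 'i \<Rightarrow> complex) \<Rightarrow> 'i list \<Rightarrow> complex" where
  "wick C [] = 1"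
| "wick C (x # xs) = (\<Sum>j<length xs. C x (xs ! j) * wick C (take j xs @ drop (Suc j) xs))"

definition circ :: "real \<Rightarrow> real \<Rightarrow> complex" where
  "circ r s = of_real r * exp (2 * of_real pi * \<i> * of_real s)"

definition circ' :: "real \<Rightarrow> real \<Rightarrow> complex" where
  "circ' r s = 2 * of_real pi * \<i> * of_real r * exp (2 * of_real pi * \<i> * of_real s)"

definition cov_formula :: "(nat \<Rightarrow> real) \<Rightarrow> (nat \<Rightarrow> nat \<Rightarrow> real) \<Rightarrow> (nat \<Rightarrow> real) \<Rightarrow> real
     \<Rightarrow> nat \<Rightarrow> nat \<Rightarrow> nat \<Rightarrow> nat \<Rightarrow> complex" where
  "cov_formula c d a eps t1 k1 t2 k2 =
     of_real (a t1 ^ k1 * a t2 ^ k2) / (2 * of_real pi * \<i>) ^ 2 *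
     integral {0..1} (\<lambda>s. integral {0..1} (\<lambda>u.
        (let z = circ eps u; w = circ (2 * eps) s in
          (1 / z + 1 + (1 + z) * F_lim c (1 + z) / of_real (a t1)) ^ k1 *
          (1 / w + 1 + (1 + w) * F_lim c (1 + w) / of_real (a t2)) ^ k2 *
          Q_lim d z w * circ' eps u * circ' (2 * eps) s)))"

definition cov_lim :: "(nat \<Rightarrow> real) \<Rightarrow> (nat \<Rightarrow> nat \<Rightarrow> real) \<Rightarrow> (nat \<Rightarrow> real) \<Rightarrow> real
     \<Rightarrow> nat \<times> nat \<Rightarrow> nat \<times> nat \<Rightarrow> complex" where
  "cov_lim c d a eps tk1 tk2 =
     (if fst tk1 \<le> fst tk2 then cov_formula c d a eps (fst tk1) (snd tk1) (fst tk2) (snd tk2)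
      else cov_formula c d a eps (fst tk2) (snd tk2) (fst tk1) (snd tk1))"

end

(* Proof idea. On the variables y with x = 1 + y the operator
   D_k = V^(-1) (sum_i ((1 + y_i) d/dy_i)^k) V, with V the Vandermonde product, has the Schur functions
   as eigenfunctions with eigenvalues p_k, and setting variables to y_i = 0 implements the transition
   coefficients pr. Hence the mixed moments of the p_k are the values at y = 0 of iterated operators D_k
   applied to the Schur generating function, with variables dropped between levels.
   Modulo functions vanishing to high order at y = 0, the generating function is exp (f_N) with f_N a
   polynomial in the power sums of y, and D_k acts on exp (f_N) phi by N^k times a convergent first order
   differential operator in the power sums plus a scalar. Centering removes the scalar, and the limits
   are of the form "multiplication by a linear form plus constant-coefficient derivation", that is,
   creation plus annihilation operators, so the limiting moments are given by Wick's formula. *)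

theory Submission
 imports Defs "HOL-Complex_Analysis.Complex_Analysis" "Jordan_Normal_Form.Determinant"
begin

text \<open>The number of variables grows with N, so functions of y have no limit. Working modulo a
  fixed order of vanishing at the origin leaves polynomials in finitely many power sums, with
  coefficients that converge in N. The order is chosen beyond the sum of all k, because D_k lowers
  it by at most k. That loss estimate is the main analytic obstacle: D_k divides by differences y_i
  - y_j and can be evaluated only off the diagonals. The functions it produces are known to extend
  holomorphically, and the maximum principle on tori with pairwise different radii bounds the
  extension. The scalar part of the operator is in general of size N and need not converge; what
  converges is its difference with the expectation, found by applying the same machinery to a single
  factor first. This is reflected in the nested contours and in the asymmetry of the covariance
  formula. Symmetry within one level is deduced from the commuting random variables instead of from
  the formula.\<close>

type_synonym point = "nat => complex"

hide_const (open) module.smult Polynomial.order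
no_notation Matrix.vec_index (infixl "$" 100)

section \<open>Determinants as sums over permutations: column operations and multilinearity\<close>

subsection \<open>Determinants\<close>

lemma detN_eq_det: "detN N M = det (mat N N (%(i, j). M i j))"
proof -
 have "det (mat N N (%(i, j). M i j)) =
   (\<Sum>p\<in>{p. p permutes {0..<N}}. of_int (sign p) * (\<Prod>i = 0..<N. mat N N (%(i, j). M i j) $$ (i, p i)))"
  by (subst det_def'[of _ N]) auto
 also have "... = (\<Sum>p\<in>{p. p permutes {0..<N}}. of_int (sign p) * (\<Prod>i = 0..<N. M i (p i)))"
 proof (intro sum.cong refl arg_cong2[where f = "(*)"] prod.cong)
  fix p i assume p: "p \<in> {p. p permutes {0..<N}}" and i: "i \<in> {0..<N}"
  have "p i < N" using p i permutes_in_image[of p "{0..<N}" i] by auto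
  then show "mat N N (%(i, j). M i j) $$ (i, p i) = M i (p i)" using i by simp
 qed
 finally show ?thesis by (simp add: detN_def atLeast0LessThan)
qed

lemma detN_cong: "(!!i j. i < N ==> j < N ==> M i j = M' i j) ==> detN N M = detN N M'"
 unfolding detN_eq_det by (intro arg_cong[where f = det] eq_matI) auto

lemma detN_mult: "detN N (%i j. \<Sum>k<N. M i k * U k j) = detN N M * detN N U"
proof -
 have "mat N N (%(i, j). \<Sum>k<N. M i k * U k j) = mat N N (%(i, j). M i j) * mat N N (%(i, j). U i j)"
  by (intro eq_matI) (auto simp: scalar_prod_def atLeast0LessThan)
 then show ?thesis
  unfolding detN_eq_det by (simp add: det_mult[of _ N])
qed

lemma detN_lower_triangular:
 assumes "!!i j. i < j ==> j < N ==> U i j = 0"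
 shows "detN N U = (\<Prod>i<N. U i i)"
 unfolding detN_eq_det
 by (subst det_lower_triangular[where n = N]) (use assms in \<open>auto simp: prod_list_diag_prod atLeast0LessThan\<close>)

text \<open>The matrix is multiplied by a unitriangular one, so multiples of the original right
  neighbours may be subtracted from all columns at once.\<close>

lemma detN_col_shift:
 "detN N (%i j. M i j - (if Suc j < N then c j * M i (Suc j) else 0)) = detN N M"
proof -
 define U where "U = (%k j. if k = j then 1 else if k = Suc j then - c j else (0::complex))"
 have "detN N (%i j. M i j - (if Suc j < N then c j * M i (Suc j) else 0))
   = detN N (%i j. \<Sum>k<N. M i k * U k j)"
 proof (rule detN_cong)
  fix i j assume ij: "i < N" "j < N"
  have "(\<Sum>k<N. M i k * U k j) = (\<Sum>k<N. (if k = j then M i k else 0) + (if k = Suc j then - c j * M i k else 0))"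
   by (intro sum.cong) (auto simp: U_def)
  also have "... = M i j - (if Suc j < N then c j * M i (Suc j) else 0)"
   using ij by (auto simp: sum.distrib sum.delta)
  finally show "M i j - (if Suc j < N then c j * M i (Suc j) else 0) = (\<Sum>k<N. M i k * U k j)" ..
 qed
 also have "... = detN N M * detN N U" by (rule detN_mult)
 also have "detN N U = 1" by (subst detN_lower_triangular) (auto simp: U_def)
 finally show ?thesis by simp
qed

lemma detN_Suc_last_row:
 assumes "!!j. j < N ==> M N j = 0"
 shows "detN (Suc N) M = M N N * detN N M"
proof -
 let ?t = "%p. of_int (sign p) * (\<Prod>i<Suc N. M i (p i))"
 have sub: "{p. p permutes {..<N}} \<subseteq> {p. p permutes {..<Suc N}}"
  by (auto intro: permutes_subset)
 have "detN (Suc N) M = (\<Sum>p | p permutes {..<Suc N}. ?t p)" by (simp add: detN_def)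
 also have "... = (\<Sum>p | p permutes {..<N}. ?t p)"
 proof (rule sum.mono_neutral_right)
  show "finite {p. p permutes {..<Suc N}}" by (simp add: finite_permutations)
  show "\<forall>p\<in>{p. p permutes {..<Suc N}} - {p. p permutes {..<N}}. ?t p = 0"
  proof
   fix p assume p: "p \<in> {p. p permutes {..<Suc N}} - {p. p permutes {..<N}}"
   have "p N ~= N"
   proof
    assume "p N = N"
    then have "p permutes {..<N}"
     using p permutes_superset[of p "{..<Suc N}" "{..<N}"] by (auto simp: less_Suc_eq)
    then show False using p by simp
   qed
   moreover have "p N < Suc N" using p permutes_in_image[of p "{..<Suc N}" N] by auto
   ultimately have "M N (p N) = 0" using assms by auto
   then show "?t p = 0" by simp
  qed
 qed (use sub in auto)
 also have "... = (\<Sum>p | p permutes {..<N}. M N N * (of_int (sign p) * (\<Prod>i<N. M i (p i))))"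
 proof (intro sum.cong refl)
  fix p assume "p \<in> {p. p permutes {..<N}}"
  then have "p N = N" by (auto simp: permutes_def)
  then show "?t p = M N N * (of_int (sign p) * (\<Prod>i<N. M i (p i)))" by simp
 qed
 finally show ?thesis by (simp add: detN_def sum_distrib_left)
qed

lemma detN_scale_rows: "detN N (%i j. r i * M i j) = (\<Prod>i<N. r i) * detN N M"
 by (simp add: detN_def prod.distrib sum_distrib_left mult_ac)

lemma detN_scale_cols: "detN N (%i j. M i j * s j) = detN N M * (\<Prod>j<N. s j)"
proof -
 have "(\<Prod>i<N. s (p i)) = (\<Prod>j<N. s j)" if "p permutes {..<N}" for p
  by (rule prod.reindex_bij_betw) (use that in \<open>simp add: permutes_imp_bij\<close>)
 then show ?thesis
  unfolding detN_def prod.distrib sum_distrib_right by (intro sum.cong refl) auto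
qed

text \<open>Multilinearity in the columns. The permutation sum is indexed by rows, so each product
  is reindexed by columns before it is distributed.\<close>

lemma detN_sum_cols:
 assumes "!!j. j < N ==> finite (I j)"
 shows "detN N (%i j. \<Sum>m\<in>I j. g i m j) = (\<Sum>f\<in>PiE {..<N} I. detN N (%i j. g i (f j) j))"
proof -
 have "(\<Prod>i<N. \<Sum>m\<in>I (p i). g i m (p i)) = (\<Sum>f\<in>PiE {..<N} I. \<Prod>i<N. g i (f (p i)) (p i))"
  if p: "p permutes {..<N}" for p
 proof -
  have bij: "bij_betw p {..<N} {..<N}" using p by (simp add: permutes_imp_bij)
  have ip: "inv_into UNIV p (p i) = i" for i using permutes_inverses(2)[OF p] by simp
  have "(\<Prod>i<N. \<Sum>m\<in>I (p i). g i m (p i)) = (\<Prod>i<N. (%j. \<Sum>m\<in>I j. g (inv_into UNIV p j) m j) (p i))"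
   by (simp add: ip)
  also have "... = (\<Prod>j<N. \<Sum>m\<in>I j. g (inv_into UNIV p j) m j)"
   by (rule prod.reindex_bij_betw[OF bij])
  also have "... = (\<Sum>f\<in>PiE {..<N} I. \<Prod>j<N. g (inv_into UNIV p j) (f j) j)"
   by (rule prod_sum_PiE) (use assms in auto)
  also have "... = (\<Sum>f\<in>PiE {..<N} I. \<Prod>i<N. (%j. g (inv_into UNIV p j) (f j) j) (p i))"
   by (intro sum.cong refl prod.reindex_bij_betw[OF bij, symmetric])
  finally show ?thesis by (simp add: ip)
 qed
 then have "detN N (%i j. \<Sum>m\<in>I j. g i m j) =
   (\<Sum>p | p permutes {..<N}. \<Sum>f\<in>PiE {..<N} I. of_int (sign p) * (\<Prod>i<N. g i (f (p i)) (p i)))"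
  by (simp add: detN_def sum_distrib_left)
 also have "... = (\<Sum>f\<in>PiE {..<N} I. detN N (%i j. g i (f j) j))"
  by (subst sum.swap) (simp add: detN_def)
 finally show ?thesis .
qed

lemma detN_permute_rows:
 assumes "s permutes {..<N}"
 shows "detN N (%i j. M (s i) j) = of_int (sign s) * detN N M"
proof -
 have s: "s permutes {0..<N}" using assms by (simp add: atLeast0LessThan)
 have "s i < N" if "i < N" for i using s that permutes_in_image[of s "{0..<N}" i] by auto
 then have "mat N N (%(i, j). M (s i) j) = mat N N (%(i, j). mat N N (%(i, j). M i j) $$ (s i, j))"
  by (intro eq_matI) auto
 then show ?thesis
  unfolding detN_eq_det using det_permute_rows[of "mat N N (%(i, j). M i j)" N s] s by simp
qed

section \<open>The branching rule for Schur functions, with symmetry, smoothness and bounds\<close>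

subsection \<open>Schur functions as Laurent polynomials\<close>

definition vander :: "nat => point => complex" where
 "vander N x = (\<Prod>i<N. \<Prod>j\<in>{i<..<N}. (x i - x j))"

text \<open>The strictly decreasing particle positions of \<open>lam\<close>; the observables
  \<open>pk\<close> are their power sums.\<close>

definition expo :: "nat => int list => nat => int" where
 "expo N lam j = lam ! j + int N - 1 - int j"

definition interlacing :: "int list => int list set" where
 "interlacing lam = {mu. Suc (length mu) = length lam &
   (\<forall>i < length mu. lam ! Suc i \<le> mu ! i & mu ! i \<le> lam ! i)}"

text \<open>The Schur function by the Gelfand-Tsetlin branching rule. Unlike the ratio of
  determinants this is a Laurent polynomial on sight, so coinciding coordinates need no
  limit.\<close>

fun sp :: "nat => int list => point => complex" where
 "sp 0 lam x = 1"
| "sp (Suc N) lam x =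
   (\<Sum>mu\<in>interlacing lam. sp N mu x * x N powi (sum_list lam - sum_list mu))"

lemma GT_I:
 assumes "length lam = N" "!!i. Suc i < N ==> lam ! Suc i \<le> lam ! i"
 shows "lam \<in> GT N"
proof -
 have "lam ! j \<le> lam ! i" if "i \<le> j" "j < N" for i j
  using that
 proof (induction j rule: dec_induct)
  case (step k)
  then show ?case using assms(2)[of k] by (meson Suc_lessD order_trans)
 qed simp
 then show ?thesis using assms(1) by (auto simp: GT_def)
qed

lemma interlacing_subset_GT:
 assumes "lam \<in> GT (Suc N)" shows "interlacing lam \<subseteq> GT N"
proof
 fix mu assume mu: "mu \<in> interlacing lam"
 have l: "length lam = Suc N" using assms by (simp add: GT_def)
 show "mu \<in> GT N"
  by (rule GT_I) (use mu l in \<open>auto simp: interlacing_def intro: order_trans[of _ "lam ! Suc i" for i]\<close>)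
qed

text \<open>The constraints on different entries are independent, so the interlacing rows form a
  product of intervals, the kind of index set that \<open>detN_sum_cols\<close> produces.\<close>

lemma interlacing_eq_image:
 assumes "length lam = Suc N"
 shows "bij_betw (%f. map f [0..<N]) (PiE {..<N} (%j. {lam ! Suc j..lam ! j})) (interlacing lam)"
proof (rule bij_betwI[where g = "%mu. restrict (%j. mu ! j) {..<N}"])
 show "(%mu. restrict (%j. mu ! j) {..<N}) \<in> interlacing lam \<rightarrow> (PiE {..<N} (%j. {lam ! Suc j..lam ! j}))"
  using assms by (auto simp: interlacing_def PiE_def)
 fix f assume f: "f \<in> PiE {..<N} (%j. {lam ! Suc j..lam ! j})"
 show "(\<lambda>j\<in>{..<N}. map f [0..<N] ! j) = f"
  using f by (auto simp: fun_eq_iff PiE_def extensional_def)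
next
 fix mu assume "mu \<in> interlacing lam"
 then show "map (\<lambda>j\<in>{..<N}. mu ! j) [0..<N] = mu"
  using assms by (intro nth_equalityI) (auto simp: interlacing_def)
qed (use assms in \<open>auto simp: interlacing_def PiE_def Pi_def\<close>)

lemma finite_interlacing: "finite (interlacing lam)"
proof (cases lam)
 case Nil then show ?thesis by (simp add: interlacing_def)
next
 case (Cons a list)
 then have "length lam = Suc (length list)" by simp
 from bij_betw_finite[OF interlacing_eq_image[OF this]] show ?thesis
  by (simp add: finite_PiE)
qed

lemma geometric_powi:
 fixes a t :: complex
 assumes "a ~= 0" "t ~= 0" "l' \<le> l"
 shows "a powi l - t powi (l - l') * a powi l' = (a - t) * (\<Sum>m\<in>{l'..<l}. a powi m * t powi (l - 1 - m))"
 using assms(3)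
proof (induction l rule: int_ge_induct)
 case base then show ?case by simp
next
 case (step l)
 have "(\<Sum>m\<in>{l'..<l+1}. a powi m * t powi (l + 1 - 1 - m))
   = a powi l + (\<Sum>m\<in>{l'..<l}. a powi m * t powi (l + 1 - 1 - m))"
 proof -
  have "{l'..<l+1} = insert l {l'..<l}" using step by auto
  then show ?thesis by simp
 qed
 also have "(\<Sum>m\<in>{l'..<l}. a powi m * t powi (l + 1 - 1 - m)) = t * (\<Sum>m\<in>{l'..<l}. a powi m * t powi (l - 1 - m))"
  unfolding sum_distrib_left
 proof (intro sum.cong refl)
  fix m
  have "t powi (l + 1 - 1 - m) = t * t powi (l - 1 - m)"
   using assms power_int_add_1[of t "l - 1 - m"] by (simp add: mult.commute)
  then show "a powi m * t powi (l + 1 - 1 - m) = t * (a powi m * t powi (l - 1 - m))" by simp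
 qed
 finally have *: "(a - t) * (\<Sum>m\<in>{l'..<l+1}. a powi m * t powi (l + 1 - 1 - m))
   = (a - t) * a powi l + t * ((a - t) * (\<Sum>m\<in>{l'..<l}. a powi m * t powi (l - 1 - m)))"
  by (simp add: algebra_simps)
 have 1: "a powi (l + 1) = a powi l * a" using assms power_int_add_1[of a l] by simp
 have 2: "t powi (l + 1 - l') = t powi (l - l') * t"
  using assms power_int_add_1[of t "l - l'"] by (simp add: algebra_simps)
 show ?case unfolding * step.IH[symmetric] 1 2 by (simp add: algebra_simps)
qed

lemma prod_powi_eq_powi_sum:
 fixes t :: complex
 assumes "t ~= 0"
 shows "(\<Prod>j\<in>A. t powi g j) = t powi (\<Sum>j\<in>A. g j)"
 using assms by (induction A rule: infinite_finite_induct) (auto simp: power_int_add)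

lemma vander_Suc: "vander (Suc N) x = vander N x * (\<Prod>i<N. (x i - x N))"
proof -
 have "(\<Prod>j\<in>{i<..<Suc N}. (x i - x j)) = (x i - x N) * (\<Prod>j\<in>{i<..<N}. (x i - x j))" if "i < N" for i
 proof -
  have "{i<..<Suc N} = insert N {i<..<N}" using that by auto
  then show ?thesis by simp
 qed
 moreover have "{N<..<Suc N} = {}" by auto
 ultimately show ?thesis
  by (simp add: vander_def prod.distrib mult.commute)
qed

text \<open>With t the last variable, subtracting t^(e_j - e_(j+1)) times the next column clears the
  last row except for its final entry, and turns the other entries into geometric sums divisible by
  x_i - t. These factors build up the Vandermonde product, and expanding the geometric sums column
  by column runs over the interlacing rows.\<close>

lemma det_eq_vander_sp:
 assumes "lam \<in> GT N" "!!i. i < N ==> x i ~= 0"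
 shows "detN N (%i j. x i powi expo N lam j) = vander N x * sp N lam x"
 using assms
proof (induction N arbitrary: lam)
 case 0
 have "{p::nat=>nat. p permutes {}} = {id}" by auto
 then show ?case by (simp add: detN_def vander_def)
next
 case (Suc N)
 define t where "t = x N"
 define e where "e = expo (Suc N) lam"
 define c where "c = (%j. t powi (e j - e (Suc j)))"
 have t0: "t ~= 0" and x0: "!!i. i < N ==> x i ~= 0" using Suc.prems by (auto simp: t_def)
 have len: "length lam = Suc N" using Suc.prems by (simp add: GT_def)
 have lam_mono: "lam ! Suc j \<le> lam ! j" if "j < N" for j using Suc.prems that by (auto simp: GT_def)
 have e_mono: "e (Suc j) \<le> e j" if "j < N" for j using lam_mono[OF that] by (simp add: e_def expo_def)
 define I where "I = (%j. {e (Suc j)..<e j})"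
 have "detN (Suc N) (%i j. x i powi e j) =
    detN (Suc N) (%i j. x i powi e j - (if Suc j < Suc N then c j * x i powi e (Suc j) else 0))"
  by (rule detN_col_shift[symmetric])
 also have "... = (x N powi e N - 0) *
    detN N (%i j. x i powi e j - (if Suc j < Suc N then c j * x i powi e (Suc j) else 0))"
  by (subst detN_Suc_last_row) (use t0 in \<open>auto simp: c_def t_def power_int_diff\<close>)
 also have "detN N (%i j. x i powi e j - (if Suc j < Suc N then c j * x i powi e (Suc j) else 0))
   = detN N (%i j. (x i - t) * (\<Sum>m\<in>I j. x i powi m * t powi (e j - 1 - m)))"
 proof (rule detN_cong)
  fix i j assume "i < N" "j < N"
  then show "x i powi e j - (if Suc j < Suc N then c j * x i powi e (Suc j) else 0)
    = (x i - t) * (\<Sum>m\<in>I j. x i powi m * t powi (e j - 1 - m))"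
   using geometric_powi[of "x i" t "e (Suc j)" "e j"] x0 t0 e_mono by (simp add: c_def I_def)
 qed
 also have "... = (\<Prod>i<N. x i - t) * detN N (%i j. \<Sum>m\<in>I j. x i powi m * t powi (e j - 1 - m))"
  by (rule detN_scale_rows)
 also have "detN N (%i j. \<Sum>m\<in>I j. x i powi m * t powi (e j - 1 - m))
    = (\<Sum>f\<in>PiE {..<N} I. detN N (%i j. x i powi f j * t powi (e j - 1 - f j)))"
  by (rule detN_sum_cols) (simp add: I_def)
 also have "... = (\<Sum>f\<in>PiE {..<N} I. detN N (%i j. x i powi f j) * (\<Prod>j<N. t powi (e j - 1 - f j)))"
  by (simp add: detN_scale_cols)
 \<comment> \<open>An exponent in column j runs through [e (Suc j), e j); subtracting N - 1 - j
   turns it into the j-th entry of a row interlacing with \<open>lam\<close>.\<close>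
 also have "... = (\<Sum>f\<in>PiE {..<N} (%j. {lam ! Suc j..lam ! j}).
    detN N (%i j. x i powi (f j + int N - 1 - int j)) * (\<Prod>j<N. t powi (lam ! j - f j)))"
 proof (rule sum.reindex_bij_witness[where
    i = "%f. \<lambda>j\<in>{..<N}. f j + int N - 1 - int j" and j = "%f. \<lambda>j\<in>{..<N}. f j - int N + 1 + int j"])
  fix f assume f: "f \<in> PiE {..<N} I"
  show "(\<lambda>j\<in>{..<N}. (\<lambda>j\<in>{..<N}. f j - int N + 1 + int j) j + int N - 1 - int j) = f"
   using f by (auto simp: fun_eq_iff PiE_def extensional_def)
  show "(\<lambda>j\<in>{..<N}. f j - int N + 1 + int j) \<in> (\<Pi>\<^sub>E j\<in>{..<N}. {lam ! Suc j..lam ! j})"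
   using f by (auto simp: PiE_def Pi_def I_def e_def expo_def dest!: bspec)
  have "detN N (%i j. x i powi ((\<lambda>j\<in>{..<N}. f j - int N + 1 + int j) j + int N - 1 - int j))
    = detN N (%i j. x i powi f j)"
   by (rule detN_cong) auto
  moreover have "(\<Prod>j<N. t powi (lam ! j - (\<lambda>j\<in>{..<N}. f j - int N + 1 + int j) j))
    = (\<Prod>j<N. t powi (e j - 1 - f j))"
   by (intro prod.cong refl) (auto simp: e_def expo_def algebra_simps)
  ultimately show "detN N (%i j. x i powi ((\<lambda>j\<in>{..<N}. f j - int N + 1 + int j) j + int N - 1 - int j)) *
    (\<Prod>j<N. t powi (lam ! j - (\<lambda>j\<in>{..<N}. f j - int N + 1 + int j) j))
   = detN N (%i j. x i powi f j) * (\<Prod>j<N. t powi (e j - 1 - f j))" by simp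
 next
  fix f assume f: "f \<in> (\<Pi>\<^sub>E j\<in>{..<N}. {lam ! Suc j..lam ! j})"
  show "(\<lambda>j\<in>{..<N}. (\<lambda>j\<in>{..<N}. f j + int N - 1 - int j) j - int N + 1 + int j) = f"
   using f by (auto simp: fun_eq_iff PiE_def extensional_def)
  show "(\<lambda>j\<in>{..<N}. f j + int N - 1 - int j) \<in> PiE {..<N} I"
   using f by (auto simp: PiE_def Pi_def I_def e_def expo_def dest!: bspec)
 qed
 also have "... = (\<Sum>f\<in>PiE {..<N} (%j. {lam ! Suc j..lam ! j}).
    (%mu. detN N (%i j. x i powi expo N mu j) * t powi (sum_list lam - lam ! N - sum_list mu)) (map f [0..<N]))"
 proof (intro sum.cong refl)
  fix f assume f: "f \<in> (\<Pi>\<^sub>E j\<in>{..<N}. {lam ! Suc j..lam ! j})"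
  have "detN N (%i j. x i powi (f j + int N - 1 - int j)) = detN N (%i j. x i powi expo N (map f [0..<N]) j)"
   by (rule detN_cong) (auto simp: expo_def)
  moreover have "(\<Prod>j<N. t powi (lam ! j - f j)) = t powi (\<Sum>j<N. lam ! j - f j)"
   by (rule prod_powi_eq_powi_sum[OF t0])
  moreover have "(\<Sum>j<N. lam ! j - f j) = sum_list lam - lam ! N - sum_list (map f [0..<N])"
   using len by (simp add: sum_list_sum_nth sum_subtractf atLeast0LessThan)
  ultimately show "detN N (%i j. x i powi (f j + int N - 1 - int j)) * (\<Prod>j<N. t powi (lam ! j - f j))
   = (%mu. detN N (%i j. x i powi expo N mu j) * t powi (sum_list lam - lam ! N - sum_list mu)) (map f [0..<N])"
   by simp
 qed
 also have "... = (\<Sum>mu\<in>interlacing lam. detN N (%i j. x i powi expo N mu j) * t powi (sum_list lam - lam ! N - sum_list mu))"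
  by (rule sum.reindex_bij_betw[OF interlacing_eq_image[OF len]])
 also have "... = (\<Sum>mu\<in>interlacing lam. vander N x * sp N mu x * t powi (sum_list lam - lam ! N - sum_list mu))"
  using interlacing_subset_GT[OF Suc.prems(1)] x0 by (intro sum.cong refl arg_cong2[where f = "(*)"] Suc.IH) auto
 finally have "detN (Suc N) (%i j. x i powi e j) = t powi e N * ((\<Prod>i<N. x i - t) *
   (\<Sum>mu\<in>interlacing lam. vander N x * sp N mu x * t powi (sum_list lam - lam ! N - sum_list mu)))"
  by (simp add: t_def)
 also have "... = vander (Suc N) x * (\<Sum>mu\<in>interlacing lam. sp N mu x * (t powi e N * t powi (sum_list lam - lam ! N - sum_list mu)))"
  by (simp add: vander_Suc t_def sum_distrib_left mult_ac)
 also have "... = vander (Suc N) x * sp (Suc N) lam x"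
 proof -
  have "t powi e N * t powi (sum_list lam - lam ! N - s) = t powi (sum_list lam - s)" for s
   using t0 by (subst power_int_add[symmetric]) (auto simp: e_def expo_def)
  then show ?thesis by (simp add: t_def)
 qed
 finally show ?case by (simp add: e_def)
qed

lemma sp_cong: "(!!i. i < N ==> x i = y i) ==> sp N lam x = sp N lam y"
proof (induction N arbitrary: lam)
 case (Suc N)
 have "sp N mu x = sp N mu y" for mu by (rule Suc.IH) (use Suc.prems in auto)
 then show ?case using Suc.prems[of N] by simp
qed simp

lemma interlacing_nonempty:
 assumes "lam \<in> GT (Suc N)" shows "interlacing lam ~= {}"
proof -
 have len: "length lam = Suc N" using assms by (simp add: GT_def)
 have "PiE {..<N} (%j. {lam ! Suc j..lam ! j}) ~= {}"
  using assms by (auto simp: PiE_eq_empty_iff GT_def)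
 then show ?thesis using interlacing_eq_image[OF len] by (auto simp: bij_betw_def)
qed

text \<open>The value counts Gelfand-Tsetlin patterns with top row \<open>lam\<close>. As a positive
  integer it can be divided by, and it keeps the rescaled branching coefficients
  nonnegative.\<close>

lemma sp_ones:
 assumes "lam \<in> GT N" shows "\<exists>k::nat. k > 0 & sp N lam ones = of_nat k"
 using assms
proof (induction N arbitrary: lam)
 case (Suc N)
 have "\<forall>mu\<in>interlacing lam. \<exists>k::nat. k > 0 & sp N mu ones = of_nat k"
  using interlacing_subset_GT[OF Suc.prems] Suc.IH by blast
 then obtain k where k: "\<forall>mu\<in>interlacing lam. k mu > (0::nat) & sp N mu ones = of_nat (k mu)"
  by metis
 have "sp (Suc N) lam ones = of_nat (\<Sum>mu\<in>interlacing lam. k mu)"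
  using k by (simp add: ones_def)
 moreover have "(\<Sum>mu\<in>interlacing lam. k mu) > 0"
  using k interlacing_nonempty[OF Suc.prems] finite_interlacing[of lam] by (metis sum_pos)
 ultimately show ?case by metis
qed (auto intro: exI[of _ 1])

lemma sp_ones_nonzero: "lam \<in> GT N ==> sp N lam ones ~= 0"
 using sp_ones[of lam N] by auto

lemma tendsto_sp:
 assumes "!!i. i < N ==> ((%b. \<gamma> b i) \<longlongrightarrow> x i) F" "!!i. i < N ==> x i ~= 0"
 shows "((%b. sp N lam (\<gamma> b)) \<longlongrightarrow> sp N lam x) F"
 using assms by (induction N arbitrary: lam) (auto intro!: tendsto_intros)

lemma vander_nonzero: "x \<in> generic_pts N ==> vander N x ~= 0"
 by (auto simp: vander_def generic_pts_def)

lemma schur_ratio_eq_sp: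
 assumes "lam \<in> GT N" "x \<in> generic_pts N"
 shows "schur_ratio N lam x = sp N lam x"
proof -
 have "detN N (%i j. x i powi expo N lam j) = vander N x * sp N lam x"
  by (rule det_eq_vander_sp) (use assms in \<open>auto simp: generic_pts_def\<close>)
 then show ?thesis
  using vander_nonzero[OF assms(2)] by (simp add: schur_ratio_def expo_def vander_def[symmetric])
qed

text \<open>A curve through x, generic for all small nonzero t when x has nonzero coordinates: the
  slopes \<open>Suc i\<close> are distinct, which separates equal coordinates, and nonzero, which
  makes the curve leave x.\<close>

definition spread :: "point => complex => nat => complex" where
 "spread x t = (%i. x i + t * of_nat (Suc i))"

lemma tendsto_spread: "((%t. spread x t i) \<longlongrightarrow> x i) (at 0)"
proof -
 have "((%t. x i + t * of_nat (Suc i)) \<longlongrightarrow> x i + 0 * of_nat (Suc i)) (at 0)"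
  by (intro tendsto_intros)
 then show ?thesis by (simp add: spread_def)
qed

lemma eventually_spread_generic:
 assumes "!!i. i < N ==> x i ~= 0"
 shows "eventually (%t. spread x t \<in> generic_pts N) (at 0)"
proof -
 have 1: "eventually (%t. \<forall>i\<in>{..<N}. spread x t i ~= 0) (at 0)"
 proof (rule eventually_ball_finite; safe)
  fix i assume "i < N"
  then show "eventually (%t. spread x t i ~= 0) (at 0)"
   using tendsto_imp_eventually_ne[OF tendsto_spread[of x i]] assms by blast
 qed
 have 2: "eventually (%t. \<forall>i\<in>{..<N}. \<forall>j\<in>{..<N}. i ~= j --> spread x t i ~= spread x t j) (at 0)"
 proof (intro eventually_ball_finite ballI)
  fix i j
  show "eventually (%t. i ~= j --> spread x t i ~= spread x t j) (at 0)"
  proof (cases "x i = x j")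
   case True
   have "eventually (%t::complex. t ~= 0) (at 0)" by (simp add: eventually_at_filter)
   then show ?thesis by eventually_elim (use True in \<open>auto simp: spread_def\<close>)
  next
   case False
   have "((%t. spread x t i - spread x t j) \<longlongrightarrow> x i - x j) (at 0)"
    by (intro tendsto_diff tendsto_spread)
   then have "eventually (%t. spread x t i - spread x t j ~= 0) (at 0)"
    by (rule tendsto_imp_eventually_ne) (use False in simp)
   then show ?thesis by eventually_elim auto
  qed
 qed auto
 show ?thesis using 1 2 by eventually_elim (auto simp: generic_pts_def)
qed

text \<open>The limit in the definition of \<open>schur\<close> is meaningful only if generic points
  accumulate at x, which the curve \<open>spread x\<close> shows. Its value is then read off from
  the continuity of \<open>sp\<close>.\<close>

lemma schur_eq_sp:
 assumes lam: "lam \<in> GT N" and x: "!!i. i < N ==> x i ~= 0"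
 shows "schur N lam x = sp N lam x"
proof (cases "x \<in> generic_pts N")
 case True then show ?thesis using schur_ratio_eq_sp[OF lam] by (simp add: schur_def)
next
 case False
 have coord: "((%y. y i) \<longlongrightarrow> x i) (at x within generic_pts N)" for i
 proof -
  have "continuous_on UNIV (%y::nat => complex. y i)" by (rule continuous_on_product_coordinates)
  then have "((%y. y i) \<longlongrightarrow> x i) (at x within UNIV)" by (auto simp: continuous_on_def)
  then show ?thesis by (rule tendsto_within_subset) simp
 qed
 have "continuous_on UNIV (spread x)"
  unfolding spread_def by (intro continuous_on_coordinatewise_then_product continuous_intros)
 then have "(spread x \<longlongrightarrow> spread x 0) (at 0)" by (auto simp: continuous_on_def)
 then have sx: "(spread x \<longlongrightarrow> x) (at 0)" by (simp add: spread_def)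
 have "filterlim (spread x) (at x within generic_pts N) (at 0)"
  unfolding filterlim_at
 proof
  have "eventually (%t::complex. t ~= 0) (at 0)" by (simp add: eventually_at_filter)
  moreover have "eventually (%t. spread x t \<in> generic_pts N) (at 0)"
   by (rule eventually_spread_generic) (use x in auto)
  ultimately show "eventually (%t. spread x t \<in> generic_pts N & spread x t ~= x) (at 0)"
  proof eventually_elim
   case (elim t)
   then have "spread x t 0 ~= x 0" by (simp add: spread_def)
   with elim show ?case by metis
  qed
 qed (rule sx)
 then have nt: "at x within generic_pts N ~= bot"
  using at_neq_bot[of "0::complex"] by (auto simp: filterlim_def filtermap_bot_iff bot_unique)
 have "(sp N lam \<longlongrightarrow> sp N lam x) (at x within generic_pts N)"
  by (rule tendsto_sp) (use coord x in auto)
 moreover have "eventually (%y. sp N lam y = schur_ratio N lam y) (at x within generic_pts N)"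
  using schur_ratio_eq_sp[OF lam] by (auto simp: eventually_at_filter)
 ultimately have "(schur_ratio N lam \<longlongrightarrow> sp N lam x) (at x within generic_pts N)"
  using tendsto_cong by fast
 then show ?thesis using False tendsto_Lim[OF nt] by (simp add: schur_def)
qed

lemma interlacing_zero: "interlacing (replicate (Suc N) 0) = {replicate N 0}"
proof -
 have "mu = replicate N 0" if "mu \<in> interlacing (replicate (Suc N) 0)" for mu
  using that by (intro nth_equalityI) (auto simp: interlacing_def nth_Cons' order_antisym split: if_splits)
 moreover have "replicate N 0 \<in> interlacing (replicate (Suc N) 0)"
  by (auto simp: interlacing_def nth_Cons')
 ultimately show ?thesis by auto
qed

lemma sp_zero: "sp N (replicate N 0) x = 1"
proof (induction N)
 case (Suc N)
 have "sum_list (replicate (Suc N) (0::int)) - sum_list (replicate N 0) = 0"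
  by (simp add: sum_list_replicate)
 then show ?case unfolding sp.simps interlacing_zero using Suc by simp
qed simp

text \<open>The zero signature has Schur function 1, so the Vandermonde product is itself an
  alternant and picks up the sign of a permutation of its rows.\<close>

lemma vander_permute:
 assumes "s permutes {..<N}" "!!i. i < N ==> x i ~= 0"
 shows "vander N (%i. x (s i)) = of_int (sign s) * vander N x"
proof -
 let ?z = "replicate N (0::int)"
 have z: "?z \<in> GT N" by (auto simp: GT_def)
 have s: "s i < N" if "i < N" for i using assms(1) that permutes_in_image[of s "{..<N}" i] by auto
 have "vander N (%i. x (s i)) = detN N (%i j. x (s i) powi expo N ?z j)"
  using det_eq_vander_sp[OF z, of "%i. x (s i)"] assms(2) s by (simp add: sp_zero)
 also have "... = of_int (sign s) * detN N (%i j. x i powi expo N ?z j)"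
  by (rule detN_permute_rows[OF assms(1)])
 also have "detN N (%i j. x i powi expo N ?z j) = vander N x"
  using det_eq_vander_sp[OF z, of x] assms(2) by (simp add: sp_zero)
 finally show ?thesis .
qed

text \<open>At generic points a quotient of two alternating expressions; elsewhere by continuity
  along \<open>spread\<close>.\<close>

lemma sp_symmetric:
 assumes lam: "lam \<in> GT N" and s: "s permutes {..<N}" and x: "!!i. i < N ==> x i ~= 0"
 shows "sp N lam (%i. x (s i)) = sp N lam x"
proof -
 have sN: "s i < N" if "i < N" for i using s that permutes_in_image[of s "{..<N}" i] by auto
 have gen: "sp N lam (%i. y (s i)) = sp N lam y" if y: "y \<in> generic_pts N" for y
 proof -
  have y0: "!!i. i < N ==> y i ~= 0" using y by (auto simp: generic_pts_def)
  have "vander N (%i. y (s i)) * sp N lam (%i. y (s i)) = detN N (%i j. y (s i) powi expo N lam j)"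
   using det_eq_vander_sp[OF lam, of "%i. y (s i)"] y0 sN by simp
  also have "... = of_int (sign s) * (vander N y * sp N lam y)"
   using detN_permute_rows[OF s, of "%i j. y i powi expo N lam j"] det_eq_vander_sp[OF lam, of y] y0 by simp
  finally have "of_int (sign s) * vander N y * sp N lam (%i. y (s i)) = of_int (sign s) * vander N y * sp N lam y"
   using vander_permute[OF s, of y] y0 by simp
  moreover have "of_int (sign s) * vander N y ~= 0" using vander_nonzero[OF y] by (simp add: sign_def)
  ultimately show ?thesis by simp
 qed
 have "eventually (%t. sp N lam (%i. spread x t (s i)) = sp N lam (spread x t)) (at 0)"
 proof -
  have "eventually (%t. spread x t \<in> generic_pts N) (at 0)"
   by (rule eventually_spread_generic) (use x in auto)
  then show ?thesis by eventually_elim (use gen in auto)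
 qed
 moreover have "((%t. sp N lam (%i. spread x t (s i))) \<longlongrightarrow> sp N lam (%i. x (s i))) (at 0)"
  by (rule tendsto_sp) (use tendsto_spread x sN in auto)
 moreover have "((%t. sp N lam (spread x t)) \<longlongrightarrow> sp N lam x) (at 0)"
  by (rule tendsto_sp) (use tendsto_spread x in auto)
 ultimately show ?thesis
  using tendsto_cong tendsto_unique[OF at_neq_bot[of "0::complex"]] by fast
qed

lemma sp_differentiable:
 assumes "!!i. i < N ==> x i ~= 0"
 shows "(%t. sp N lam (x(i := t))) field_differentiable (at (x i))"
 using assms
proof (induction N arbitrary: lam)
 case (Suc N)
 have "(%t. (x(i := t)) N powi k) field_differentiable (at (x i))" for k
 proof (cases "i = N")
  case True
  have "(%t. t powi k) field_differentiable (at (x i))"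
   unfolding field_differentiable_def has_field_derivative_def
   using has_derivative_power_int'[of "x i" k UNIV] Suc.prems[of N] True
   by (auto simp: mult.commute[of _ "of_int k * _"] intro!: exI[of _ "of_int k * x i powi (k - 1)"])
  then show ?thesis using True by simp
 qed simp
 moreover have "(%t. sp N mu (x(i := t))) field_differentiable (at (x i))" for mu
  by (rule Suc.IH) (use Suc.prems in auto)
 ultimately show ?case
  unfolding sp.simps by (intro field_differentiable_sum field_differentiable_mult)
qed simp

lemma cmod_powi_bound:
 assumes "1 / 2 \<le> cmod t" "cmod t \<le> 3 / 2"
 shows "cmod (t powi k) \<le> 2 ^ nat \<bar>k\<bar>"
proof (cases "k \<ge> 0")
 case True
 have "cmod (t powi k) = cmod t ^ nat k" using True by (simp add: power_int_def norm_power)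
 also have "... \<le> 2 ^ nat k" using assms by (intro power_mono) auto
 finally show ?thesis using True by simp
next
 case False
 have "cmod (t powi k) = (inverse (cmod t)) ^ nat (- k)"
  using False by (simp add: power_int_def norm_power norm_inverse)
 also have "... \<le> 2 ^ nat (- k)"
  using assms le_imp_inverse_le[of "1 / 2" "cmod t"] by (intro power_mono) auto
 finally show ?thesis using False by simp
qed

text \<open>On the annulus every power t^k is at most 2^|k| in modulus. The annulus contains 1 + y
  for |y| < 1/2, where all later expansions live.\<close>

lemma sp_bounded:
 "\<exists>B. \<forall>x. (\<forall>i<N. 1 / 2 \<le> cmod (x i) & cmod (x i) \<le> 3 / 2) --> cmod (sp N lam x) \<le> B"
proof (induction N arbitrary: lam)
 case (Suc N)
 obtain B where B: "!!mu x. (\<forall>i<N. 1 / 2 \<le> cmod (x i) & cmod (x i) \<le> 3 / 2) ==> cmod (sp N mu x) \<le> B mu"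
  using Suc by metis
 have "cmod (sp (Suc N) lam x) \<le> (\<Sum>mu\<in>interlacing lam. \<bar>B mu\<bar> * 2 ^ nat \<bar>sum_list lam - sum_list mu\<bar>)"
  if x: "\<forall>i<Suc N. 1 / 2 \<le> cmod (x i) & cmod (x i) \<le> 3 / 2" for x
 proof -
  have "cmod (sp (Suc N) lam x) \<le> (\<Sum>mu\<in>interlacing lam. cmod (sp N mu x * x N powi (sum_list lam - sum_list mu)))"
   by (simp add: norm_sum)
  also have "... \<le> (\<Sum>mu\<in>interlacing lam. \<bar>B mu\<bar> * 2 ^ nat \<bar>sum_list lam - sum_list mu\<bar>)"
   unfolding norm_mult using x B[of x] cmod_powi_bound[of "x N"]
   by (intro sum_mono mult_mono) (auto intro: order_trans[OF _ abs_ge_self])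
  finally show ?thesis .
 qed
 then show ?case by blast
qed (auto intro: exI[of _ 1])

section \<open>Linear independence of Schur functions and well-definedness of the transition
  coefficients\<close>

subsection \<open>Linear independence and the branching coefficients\<close>

text \<open>Replacing x_i by 2 x_i and subtracting a multiple of the relation removes the monomial
  k0 and multiplies the coefficient of k1 by a nonzero difference of powers of 2. This leaves a
  relation with fewer terms.\<close>

lemma laurent_monomials_independent:
 fixes e :: "'k => complex" and n :: "'k => nat => int"
 assumes "finite K" "!!k k'. k \<in> K ==> k' \<in> K ==> k ~= k' ==> \<exists>i<N. n k i ~= n k' i"
  and "!!x. (!!i. i < N ==> x i ~= 0) ==> (\<Sum>k\<in>K. e k * (\<Prod>i<N. x i powi n k i)) = 0"
 shows "\<forall>k\<in>K. e k = 0"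
 using assms
proof (induction K arbitrary: e rule: finite_induct)
 case (insert k0 K)
 have zero: "e k1 = 0" if k1: "k1 \<in> K" for k1
 proof -
  obtain i where i: "i < N" "n k1 i ~= n k0 i" using insert.prems(1)[of k1 k0] k1 insert.hyps by auto
  define e' where "e' = (%k. e k * (2 powi n k i - 2 powi n k0 i))"
  have "\<forall>k\<in>K. e' k = 0"
  proof (rule insert.IH)
   show "\<exists>i<N. n k i ~= n k' i" if "k \<in> K" "k' \<in> K" "k ~= k'" for k k'
    using insert.prems(1) that by blast
   fix x :: "nat => complex" assume x: "!!i. i < N ==> x i ~= 0"
   have scale: "(\<Prod>j<N. (x(i := 2 * x i)) j powi n k j) = 2 powi n k i * (\<Prod>j<N. x j powi n k j)" for k
   proof -
    have "(\<Prod>j<N. (x(i := 2 * x i)) j powi n k j) = (\<Prod>j<N. (if j = i then 2 powi n k i else 1) * x j powi n k j)"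
     by (intro prod.cong) (auto simp: power_int_mult_distrib)
    also have "... = 2 powi n k i * (\<Prod>j<N. x j powi n k j)"
     using i by (simp add: prod.distrib prod.delta)
    finally show ?thesis .
   qed
   have "(\<Sum>k\<in>insert k0 K. e k * (\<Prod>j<N. (x(i := 2 * x i)) j powi n k j))
      - 2 powi n k0 i * (\<Sum>k\<in>insert k0 K. e k * (\<Prod>j<N. x j powi n k j)) = 0"
    using insert.prems(2)[of x] insert.prems(2)[of "x(i := 2 * x i)"] x by (simp split: if_splits)
   then have "(\<Sum>k\<in>insert k0 K. e' k * (\<Prod>j<N. x j powi n k j)) = 0"
    unfolding scale sum_distrib_left sum_subtractf[symmetric] e'_def by (simp add: algebra_simps)
   then show "(\<Sum>k\<in>K. e' k * (\<Prod>j<N. x j powi n k j)) = 0"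
    using insert.hyps by (simp add: e'_def)
  qed
  then have "e k1 * (2 powi n k1 i - 2 powi n k0 i) = 0" using k1 by (auto simp: e'_def)
  moreover have "2 powi n k1 i ~= (2::complex) powi n k0 i"
  proof
   assume "2 powi n k1 i = (2::complex) powi n k0 i"
   then have "cmod (2 powi n k1 i) = cmod (2 powi n k0 i)" by simp
   then have "(2::real) powi n k1 i = 2 powi n k0 i" by (simp add: norm_power_int)
   then show False
    using i power_int_strict_increasing[of "n k1 i" "n k0 i" "2::real"]
     power_int_strict_increasing[of "n k0 i" "n k1 i" "2::real"] by linarith
  qed
  ultimately show ?thesis by simp
 qed
 moreover have "e k0 = 0"
  using insert.prems(2)[of "%_. 1"] insert.hyps zero by simp
 ultimately show ?case by simp
qed simp

lemma expo_strict:
 assumes "mu \<in> GT N" "i < j" "j < N" shows "expo N mu j < expo N mu i"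
proof -
 have "mu ! j \<le> mu ! i" using assms unfolding GT_def by simp
 then show ?thesis using assms by (simp add: expo_def)
qed

text \<open>The exponents of a signature are strictly decreasing, so a rearranged exponent vector
  determines its sorted form, hence the signature, and then the permutation.\<close>

lemma expo_permuted_inj:
 assumes mu: "mu \<in> GT N" "mu' \<in> GT N" and p: "p permutes {..<N}" "p' permutes {..<N}"
  and eq: "!!i. i < N ==> expo N mu (p i) = expo N mu' (p' i)"
 shows "mu = mu' & p = p'"
proof -
 let ?l = "%mu. rev (map (expo N mu) [0..<N])"
 have srt: "sorted (?l mu) & distinct (?l mu)" if "mu \<in> GT N" for mu
 proof -
  have inj: "inj_on (expo N mu) {0..<N}"
   using expo_strict[OF that] by (intro linorder_inj_onI') (metis atLeastLessThan_iff less_irrefl)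
  have "sorted_wrt (\<ge>) (map (expo N mu) [0..<N])"
   unfolding sorted_wrt_iff_nth_less using expo_strict[OF that] by (auto intro: less_imp_le)
  then show ?thesis using inj by (auto simp: sorted_wrt_rev distinct_map)
 qed
 have img: "set (?l mu) = (%i. expo N mu (p i)) ` {..<N}" if "p permutes {..<N}" for mu p
  using permutes_image[OF that] by (auto simp: image_image[symmetric] atLeast0LessThan)
 have "set (?l mu) = set (?l mu')"
  using img[OF p(1), of mu] img[OF p(2), of mu'] eq by auto
 then have "?l mu = ?l mu'"
  using srt[OF mu(1)] srt[OF mu(2)] sorted_distinct_set_unique by blast
 then have e: "expo N mu j = expo N mu' j" if "j < N" for j
  using that by (simp add: map_eq_conv)
 then have mm: "mu = mu'"
  using mu by (intro nth_equalityI) (auto simp: GT_def expo_def)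
 have "p i = p' i" for i
 proof (cases "i < N")
  case True
  have "p i < N" "p' i < N"
   using p True permutes_in_image[of _ "{..<N}" i] by auto
  then show ?thesis using eq[OF True] expo_strict[OF mu(2)] mm by (metis less_irrefl nat_neq_iff)
 next
  case False
  then show ?thesis using p by (auto simp: permutes_def)
 qed
 then show ?thesis using mm by auto
qed

text \<open>Multiplied by the Vandermonde product the relation becomes one between alternants, and
  monomials of different alternants never coincide.\<close>

lemma sp_independent:
 fixes e :: "int list => complex"
 assumes fin: "finite M" and M: "M \<subseteq> GT N"
  and zero: "!!x. (!!i. i < N ==> x i ~= 0) ==> (\<Sum>mu\<in>M. e mu * sp N mu x) = 0"
 shows "\<forall>mu\<in>M. e mu = 0"
proof -
 define K where "K = M \<times> {p. p permutes {..<N}}"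
 have "\<forall>k\<in>K. e (fst k) * of_int (sign (snd k)) = 0"
 proof (rule laurent_monomials_independent[where n = "%k i. expo N (fst k) (snd k i)" and N = N])
  show "finite K" using fin by (simp add: K_def finite_permutations)
  show "\<exists>i<N. expo N (fst k) (snd k i) ~= expo N (fst k') (snd k' i)"
   if "k \<in> K" "k' \<in> K" "k ~= k'" for k k'
   using expo_permuted_inj[of "fst k" N "fst k'" "snd k" "snd k'"] that M by (force simp: K_def)
  fix x :: "nat => complex" assume x: "!!i. i < N ==> x i ~= 0"
  have "(\<Sum>k\<in>K. e (fst k) * of_int (sign (snd k)) * (\<Prod>i<N. x i powi expo N (fst k) (snd k i)))
    = (\<Sum>mu\<in>M. e mu * detN N (%i j. x i powi expo N mu j))"
   by (simp add: K_def sum.cartesian_product' detN_def sum_distrib_left mult_ac)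
  also have "... = vander N x * (\<Sum>mu\<in>M. e mu * sp N mu x)"
   unfolding sum_distrib_left using det_eq_vander_sp[of _ N x] M x by (intro sum.cong) (auto simp: subset_iff)
  finally show "(\<Sum>k\<in>K. e (fst k) * of_int (sign (snd k)) * (\<Prod>i<N. x i powi expo N (fst k) (snd k i))) = 0"
   using zero[OF x] by simp
 qed
 note * = this
 show ?thesis
 proof
  fix mu assume "mu \<in> M"
  then have "(mu, id) \<in> K" by (simp add: K_def permutes_id)
  from bspec[OF * this] show "e mu = 0" by simp
 qed
qed

text \<open>A variable equal to 1 contributes the factor 1 in the branching rule, so iterating the
  rule gives path counts as coefficients.\<close>

lemma sp_branching:
 assumes "lam \<in> GT (k + n)"
 shows "\<exists>c :: int list => real. (\<forall>mu. 0 \<le> c mu) & {mu. c mu ~= 0} \<subseteq> GT k & finite {mu. c mu ~= 0} &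
   (\<forall>x. (\<forall>i<k. x i ~= 0) --> sp (k + n) lam (%i. if i < k then x i else 1)
    = (\<Sum>mu | c mu ~= 0. of_real (c mu) * sp k mu x))"
 using assms
proof (induction n arbitrary: lam)
 case 0
 have "sp k lam (%i. if i < k then x i else 1) = sp k lam x" for x by (rule sp_cong) simp
 moreover have "{mu. (if mu = lam then 1 else 0) ~= (0::real)} = {lam}" by auto
 ultimately show ?case using 0
  by (intro exI[of _ "%mu. if mu = lam then 1 else 0"]) auto
next
 case (Suc n)
 let ?x = "%x i. if i < k then x i else (1::complex)"
 have "\<forall>nu\<in>interlacing lam. \<exists>c :: int list => real. (\<forall>mu. 0 \<le> c mu) & {mu. c mu ~= 0} \<subseteq> GT k & finite {mu. c mu ~= 0} &
   (\<forall>x. (\<forall>i<k. x i ~= 0) --> sp (k + n) nu (?x x) = (\<Sum>mu | c mu ~= 0. of_real (c mu) * sp k mu x))"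
  using Suc.IH interlacing_subset_GT[of lam "k + n"] Suc.prems by auto
 from bchoice[OF this] obtain C where "\<forall>nu\<in>interlacing lam. (\<forall>mu. 0 \<le> C nu mu) & {mu. C nu mu ~= (0::real)} \<subseteq> GT k & finite {mu. C nu mu ~= 0} &
   (\<forall>x. (\<forall>i<k. x i ~= 0) --> sp (k + n) nu (?x x) = (\<Sum>mu | C nu mu ~= 0. of_real (C nu mu) * sp k mu x))" ..
 note C = bspec[OF this]
 define c where "c = (%mu. \<Sum>nu\<in>interlacing lam. C nu mu)"
 define B where "B = (\<Union>nu\<in>interlacing lam. {mu. C nu mu ~= 0})"
 have finB: "finite B" unfolding B_def using C finite_interlacing by auto
 have sub: "{mu. c mu ~= 0} \<subseteq> B"
  unfolding c_def B_def by (auto dest: sum.not_neutral_contains_not_neutral)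
 have "sp (k + Suc n) lam (?x x) = (\<Sum>mu | c mu ~= 0. of_real (c mu) * sp k mu x)"
  if x: "\<forall>i<k. x i ~= 0" for x
 proof -
  have "sp (k + Suc n) lam (?x x) = (\<Sum>nu\<in>interlacing lam. sp (k + n) nu (?x x))" by simp
  also have "... = (\<Sum>nu\<in>interlacing lam. \<Sum>mu\<in>B. of_real (C nu mu) * sp k mu x)"
  proof (rule sum.cong[OF refl])
   fix nu assume nu: "nu \<in> interlacing lam"
   have "sp (k + n) nu (?x x) = (\<Sum>mu | C nu mu ~= 0. of_real (C nu mu) * sp k mu x)" using C[OF nu] x by blast
   also have "... = (\<Sum>mu\<in>B. of_real (C nu mu) * sp k mu x)"
    by (rule sum.mono_neutral_left) (use finB nu in \<open>auto simp: B_def\<close>)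
   finally show "sp (k + n) nu (?x x) = (\<Sum>mu\<in>B. of_real (C nu mu) * sp k mu x)" .
  qed
  also have "... = (\<Sum>mu\<in>B. of_real (c mu) * sp k mu x)"
   by (subst sum.swap) (simp add: c_def sum_distrib_right)
  also have "... = (\<Sum>mu | c mu ~= 0. of_real (c mu) * sp k mu x)"
   by (rule sum.mono_neutral_right) (use finB sub in auto)
  finally show ?thesis .
 qed
 moreover have "\<forall>mu. 0 \<le> c mu" using C by (auto simp: c_def intro!: sum_nonneg)
 moreover have "B \<subseteq> GT k" using C by (auto simp: B_def)
 ultimately show ?case using finB sub by (intro exI[of _ c]) (auto intro: finite_subset)
qed

text \<open>\<open>prc\<close> is a definite description, so existence and uniqueness are both
  required: the first comes from \<open>sp_branching\<close>, the second from
  \<open>sp_independent\<close>, after \<open>schur\<close> has been rewritten as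
  \<open>sp\<close>.\<close>

lemma prc_properties:
 assumes lam: "lam \<in> GT k1" and k: "k2 \<le> k1"
 shows "0 \<le> prc k1 k2 lam mu"
  and "{mu. prc k1 k2 lam mu ~= 0} \<subseteq> GT k2"
  and "finite {mu. prc k1 k2 lam mu ~= 0}"
  and "(!!i. i < k2 ==> x i ~= 0) ==>
   sp k1 lam (%i. if i < k2 then x i else 1) / sp k1 lam ones =
   (\<Sum>mu | prc k1 k2 lam mu ~= 0. of_real (prc k1 k2 lam mu) * (sp k2 mu x / sp k2 mu ones))"
proof -
 define Q where "Q = (%c. (\<forall>mu. 0 \<le> c mu) & (\<forall>mu. c mu ~= 0 --> mu \<in> GT k2)
   & finite {mu. c mu ~= (0::real)}
   & (\<forall>x::nat => complex. (\<forall>i<k2. x i ~= 0) -->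
      schur k1 lam (%i. if i < k2 then x i else 1) / schur k1 lam ones
      = (\<Sum>mu\<in>{mu. c mu ~= 0}. of_real (c mu) * (schur k2 mu x / schur k2 mu ones))))"
 have ones0: "ones i ~= 0" for i by (simp add: ones_def)
 have L: "schur k1 lam (%i. if i < k2 then x i else 1) / schur k1 lam ones =
    sp k1 lam (%i. if i < k2 then x i else 1) / sp k1 lam ones"
  if "\<forall>i<k2. x i ~= 0" for x
  using that ones0 by (subst (1 2) schur_eq_sp[OF lam]) auto
 have R: "schur k2 mu x / schur k2 mu ones = sp k2 mu x / sp k2 mu ones"
  if "\<forall>i<k2. x i ~= 0" "mu \<in> GT k2" for x mu
  using that ones0 by (subst (1 2) schur_eq_sp) auto
 have Q: "Q c \<longleftrightarrow> (\<forall>mu. 0 \<le> c mu) & {mu. c mu ~= 0} \<subseteq> GT k2 & finite {mu. c mu ~= 0} &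
   (\<forall>x::nat => complex. (\<forall>i<k2. x i ~= 0) -->
      sp k1 lam (%i. if i < k2 then x i else 1) / sp k1 lam ones
      = (\<Sum>mu\<in>{mu. c mu ~= 0}. of_real (c mu) * (sp k2 mu x / sp k2 mu ones)))" for c
 proof -
  have "(\<Sum>mu\<in>{mu. c mu ~= 0}. of_real (c mu) * (schur k2 mu x / schur k2 mu ones))
    = (\<Sum>mu\<in>{mu. c mu ~= 0}. of_real (c mu) * (sp k2 mu x / sp k2 mu ones))"
   if "\<forall>i<k2. x i ~= 0" "{mu. c mu ~= 0} \<subseteq> GT k2" for x
  proof (intro sum.cong refl arg_cong2[where f = "(*)"])
   fix mu assume "mu \<in> {mu. c mu ~= 0}"
   then show "schur k2 mu x / schur k2 mu ones = sp k2 mu x / sp k2 mu ones"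
    using R[OF that(1)] that(2) by blast
  qed
  then show ?thesis unfolding Q_def using L by (auto simp: subset_iff)
 qed
 have ex: "\<exists>c. Q c"
 proof -
  from k obtain n where n: "k1 = k2 + n" using le_Suc_ex by blast
  obtain c :: "int list => real" where c: "\<forall>mu. 0 \<le> c mu" "{mu. c mu ~= 0} \<subseteq> GT k2" "finite {mu. c mu ~= 0}"
   and id: "!!x. (\<forall>i<k2. x i ~= 0) ==> sp k1 lam (%i. if i < k2 then x i else 1) = (\<Sum>mu | c mu ~= 0. of_real (c mu) * sp k2 mu x)"
   using sp_branching[of lam k2 n] lam n by blast
  obtain b where b: "b > (0::nat)" "sp k1 lam ones = of_nat b" using sp_ones[OF lam] by blast
  obtain f where f: "!!mu. mu \<in> GT k2 ==> f mu > (0::nat) & sp k2 mu ones = of_nat (f mu)"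
  proof -
   have "\<forall>mu\<in>GT k2. \<exists>k::nat. k > 0 & sp k2 mu ones = of_nat k" using sp_ones by blast
   from bchoice[OF this] obtain f where
    "\<forall>mu\<in>GT k2. f mu > (0::nat) & sp k2 mu ones = of_nat (f mu)" ..
   then show thesis by (intro that) (rule bspec)
  qed
  \<comment> \<open>The ratio of the values at \<open>ones\<close> converts path counts into
    coefficients for normalised Schur functions.\<close>
  define c' where "c' = (%mu. c mu * real (f mu) / real b)"
  have supp: "{mu. c' mu ~= 0} = {mu. c mu ~= 0}"
   using b c f by (auto simp: c'_def)
  have "Q c'" unfolding Q supp
  proof (intro conjI allI impI)
   show "0 \<le> c' mu" for mu using c by (simp add: c'_def)
   fix x :: "nat => complex" assume x: "\<forall>i<k2. x i ~= 0"
   show "sp k1 lam (%i. if i < k2 then x i else 1) / sp k1 lam ones =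
     (\<Sum>mu | c mu ~= 0. of_real (c' mu) * (sp k2 mu x / sp k2 mu ones))"
    unfolding id[OF x] b(2) sum_divide_distrib
   proof (intro sum.cong refl)
    fix mu assume "mu \<in> {mu. c mu ~= 0}"
    then have "f mu > 0 & sp k2 mu ones = of_nat (f mu)" using c f by blast
    then show "of_real (c mu) * sp k2 mu x / of_nat b = of_real (c' mu) * (sp k2 mu x / sp k2 mu ones)"
     by (simp add: c'_def)
   qed
  qed (use c in auto)
  then show ?thesis by blast
 qed
 have uniq: "c = c'" if c: "Q c" and c': "Q c'" for c c'
 proof -
  let ?M = "{mu. c mu ~= 0} \<union> {mu. c' mu ~= 0}"
  have M: "finite ?M" "?M \<subseteq> GT k2" using c c' by (auto simp: Q)
  have *: "\<forall>mu\<in>?M. of_real (c mu - c' mu) / sp k2 mu ones = 0"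
  proof (rule sp_independent[OF M])
   fix x :: "nat => complex" assume x: "!!i. i < k2 ==> x i ~= 0"
   let ?s = "%c. \<Sum>mu\<in>?M. of_real (c mu) * (sp k2 mu x / sp k2 mu ones)"
   have "?s c = (\<Sum>mu | c mu ~= 0. of_real (c mu) * (sp k2 mu x / sp k2 mu ones))"
    by (rule sum.mono_neutral_right) (use M in auto)
   moreover have "?s c' = (\<Sum>mu | c' mu ~= 0. of_real (c' mu) * (sp k2 mu x / sp k2 mu ones))"
    by (rule sum.mono_neutral_right) (use M in auto)
   ultimately have "?s c = ?s c'" using c c' x by (auto simp: Q)
   then have "?s c - ?s c' = 0" by simp
   then show "(\<Sum>mu\<in>?M. of_real (c mu - c' mu) / sp k2 mu ones * sp k2 mu x) = 0"
    unfolding sum_subtractf[symmetric] by (simp add: algebra_simps diff_divide_distrib)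
  qed
  have **: "c mu = c' mu" if "mu \<in> ?M" for mu
  proof -
   have "of_real (c mu - c' mu) / sp k2 mu ones = 0" using * that by blast
   moreover have "sp k2 mu ones ~= 0" using that M sp_ones_nonzero by blast
   ultimately show ?thesis by simp
  qed
  show ?thesis
  proof
   fix mu show "c mu = c' mu"
   proof (cases "mu \<in> ?M")
    case True then show ?thesis by (rule **)
   next
    case False then show ?thesis by simp
   qed
  qed
 qed
 have "prc k1 k2 lam = (THE c. Q c)" unfolding prc_def Q_def ..
 moreover have "\<exists>!c. Q c"
 proof -
  from ex obtain c where c: "Q c" ..
  show ?thesis
  proof (rule ex1I[of Q, OF c])
   fix c' assume "Q c'" from uniq[OF this c] show "c' = c" .
  qed
 qed
 ultimately have QQ: "Q (prc k1 k2 lam)" using theI'[of Q] by metis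
 show "0 \<le> prc k1 k2 lam mu" "{mu. prc k1 k2 lam mu ~= 0} \<subseteq> GT k2" "finite {mu. prc k1 k2 lam mu ~= 0}"
  using QQ by (auto simp: Q)
 show "sp k1 lam (%i. if i < k2 then x i else 1) / sp k1 lam ones =
   (\<Sum>mu | prc k1 k2 lam mu ~= 0. of_real (prc k1 k2 lam mu) * (sp k2 mu x / sp k2 mu ones))"
  if "!!i. i < k2 ==> x i ~= 0"
  using QQ that by (auto simp: Q)
qed

section \<open>A calculus of bounded functions that are holomorphic in each variable\<close>

subsection \<open>Bounded separately holomorphic functions on polydiscs\<close>

text \<open>Coordinates beyond m are 0, so that a polydisc in fewer variables is a subset of one in
  more, and dropping variables is plain restriction.\<close>

definition pdisc :: "nat => real => point set" where
 "pdisc m e = {y. (\<forall>i<m. cmod (y i) < e) & (\<forall>i\<ge>m. y i = 0)}"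

text \<open>Boundedness is built in: it makes the Cauchy estimates in each variable uniform and
  passes to products and uniform limits, so that one-variable arguments carry the whole
  theory.\<close>

definition sepholo :: "nat => real => (point => complex) => bool" where
 "sepholo m e G \<longleftrightarrow> (\<exists>M. \<forall>y\<in>pdisc m e. cmod (G y) \<le> M) &
   (\<forall>y\<in>pdisc m e. \<forall>i<m. (%t. G (y(i := t))) field_differentiable (at (y i)))"

lemma pdisc_upd: "y \<in> pdisc m e ==> i < m ==> cmod t < e ==> y(i := t) \<in> pdisc m e"
 by (auto simp: pdisc_def)

lemma pdisc_mono: "m' \<le> m ==> e' \<le> e ==> 0 < e ==> pdisc m' e' \<subseteq> pdisc m e"
proof
 fix y assume *: "m' \<le> m" "e' \<le> e" "0 < e" "y \<in> pdisc m' e'"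
 have "cmod (y i) < e" if "i < m" for i
  using * that by (cases "i < m'") (auto simp: pdisc_def intro: less_le_trans)
 then show "y \<in> pdisc m e" using * by (auto simp: pdisc_def)
qed

lemma sepholo_bound: "sepholo m e G ==> \<exists>M\<ge>0. \<forall>y\<in>pdisc m e. cmod (G y) \<le> M"
 unfolding sepholo_def by (meson order_trans abs_ge_self abs_ge_zero)

lemma sepholo_slice:
 assumes "sepholo m e G" "y \<in> pdisc m e" "i < m"
 shows "(%t. G (y(i := t))) holomorphic_on ball 0 e"
proof (subst holomorphic_on_open[OF open_ball], safe)
 fix t :: complex assume "t \<in> ball 0 e"
 then have "y(i := t) \<in> pdisc m e" using assms by (intro pdisc_upd) auto
 then have "(%s. G ((y(i := t))(i := s))) field_differentiable (at ((y(i := t)) i))"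
  using assms unfolding sepholo_def by blast
 then show "\<exists>f'. ((%t. G (y(i := t))) has_field_derivative f') (at t)"
  by (simp add: field_differentiable_def)
qed

lemma sepholoI:
 assumes "!!y. y \<in> pdisc m e ==> cmod (G y) \<le> M"
  and "!!y i. y \<in> pdisc m e ==> i < m ==> (%t. G (y(i := t))) field_differentiable (at (y i))"
 shows "sepholo m e G"
 using assms unfolding sepholo_def by blast

lemma sepholo_diff_at: "sepholo m e G ==> y \<in> pdisc m e ==> i < m ==>
  (%t. G (y(i := t))) field_differentiable (at (y i))"
 unfolding sepholo_def by blast

lemma sepholo_const: "sepholo m e (%_. c)"
 by (rule sepholoI[where M = "cmod c"]) auto

lemma sepholo_add:
 assumes "sepholo m e F" "sepholo m e G" shows "sepholo m e (%y. F y + G y)"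
proof -
 obtain M1 M2 where "\<forall>y\<in>pdisc m e. cmod (F y) \<le> M1" "\<forall>y\<in>pdisc m e. cmod (G y) \<le> M2"
  using assms unfolding sepholo_def by blast
 then show ?thesis using assms
  by (intro sepholoI[where M = "M1 + M2"])
    (auto intro!: field_differentiable_add sepholo_diff_at intro: order_trans[OF norm_triangle_ineq] add_mono)
qed

lemma sepholo_mult:
 assumes "sepholo m e F" "sepholo m e G" shows "sepholo m e (%y. F y * G y)"
proof -
 obtain M1 M2 where *: "M1 \<ge> 0" "M2 \<ge> 0" "\<forall>y\<in>pdisc m e. cmod (F y) \<le> M1" "\<forall>y\<in>pdisc m e. cmod (G y) \<le> M2"
  using assms sepholo_bound by metis
 then show ?thesis using assms
  by (intro sepholoI[where M = "M1 * M2"])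
    (auto intro!: field_differentiable_mult sepholo_diff_at mult_mono simp: norm_mult)
qed

lemma sepholo_diff:
 assumes "sepholo m e F" "sepholo m e G" shows "sepholo m e (%y. F y - G y)"
 using sepholo_add[OF assms(1) sepholo_mult[OF sepholo_const[of m e "-1"] assms(2)]] by simp

lemma sepholo_sum:
 assumes "!!l. l \<in> A ==> sepholo m e (F l)" shows "sepholo m e (%y. \<Sum>l\<in>A. F l y)"
 using assms by (induction A rule: infinite_finite_induct) (auto intro: sepholo_const sepholo_add)

lemma sepholo_mono:
 assumes "sepholo m e F" "m' \<le> m" "e' \<le> e" "0 < e" shows "sepholo m' e' F"
 using assms pdisc_mono[OF assms(2-4)] unfolding sepholo_def by (meson less_le_trans subsetD)

lemma sepholo_coord: "sepholo m e (%y. y i)"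
proof (rule sepholoI[where M = "\<bar>e\<bar>"])
 fix y assume y: "y \<in> pdisc m e"
 show "cmod (y i) \<le> \<bar>e\<bar>"
 proof (cases "i < m")
  case True
  then have "cmod (y i) < e" using y by (simp add: pdisc_def)
  then show ?thesis by simp
 next
  case False
  then show ?thesis using y by (simp add: pdisc_def)
 qed
next
 fix y :: "nat => complex" and j show "(%t. (y(j := t)) i) field_differentiable (at (y j))"
  by (cases "i = j") auto
qed

lemma sepholo_power: "sepholo m e F ==> sepholo m e (%y. F y ^ k)"
 by (induction k) (auto intro: sepholo_const sepholo_mult)

lemma sepholo_exp:
 assumes "sepholo m e F" shows "sepholo m e (%y. exp (F y))"
proof -
 obtain M where M: "\<forall>y\<in>pdisc m e. cmod (F y) \<le> M" using assms unfolding sepholo_def by blast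
 show ?thesis
 proof (rule sepholoI[where M = "exp M"])
  fix y assume "y \<in> pdisc m e"
  then show "cmod (exp (F y)) \<le> exp M"
   using M complex_Re_le_cmod[of "F y"] by (simp add: order_trans)
 next
  fix y i assume "y \<in> pdisc m e" "i < m"
  from sepholo_diff_at[OF assms this]
  obtain f' where "((%t. F (y(i := t))) has_field_derivative f') (at (y i))"
   by (auto simp: field_differentiable_def)
  then have "((%t. exp (F (y(i := t)))) has_field_derivative exp (F (y(i := y i))) * f') (at (y i))"
   by (rule DERIV_fun_exp)
  then show "(%t. exp (F (y(i := t)))) field_differentiable at (y i)"
   by (auto simp: field_differentiable_def)
 qed
qed

text \<open>The one-variable maximum principle, one coordinate at a time. The radii may differ,
  which allows a torus that avoids all diagonals y_i = y_j.\<close>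

lemma sepholo_torus_max:
 assumes h: "sepholo m e h" and r: "!!i. i < m ==> 0 < r i & r i < e"
  and B: "!!y. (!!i. i < m ==> cmod (y i) = r i) ==> (!!i. m \<le> i ==> y i = 0) ==> cmod (h y) \<le> B"
  and y: "!!i. i < m ==> cmod (y i) \<le> r i" "!!i. m \<le> i ==> y i = 0"
 shows "cmod (h y) \<le> B"
proof -
 \<comment> \<open>The coordinates from k on already lie on their circles; each induction step moves
   one more coordinate to its circle.\<close>
 have "k \<le> m ==> (!!i. i < k ==> cmod (y i) \<le> r i) ==> (!!i. k \<le> i ==> i < m ==> cmod (y i) = r i) ==>
   (!!i. m \<le> i ==> y i = 0) ==> cmod (h y) \<le> B" for k y
 proof (induction k arbitrary: y)
  case 0 then show ?case by (intro B) auto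
 next
  case (Suc k)
  have k: "k < m" using Suc.prems by simp
  have le: "cmod (y i) \<le> r i" if "i < m" for i
   using Suc.prems(2)[of i] Suc.prems(3)[of i] that by (cases "i < Suc k") auto
  have yp: "y \<in> pdisc m e"
   using le r Suc.prems(4) unfolding pdisc_def by (auto intro: le_less_trans)
  have hol: "(%t. h (y(k := t))) holomorphic_on ball 0 e" by (rule sepholo_slice[OF h yp k])
  have sub: "cball 0 (r k) \<subseteq> ball (0::complex) e" using r[OF k] by (auto simp: subset_iff)
  have "cmod (h (y(k := y k))) \<le> B"
  proof (rule maximum_modulus_frontier[of "%t. h (y(k := t))" "cball 0 (r k)" B "y k"])
   show "(%t. h (y(k := t))) holomorphic_on interior (cball 0 (r k))"
    by (rule holomorphic_on_subset[OF hol]) (use sub interior_subset in blast)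
   show "continuous_on (closure (cball 0 (r k))) (%t. h (y(k := t)))"
    using holomorphic_on_imp_continuous_on[OF hol] sub by (auto intro: continuous_on_subset)
   show "y k \<in> cball 0 (r k)" using le[OF k] by simp
   fix z :: complex assume "z \<in> frontier (cball 0 (r k))"
   then have z: "cmod z = r k" by (simp add: frontier_cball)
   show "cmod (h (y(k := z))) \<le> B"
   proof (rule Suc.IH)
    fix i assume "i < k"
    then show "cmod ((y(k := z)) i) \<le> r i" using Suc.prems(2)[of i] by simp
   next
    fix i assume "k \<le> i" "i < m"
    then show "cmod ((y(k := z)) i) = r i" using Suc.prems(3)[of i] z by (cases "i = k") auto
   next
    fix i assume "m \<le> i"
    then show "(y(k := z)) i = 0" using Suc.prems(4)[of i] k by simp
   qed (use k in simp)
  qed simp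
  then show ?case by simp
 qed
 from this[of m y] show ?thesis using y by auto
qed

lemma sepholo_uniform_limit:
 assumes F: "!!A. sepholo m e (S A)" and ul: "uniform_limit (pdisc m e) S G \<F>" and nt: "\<F> ~= bot"
 shows "sepholo m e G"
proof -
 have "eventually (%A. \<forall>y\<in>pdisc m e. dist (S A y) (G y) < 1) \<F>"
  using uniform_limitD[OF ul, of 1] by simp
 then obtain A where A: "\<forall>y\<in>pdisc m e. dist (S A y) (G y) < 1"
  using eventually_happens'[OF nt] by blast
 obtain M where M: "\<forall>y\<in>pdisc m e. cmod (S A y) \<le> M" using F[of A] unfolding sepholo_def by blast
 show ?thesis
 proof (rule sepholoI[where M = "M + 1"])
  fix y assume y: "y \<in> pdisc m e"
  have "cmod (G y) \<le> cmod (S A y) + dist (S A y) (G y)"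
   by (metis dist_commute dist_norm norm_triangle_sub)
  then show "cmod (G y) \<le> M + 1" using A M y by force
 next
  fix y i assume y: "y \<in> pdisc m e" and i: "i < m"
  define r where "r = (e - cmod (y i)) / 2"
  have r: "r > 0" using y i by (auto simp: r_def pdisc_def)
  have sub: "cball (y i) r \<subseteq> ball 0 e"
  proof
   fix t assume "t \<in> cball (y i) r"
   then have "dist (y i) t \<le> (e - cmod (y i)) / 2" by (simp add: r_def)
   moreover have "cmod t \<le> cmod (y i) + dist (y i) t"
    by (metis dist_commute dist_norm norm_triangle_sub)
   ultimately show "t \<in> ball 0 e" using r by (simp add: r_def)
  qed
  have "(%t. G (y(i := t))) holomorphic_on ball (y i) r"
  proof (rule holomorphic_uniform_limit[where f = "%A t. S A (y(i := t))" and z = "y i" and r = r and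
      g = "%t. G (y(i := t))" and F = \<F>])
   show "\<forall>\<^sub>F A in \<F>. continuous_on (cball (y i) r) (%t. S A (y(i := t))) & (%t. S A (y(i := t))) holomorphic_on ball (y i) r"
    using sepholo_slice[OF F y i] sub ball_subset_cball
    by (intro always_eventually allI conjI)
      (blast intro: holomorphic_on_subset holomorphic_on_imp_continuous_on continuous_on_subset)+
   show "uniform_limit (cball (y i) r) (%A t. S A (y(i := t))) (%t. G (y(i := t))) \<F>"
    unfolding uniform_limit_iff
   proof (intro allI impI)
    fix \<epsilon> :: real assume "\<epsilon> > 0"
    from uniform_limitD[OF ul this]
    show "\<forall>\<^sub>F n in \<F>. \<forall>t\<in>cball (y i) r. dist (S n (y(i := t))) (G (y(i := t))) < \<epsilon>"
    proof eventually_elim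
     case (elim A)
     then show ?case using pdisc_upd[OF y i] sub by (auto simp: subset_iff)
    qed
   qed
  qed (use nt in auto)
  then show "(%t. G (y(i := t))) field_differentiable at (y i)"
   using r by (auto simp: holomorphic_on_open field_differentiable_def)
 qed
qed

section \<open>Conjugated Euler operators and their bounds across the diagonals\<close>

subsection \<open>The operators \<open>D\<^sub>k\<close>\<close>

text \<open>The Euler operator x d/dx in the coordinate x = 1 + z; powers of x are its
  eigenfunctions.\<close>

definition theta :: "(complex => complex) => complex => complex" where
 "theta h = (%z. (1 + z) * deriv h z)"

lemma theta_apply: "theta h z = (1 + z) * deriv h z"
 by (simp add: theta_def)

lemma theta_pow_Suc: "(theta ^^ Suc k) h z = (1 + z) * deriv ((theta ^^ k) h) z"
proof -
 have "(theta ^^ Suc k) h z = theta ((theta ^^ k) h) z" by simp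
 then show ?thesis unfolding theta_apply .
qed

lemma theta_pow_holomorphic:
 assumes "open S" "f holomorphic_on S" shows "(theta ^^ k) f holomorphic_on S"
 by (induction k) (use assms in \<open>auto simp: theta_def intro!: holomorphic_intros holomorphic_deriv\<close>)

lemma theta_pow_cong:
 assumes S: "open S" and eq: "!!z. z \<in> S ==> f z = g z" and z: "z \<in> S"
 shows "(theta ^^ k) f z = (theta ^^ k) g z"
 using z
proof (induction k arbitrary: z)
 case (Suc k)
 have "eventually (%w. (theta ^^ k) f w = (theta ^^ k) g w) (nhds z)"
  using eventually_nhds_in_open[OF S Suc.prems] by eventually_elim (rule Suc.IH)
 then have "deriv ((theta ^^ k) f) z = deriv ((theta ^^ k) g) z" by (rule deriv_cong_ev) simp
 then show ?case by (simp add: theta_pow_Suc del: funpow.simps)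
qed (use eq in auto)

lemma theta_pow_add:
 assumes S: "open S" and fg: "f holomorphic_on S" "g holomorphic_on S" and z: "z \<in> S"
 shows "(theta ^^ k) (%z. f z + g z) z = (theta ^^ k) f z + (theta ^^ k) g z"
 using z
proof (induction k arbitrary: z)
 case (Suc k)
 have "eventually (%w. (theta ^^ k) (%z. f z + g z) w = (theta ^^ k) f w + (theta ^^ k) g w) (nhds z)"
  using eventually_nhds_in_open[OF S Suc.prems] by eventually_elim (rule Suc.IH)
 then have "deriv ((theta ^^ k) (%z. f z + g z)) z = deriv (%w. (theta ^^ k) f w + (theta ^^ k) g w) z"
  by (rule deriv_cong_ev) simp
 also have "... = deriv ((theta ^^ k) f) z + deriv ((theta ^^ k) g) z"
  by (rule deriv_add) (use theta_pow_holomorphic[OF S] fg S Suc.prems holomorphic_on_imp_differentiable_at in blast)+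
 finally show ?case by (simp add: theta_pow_Suc algebra_simps del: funpow.simps)
qed simp

lemma theta_pow_cmult:
 assumes S: "open S" and f: "f holomorphic_on S" and z: "z \<in> S"
 shows "(theta ^^ k) (%z. c * f z) z = c * (theta ^^ k) f z"
 using z
proof (induction k arbitrary: z)
 case (Suc k)
 have "eventually (%w. (theta ^^ k) (%z. c * f z) w = c * (theta ^^ k) f w) (nhds z)"
  using eventually_nhds_in_open[OF S Suc.prems] by eventually_elim (rule Suc.IH)
 then have "deriv ((theta ^^ k) (%z. c * f z)) z = deriv (%w. c * (theta ^^ k) f w) z"
  by (rule deriv_cong_ev) simp
 also have "... = c * deriv ((theta ^^ k) f) z"
  by (rule deriv_cmult) (use theta_pow_holomorphic[OF S f] S Suc.prems holomorphic_on_imp_differentiable_at in blast)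
 finally show ?case by (simp add: theta_pow_Suc algebra_simps del: funpow.simps)
qed simp

lemma deriv_bound:
 assumes "f holomorphic_on ball z r" "!!w. w \<in> ball z r ==> cmod (f w) \<le> B" "0 < \<rho>" "\<rho> < r"
 shows "cmod ((deriv ^^ n) f z) \<le> fact n * B / \<rho> ^ n"
proof (rule Cauchy_inequality)
 have sub: "cball z \<rho> \<subseteq> ball z r" using assms by auto
 show "f holomorphic_on ball z \<rho>" using assms by (auto intro: holomorphic_on_subset)
 show "continuous_on (cball z \<rho>) f"
  using assms sub by (blast intro: holomorphic_on_imp_continuous_on continuous_on_subset)
 show "cmod (f x) \<le> B" if "cmod (z - x) = \<rho>" for x using that assms by (auto simp: dist_norm)
qed fact

text \<open>Cauchy's estimate iterated. The constant depends on k only, so the bound can be used at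
  every scale r.\<close>

lemma theta_pow_bound:
 "\<exists>C\<ge>0. \<forall>H z r B. H holomorphic_on ball z r --> 0 < r --> r \<le> 1 --> cmod z \<le> 1 -->
   (\<forall>w\<in>ball z r. cmod (H w) \<le> B) --> cmod ((theta ^^ k) H z) \<le> C * B / r ^ k"
proof (induction k)
 case 0 show ?case by (rule exI[of _ 1]) auto
next
 case (Suc k)
 then obtain C where C: "C \<ge> 0" "!!H z r B. H holomorphic_on ball z r ==> 0 < r ==> r \<le> 1 ==> cmod z \<le> 1 ==>
   (!!w. w\<in>ball z r ==> cmod (H w) \<le> B) ==> cmod ((theta ^^ k) H z) \<le> C * B / r ^ k" by blast
 show ?case
 \<comment> \<open>On the ball of half the radius, Cauchy's estimate with radius r / 4 gives |H'| <=
   4 B / r, and |1 + w| <= 3; this is the 12. Halving the radius for the remaining k steps costs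
   2^k.\<close>
 proof (intro exI[of _ "12 * 2 ^ k * C"] conjI allI impI)
  fix H and z :: complex and r B :: real
  assume H: "H holomorphic_on ball z r" and r: "0 < r" "r \<le> 1" and z: "cmod z \<le> 1"
   and B: "\<forall>w\<in>ball z r. cmod (H w) \<le> B"
  have "cmod ((theta ^^ k) (theta H) z) \<le> C * (12 * B / r) / (r / 2) ^ k"
  proof (rule C(2))
   show "theta H holomorphic_on ball z (r / 2)"
    using H r unfolding theta_def
    by (intro holomorphic_intros holomorphic_deriv) (auto intro: holomorphic_on_subset)
   fix w assume w: "w \<in> ball z (r / 2)"
   have sub: "ball w (r / 2) \<subseteq> ball z r"
   proof
    fix u assume "u \<in> ball w (r / 2)"
    then show "u \<in> ball z r" using w dist_triangle[of z u w] by simp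
   qed
   have "cmod ((deriv ^^ 1) H w) \<le> fact 1 * B / (r / 4) ^ 1"
    by (rule deriv_bound[where r = "r / 2"]) (use H B sub r in \<open>auto intro: holomorphic_on_subset\<close>)
   then have d: "cmod (deriv H w) \<le> 4 * B / r" by (simp add: mult.commute)
   have "cmod (1 + w) \<le> 1 + (cmod z + dist z w)"
    by (metis add_left_mono dist_commute dist_norm norm_one norm_triangle_ineq norm_triangle_sub order_trans)
   also have "... \<le> 3" using z w r by simp
   finally have "cmod (theta H w) \<le> 3 * (4 * B / r)"
    unfolding theta_def norm_mult using d by (intro mult_mono) auto
   then show "cmod (theta H w) \<le> 12 * B / r" by simp
  qed (use r z in auto)
  then show "cmod ((theta ^^ Suc k) H z) \<le> 12 * 2 ^ k * C * B / r ^ Suc k"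
   by (simp add: funpow_swap1 power_divide field_simps)
 qed (use C in simp)
qed

definition nodeprod :: "nat => point => nat => complex => complex" where
 "nodeprod m y i z = (\<Prod>a\<in>{..<m} - {i}. (z - y a))"

text \<open>As a function of y_i the Vandermonde product is a constant times
  \<open>nodeprod\<close>, so the conjugation needs this factor only. When coordinates coincide the
  division by zero gives a meaningless value; the operator is therefore used under
  \<open>distinct_coords\<close>, and extended holomorphically from there.\<close>

definition Dop :: "nat => nat => (point => complex) => point => complex" where
 "Dop k m G y = (\<Sum>i<m. (theta ^^ k) (%z. nodeprod m y i z * G (y(i := z))) (y i) / nodeprod m y i (y i))"

definition distinct_coords :: "nat => point => bool" where
 "distinct_coords m y \<longleftrightarrow> (\<forall>i<m. \<forall>j<m. i ~= j --> y i ~= y j)"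

lemma nodeprod_holomorphic [holomorphic_intros]: "nodeprod m y i holomorphic_on S"
 unfolding nodeprod_def by (intro holomorphic_intros)

lemma Dop_slice_holomorphic:
 assumes "sepholo m e G" "y \<in> pdisc m e" "i < m"
 shows "(%z. nodeprod m y i z * G (y(i := z))) holomorphic_on ball 0 e"
 by (intro holomorphic_intros sepholo_slice[OF assms])

lemma Dop_add:
 assumes "sepholo m e F" "sepholo m e G" "y \<in> pdisc m e"
 shows "Dop k m (%y. F y + G y) y = Dop k m F y + Dop k m G y"
 unfolding Dop_def sum.distrib[symmetric] add_divide_distrib[symmetric]
proof (intro sum.cong refl arg_cong2[where f = "(/)"])
 fix i assume i: "i \<in> {..<m}"
 have "(theta ^^ k) (%z. nodeprod m y i z * F (y(i := z)) + nodeprod m y i z * G (y(i := z))) (y i) =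
    (theta ^^ k) (%z. nodeprod m y i z * F (y(i := z))) (y i) + (theta ^^ k) (%z. nodeprod m y i z * G (y(i := z))) (y i)"
  by (rule theta_pow_add[where S = "ball 0 e"])
    (use assms i in \<open>auto intro: Dop_slice_holomorphic simp: pdisc_def\<close>)
 then show "(theta ^^ k) (%z. nodeprod m y i z * (F (y(i := z)) + G (y(i := z)))) (y i) =
    (theta ^^ k) (%z. nodeprod m y i z * F (y(i := z))) (y i) + (theta ^^ k) (%z. nodeprod m y i z * G (y(i := z))) (y i)"
  by (simp add: distrib_left)
qed

lemma Dop_cmult:
 assumes "sepholo m e F" "y \<in> pdisc m e"
 shows "Dop k m (%y. c * F y) y = c * Dop k m F y"
 unfolding Dop_def sum_distrib_left
proof (intro sum.cong refl)
 fix i assume i: "i \<in> {..<m}"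
 have "(theta ^^ k) (%z. c * (nodeprod m y i z * F (y(i := z)))) (y i) =
    c * (theta ^^ k) (%z. nodeprod m y i z * F (y(i := z))) (y i)"
  by (rule theta_pow_cmult[where S = "ball 0 e"])
    (use assms i in \<open>auto intro: Dop_slice_holomorphic simp: pdisc_def\<close>)
 then show "(theta ^^ k) (%z. nodeprod m y i z * (c * F (y(i := z)))) (y i) / nodeprod m y i (y i) =
    c * ((theta ^^ k) (%z. nodeprod m y i z * F (y(i := z))) (y i) / nodeprod m y i (y i))"
  by (simp add: mult_ac)
qed

lemma Dop_diff:
 assumes "sepholo m e F" "sepholo m e G" "y \<in> pdisc m e"
 shows "Dop k m (%y. F y - G y) y = Dop k m F y - Dop k m G y"
 using Dop_add[OF assms(1) sepholo_mult[OF sepholo_const[of m e "-1"] assms(2)] assms(3)]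
  Dop_cmult[OF assms(2,3), of k "-1"] by simp

lemma Dop_zero: assumes "y \<in> pdisc m e" shows "Dop k m (%_. 0) y = 0"
 using Dop_cmult[OF sepholo_const[of m e 0] assms, of k 0] by simp

lemma Dop_sum:
 assumes "!!l. l \<in> A ==> sepholo m e (F l)" "y \<in> pdisc m e"
 shows "Dop k m (%y. \<Sum>l\<in>A. F l y) y = (\<Sum>l\<in>A. Dop k m (F l) y)"
 using assms(1)
proof (induction A rule: infinite_finite_induct)
 case (insert x A)
 have "sepholo m e (%y. \<Sum>l\<in>A. F l y)" by (rule sepholo_sum) (use insert in auto)
 then show ?case using insert Dop_add[OF _ _ assms(2), of "F x" "%y. \<Sum>l\<in>A. F l y" k] by simp
qed (use Dop_zero[OF assms(2)] in auto)

lemma nodeprod_bound: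
 assumes "i < m" "!!a. a < m ==> cmod (z - y a) \<le> R"
 shows "cmod (nodeprod m y i z) \<le> R ^ (m - 1)"
proof -
 have "cmod (nodeprod m y i z) \<le> (\<Prod>a\<in>{..<m} - {i}. R)"
  unfolding nodeprod_def prod_norm[symmetric] by (rule prod_mono) (use assms in auto)
 then show ?thesis using assms by (simp add: card_Diff_singleton)
qed

lemma nodeprod_lower:
 assumes "i < m" "!!a. a < m ==> a ~= i ==> R \<le> cmod (z - y a)" "0 \<le> R"
 shows "R ^ (m - 1) \<le> cmod (nodeprod m y i z)"
proof -
 have "(\<Prod>a\<in>{..<m} - {i}. R) \<le> cmod (nodeprod m y i z)"
  unfolding nodeprod_def prod_norm[symmetric] by (rule prod_mono) (use assms in auto)
 then show ?thesis using assms by (simp add: card_Diff_singleton)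
qed

text \<open>The radii (i + 2) \<delta> keep the coordinates at mutual distance at least \<delta>, so
  the denominator is at least \<delta>^(m-1), while the numerator product is at most ((2 m + 3)
  \<delta>)^(m-1). These powers of \<delta> cancel, and only the k derivatives cost a factor
  \<delta>^(-k).\<close>

lemma Dop_bound_torus:
 "\<exists>C\<ge>0. \<forall>e g \<delta> B y. sepholo m e g --> 0 < \<delta> --> (real m + 3) * \<delta> \<le> 1 --> (real m + 3) * \<delta> < e -->
   (\<forall>y\<in>pdisc m ((real m + 3) * \<delta>). cmod (g y) \<le> B) -->
   (\<forall>i<m. cmod (y i) = (i + 2) * \<delta>) --> (\<forall>i\<ge>m. y i = 0) --> cmod (Dop k m g y) \<le> C * B / \<delta> ^ k"
proof -
 obtain C where C: "C \<ge> 0" "!!H z r B. H holomorphic_on ball z r ==> 0 < r ==> r \<le> 1 ==> cmod z \<le> 1 ==>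
   (!!w. w\<in>ball z r ==> cmod (H w) \<le> B) ==> cmod ((theta ^^ k) H z) \<le> C * B / r ^ k"
  using theta_pow_bound[of k] by blast
 define K where "K = real m * (C * (2 * m + 3) ^ (m - 1) * 2 ^ k)"
 show ?thesis
 proof (intro exI[of _ K] conjI allI impI)
  show "0 \<le> K" using C(1) by (simp add: K_def)
  fix e \<delta> B :: real and g and y :: "nat => complex"
  assume g: "sepholo m e g" and \<delta>: "0 < \<delta>" "(real m + 3) * \<delta> \<le> 1" "(real m + 3) * \<delta> < e"
   and B: "\<forall>y\<in>pdisc m ((real m + 3) * \<delta>). cmod (g y) \<le> B"
   and y: "\<forall>i<m. cmod (y i) = (i + 2) * \<delta>" "\<forall>i\<ge>m. y i = 0"
  have yle: "cmod (y i) \<le> (real m + 1) * \<delta>" if "i < m" for i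
  proof -
   have "real i + 2 \<le> real m + 1" using that by linarith
   then show ?thesis using y(1) that \<delta> by (simp add: mult_right_mono)
  qed
  have m1: "(real m + 1) * \<delta> < (real m + 3) * \<delta>" "(real m + 2) * \<delta> < (real m + 3) * \<delta>" using \<delta> by auto
  have "cmod (y i) < (real m + 3) * \<delta>" if "i < m" for i using yle[OF that] m1(1) by linarith
  then have yp: "y \<in> pdisc m ((real m + 3) * \<delta>)"
   using y(2) by (auto simp: pdisc_def)
  have ype: "y \<in> pdisc m e" using yp \<delta> by (auto simp: pdisc_def intro: less_trans)
  have B0: "B \<ge> 0" using B yp norm_ge_zero order_trans by blast
  have summand: "cmod ((theta ^^ k) (%z. nodeprod m y i z * g (y(i := z))) (y i) / nodeprod m y i (y i))
    \<le> C * (2 * m + 3) ^ (m - 1) * 2 ^ k * B / \<delta> ^ k" if i: "i < m" for i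
  proof -
   have near: "cmod w < (real m + 2) * \<delta>" if "w \<in> ball (y i) (\<delta> / 2)" for w
   proof -
    have "cmod w \<le> cmod (y i) + dist (y i) w" by (metis dist_commute dist_norm norm_triangle_sub)
    also have "... < (real m + 1) * \<delta> + \<delta> / 2" using yle[OF i] that by auto
    finally show ?thesis using \<delta> by (simp add: algebra_simps)
   qed
   have "cmod ((theta ^^ k) (%z. nodeprod m y i z * g (y(i := z))) (y i))
     \<le> C * (((2 * m + 3) * \<delta>) ^ (m - 1) * B) / (\<delta> / 2) ^ k"
   proof (rule C(2))
    show "(%z. nodeprod m y i z * g (y(i := z))) holomorphic_on ball (y i) (\<delta> / 2)"
    proof (rule holomorphic_on_subset[OF Dop_slice_holomorphic[OF g ype i]], rule subsetI)
     fix w assume "w \<in> ball (y i) (\<delta> / 2)"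
     from near[OF this] have "cmod w < (real m + 2) * \<delta>" by (simp add: add.commute)
     also have "(real m + 2) * \<delta> < e" using m1(2) \<delta>(3) by linarith
     finally show "w \<in> ball 0 e" by simp
    qed
    have "(1::real) * \<delta> \<le> (real m + 3) * \<delta>" using \<delta> by (intro mult_right_mono) auto
    then have "\<delta> \<le> 1" using \<delta>(2) by simp
    then show "\<delta> / 2 \<le> 1" by simp
    show "cmod (y i) \<le> 1" using yle[OF i] m1(1) \<delta>(2) by linarith
    fix w assume w: "w \<in> ball (y i) (\<delta> / 2)"
    have "y(i := w) \<in> pdisc m ((real m + 3) * \<delta>)" using near[OF w] m1(2) by (intro pdisc_upd[OF yp i]) linarith
    then have "cmod (g (y(i := w))) \<le> B" using B by blast
    moreover have "cmod (nodeprod m y i w) \<le> ((2 * m + 3) * \<delta>) ^ (m - 1)"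
    proof (rule nodeprod_bound[OF i])
     fix a assume "a < m"
     then have "cmod (w - y a) \<le> (real m + 2) * \<delta> + (real m + 1) * \<delta>"
      using near[OF w] yle[of a] norm_triangle_ineq4[of w "y a"] by linarith
     then show "cmod (w - y a) \<le> (2 * m + 3) * \<delta>" by (simp add: algebra_simps)
    qed
    ultimately show "cmod (nodeprod m y i w * g (y(i := w))) \<le> ((2 * m + 3) * \<delta>) ^ (m - 1) * B"
     unfolding norm_mult using \<delta> by (intro mult_mono) auto
   qed (use \<delta> in auto)
   moreover have "\<delta> ^ (m - 1) \<le> cmod (nodeprod m y i (y i))"
   proof (rule nodeprod_lower[OF i])
    fix a assume a: "a < m" "a ~= i"
    have "\<delta> * 1 \<le> \<delta> * \<bar>real i - real a\<bar>" using a \<delta> by (intro mult_left_mono) auto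
    also have "... = \<bar>cmod (y i) - cmod (y a)\<bar>"
     using y(1) i a \<delta> by (simp add: left_diff_distrib[symmetric] abs_mult)
    also have "... \<le> cmod (y i - y a)" by (rule norm_triangle_ineq3)
    finally show "\<delta> \<le> cmod (y i - y a)" by simp
   qed (use \<delta> in simp)
   ultimately have "cmod ((theta ^^ k) (%z. nodeprod m y i z * g (y(i := z))) (y i) / nodeprod m y i (y i))
     \<le> (C * (((2 * m + 3) * \<delta>) ^ (m - 1) * B) / (\<delta> / 2) ^ k) / \<delta> ^ (m - 1)"
    unfolding norm_divide using \<delta> C(1) B0 by (intro frac_le) auto
   also have "((2 * m + 3) * \<delta>) ^ (m - 1) = real (2 * m + 3) ^ (m - 1) * \<delta> ^ (m - 1)"
    by (rule power_mult_distrib)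
   also have "(C * (real (2 * m + 3) ^ (m - 1) * \<delta> ^ (m - 1) * B) / (\<delta> / 2) ^ k) / \<delta> ^ (m - 1)
     = C * (2 * m + 3) ^ (m - 1) * 2 ^ k * B / \<delta> ^ k"
    using \<delta>(1) by (simp add: power_divide)
   finally show ?thesis .
  qed
  have "cmod (Dop k m g y) \<le> (\<Sum>i<m. C * (2 * m + 3) ^ (m - 1) * 2 ^ k * B / \<delta> ^ k)"
   unfolding Dop_def by (intro order_trans[OF norm_sum] sum_mono summand) simp
  then show "cmod (Dop k m g y) \<le> K * B / \<delta> ^ k" by (simp add: K_def)
 qed
qed

text \<open>F is holomorphic and agrees with D_k g off the diagonals. The torus of radii (i + 2)
  \<delta> avoids them, so the bound for D_k g holds on it and spreads inwards; 2 \<delta> is the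
  smallest radius.\<close>

lemma Dop_extension_bound:
 "\<exists>C\<ge>0. \<forall>e g F \<delta> B y. sepholo m e g --> sepholo m e F -->
   (\<forall>y\<in>pdisc m e. distinct_coords m y --> F y = Dop k m g y) -->
   0 < \<delta> --> (real m + 3) * \<delta> \<le> 1 --> (real m + 3) * \<delta> < e -->
   (\<forall>y\<in>pdisc m ((real m + 3) * \<delta>). cmod (g y) \<le> B) -->
   (\<forall>i<m. cmod (y i) \<le> 2 * \<delta>) --> (\<forall>i\<ge>m. y i = 0) --> cmod (F y) \<le> C * B / \<delta> ^ k"
proof -
 obtain C where C: "C \<ge> 0" and bnd: "!!e g \<delta> B y. sepholo m e g ==> 0 < \<delta> ==> (real m + 3) * \<delta> \<le> 1 ==> (real m + 3) * \<delta> < e ==>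
   (\<forall>y\<in>pdisc m ((real m + 3) * \<delta>). cmod (g y) \<le> B) ==>
   (\<forall>i<m. cmod (y i) = (i + 2) * \<delta>) ==> (\<forall>i\<ge>m. y i = 0) ==> cmod (Dop k m g y) \<le> C * B / \<delta> ^ k"
  using Dop_bound_torus[of m k] by blast
 show ?thesis
 proof (intro exI[of _ C] conjI allI impI)
  fix e \<delta> B :: real and g F and y :: "nat => complex"
  assume g: "sepholo m e g" and F: "sepholo m e F"
   and FD: "\<forall>y\<in>pdisc m e. distinct_coords m y --> F y = Dop k m g y"
   and \<delta>: "0 < \<delta>" "(real m + 3) * \<delta> \<le> 1" "(real m + 3) * \<delta> < e"
   and B: "\<forall>y\<in>pdisc m ((real m + 3) * \<delta>). cmod (g y) \<le> B"
   and y: "\<forall>i<m. cmod (y i) \<le> 2 * \<delta>" "\<forall>i\<ge>m. y i = 0"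
  have lt: "(real i + 2) * \<delta> < e" if "i < m" for i
  proof -
   have "(real i + 2) * \<delta> \<le> (real m + 3) * \<delta>" using that \<delta> by (intro mult_right_mono) auto
   then show ?thesis using \<delta>(3) by linarith
  qed
  show "cmod (F y) \<le> C * B / \<delta> ^ k"
  proof (rule sepholo_torus_max[OF F, of "%i. (i + 2) * \<delta>"])
   show "0 < (real i + 2) * \<delta> & (real i + 2) * \<delta> < e" if "i < m" for i using lt[OF that] \<delta> by auto
   show "cmod (y i) \<le> (real i + 2) * \<delta>" if "i < m" for i
   proof -
    have "2 * \<delta> \<le> (real i + 2) * \<delta>" using \<delta> by (intro mult_right_mono) auto
    then show ?thesis using y that by fastforce
   qed
   show "y i = 0" if "m \<le> i" for i using y that by auto
   fix v :: "nat => complex"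
   assume v: "!!i. i < m ==> cmod (v i) = (real i + 2) * \<delta>" "!!i. m \<le> i ==> v i = 0"
   have "v \<in> pdisc m e" using v lt by (auto simp: pdisc_def)
   moreover have "distinct_coords m v"
    unfolding distinct_coords_def
   proof (intro allI impI notI)
    fix i j assume "i < m" "j < m" "i ~= j" "v i = v j"
    then have "(real i + 2) * \<delta> = (real j + 2) * \<delta>" using v(1)[of i] v(1)[of j] by simp
    then show False using \<delta> \<open>i ~= j\<close> by simp
   qed
   ultimately have "F v = Dop k m g v" using FD by blast
   then show "cmod (F v) \<le> C * B / \<delta> ^ k" using bnd[OF g \<delta> B] v by simp
  qed
 qed (use C in simp)
qed

section \<open>Orders of vanishing and their loss under D_k\<close>

subsection \<open>Order of vanishing at the origin\<close>

text \<open>Order of vanishing as a size estimate on small polydiscs, not through derivatives, so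
  that it combines directly with products, restrictions and the torus bounds.\<close>

definition vanO :: "nat => nat => (point => complex) => bool" where
 "vanO m q G \<longleftrightarrow> (\<exists>C\<ge>0. \<exists>e>0. \<forall>\<delta> y. 0 < \<delta> --> \<delta> < e --> (\<forall>i<m. cmod (y i) \<le> \<delta>) --> (\<forall>i\<ge>m. y i = 0) -->
   cmod (G y) \<le> C * \<delta> ^ q)"

lemma vanOI:
 assumes "C \<ge> 0" "e > 0"
  and "!!\<delta> y. 0 < \<delta> ==> \<delta> < e ==> (\<forall>i<m. cmod (y i) \<le> \<delta>) ==> (\<forall>i\<ge>m. y i = 0) ==> cmod (G y) \<le> C * \<delta> ^ q"
 shows "vanO m q G"
 using assms unfolding vanO_def by blast

lemma vanOE:
 assumes "vanO m q G"
 obtains C e where "C \<ge> 0" "e > 0"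
  "!!\<delta> y. 0 < \<delta> ==> \<delta> < e ==> (\<forall>i<m. cmod (y i) \<le> \<delta>) ==> (\<forall>i\<ge>m. y i = 0) ==> cmod (G y) \<le> C * \<delta> ^ q"
 using assms unfolding vanO_def by blast

lemma vanO_restrict: "vanO m q G ==> m' \<le> m ==> vanO m' q G"
proof -
 assume van: "vanO m q G" and m: "m' \<le> m"
 obtain C e where C: "C \<ge> 0" "e > 0" "!!\<delta> y. 0 < \<delta> ==> \<delta> < e ==> (\<forall>i<m. cmod (y i) \<le> \<delta>) ==> (\<forall>i\<ge>m. y i = 0) ==>
   cmod (G y) \<le> C * \<delta> ^ q"
  by (rule vanOE[OF van]) blast
 show "vanO m' q G"
 proof (rule vanOI[of "C" "e"])
  fix \<delta> y assume *: "0 < \<delta>" "\<delta> < e" "\<forall>i<m'. cmod (y i) \<le> \<delta>" "\<forall>i\<ge>m'. y i = 0"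
  have "cmod (y i) \<le> \<delta>" for i using * by (cases "i < m'") auto
  then show "cmod (G y) \<le> C * \<delta> ^ q" using * m by (intro C) auto
 qed (use C in auto)
qed

lemma vanO_zero:
 assumes "vanO m q G" "q \<ge> 1" shows "G (%_. 0) = 0"
proof -
 obtain C e where C: "C \<ge> 0" "e > 0" "!!\<delta> y. 0 < \<delta> ==> \<delta> < e ==> (\<forall>i<m. cmod (y i) \<le> \<delta>) ==> (\<forall>i\<ge>m. y i = 0) ==>
   cmod (G y) \<le> C * \<delta> ^ q"
  by (rule vanOE[OF assms(1)]) blast
 have ev: "eventually (%\<delta>. cmod (G (%_. 0)) \<le> C * \<delta> ^ q) (at_right (0::real))"
  using eventually_at_right_real[OF C(2)] by eventually_elim (rule C(3), auto)
 have "((%\<delta>::real. C * \<delta> ^ q) \<longlongrightarrow> C * 0 ^ q) (at_right 0)" by (intro tendsto_intros)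
 then have "cmod (G (%_. 0)) \<le> C * 0 ^ q"
  by (rule tendsto_lowerbound[OF _ ev]) simp
 then show ?thesis using assms(2) by (simp add: power_0_left)
qed

lemma vanO_add:
 assumes "vanO m q F" "vanO m q G" shows "vanO m q (%y. F y + G y)"
proof -
 obtain C e where C: "C \<ge> 0" "e > 0" "!!\<delta> y. 0 < \<delta> ==> \<delta> < e ==> (\<forall>i<m. cmod (y i) \<le> \<delta>) ==> (\<forall>i\<ge>m. y i = 0) ==>
   cmod (F y) \<le> C * \<delta> ^ q"
  by (rule vanOE[OF assms(1)]) blast
 obtain C' e' where C': "C' \<ge> 0" "e' > 0" "!!\<delta> y. 0 < \<delta> ==> \<delta> < e' ==> (\<forall>i<m. cmod (y i) \<le> \<delta>) ==> (\<forall>i\<ge>m. y i = 0) ==>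
   cmod (G y) \<le> C' * \<delta> ^ q"
  by (rule vanOE[OF assms(2)]) blast
 show ?thesis
 proof (rule vanOI[of "C + C'" "min e e'"])
  fix \<delta> y assume *: "0 < \<delta>" "\<delta> < min e e'" "\<forall>i<m. cmod (y i) \<le> \<delta>" "\<forall>i\<ge>m. y i = 0"
  have "cmod (F y + G y) \<le> C * \<delta> ^ q + C' * \<delta> ^ q"
   using * by (intro order_trans[OF norm_triangle_ineq] add_mono C C') auto
  then show "cmod (F y + G y) \<le> (C + C') * \<delta> ^ q" by (simp add: algebra_simps)
 qed (use C C' in auto)
qed

lemma vanO_mult:
 assumes "vanO m p F" "vanO m q G" shows "vanO m (p + q) (%y. F y * G y)"
proof -
 obtain C e where C: "C \<ge> 0" "e > 0" "!!\<delta> y. 0 < \<delta> ==> \<delta> < e ==> (\<forall>i<m. cmod (y i) \<le> \<delta>) ==> (\<forall>i\<ge>m. y i = 0) ==>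
   cmod (F y) \<le> C * \<delta> ^ p"
  by (rule vanOE[OF assms(1)]) blast
 obtain C' e' where C': "C' \<ge> 0" "e' > 0" "!!\<delta> y. 0 < \<delta> ==> \<delta> < e' ==> (\<forall>i<m. cmod (y i) \<le> \<delta>) ==> (\<forall>i\<ge>m. y i = 0) ==>
   cmod (G y) \<le> C' * \<delta> ^ q"
  by (rule vanOE[OF assms(2)]) blast
 show ?thesis
 proof (rule vanOI[of "C * C'" "min e e'"])
  fix \<delta> y assume *: "0 < \<delta>" "\<delta> < min e e'" "\<forall>i<m. cmod (y i) \<le> \<delta>" "\<forall>i\<ge>m. y i = 0"
  have "cmod (F y * G y) \<le> (C * \<delta> ^ p) * (C' * \<delta> ^ q)"
   unfolding norm_mult using * C(1) by (intro mult_mono C C') auto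
  then show "cmod (F y * G y) \<le> (C * C') * \<delta> ^ (p + q)" by (simp add: power_add mult_ac)
 qed (use C C' in auto)
qed

lemma vanO_bounded:
 assumes "sepholo m e G" "e > 0" shows "vanO m 0 G"
proof -
 obtain M where M: "M \<ge> 0" "\<forall>y\<in>pdisc m e. cmod (G y) \<le> M" using sepholo_bound[OF assms(1)] by blast
 show ?thesis
 proof (rule vanOI[of M e])
  fix \<delta> y assume *: "0 < \<delta>" "\<delta> < e" "\<forall>i<m. cmod (y i) \<le> \<delta>" "\<forall>i\<ge>m. y i = 0"
  have "y \<in> pdisc m e" unfolding pdisc_def using * by (auto intro: le_less_trans)
  then show "cmod (G y) \<le> M * \<delta> ^ 0" using M by simp
 qed (use M assms in auto)
qed

lemma vanO_mono:
 assumes "vanO m q G" "q' \<le> q" shows "vanO m q' G"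
proof -
 obtain C e where C: "C \<ge> 0" "e > 0" "!!\<delta> y. 0 < \<delta> ==> \<delta> < e ==> (\<forall>i<m. cmod (y i) \<le> \<delta>) ==> (\<forall>i\<ge>m. y i = 0) ==>
   cmod (G y) \<le> C * \<delta> ^ q"
  by (rule vanOE[OF assms(1)]) blast
 show ?thesis
 proof (rule vanOI[of "C" "min e 1"])
  fix \<delta> y assume *: "0 < \<delta>" "\<delta> < min e 1" "\<forall>i<m. cmod (y i) \<le> \<delta>" "\<forall>i\<ge>m. y i = 0"
  have "cmod (G y) \<le> C * \<delta> ^ q" using * by (intro C) auto
  also have "... \<le> C * \<delta> ^ q'" using * C assms(2) by (intro mult_left_mono power_decreasing) auto
  finally show "cmod (G y) \<le> C * \<delta> ^ q'" .
 qed (use C in auto)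
qed

text \<open>A bound of order \<delta>^q for g becomes one of order \<delta>^q / \<delta>^k for F.
  This is why a jet of fixed order determines the moments.\<close>

lemma vanO_Dop:
 assumes g: "sepholo m e g" and F: "sepholo m e F" and e: "e > 0"
  and FD: "!!y. y\<in>pdisc m e ==> distinct_coords m y ==> F y = Dop k m g y"
  and van: "vanO m q g" and k: "k \<le> q"
 shows "vanO m (q - k) F"
proof -
 obtain K where K: "K \<ge> 0" "!!e g F \<delta> B y. sepholo m e g ==> sepholo m e F ==>
   (\<forall>y\<in>pdisc m e. distinct_coords m y --> F y = Dop k m g y) ==>
   0 < \<delta> ==> (real m + 3) * \<delta> \<le> 1 ==> (real m + 3) * \<delta> < e ==>
   (\<forall>y\<in>pdisc m ((real m + 3) * \<delta>). cmod (g y) \<le> B) ==>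
   (\<forall>i<m. cmod (y i) \<le> 2 * \<delta>) ==> (\<forall>i\<ge>m. y i = 0) ==> cmod (F y) \<le> K * B / \<delta> ^ k"
  using Dop_extension_bound[of m k] by blast
 obtain C e1 where C: "C \<ge> 0" "e1 > 0" "!!\<delta> y. 0 < \<delta> ==> \<delta> < e1 ==> (\<forall>i<m. cmod (y i) \<le> \<delta>) ==> (\<forall>i\<ge>m. y i = 0) ==>
   cmod (g y) \<le> C * \<delta> ^ q"
  by (rule vanOE[OF van]) blast
 let ?m = "real m + 3"
 show ?thesis
 \<comment> \<open>The extension bound is used at scale \<delta> / 2: it then covers |y_i| <=
   \<delta> and needs g only up to radius (m + 3) \<delta> / 2.\<close>
 proof (rule vanOI[of "K * C * (?m / 2) ^ q * 2 ^ k" "min 1 (min e e1) / ?m"])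
  fix \<delta> y assume *: "0 < \<delta>" "\<delta> < min 1 (min e e1) / ?m" "\<forall>i<m. cmod (y i) \<le> \<delta>" "\<forall>i\<ge>m. y i = 0"
  have d: "?m * \<delta> < min 1 (min e e1)" using *(2) by (simp add: field_simps)
  have pos: "0 < ?m * (\<delta> / 2)" using *(1) by simp
  have half: "?m * (\<delta> / 2) < ?m * \<delta>" using *(1) by simp
  have "?m * \<delta> < 1" "?m * \<delta> < e" using d by simp_all
  then have half': "?m * (\<delta> / 2) \<le> 1" "?m * (\<delta> / 2) < e" using half by linarith+
  have "cmod (F y) \<le> K * (C * (?m * (\<delta> / 2)) ^ q) / (\<delta> / 2) ^ k"
  proof (rule K(2)[OF g F])
   show "\<forall>y\<in>pdisc m ((real m + 3) * (\<delta> / 2)). cmod (g y) \<le> C * (?m * (\<delta> / 2)) ^ q"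
   proof
    fix v assume "v \<in> pdisc m ((real m + 3) * (\<delta> / 2))"
    then show "cmod (g v) \<le> C * (?m * (\<delta> / 2)) ^ q"
    proof (intro C pos)
     have "?m * \<delta> < e1" using d by simp
     then show "?m * (\<delta> / 2) < e1" using half by linarith
    qed (use \<open>v \<in> _\<close> in \<open>auto simp: pdisc_def less_imp_le\<close>)
   qed
  qed (use *(1,3,4) half' FD in auto)
  also have "(?m * (\<delta> / 2)) ^ q = (?m / 2) ^ q * \<delta> ^ q"
   by (simp add: power_mult_distrib[symmetric])
  also have "K * (C * ((?m / 2) ^ q * \<delta> ^ q)) / (\<delta> / 2) ^ k = K * C * (?m / 2) ^ q * 2 ^ k * (\<delta> ^ q / \<delta> ^ k)"
   by (simp add: power_divide)
  also have "\<delta> ^ q / \<delta> ^ k = \<delta> ^ (q - k)" using *(1) k by (simp add: power_diff)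
  finally show "cmod (F y) \<le> K * C * (?m / 2) ^ q * 2 ^ k * \<delta> ^ (q - k)" .
 qed (use K C e in auto)
qed

section \<open>Termwise application of D_k to uniformly convergent series\<close>

subsection \<open>Uniformly convergent sums\<close>

definition usum :: "nat => real => 'l set => ('l => point => complex) => (point => complex) => bool" where
 "usum m e I \<Psi> F \<longleftrightarrow> uniform_limit (pdisc m e) (%A y. \<Sum>l\<in>A. \<Psi> l y) F (finite_subsets_at_top I)"

lemma usum_sepholo:
 assumes "!!l. sepholo m e (\<Psi> l)" "usum m e I \<Psi> F"
 shows "sepholo m e F"
 using assms(2) unfolding usum_def
 by (rule sepholo_uniform_limit[rotated]) (auto intro: sepholo_sum assms(1))

lemma usum_subset: "usum m e I \<Psi> F ==> pdisc m' e' \<subseteq> pdisc m e ==> usum m' e' I \<Psi> F"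
 unfolding usum_def by (rule uniform_limit_on_subset)

lemma usum_has_sum:
 assumes "usum m e I \<Psi> F" "y \<in> pdisc m e"
 shows "((%l. \<Psi> l y) has_sum F y) I"
 unfolding has_sum_def using tendsto_uniform_limitI[OF assms[unfolded usum_def]] by simp

text \<open>At a fixed point with distinct coordinates the denominators are constants, so D_k is
  continuous in the supremum norm; this identifies the limit in \<open>usum_Dop\<close>.\<close>

lemma Dop_bound_at_point:
 assumes y: "y \<in> pdisc m e" and gen: "distinct_coords m y" and e: "0 < e" "e \<le> 1"
 shows "\<exists>K\<ge>0. \<forall>g B. sepholo m e g --> (\<forall>y\<in>pdisc m e. cmod (g y) \<le> B) --> cmod (Dop k m g y) \<le> K * B"
proof -
 obtain C where C: "C \<ge> 0" "!!H z r B. H holomorphic_on ball z r ==> 0 < r ==> r \<le> 1 ==> cmod z \<le> 1 ==>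
   (!!w. w\<in>ball z r ==> cmod (H w) \<le> B) ==> cmod ((theta ^^ k) H z) \<le> C * B / r ^ k"
  using theta_pow_bound[of k] by blast
 define K where "K = (\<Sum>i<m. C * 2 ^ (m - 1) / (e - cmod (y i)) ^ k / cmod (nodeprod m y i (y i)))"
 have lt: "cmod (y i) < e" if "i < m" for i using y that by (auto simp: pdisc_def)
 show ?thesis
 proof (intro exI[of _ K] conjI allI impI)
  show "0 \<le> K" unfolding K_def using C(1) lt by (intro sum_nonneg divide_nonneg_nonneg) (auto simp: less_imp_le)
  fix g B assume g: "sepholo m e g" and B: "\<forall>y\<in>pdisc m e. cmod (g y) \<le> B"
  have "cmod (Dop k m g y) \<le> (\<Sum>i<m. C * 2 ^ (m - 1) / (e - cmod (y i)) ^ k / cmod (nodeprod m y i (y i)) * B)"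
   unfolding Dop_def
  proof (intro order_trans[OF norm_sum] sum_mono)
   fix i assume "i \<in> {..<m}"
   then have i: "i < m" by simp
   define r where "r = e - cmod (y i)"
   have r: "0 < r" "r \<le> 1" using lt[OF i] e unfolding r_def by (auto intro: order_trans[of _ e])
   have sub: "cmod w < e" if "w \<in> ball (y i) r" for w
   proof -
    have "cmod w \<le> cmod (y i) + dist (y i) w" by (metis dist_commute dist_norm norm_triangle_sub)
    then show ?thesis using that by (simp add: r_def)
   qed
   have "cmod ((theta ^^ k) (%z. nodeprod m y i z * g (y(i := z))) (y i)) \<le> C * (2 ^ (m - 1) * B) / r ^ k"
   proof (rule C(2))
    show "(%z. nodeprod m y i z * g (y(i := z))) holomorphic_on ball (y i) r"
     using Dop_slice_holomorphic[OF g y i] by (rule holomorphic_on_subset) (use sub in auto)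
    show "cmod (y i) \<le> 1" using lt[OF i] e by simp
    fix w assume w: "w \<in> ball (y i) r"
    have "cmod (g (y(i := w))) \<le> B" using B pdisc_upd[OF y i sub[OF w]] by blast
    moreover have "cmod (nodeprod m y i w) \<le> 2 ^ (m - 1)"
    proof (rule nodeprod_bound[OF i])
     fix a assume "a < m"
     then show "cmod (w - y a) \<le> 2"
      using sub[OF w] lt[of a] norm_triangle_ineq4[of w "y a"] e by linarith
    qed
    ultimately show "cmod (nodeprod m y i w * g (y(i := w))) \<le> 2 ^ (m - 1) * B"
     unfolding norm_mult by (intro mult_mono) auto
   qed (use r in auto)
   then have "cmod ((theta ^^ k) (%z. nodeprod m y i z * g (y(i := z))) (y i) / nodeprod m y i (y i))
     \<le> C * (2 ^ (m - 1) * B) / r ^ k / cmod (nodeprod m y i (y i))"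
    unfolding norm_divide by (rule divide_right_mono) simp
   then show "cmod ((theta ^^ k) (%z. nodeprod m y i z * g (y(i := z))) (y i) / nodeprod m y i (y i))
     \<le> C * 2 ^ (m - 1) / (e - cmod (y i)) ^ k / cmod (nodeprod m y i (y i)) * B"
    by (simp add: r_def mult_ac)
  qed
  then show "cmod (Dop k m g y) \<le> K * B" by (simp add: K_def sum_distrib_right)
 qed
qed

text \<open>For every term the extension of D_k across the diagonals is given. By linearity
  differences of partial sums have extensions too, and \<open>Dop_extension_bound\<close> turns the
  Cauchy property of the series into that of the transformed series on a smaller polydisc. Off the
  diagonals the limit is D_k F by continuity at a point.\<close>

lemma usum_Dop:
 assumes e: "0 < e" and \<Psi>: "!!l. sepholo m e (\<Psi> l)" and \<Psi>': "!!l. sepholo m e (\<Psi>' l)"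
  and D: "!!l y. y \<in> pdisc m e ==> distinct_coords m y ==> \<Psi>' l y = Dop k m (\<Psi> l) y"
  and us: "usum m e I \<Psi> F"
 shows "\<exists>e'>0. e' \<le> e & (\<exists>F'. usum m e' I \<Psi>' F' &
   (\<forall>y\<in>pdisc m e'. distinct_coords m y --> F' y = Dop k m F y))"
proof -
 let ?m = "real m + 3"
 \<comment> \<open>Makes (m + 3) \<delta> half of min 1 e, so that the tori fit; the extension bound
   then holds on the polydisc of radius 2 \<delta>, which becomes e'.\<close>
 define \<delta> where "\<delta> = min 1 e / (2 * ?m)"
 have "x * (c / (2 * x)) = c / 2" if "x ~= 0" for x c :: real using that by simp
 from this[of ?m] have eq: "?m * \<delta> = min 1 e / 2" unfolding \<delta>_def by (simp del: times_divide_eq_right)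
 have le: "min 1 e / 2 \<le> 1" "min 1 e / 2 < e" using e by (auto simp: min_def)
 have "0 < \<delta>" using e by (simp add: \<delta>_def)
 note \<delta> = this le[folded eq]
 have "2 * \<delta> \<le> ?m * \<delta>" using \<delta>(1) by (intro mult_right_mono) auto
 then have \<delta>2: "2 * \<delta> \<le> 1" "2 * \<delta> < e" using \<delta> by linarith+
 obtain K where K: "K \<ge> 0" "!!e g F \<delta> B y. sepholo m e g ==> sepholo m e F ==>
   (\<forall>y\<in>pdisc m e. distinct_coords m y --> F y = Dop k m g y) ==>
   0 < \<delta> ==> (real m + 3) * \<delta> \<le> 1 ==> (real m + 3) * \<delta> < e ==>
   (\<forall>y\<in>pdisc m ((real m + 3) * \<delta>). cmod (g y) \<le> B) ==>
   (\<forall>i<m. cmod (y i) \<le> 2 * \<delta>) ==> (\<forall>i\<ge>m. y i = 0) ==> cmod (F y) \<le> K * B / \<delta> ^ k"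
  using Dop_extension_bound[of m k] by blast
 let ?S = "%A y. \<Sum>l\<in>A. \<Psi> l y" and ?S' = "%A y. \<Sum>l\<in>A. \<Psi>' l y"
 let ?F = "finite_subsets_at_top I"
 have sS: "sepholo m e (?S A)" "sepholo m e (?S' A)" for A by (auto intro: sepholo_sum \<Psi> \<Psi>')
 have DS: "?S' A y = Dop k m (?S A) y" if "y \<in> pdisc m e" "distinct_coords m y" for A y
  using D[OF that] Dop_sum[OF \<Psi> that(1), where A = A and k = k] by simp
 have sub: "pdisc m (?m * \<delta>) \<subseteq> pdisc m e" by (rule pdisc_mono) (use \<delta> e in auto)
 have sub2: "pdisc m (2 * \<delta>) \<subseteq> pdisc m e" by (rule pdisc_mono) (use \<delta>2 e in auto)
 have cauchy: "\<exists>P. eventually P ?F & (\<forall>A B. P A --> P B --> (\<forall>y\<in>pdisc m (2 * \<delta>). cmod (?S' A y - ?S' B y) \<le> \<epsilon>))"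
  if \<epsilon>: "\<epsilon> > 0" for \<epsilon> :: real
 proof -
  \<comment> \<open>Partial sums differ by at most 2 \<eta>, and K (2 \<eta>) / \<delta>^k stays
    below \<epsilon>; K + 1 in place of K avoids a zero denominator.\<close>
  define \<eta> where "\<eta> = \<epsilon> / (2 * (K + 1)) * \<delta> ^ k"
  have \<eta>: "\<eta> > 0" using \<epsilon> \<delta> K(1) by (simp add: \<eta>_def)
  define P where "P = (%A. \<forall>y\<in>pdisc m e. dist (?S A y) (F y) < \<eta>)"
  have "eventually P ?F" unfolding P_def using uniform_limitD[OF us[unfolded usum_def] \<eta>] .
  moreover have "cmod (?S' A y - ?S' B y) \<le> \<epsilon>" if P: "P A" "P B" and y: "y \<in> pdisc m (2 * \<delta>)" for A B y
  proof -
   have "cmod (?S' A y - ?S' B y) \<le> K * (2 * \<eta>) / \<delta> ^ k"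
   proof (rule K(2)[OF sepholo_diff[OF sS(1) sS(1), of A B] sepholo_diff[OF sS(2) sS(2)] _ \<delta>])
    show "\<forall>y\<in>pdisc m e. distinct_coords m y --> ?S' A y - ?S' B y = Dop k m (%y. ?S A y - ?S B y) y"
    proof (intro ballI impI)
     fix v assume v: "v \<in> pdisc m e" and gen: "distinct_coords m v"
     show "?S' A v - ?S' B v = Dop k m (%y. ?S A y - ?S B y) v"
      unfolding DS[OF v gen] by (rule Dop_diff[OF sS(1) sS(1) v, symmetric])
    qed
    show "\<forall>y\<in>pdisc m (?m * \<delta>). cmod (?S A y - ?S B y) \<le> 2 * \<eta>"
    proof
     fix v assume "v \<in> pdisc m (?m * \<delta>)"
     then have v: "v \<in> pdisc m e" using sub by blast
     have "dist (?S A v) (?S B v) \<le> dist (?S A v) (F v) + dist (?S B v) (F v)"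
      by (rule dist_triangle2)
     moreover have "dist (?S A v) (F v) < \<eta>" "dist (?S B v) (F v) < \<eta>" using P v by (auto simp: P_def)
     ultimately show "cmod (?S A v - ?S B v) \<le> 2 * \<eta>" by (simp add: dist_norm)
    qed
   qed (use y in \<open>auto simp: pdisc_def less_imp_le\<close>)
   also have "... = K * (2 * (\<epsilon> / (2 * (K + 1))))" using \<delta>(1) by (simp add: \<eta>_def)
   also have "... = \<epsilon> * (K / (K + 1))" using K(1) by (simp add: field_simps)
   also have "... \<le> \<epsilon> * 1" using \<epsilon> K(1) by (intro mult_left_mono) auto
   finally show ?thesis by simp
  qed
  ultimately show ?thesis by blast
 qed
 have conv: "\<exists>c. ((%A. ?S' A y) \<longlongrightarrow> c) ?F" if y: "y \<in> pdisc m (2 * \<delta>)" for y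
 proof -
  have "cauchy_filter (filtermap (%A. ?S' A y) ?F)"
   unfolding cauchy_filter_metric_filtermap
  proof (intro allI impI)
   fix \<epsilon> :: real assume "\<epsilon> > 0"
   then obtain P where P: "eventually P ?F" "!!A B. P A ==> P B ==> cmod (?S' A y - ?S' B y) \<le> \<epsilon> / 2"
    using cauchy[of "\<epsilon> / 2"] y by auto
   show "\<exists>P. eventually P ?F & (\<forall>A B. P A & P B --> dist (?S' A y) (?S' B y) < \<epsilon>)"
    using P \<open>\<epsilon> > 0\<close> by (intro exI[of _ P]) (force simp: dist_norm)
  qed
  then have "\<exists>c. filtermap (%A. ?S' A y) ?F \<le> nhds c"
   by (intro cauchy_filter_complete_converges[where A = UNIV]) (auto simp: complete_UNIV filtermap_bot_iff)
  then show ?thesis by (simp add: filterlim_def)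
 qed
 then have "\<forall>y\<in>pdisc m (2 * \<delta>). \<exists>c. ((%A. ?S' A y) \<longlongrightarrow> c) ?F" by blast
 from bchoice[OF this] obtain F' where F': "\<forall>y\<in>pdisc m (2 * \<delta>). ((%A. ?S' A y) \<longlongrightarrow> F' y) ?F" ..
 have nt: "?F ~= bot" by simp
 have us': "usum m (2 * \<delta>) I \<Psi>' F'"
  unfolding usum_def uniform_limit_iff
 proof (intro allI impI)
  fix \<epsilon> :: real assume \<epsilon>: "\<epsilon> > 0"
  then obtain P where P: "eventually P ?F" "!!A B y. P A ==> P B ==> y \<in> pdisc m (2 * \<delta>) ==> cmod (?S' A y - ?S' B y) \<le> \<epsilon> / 2"
   using cauchy[of "\<epsilon> / 2"] by auto
  show "eventually (%A. \<forall>y\<in>pdisc m (2 * \<delta>). dist (?S' A y) (F' y) < \<epsilon>) ?F"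
   using P(1)
  proof eventually_elim
   case (elim A)
   show ?case
   proof
    fix y assume y: "y \<in> pdisc m (2 * \<delta>)"
    have "((%B. cmod (?S' A y - ?S' B y)) \<longlongrightarrow> cmod (?S' A y - F' y)) ?F"
     using F' y by (intro tendsto_intros) blast
    moreover have "eventually (%B. cmod (?S' A y - ?S' B y) \<le> \<epsilon> / 2) ?F"
     using P(1) by eventually_elim (rule P(2)[OF elim _ y])
    ultimately have "cmod (?S' A y - F' y) \<le> \<epsilon> / 2" by (rule tendsto_upperbound[OF _ _ nt])
    then show "dist (?S' A y) (F' y) < \<epsilon>" using \<epsilon> by (simp add: dist_norm)
   qed
  qed
 qed
 have "F' y = Dop k m F y" if y: "y \<in> pdisc m (2 * \<delta>)" and gen: "distinct_coords m y" for y
 proof -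
  have ye: "y \<in> pdisc m e" using y sub2 by blast
  obtain K' where K': "K' \<ge> 0" "!!g B. sepholo m (2 * \<delta>) g ==> (\<forall>y\<in>pdisc m (2 * \<delta>). cmod (g y) \<le> B) ==> cmod (Dop k m g y) \<le> K' * B"
   using Dop_bound_at_point[OF y gen, where k = k] \<delta> \<delta>2 by auto
  have sF: "sepholo m e F" by (rule usum_sepholo[OF \<Psi> us])
  have "((%A. ?S' A y) \<longlongrightarrow> Dop k m F y) ?F"
  proof (rule tendstoI)
   fix \<epsilon> :: real assume \<epsilon>: "\<epsilon> > 0"
   define \<eta> where "\<eta> = \<epsilon> / (2 * (K' + 1))"
   have \<eta>: "\<eta> > 0" using \<epsilon> K'(1) by (simp add: \<eta>_def)
   from uniform_limitD[OF us[unfolded usum_def] \<eta>]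
   show "eventually (%A. dist (?S' A y) (Dop k m F y) < \<epsilon>) ?F"
   proof eventually_elim
    case (elim A)
    have "?S' A y - Dop k m F y = Dop k m (%y. ?S A y - F y) y"
     using DS[OF ye gen] Dop_diff[OF sS(1) sF ye] by simp
    also have "cmod ... \<le> K' * \<eta>"
    proof (rule K'(2))
     show "sepholo m (2 * \<delta>) (%y. ?S A y - F y)"
      by (rule sepholo_mono[OF sepholo_diff[OF sS(1) sF]]) (use \<delta>2 e in auto)
     show "\<forall>y\<in>pdisc m (2 * \<delta>). cmod (?S A y - F y) \<le> \<eta>"
      using elim sub2 by (auto simp: dist_norm less_imp_le)
    qed
    also have "K' * \<eta> = \<epsilon> / 2 * (K' / (K' + 1))" using K'(1) by (simp add: \<eta>_def field_simps)
    also have "... \<le> \<epsilon> / 2 * 1" using \<epsilon> K'(1) by (intro mult_left_mono) auto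
    finally show ?case using \<epsilon> by (simp add: dist_norm)
   qed
  qed
  with F' y show ?thesis using tendsto_unique[OF nt] by blast
 qed
 then show ?thesis using \<delta> \<delta>2 us' by (intro exI[of _ "2 * \<delta>"]) auto
qed

section \<open>Partial derivatives: holomorphy, commutation, permutation of variables\<close>

subsection \<open>Partial derivatives\<close>

lemma pderiv_at_bound:
 assumes G: "sepholo m e G" and M: "\<forall>y\<in>pdisc m e. cmod (G y) \<le> M" and i: "i < m"
  and e': "0 < e'" "e' < e" and y: "y \<in> pdisc m e'"
 shows "cmod ((deriv ^^ n) (%t. G (y(i := t))) (y i)) \<le> fact n * M / ((e - e') / 2) ^ n"
proof (rule deriv_bound[where r = "e - e'"])
 have ye: "y \<in> pdisc m e" using y pdisc_mono[of m m e' e] e' by auto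
 have yi: "cmod (y i) < e'" using y i by (simp add: pdisc_def)
 have sub: "cmod w < e" if "w \<in> ball (y i) (e - e')" for w
 proof -
  have "cmod w \<le> cmod (y i) + dist (y i) w" by (metis dist_commute dist_norm norm_triangle_sub)
  then show ?thesis using that yi by simp
 qed
 show "(%t. G (y(i := t))) holomorphic_on ball (y i) (e - e')"
  by (rule holomorphic_on_subset[OF sepholo_slice[OF G ye i]]) (use sub in auto)
 show "cmod (G (y(i := w))) \<le> M" if "w \<in> ball (y i) (e - e')" for w
  using M pdisc_upd[OF ye i sub[OF that]] by blast
qed (use e' in auto)

text \<open>Second order Taylor remainder. What matters is that the error is linear in h with a
  constant depending only on the bound and the radius.\<close>

lemma diff_quotient_bound:
 assumes f: "f holomorphic_on ball w r" and B: "!!t. t \<in> ball w r ==> cmod (f t) \<le> B"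
  and r: "0 < r" and h: "h ~= 0" "cmod h < r / 2"
 shows "cmod ((f (w + h) - f w) / h - deriv f w) \<le> 2 * B / (r / 4) ^ 2 * cmod h"
proof -
 let ?f = "%i. (deriv ^^ i) f"
 have sub: "ball w (r / 2) \<subseteq> ball w r" using r by auto
 have hol: "?f i holomorphic_on ball w r" for i by (rule holomorphic_higher_deriv[OF f]) simp
 have "cmod (?f 0 (w + h) - (\<Sum>i\<le>1. ?f i w * (w + h - w) ^ i / fact i)) \<le> 2 * B / (r / 4) ^ 2 * cmod (w + h - w) ^ Suc 1 / fact 1"
 proof (rule complex_Taylor[where S = "ball w (r / 2)"])
  fix i x assume "x \<in> ball w (r / 2)"
  then have "x \<in> ball w r" using sub by blast
  then show "(?f i has_field_derivative ?f (Suc i) x) (at x within ball w (r / 2))"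
   using holomorphic_derivI[OF hol open_ball] by (simp add: DERIV_subset)
 next
  fix x assume x: "x \<in> ball w (r / 2)"
  have sub': "ball x (r / 2) \<subseteq> ball w r"
  proof
   fix u assume "u \<in> ball x (r / 2)"
   then show "u \<in> ball w r" using x dist_triangle[of w u x] by simp
  qed
  have "cmod ((deriv ^^ 2) f x) \<le> fact 2 * B / (r / 4) ^ 2"
   by (rule deriv_bound[where r = "r / 2"]) (use f B sub' r in \<open>auto intro: holomorphic_on_subset\<close>)
  then show "cmod (?f (Suc 1) x) \<le> 2 * B / (r / 4) ^ 2" by (simp add: numeral_2_eq_2)
 qed (use r h in \<open>auto simp: dist_norm\<close>)
 then have "cmod (f (w + h) - f w - deriv f w * h) \<le> 2 * B / (r / 4) ^ 2 * cmod h ^ 2"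
  by (simp add: numeral_2_eq_2 algebra_simps)
 moreover have "(f (w + h) - f w) / h - deriv f w = (f (w + h) - f w - deriv f w * h) / h"
  using h by (simp add: field_simps)
 ultimately have "cmod ((f (w + h) - f w) / h - deriv f w) \<le> 2 * B / (r / 4) ^ 2 * cmod h ^ 2 / cmod h"
  unfolding norm_divide by (metis divide_right_mono norm_divide norm_ge_zero)
 then show ?thesis using h by (simp add: power2_eq_square)
qed

text \<open>The error of the quotient in direction i is uniform along the slice in direction j, so
  the i-derivative is a uniform limit of holomorphic functions of the j-th variable. Both holomorphy
  and commutation of derivatives follow from this.\<close>

lemma pderiv_at_slice_limit:
 assumes G: "sepholo m e G" and ij: "i < m" "j < m" "i ~= j" and y: "y \<in> pdisc m e"
 shows "\<exists>r>0. cball (y j) r \<subseteq> ball 0 e &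
   uniform_limit (cball (y j) r) (%(h::complex) t. (G (y(j := t, i := y i + h)) - G (y(j := t))) / h)
    (%t. pderiv_at i G (y(j := t))) (at 0) &
   (\<forall>(h::complex) t. cmod h < r --> t \<in> cball (y j) r --> y(j := t, i := y i + h) \<in> pdisc m e)"
proof -
 obtain M where M: "M \<ge> 0" "\<forall>y\<in>pdisc m e. cmod (G y) \<le> M" using sepholo_bound[OF G] by blast
 define r where "r = min (e - cmod (y i)) (e - cmod (y j)) / 2"
 have r: "r > 0" "2 * r \<le> e - cmod (y i)" "2 * r \<le> e - cmod (y j)"
  using y ij by (auto simp: r_def pdisc_def)
 have subj: "cmod t < e" if "t \<in> cball (y j) r" for t
 proof -
  have "cmod t \<le> cmod (y j) + dist (y j) t" by (metis dist_commute dist_norm norm_triangle_sub)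
  then show ?thesis using that r by simp
 qed
 have subi: "cmod w < e" if "w \<in> ball (y i) r" for w
 proof -
  have "cmod w \<le> cmod (y i) + dist (y i) w" by (metis dist_commute dist_norm norm_triangle_sub)
  then show ?thesis using that r by simp
 qed
 have yt: "y(j := t) \<in> pdisc m e" if "t \<in> cball (y j) r" for t
  by (rule pdisc_upd[OF y ij(2) subj[OF that]])
 have est: "cmod ((G (y(j := t, i := y i + h)) - G (y(j := t))) / h - pderiv_at i G (y(j := t)))
   \<le> 2 * M / (r / 4) ^ 2 * cmod h" if t: "t \<in> cball (y j) r" and h: "h ~= 0" "cmod h < r / 2" for t h :: complex
 proof -
  have "cmod ((G ((y(j := t))(i := y i + h)) - G ((y(j := t))(i := y i))) / h - deriv (%s. G ((y(j := t))(i := s))) (y i))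
    \<le> 2 * M / (r / 4) ^ 2 * cmod h"
  proof (rule diff_quotient_bound[OF _ _ r(1) h])
   show "(%s. G ((y(j := t))(i := s))) holomorphic_on ball (y i) r"
    by (rule holomorphic_on_subset[OF sepholo_slice[OF G yt[OF t] ij(1)]]) (use subi in auto)
   show "cmod (G ((y(j := t))(i := s))) \<le> M" if "s \<in> ball (y i) r" for s
    using M(2) pdisc_upd[OF yt[OF t] ij(1) subi[OF that]] by blast
  qed
  moreover have "(y(j := t))(i := y i) = y(j := t)" using ij(3) by (simp add: fun_upd_idem)
  ultimately show ?thesis using ij(3) by (simp add: pderiv_at_def)
 qed
 have ul: "uniform_limit (cball (y j) r) (%(h::complex) t. (G (y(j := t, i := y i + h)) - G (y(j := t))) / h)
    (%t. pderiv_at i G (y(j := t))) (at 0)"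
  unfolding uniform_limit_iff
 proof (intro allI impI)
  fix \<epsilon> :: real assume \<epsilon>: "\<epsilon> > 0"
  define L where "L = 2 * M / (r / 4) ^ 2"
  have L: "L \<ge> 0" using M(1) by (simp add: L_def)
  define d where "d = min (r / 2) (\<epsilon> / (L + 1))"
  have d: "d > 0" using r \<epsilon> L by (simp add: d_def)
  show "\<forall>\<^sub>F h in at 0. \<forall>t\<in>cball (y j) r. dist ((G (y(j := t, i := y i + h)) - G (y(j := t))) / h) (pderiv_at i G (y(j := t))) < \<epsilon>"
   unfolding eventually_at
  proof (intro exI[of _ d] conjI ballI impI d)
   fix h t :: complex assume h: "h \<in> UNIV" "h ~= 0 & dist h 0 < d" and t: "t \<in> cball (y j) r"
   have hd: "cmod h < d" using h by simp
   then have "cmod h < r / 2" unfolding d_def by simp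
   from est[OF t _ this] h have "dist ((G (y(j := t, i := y i + h)) - G (y(j := t))) / h) (pderiv_at i G (y(j := t))) \<le> L * cmod h"
    by (simp add: dist_norm L_def)
   also have "... \<le> L * d" using hd L by (intro mult_left_mono) auto
   also have "... \<le> L * (\<epsilon> / (L + 1))" unfolding d_def using L by (intro mult_left_mono) auto
   also have "... < \<epsilon>" using L \<epsilon> by (simp add: field_simps)
   finally show "dist ((G (y(j := t, i := y i + h)) - G (y(j := t))) / h) (pderiv_at i G (y(j := t))) < \<epsilon>" .
  qed
 qed
 have "y(j := t, i := y i + h) \<in> pdisc m e" if "cmod h < r" "t \<in> cball (y j) r" for h t :: complex
  by (rule pdisc_upd[OF yt[OF that(2)] ij(1) subi]) (use that in \<open>simp add: dist_norm\<close>)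
 then show ?thesis using r ul subj by (intro exI[of _ r]) auto
qed

lemma sepholo_pderiv_at:
 assumes G: "sepholo m e G" and i: "i < m" and e': "0 < e'" "e' < e"
 shows "sepholo m e' (pderiv_at i G)"
proof -
 obtain M where M: "M \<ge> 0" "\<forall>y\<in>pdisc m e. cmod (G y) \<le> M" using sepholo_bound[OF G] by blast
 show ?thesis
 proof (rule sepholoI[where M = "M / ((e - e') / 2)"])
  fix y assume "y \<in> pdisc m e'"
  from pderiv_at_bound[OF G M(2) i e' this, of 1]
  show "cmod (pderiv_at i G y) \<le> M / ((e - e') / 2)" by (simp add: pderiv_at_def)
 next
  fix y j assume y': "y \<in> pdisc m e'" and j: "j < m"
  have y: "y \<in> pdisc m e" using y' pdisc_mono[of m m e' e] e' by auto
  show "(%t. pderiv_at i G (y(j := t))) field_differentiable at (y j)"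
  proof (cases "i = j")
   case True
   have "deriv (%s. G (y(j := s))) holomorphic_on ball 0 e"
    by (intro holomorphic_deriv sepholo_slice[OF G y j]) simp
   moreover have "(%t. pderiv_at i G (y(j := t))) = deriv (%s. G (y(j := s)))"
    using True by (simp add: pderiv_at_def)
   moreover have "y j \<in> ball 0 e" using y j by (simp add: pdisc_def)
   ultimately show ?thesis
    using holomorphic_on_imp_differentiable_at open_ball by metis
  next
   case False
   obtain r where r: "r > 0" "cball (y j) r \<subseteq> ball 0 e"
    "uniform_limit (cball (y j) r) (%h t. (G (y(j := t, i := y i + h)) - G (y(j := t))) / h)
     (%t. pderiv_at i G (y(j := t))) (at 0)"
    "!!h t. cmod h < r ==> t \<in> cball (y j) r ==> y(j := t, i := y i + h) \<in> pdisc m e"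
    using pderiv_at_slice_limit[OF G i j False y] by blast
   have "(%t. pderiv_at i G (y(j := t))) holomorphic_on ball (y j) r"
   proof (rule holomorphic_uniform_limit[OF _ r(3)])
    have "\<forall>\<^sub>F h in at (0::complex). cmod h < r"
     using r(1) by (auto simp: eventually_at intro!: exI[of _ r])
    then show "\<forall>\<^sub>F h in at 0. continuous_on (cball (y j) r) (%t. (G (y(j := t, i := y i + h)) - G (y(j := t))) / h) &
      (%t. (G (y(j := t, i := y i + h)) - G (y(j := t))) / h) holomorphic_on ball (y j) r"
    proof eventually_elim
     case (elim h)
     have "y(i := y i + h) \<in> pdisc m e" using r(4)[OF elim, of "y j"] r(1) by simp
     from sepholo_slice[OF G this j] have "(%t. G (y(j := t, i := y i + h))) holomorphic_on ball 0 e"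
      using False by (simp add: fun_upd_twist)
     then have "(%t. (G (y(j := t, i := y i + h)) - G (y(j := t))) / h) holomorphic_on ball 0 e"
     proof (cases "h = 0")
      case False
      with \<open>(%t. G (y(j := t, i := y i + h))) holomorphic_on ball 0 e\<close> show ?thesis
       by (intro holomorphic_intros sepholo_slice[OF G y j]) auto
     qed simp
     then show ?case using r(2) ball_subset_cball
      by (blast intro: holomorphic_on_subset holomorphic_on_imp_continuous_on continuous_on_subset)
    qed
   qed auto
   then show ?thesis using r(1) by (auto simp: holomorphic_on_open field_differentiable_def)
  qed
 qed
qed

lemma pdisc_shrink:
 assumes "y \<in> pdisc m e" "0 < e" shows "\<exists>e'>0. e' < e & y \<in> pdisc m e'"
proof -
 define M where "M = Max (insert 0 ((%i. cmod (y i)) ` {..<m}))"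
 have M: "M < e" using assms unfolding M_def by (subst Max_less_iff) (auto simp: pdisc_def)
 have "0 \<le> M" unfolding M_def by (intro Max_ge) auto
 have lt: "cmod (y i) < (e + M) / 2" if "i < m" for i
 proof -
  have "cmod (y i) \<le> M" unfolding M_def by (intro Max_ge) (use that in auto)
  then show ?thesis using M by (simp add: field_simps)
 qed
 show ?thesis
  by (rule exI[of _ "(e + M) / 2"]) (use assms lt M \<open>0 \<le> M\<close> in \<open>auto simp: pdisc_def\<close>)
qed

text \<open>The derivative of a uniform limit of holomorphic functions is the limit of the
  derivatives. Differentiating the quotients in y_j gives quotients of the j-derivative in direction
  i.\<close>

lemma pderiv_at_commute:
 assumes G: "sepholo m e G" and ij: "i < m" "j < m" and y: "y \<in> pdisc m e"
 shows "pderiv_at j (pderiv_at i G) y = pderiv_at i (pderiv_at j G) y"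
proof (cases "i = j")
 case False
 obtain r where r: "r > 0" "cball (y j) r \<subseteq> ball 0 e"
  "uniform_limit (cball (y j) r) (%h t. (G (y(j := t, i := y i + h)) - G (y(j := t))) / h)
   (%t. pderiv_at i G (y(j := t))) (at 0)"
  "!!h t. cmod h < r ==> t \<in> cball (y j) r ==> y(j := t, i := y i + h) \<in> pdisc m e"
  using pderiv_at_slice_limit[OF G ij False y] by blast
 define f' where "f' = (%h w. (pderiv_at j G (y(j := w, i := y i + h)) - pderiv_at j G (y(j := w))) / h)"
 have ev: "\<forall>\<^sub>F h in at (0::complex). cmod h < r & h ~= 0"
  using r(1) by (auto simp: eventually_at intro!: exI[of _ r])
 have der: "((%t. G (v(j := t))) has_field_derivative pderiv_at j G (v(j := w))) (at w)"
  if "v \<in> pdisc m e" "w \<in> ball 0 e" for v w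
  using holomorphic_derivI[OF sepholo_slice[OF G that(1) ij(2)] open_ball that(2)]
  by (simp add: pderiv_at_def)
 obtain g' where g': "!!w. w \<in> ball (y j) r ==> ((%t. pderiv_at i G (y(j := t))) has_field_derivative (g' w)) (at w)
    & ((%h. f' h w) \<longlongrightarrow> g' w) (at 0)"
 proof (rule has_complex_derivative_uniform_limit[OF _ r(3) _ r(1), of f'])
  show "\<forall>\<^sub>F h in at 0. continuous_on (cball (y j) r) (%t. (G (y(j := t, i := y i + h)) - G (y(j := t))) / h) &
    (\<forall>w\<in>ball (y j) r. ((%t. (G (y(j := t, i := y i + h)) - G (y(j := t))) / h) has_field_derivative f' h w) (at w))"
   using ev
  proof eventually_elim
   case (elim h)
   have yh: "y(i := y i + h) \<in> pdisc m e" using r(4)[of h "y j"] r(1) elim by simp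
   have d: "((%t. (G (y(j := t, i := y i + h)) - G (y(j := t))) / h) has_field_derivative f' h w) (at w)"
    if "w \<in> ball 0 e" for w
    using der[OF yh that] der[OF y that] False elim unfolding f'_def
    by (auto intro!: derivative_eq_intros simp: fun_upd_twist)
   then have "continuous_on (ball 0 e) (%t. (G (y(j := t, i := y i + h)) - G (y(j := t))) / h)"
    by (auto intro!: continuous_at_imp_continuous_on DERIV_isCont)
   then show ?case using d r(2) ball_subset_cball by (blast intro: continuous_on_subset)
  qed
 qed auto
 have yj: "y j \<in> ball (y j) r" using r by simp
 have "pderiv_at j (pderiv_at i G) y = g' (y j)"
  unfolding pderiv_at_def[of j "pderiv_at i G"] using g'[OF yj] DERIV_imp_deriv by blast
 moreover have "pderiv_at i (pderiv_at j G) y = g' (y j)"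
 proof -
  have "cmod (y i) < e" using y ij by (simp add: pdisc_def)
  then have "0 < e" using norm_ge_zero[of "y i"] by linarith
  then obtain e' where e': "0 < e'" "e' < e" "y \<in> pdisc m e'" using pdisc_shrink[OF y] by blast
  have "(%s. pderiv_at j G (y(i := s))) field_differentiable at (y i)"
   using sepholo_diff_at[OF sepholo_pderiv_at[OF G ij(2) e'(1,2)] e'(3) ij(1)] by blast
  then have "((%s. pderiv_at j G (y(i := s))) has_field_derivative pderiv_at i (pderiv_at j G) y) (at (y i))"
   unfolding pderiv_at_def[of i "pderiv_at j G"] by (simp add: DERIV_deriv_iff_field_differentiable)
  then have "((%h. (pderiv_at j G (y(i := y i + h)) - pderiv_at j G (y(i := y i))) / h) \<longlongrightarrow> pderiv_at i (pderiv_at j G) y) (at 0)"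
   by (simp add: DERIV_def)
  moreover have "(%h. f' h (y j)) = (%h. (pderiv_at j G (y(i := y i + h)) - pderiv_at j G (y(i := y i))) / h)"
   by (simp add: f'_def)
  ultimately show ?thesis using g'[OF yj] tendsto_unique[of "at (0::complex)"] by force
 qed
 ultimately show ?thesis by simp
qed simp

lemma pderiv_at_cong:
 assumes "!!y. y \<in> pdisc m e ==> f y = g y" "y \<in> pdisc m e" "i < m"
 shows "pderiv_at i f y = pderiv_at i g y"
 unfolding pderiv_at_def
proof (rule deriv_cong_ev)
 have "y i \<in> ball 0 e" using assms by (simp add: pdisc_def)
 from eventually_nhds_in_open[OF open_ball this]
 show "\<forall>\<^sub>F t in nhds (y i). f (y(i := t)) = g (y(i := t))"
  by eventually_elim (use assms in \<open>auto intro: pdisc_upd\<close>)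
qed simp

lemma sepholo_pderivs:
 assumes "sepholo m e G" "set is \<subseteq> {..<m}" "0 < e'" "e' < e"
 shows "sepholo m e' (pderivs is G)"
 using assms(2-)
proof (induction "is" arbitrary: e')
 case Nil then show ?case using sepholo_mono[OF assms(1), of m e'] by simp
next
 case (Cons i "is")
 define e1 where "e1 = (e' + e) / 2"
 have e1: "0 < e1" "e1 < e" "e' < e1" using Cons.prems by (auto simp: e1_def)
 have "sepholo m e1 (pderivs is G)" by (rule Cons.IH) (use Cons.prems e1 in auto)
 then show ?case using Cons.prems e1 by (simp add: sepholo_pderiv_at)
qed

lemma pderivs_move_front:
 assumes G: "sepholo m e G" and e: "0 < e" and "set (xs @ i # ys) \<subseteq> {..<m}" "y \<in> pdisc m e"
 shows "pderivs (xs @ i # ys) G y = pderivs (i # xs @ ys) G y"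
 using assms(3-)
proof (induction xs arbitrary: y)
 case (Cons x xs)
 have "pderivs ((x # xs) @ i # ys) G y = pderiv_at x (pderivs (xs @ i # ys) G) y" by simp
 also have "... = pderiv_at x (pderivs (i # xs @ ys) G) y"
  by (rule pderiv_at_cong[where m = m and e = e]) (use Cons in auto)
 also have "... = pderiv_at x (pderiv_at i (pderivs (xs @ ys) G)) y" by simp
 also have "... = pderiv_at i (pderiv_at x (pderivs (xs @ ys) G)) y"
 proof -
  obtain e' where "0 < e'" "e' < e" "y \<in> pdisc m e'" using pdisc_shrink[OF Cons.prems(2) e] by blast
  then show ?thesis
   using pderiv_at_commute[OF sepholo_pderivs[OF G, of "xs @ ys" e'], of i x y] Cons.prems by auto
 qed
 finally show ?case by simp
qed simp

lemma pderivs_mset: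
 assumes G: "sepholo m e G" and e: "0 < e"
 shows "mset xs = mset ys ==> set xs \<subseteq> {..<m} ==> y \<in> pdisc m e ==> pderivs xs G y = pderivs ys G y"
proof (induction xs arbitrary: ys y)
 case (Cons x xs)
 have "x \<in> set ys" using Cons.prems(1) by (metis list.set_intros(1) set_mset_mset)
 then obtain us vs where ys: "ys = us @ x # vs" using split_list by metis
 have m: "mset xs = mset (us @ vs)" using Cons.prems(1) ys by simp
 have st: "set ys \<subseteq> {..<m}" using Cons.prems by (metis set_mset_mset)
 have "pderivs (x # xs) G y = pderiv_at x (pderivs (us @ vs) G) y"
  by (simp, rule pderiv_at_cong[where m = m and e = e]) (use Cons.IH[OF m] Cons.prems in auto)
 also have "... = pderivs ys G y"
  using pderivs_move_front[OF G e, of us x vs y] st Cons.prems(3) ys by simp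
 finally show ?case .
qed simp

lemma pderivs_permute:
 assumes s: "s permutes {..<m}" and sym: "!!y. y \<in> pdisc m e ==> \<psi> (%i. y (s i)) = \<psi> y"
 shows "set is \<subseteq> {..<m} ==> y \<in> pdisc m e ==> pderivs (map s is) \<psi> y = pderivs is \<psi> (%i. y (s i))"
proof (induction "is" arbitrary: y)
 case (Cons i "is")
 have si: "s i < m" using Cons.prems s permutes_in_image[of s "{..<m}" i] by auto
 have "pderivs (map s (i # is)) \<psi> y = pderiv_at (s i) (%y. pderivs is \<psi> (%i. y (s i))) y"
  by (simp, rule pderiv_at_cong[where m = m and e = e]) (use Cons si in auto)
 also have "... = pderivs (i # is) \<psi> (%i. y (s i))"
 proof -
  have "(%a. (y(s i := t)) (s a)) = (%a. y (s a))(i := t)" for t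
   using permutes_inj[OF s] by (auto simp: fun_eq_iff inj_eq)
  then show ?thesis by (simp add: pderiv_at_def)
 qed
 finally show ?case .
qed (simp add: sym)

lemma pderivs_replicate: "pderivs (replicate n i) G y = (deriv ^^ n) (%t. G (y(i := t))) (y i)"
proof (induction n arbitrary: y)
 case (Suc n)
 have "pderivs (replicate (Suc n) i) G y = deriv (%t. pderivs (replicate n i) G (y(i := t))) (y i)"
  by (simp add: pderiv_at_def)
 also have "... = deriv (%t. (deriv ^^ n) (%s. G (y(i := s))) t) (y i)"
  by (simp only: Suc fun_upd_upd fun_upd_same)
 finally show ?case by (simp only: funpow.simps o_apply)
qed simp

text \<open>Differentiability is not assumed: both sides choose from the same set of possible
  derivatives, empty or not.\<close>

lemma deriv_shift: "deriv (%t. g (c + t)) z = deriv g (c + z :: complex)"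
proof -
 have "((%t. g (c + t)) has_field_derivative D) (at z) \<longleftrightarrow> (g has_field_derivative D) (at (c + z))" for D
  using DERIV_shift[of g D z c] by (simp add: add.commute)
 then show ?thesis by (simp add: deriv_def)
qed

lemma pderivs_shift: "pderivs is (%y. f (%j. 1 + y j)) y = pderivs is f (%j. 1 + y j)"
proof (induction "is" arbitrary: y)
 case (Cons i "is")
 have "(%j. 1 + (y(i := t)) j) = (%j. 1 + y j)(i := 1 + t)" for t by auto
 then show ?case
  by (simp add: pderiv_at_def Cons) (rule deriv_shift)
qed simp

lemma pderivs_diff_const: "is ~= [] ==> pderivs is (%y. f y - c) = pderivs is f"
proof (induction "is")
 case (Cons i "is")
 show ?case
 proof (cases "is = []")
  case True
  have "((%t. g t - c) has_field_derivative D) (at z) \<longleftrightarrow> (g has_field_derivative D) (at z)" for g :: "complex => complex" and D z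
   using DERIV_diff[OF _ DERIV_const, of g D z UNIV c] DERIV_add[OF _ DERIV_const, of "%t. g t - c" D z UNIV c] by auto
  then show ?thesis using True by (simp add: pderiv_at_def deriv_def fun_eq_iff)
 qed (use Cons in simp)
qed simp

section \<open>Polynomials in a fixed set of variables with convergent coefficients\<close>

subsection \<open>Convergent families of polynomial functions\<close>

text \<open>Polynomials in v 0, ..., v (D - 1) of bounded degree with coefficients converging in N,
  paired with their limit. Generating them inductively gives limits, derivatives and closure
  properties without naming coefficients. D stays fixed while N grows.\<close>

inductive cv :: "nat => (nat => point => complex) => (point => complex) => bool"
 for D :: nat where
 cv_const: "c \<longlonglongrightarrow> l ==> cv D (%N v. c N) (%v. l)"
| cv_var: "i < D ==> cv D (%N v. v i) (%v. v i)"
| cv_add: "cv D f f' ==> cv D g g' ==> cv D (%N v. f N v + g N v) (%v. f' v + g' v)"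
| cv_mult: "cv D f f' ==> cv D g g' ==> cv D (%N v. f N v * g N v) (%v. f' v * g' v)"

lemma cv_mono: "cv D f g ==> D \<le> D' ==> cv D' f g"
 by (induction rule: cv.induct) (auto intro: cv.intros)

lemma cv_cong: "cv D f g ==> (!!N v. f' N v = f N v) ==> (!!v. g' v = g v) ==> cv D f' g'"
 by (metis ext)

lemma cv_scalar: "cv D (%N v. c) (%v. c)"
 by (rule cv_const) simp

lemma cv_sum: "(!!i. i \<in> A ==> cv D (f i) (g i)) ==> cv D (%N v. \<Sum>i\<in>A. f i N v) (%v. \<Sum>i\<in>A. g i v)"
 by (induction A rule: infinite_finite_induct) (auto intro: cv_scalar cv_add)

lemma cv_power: "cv D f g ==> cv D (%N v. f N v ^ k) (%v. g v ^ k)"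
 by (induction k) (auto intro: cv_scalar cv_mult)

lemma cv_cmult: "cv D f g ==> cv D (%N v. c * f N v) (%v. c * g v)"
 by (intro cv_mult cv_scalar)

lemma cv_diff: "cv D f f' ==> cv D g g' ==> cv D (%N v. f N v - g N v) (%v. f' v - g' v)"
 using cv_add[OF _ cv_cmult[of D g g' "-1"], of f f'] by simp

lemma cv_tendsto: "cv D f g ==> (%N. f N v) \<longlonglongrightarrow> g v"
 by (induction rule: cv.induct) (auto intro: tendsto_add tendsto_mult)

lemma cv_limit: "cv D f g ==> cv D (%_. g) g"
 by (induction rule: cv.induct) (auto intro: cv.intros cv_scalar)

lemma cv_indep: "cv D f g ==> D \<le> i ==> f N (v(i := t)) = f N v"
 by (induction rule: cv.induct) auto

lemma cv_differentiable: "cv D f g ==> (%t. f N (v(i := t))) field_differentiable (at z)"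
proof (induction rule: cv.induct)
 case (cv_var j) then show ?case by (cases "i = j") auto
qed (auto intro: field_differentiable_add field_differentiable_mult)

lemma pderiv_at_const [simp]: "pderiv_at i (%v. c) = (%v. 0)"
 by (simp add: pderiv_at_def fun_eq_iff)

lemma pderiv_at_var: "pderiv_at i (%v. v j) = (%v. if i = j then 1 else 0)"
 by (simp add: pderiv_at_def fun_eq_iff)

lemma pderiv_at_add:
 assumes "!!v z. (%t. f (v(i := t))) field_differentiable (at z)" "!!v z. (%t. g (v(i := t))) field_differentiable (at z)"
 shows "pderiv_at i (%v. f v + g v) = (%v. pderiv_at i f v + pderiv_at i g v)"
 unfolding pderiv_at_def by (intro ext deriv_add assms)

lemma pderiv_at_mult:
 assumes "!!v z. (%t. f (v(i := t))) field_differentiable (at z)" "!!v z. (%t. g (v(i := t))) field_differentiable (at z)"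
 shows "pderiv_at i (%v. f v * g v) = (%v. f v * pderiv_at i g v + pderiv_at i f v * g v)"
 unfolding pderiv_at_def by (intro ext trans[OF deriv_mult[OF assms]]) simp

lemma cv_pderiv: "cv D f g ==> cv D (%N. pderiv_at i (f N)) (pderiv_at i g)"
proof (induction rule: cv.induct)
 case (cv_const c l) show ?case by (simp add: cv_scalar)
next
 case (cv_var j) then show ?case by (simp add: pderiv_at_var cv_scalar)
next
 case (cv_add f f' g g')
 note d = cv_differentiable[OF cv_add.hyps(1)] cv_differentiable[OF cv_add.hyps(2)]
  cv_differentiable[OF cv_limit[OF cv_add.hyps(1)]] cv_differentiable[OF cv_limit[OF cv_add.hyps(2)]]
 show ?case using cv.cv_add[OF cv_add.IH] by (simp add: pderiv_at_add d)
next
 case (cv_mult f f' g g')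
 note d = cv_differentiable[OF cv_mult.hyps(1)] cv_differentiable[OF cv_mult.hyps(2)]
  cv_differentiable[OF cv_limit[OF cv_mult.hyps(1)]] cv_differentiable[OF cv_limit[OF cv_mult.hyps(2)]]
 show ?case
  using cv.cv_add[OF cv.cv_mult[OF cv_mult.hyps(1) cv_mult.IH(2)] cv.cv_mult[OF cv_mult.IH(1) cv_mult.hyps(2)]]
  by (simp add: pderiv_at_mult d)
qed

lemma cv_pderiv_add: "cv D f f' ==> cv D g g' ==>
  pderiv_at i (%v. f N v + g N v) v = pderiv_at i (f N) v + pderiv_at i (g N) v"
 by (subst pderiv_at_add) (auto intro: cv_differentiable)

lemma cv_pderiv_mult: "cv D f f' ==> cv D g g' ==>
  pderiv_at i (%v. f N v * g N v) v = f N v * pderiv_at i (g N) v + pderiv_at i (f N) v * g N v"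
 by (subst pderiv_at_mult) (auto intro: cv_differentiable)

lemma cv_pderiv_cmult: "cv D f f' ==> pderiv_at i (%v. c * f N v) v = c * pderiv_at i (f N) v"
 by (subst pderiv_at_mult) (auto intro: cv_differentiable)

lemma cv_pderiv_sum: "(!!l. l \<in> A ==> cv D (f l) (f' l)) ==>
  pderiv_at i (%v. \<Sum>l\<in>A. f l N v) v = (\<Sum>l\<in>A. pderiv_at i (f l N) v)"
proof (induction A rule: infinite_finite_induct)
 case (insert x A)
 have "cv D (%N v. \<Sum>l\<in>A. f l N v) (%v. \<Sum>l\<in>A. f' l v)" by (rule cv_sum) (use insert in auto)
 from cv_pderiv_add[OF _ this, of "f x" "f' x" i N v] show ?case using insert by simp
qed auto

lemma pderiv_at_indep: "(!!v t. f (v(i := t)) = f v) ==> pderiv_at i f = (%v. 0)"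
 by (simp add: pderiv_at_def fun_eq_iff)

lemma pderiv_at_keeps_indep:
 assumes "!!v t. f (v(j := t)) = f v" shows "pderiv_at i f (v(j := t)) = pderiv_at i f v"
proof (cases "i = j")
 case True then show ?thesis using pderiv_at_indep[of f j] assms by simp
next
 case False
 then show ?thesis unfolding pderiv_at_def using assms by (simp add: fun_upd_twist)
qed

lemma cv_pderiv_zero: "cv D f g ==> D \<le> i ==> pderiv_at i (f N) v = 0"
 using pderiv_at_indep[of "f N" i] cv_indep by metis

lemma cv_pderiv_commute:
 "cv D f g ==> pderiv_at i (pderiv_at j g) = pderiv_at j (pderiv_at i g)"
proof (induction rule: cv.induct)
 case (cv_var k) then show ?case by (simp add: pderiv_at_var)
next
 case (cv_add f f' g g')
 note c = cv_limit[OF cv_add.hyps(1)] cv_limit[OF cv_add.hyps(2)]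
 note d = cv_differentiable[OF c(1)] cv_differentiable[OF c(2)]
  cv_differentiable[OF cv_pderiv[OF c(1)]] cv_differentiable[OF cv_pderiv[OF c(2)]]
 show ?case using cv_add.IH by (simp add: pderiv_at_add d)
next
 case (cv_mult f f' g g')
 note c = cv_limit[OF cv_mult.hyps(1)] cv_limit[OF cv_mult.hyps(2)]
 note d = cv_differentiable[OF c(1)] cv_differentiable[OF c(2)]
  cv_differentiable[OF cv_pderiv[OF c(1)]] cv_differentiable[OF cv_pderiv[OF c(2)]]
  cv_differentiable[OF cv.cv_mult[OF cv_pderiv[OF c(1)] c(2)]]
  cv_differentiable[OF cv.cv_mult[OF c(1) cv_pderiv[OF c(2)]]]
 show ?case using cv_mult.IH
  by (simp add: pderiv_at_mult pderiv_at_add d fun_eq_iff)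
qed auto

text \<open>For curves along which a single variable moves and all power sums follow.\<close>

lemma cv_chain:
 assumes "cv D f g" "!!i. i < D ==> ((%z. c z i) has_field_derivative c' i) (at z)"
 shows "((%z. f N (c z)) has_field_derivative (\<Sum>i<D. pderiv_at i (f N) (c z) * c' i)) (at z)"
 using assms
proof (induction rule: cv.induct)
 case (cv_var j)
 then have "(\<Sum>i<D. pderiv_at i (%v. v j) (c z) * c' i) = c' j"
  by (simp add: pderiv_at_var if_distrib[of "%x. x * _"] sum.delta' cong: if_cong)
 then show ?case using cv_var by simp
next
 case (cv_add f f' g g')
 from DERIV_add[OF cv_add.IH(1)[OF cv_add.prems] cv_add.IH(2)[OF cv_add.prems]]
 show ?case by (simp add: cv_pderiv_add[OF cv_add.hyps] sum.distrib[symmetric] algebra_simps)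
next
 case (cv_mult f f' g g')
 have 1: "((%z. f N (c z)) has_field_derivative (\<Sum>i<D. pderiv_at i (f N) (c z) * c' i)) (at z)"
  by (rule cv_mult.IH(1)) (rule cv_mult.prems)
 have 2: "((%z. g N (c z)) has_field_derivative (\<Sum>i<D. pderiv_at i (g N) (c z) * c' i)) (at z)"
  by (rule cv_mult.IH(2)) (rule cv_mult.prems)
 have "(\<Sum>i<D. pderiv_at i (f N) (c z) * c' i) * g N (c z) + (\<Sum>i<D. pderiv_at i (g N) (c z) * c' i) * f N (c z)
   = (\<Sum>i<D. pderiv_at i (%v. f N v * g N v) (c z) * c' i)"
  unfolding cv_pderiv_mult[OF cv_mult.hyps] sum_distrib_right sum.distrib[symmetric]
  by (intro sum.cong refl) (simp add: algebra_simps)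
 from DERIV_cong[OF DERIV_mult[OF 1 2] this] show ?case .
qed auto

text \<open>Slot 0 of a point is reserved for the variable y_i on which the one-variable operator
  acts, the slots r >= 1 for the power sums. Functions of the power sums alone ignore slot
  0.\<close>

definition indep0 :: "(point => complex) => bool" where
 "indep0 f \<longleftrightarrow> (\<forall>v t. f (v(0 := t)) = f v)"

text \<open>Coefficients of an expansion in powers of slot 0. They are continued by zero beyond R,
  so that any larger cutoff may be used and expansions with different cutoffs can be added.\<close>

definition zexp :: "nat => nat => (nat => nat => point => complex) => (nat => point => complex) => bool" where
 "zexp D R \<phi> \<phi>' \<longleftrightarrow> (\<forall>r. cv D (\<phi> r) (\<phi>' r) & (\<forall>N. indep0 (\<phi> r N)) & indep0 (\<phi>' r)) &
   (\<forall>r\<ge>R. \<phi> r = (%N v. 0) & \<phi>' r = (%v. 0))"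

lemma zexp_sum_extend:
 assumes "zexp D R \<phi> \<phi>'" "R \<le> R'"
 shows "(\<Sum>r<R'. v 0 ^ r * \<phi> r N v) = (\<Sum>r<R. v 0 ^ r * \<phi> r N v)"
  and "(\<Sum>r<R'. v 0 ^ r * \<phi>' r v) = (\<Sum>r<R. v 0 ^ r * \<phi>' r v)"
 by (rule sum.mono_neutral_right; use assms in \<open>auto simp: zexp_def\<close>)+

definition zdec where
 "zdec D f g \<longleftrightarrow> (\<exists>R \<phi> \<phi>'. zexp D R \<phi> \<phi>' &
   (\<forall>N v. f N v = (\<Sum>r<R. v 0 ^ r * \<phi> r N v)) & (\<forall>v. g v = (\<Sum>r<R. v 0 ^ r * \<phi>' r v)))"

lemma zdec_add:
 assumes "zdec D f f'" "zdec D g g'"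
 shows "zdec D (%N v. f N v + g N v) (%v. f' v + g' v)"
proof -
 from assms(1) obtain R \<phi> \<phi>' where 1: "zexp D R \<phi> \<phi>'" "!!N v. f N v = (\<Sum>r<R. v 0 ^ r * \<phi> r N v)"
   "!!v. f' v = (\<Sum>r<R. v 0 ^ r * \<phi>' r v)" unfolding zdec_def by blast
 from assms(2) obtain S \<psi> \<psi>' where 2: "zexp D S \<psi> \<psi>'" "!!N v. g N v = (\<Sum>r<S. v 0 ^ r * \<psi> r N v)"
   "!!v. g' v = (\<Sum>r<S. v 0 ^ r * \<psi>' r v)" unfolding zdec_def by blast
 let ?T = "max R S"
 have "zexp D ?T (%r N v. \<phi> r N v + \<psi> r N v) (%r v. \<phi>' r v + \<psi>' r v)"
  using 1(1) 2(1) by (auto simp: zexp_def indep0_def intro: cv_add)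
 moreover have "f N v + g N v = (\<Sum>r<?T. v 0 ^ r * (\<phi> r N v + \<psi> r N v))" for N v
  unfolding 1(2) 2(2) distrib_left sum.distrib
  using zexp_sum_extend(1)[OF 1(1), of ?T] zexp_sum_extend(1)[OF 2(1), of ?T] by simp
 moreover have "f' v + g' v = (\<Sum>r<?T. v 0 ^ r * (\<phi>' r v + \<psi>' r v))" for v
  unfolding 1(3) 2(3) distrib_left sum.distrib
  using zexp_sum_extend(2)[OF 1(1), of ?T] zexp_sum_extend(2)[OF 2(1), of ?T] by simp
 ultimately show ?thesis unfolding zdec_def by blast
qed

lemma zdec_shift:
 assumes "zdec D f f'" "cv D \<psi> \<psi>'" "!!N. indep0 (\<psi> N)" "indep0 \<psi>'"
 shows "zdec D (%N v. v 0 ^ k * \<psi> N v * f N v) (%v. v 0 ^ k * \<psi>' v * f' v)"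
proof -
 from assms(1) obtain R \<phi> \<phi>' where 1: "zexp D R \<phi> \<phi>'" "!!N v. f N v = (\<Sum>r<R. v 0 ^ r * \<phi> r N v)"
   "!!v. f' v = (\<Sum>r<R. v 0 ^ r * \<phi>' r v)" unfolding zdec_def by blast
 define \<xi> where "\<xi> = (%r N v. if r < k then 0 else \<psi> N v * \<phi> (r - k) N v)"
 define \<xi>' where "\<xi>' = (%r v. if r < k then 0 else \<psi>' v * \<phi>' (r - k) v)"
 have "zexp D (R + k) \<xi> \<xi>'"
  unfolding zexp_def
 proof (intro conjI allI impI)
  fix r show "cv D (\<xi> r) (\<xi>' r)"
  proof (cases "r < k")
   case True then show ?thesis by (simp add: \<xi>_def \<xi>'_def cv_scalar)
  next
   case False
   then show ?thesis using cv_mult[OF assms(2), of "\<phi> (r - k)" "\<phi>' (r - k)"] 1(1)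
    by (simp add: \<xi>_def \<xi>'_def zexp_def)
  qed
 qed (use 1(1) assms(3,4) in \<open>auto simp: \<xi>_def \<xi>'_def zexp_def indep0_def\<close>)
 moreover have sh: "(\<Sum>r<R + k. x ^ r * (if r < k then 0 else c (r - k))) = x ^ k * (\<Sum>r<R. x ^ r * c r)" for x :: complex and c
 proof -
  have "(\<Sum>r<R + k. x ^ r * (if r < k then 0 else c (r - k))) = (\<Sum>r\<in>{k..<R + k}. x ^ r * c (r - k))"
   by (rule sum.mono_neutral_cong_right) auto
  also have "... = (\<Sum>r<R. x ^ (r + k) * c r)"
   by (rule sum.reindex_bij_witness[of _ "%r. r + k" "%r. r - k"]) auto
  finally show ?thesis by (simp add: sum_distrib_left power_add mult_ac)
 qed
 have "v 0 ^ k * \<psi> N v * f N v = (\<Sum>r<R + k. v 0 ^ r * \<xi> r N v)" for N v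
  using sh[of "v 0" "%r. \<psi> N v * \<phi> r N v"] unfolding 1(2) \<xi>_def
  by (simp add: sum_distrib_left mult_ac)
 moreover have "v 0 ^ k * \<psi>' v * f' v = (\<Sum>r<R + k. v 0 ^ r * \<xi>' r v)" for v
  using sh[of "v 0" "%r. \<psi>' v * \<phi>' r v"] unfolding 1(3) \<xi>'_def
  by (simp add: sum_distrib_left mult_ac)
 ultimately show ?thesis unfolding zdec_def by blast
qed

lemma zdec_indep: "cv D f g ==> (!!N. indep0 (f N)) ==> indep0 g ==> zdec D f g"
 unfolding zdec_def
 by (rule exI[of _ 1], rule exI[of _ "%r. if r = 0 then f else (%N v. 0)"],
   rule exI[of _ "%r. if r = 0 then g else (%v. 0)"])
   (auto simp: zexp_def cv_scalar indep0_def)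

lemma zdec_sum:
 assumes "finite A" "!!i. i \<in> A ==> zdec D (f i) (g i)"
 shows "zdec D (%N v. \<Sum>i\<in>A. f i N v) (%v. \<Sum>i\<in>A. g i v)"
 using assms
 by (induction A rule: finite_induct) (auto intro: zdec_add zdec_indep cv_scalar simp: indep0_def)

text \<open>The sum over i in \<open>Dop\<close> meets y_i through slot 0 only. With the powers of
  slot 0 made explicit it becomes a combination of weighted power sums.\<close>

lemma cv_zdec: "cv D f g ==> zdec D f g"
proof (induction rule: cv.induct)
 case (cv_const c l) then show ?case by (intro zdec_indep cv.cv_const) (auto simp: indep0_def)
next
 case (cv_var j)
 show ?case
 proof (cases "j = 0")
  case True
  have "zdec D (%N v. 1) (%v. 1)" by (rule zdec_indep) (auto simp: indep0_def cv_scalar)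
  from zdec_shift[OF this cv_scalar[of D 1], of 1] show ?thesis using True by (simp add: indep0_def)
 next
  case False
  then show ?thesis by (intro zdec_indep cv.cv_var cv_var) (auto simp: indep0_def)
 qed
next
 case (cv_add f f' g g') then show ?case by (intro zdec_add)
next
 case (cv_mult f f' g g')
 from cv_mult.IH(1) obtain R \<phi> \<phi>' where 1: "zexp D R \<phi> \<phi>'" "!!N v. f N v = (\<Sum>r<R. v 0 ^ r * \<phi> r N v)"
   "!!v. f' v = (\<Sum>r<R. v 0 ^ r * \<phi>' r v)" unfolding zdec_def by blast
 have "zdec D (%N v. \<Sum>r<R. v 0 ^ r * \<phi> r N v * g N v) (%v. \<Sum>r<R. v 0 ^ r * \<phi>' r v * g' v)"
  by (intro zdec_sum zdec_shift cv_mult.IH) (use 1(1) in \<open>auto simp: zexp_def\<close>)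
 then show ?case unfolding 1 by (simp add: sum_distrib_right)
qed

section \<open>Weighted power sums: removal of the poles and asymptotics\<close>

subsection \<open>Power sums weighted by logarithmic derivatives of the Vandermonde product\<close>

definition nodepoly :: "nat => point => nat => complex poly" where
 "nodepoly m y i = (\<Prod>a\<in>{..<m} - {i}. [:- y a, 1:])"

text \<open>For distinct nodes this is j! times the j-th elementary symmetric polynomial in the
  numbers 1 / (y_i - y_a), a /= i: the factor left when j derivatives fall on the Vandermonde
  product.\<close>

definition nodeweight :: "nat => point => nat => nat => complex" where
 "nodeweight m y j i = poly ((pderiv ^^ j) (nodepoly m y i)) (y i) / poly (nodepoly m y i) (y i)"

lemma pderiv_pow_linear_mult:
 fixes p :: "complex poly"
 shows "(pderiv ^^ Suc n) ([:- c, 1:] * p) = [:- c, 1:] * (pderiv ^^ Suc n) p + smult (of_nat (Suc n)) ((pderiv ^^ n) p)"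
proof (induction n)
 have e: "pderiv ([:- c, 1:] * A) = [:- c, 1:] * pderiv A + A" for A
  by (subst pderiv_mult) (simp add: pderiv_pCons)
 {
  case 0 show ?case using e[of p] by (simp del: mult_pCons_left)
 next
  case (Suc n)
  have "(pderiv ^^ Suc (Suc n)) ([:- c, 1:] * p) = pderiv ((pderiv ^^ Suc n) ([:- c, 1:] * p))" by simp
  also have "... = [:- c, 1:] * pderiv ((pderiv ^^ Suc n) p) + (pderiv ^^ Suc n) p
     + smult (of_nat (Suc n)) (pderiv ((pderiv ^^ n) p))"
   unfolding Suc pderiv_add e pderiv_smult ..
  also have "... = [:- c, 1:] * (pderiv ^^ Suc (Suc n)) p + smult (1 + of_nat (Suc n)) ((pderiv ^^ Suc n) p)"
   unfolding smult_add_left by (simp del: mult_pCons_left add: add.assoc)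
  finally show ?case by simp
 }
qed

lemma pderiv_sum: "pderiv (\<Sum>i\<in>A. f i) = (\<Sum>i\<in>A. pderiv (f i :: complex poly))"
 by (induction A rule: infinite_finite_induct) (auto simp: pderiv_add)

lemma degree_pderiv_pow: "degree ((pderiv ^^ n) p) \<le> degree (p :: complex poly) - n"
 by (induction n) (auto simp: degree_pderiv)

lemma lagrange_interpolation:
 fixes R :: "complex poly"
 assumes inj: "inj_on y {..<m}" and deg: "degree R < m"
 shows "R = (\<Sum>b<m. smult (poly R (y b) / poly (nodepoly m y b) (y b)) (nodepoly m y b))"
proof (rule poly_eqI_degree[where A = "y ` {..<m}"])
 have card: "card (y ` {..<m}) = m" using inj by (simp add: card_image)
 have nz: "poly (nodepoly m y b) (y b) ~= 0" if "b < m" for b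
  using inj that by (auto simp: nodepoly_def poly_prod inj_on_def)
 have z: "poly (nodepoly m y b) (y i) = 0" if "b ~= i" "i < m" for b i
  using that by (auto simp: nodepoly_def poly_prod)
 show "poly R x = poly (\<Sum>b<m. smult (poly R (y b) / poly (nodepoly m y b) (y b)) (nodepoly m y b)) x"
  if "x \<in> y ` {..<m}" for x
 proof -
  from that obtain i where i: "i < m" "x = y i" by auto
  have "(\<Sum>b<m. poly R (y b) / poly (nodepoly m y b) (y b) * poly (nodepoly m y b) (y i))
    = (\<Sum>b<m. if b = i then poly R (y i) else 0)"
   by (intro sum.cong refl) (use z i nz in auto)
  then show ?thesis using i by (simp add: poly_sum)
 qed
 show "card (y ` {..<m}) > degree R" using card deg by simp
 have "degree (nodepoly m y b) \<le> m - 1" if "b < m" for b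
 proof -
  have "degree (nodepoly m y b) \<le> sum (degree \<circ> (%a. [:- y a, 1:])) ({..<m} - {b})"
   unfolding nodepoly_def by (rule degree_prod_sum_le) simp
  then show ?thesis using that by (simp add: card_Diff_singleton)
 qed
 then have "degree (\<Sum>b<m. smult (poly R (y b) / poly (nodepoly m y b) (y b)) (nodepoly m y b)) \<le> m - 1"
  by (intro degree_sum_le) (auto intro: order_trans[OF degree_smult_le])
 then show "card (y ` {..<m}) > degree (\<Sum>b<m. smult (poly R (y b) / poly (nodepoly m y b) (y b)) (nodepoly m y b))"
  using card deg by simp
qed

text \<open>Let P be the product of all x - y_a and P_b the same product without b. Leibniz gives
  P^(j+1)(y_b) = (j+1) w_j(b) P_b(y_b). As P^(j+1) has degree below m it equals its Lagrange
  interpolant, and differentiating the latter at y_i expresses w_(j+1)(i) through the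
  w_j(b).\<close>

lemma nodeweight_recursion:
 assumes inj: "inj_on y {..<m}" and i: "i < m"
 shows "of_nat (j + 2) * nodeweight m y (Suc j) i =
   of_nat (j + 1) * (\<Sum>b\<in>{..<m} - {i}. (nodeweight m y j i + nodeweight m y j b) / (y i - y b))"
proof -
 define P where "P = (\<Prod>a<m. [:- y a, 1:])"
 define R where "R = (pderiv ^^ Suc j) P"
 have Psplit: "P = [:- y b, 1:] * nodepoly m y b" if "b < m" for b
  unfolding P_def nodepoly_def by (rule prod.remove) (use that in auto)
 have nz: "poly (nodepoly m y b) (y b) ~= 0" if "b < m" for b
  using inj that by (auto simp: nodepoly_def poly_prod inj_on_def)
 have w: "poly ((pderiv ^^ Suc n) P) (y b) = of_nat (Suc n) * (nodeweight m y n b * poly (nodepoly m y b) (y b))"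
  if "b < m" for b n
  unfolding Psplit[OF that] pderiv_pow_linear_mult nodeweight_def using nz[OF that] by simp
 have degP: "degree P \<le> m"
 proof -
  have "degree P \<le> sum (degree \<circ> (%a. [:- y a, 1:])) {..<m}"
   unfolding P_def by (rule degree_prod_sum_le) simp
  then show ?thesis by simp
 qed
 have degR: "degree R < m"
  using degree_pderiv_pow[of "Suc j" P] degP i unfolding R_def by linarith
 define c where "c = (%b. of_nat (Suc j) * nodeweight m y j b)"
 have c: "poly R (y b) / poly (nodepoly m y b) (y b) = c b" if "b < m" for b
  using w[OF that, of j] nz[OF that] by (simp add: R_def c_def)
 have "R = (\<Sum>b<m. smult (c b) (nodepoly m y b))"
  using lagrange_interpolation[OF inj degR] c by simp
 then have "pderiv R = pderiv (\<Sum>b<m. smult (c b) (nodepoly m y b))" by simp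
 then have "poly (pderiv R) (y i) = (\<Sum>b<m. c b * poly (pderiv (nodepoly m y b)) (y i))"
  by (simp add: pderiv_sum pderiv_smult poly_sum)
 also have "... = c i * poly (pderiv (nodepoly m y i)) (y i)
   + (\<Sum>b\<in>{..<m} - {i}. c b * poly (pderiv (nodepoly m y b)) (y i))"
  by (rule sum.remove) (use i in auto)
 also have "poly (pderiv (nodepoly m y i)) (y i) = (\<Sum>b\<in>{..<m} - {i}. poly (nodepoly m y i) (y i) / (y i - y b))"
  unfolding nodepoly_def pderiv_prod poly_sum
 proof (rule sum.cong[OF refl])
  fix b assume b: "b \<in> {..<m} - {i}"
  have "y i ~= y b" using inj b i by (auto simp: inj_on_def)
  moreover have "(\<Prod>a\<in>{..<m} - {i}. [:- y a, 1:]) = [:- y b, 1:] * (\<Prod>a\<in>{..<m} - {i} - {b}. [:- y a, 1:])"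
   by (rule prod.remove) (use b in auto)
  ultimately show "poly ((\<Prod>a\<in>{..<m} - {i} - {b}. [:- y a, 1:]) * pderiv [:- y b, 1:]) (y i) =
     poly (\<Prod>a\<in>{..<m} - {i}. [:- y a, 1:]) (y i) / (y i - y b)"
   by (simp add: pderiv_pCons left_diff_distrib[symmetric])
 qed
 also have "(\<Sum>b\<in>{..<m} - {i}. c b * poly (pderiv (nodepoly m y b)) (y i))
   = (\<Sum>b\<in>{..<m} - {i}. c b * (poly (nodepoly m y i) (y i) / (y i - y b)))"
 proof (intro sum.cong refl arg_cong2[where f = "(*)"])
  fix b assume b: "b \<in> {..<m} - {i}"
  have ne: "y i ~= y b" using inj b i by (auto simp: inj_on_def)
  define Q where "Q = (\<Prod>a\<in>{..<m} - {i} - {b}. [:- y a, 1:])"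
  have Qi: "nodepoly m y i = [:- y b, 1:] * Q"
   unfolding Q_def nodepoly_def by (rule prod.remove) (use b in auto)
  have "nodepoly m y b = [:- y i, 1:] * (\<Prod>a\<in>{..<m} - {b} - {i}. [:- y a, 1:])"
   unfolding nodepoly_def by (rule prod.remove) (use b i in auto)
  also have "{..<m} - {b} - {i} = {..<m} - {i} - {b}" by auto
  finally have Qb: "nodepoly m y b = [:- y i, 1:] * Q" unfolding Q_def .
  have "poly (pderiv (nodepoly m y b)) (y i) = poly Q (y i)"
   unfolding Qb pderiv_mult by (simp add: pderiv_pCons)
  moreover have "poly (nodepoly m y i) (y i) = (y i - y b) * poly Q (y i)" unfolding Qi by (simp add: left_diff_distrib)
  ultimately show "poly (pderiv (nodepoly m y b)) (y i) = poly (nodepoly m y i) (y i) / (y i - y b)"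
   using ne by simp
 qed
 finally have A: "poly (pderiv R) (y i) = poly (nodepoly m y i) (y i) * (\<Sum>b\<in>{..<m} - {i}. (c i + c b) / (y i - y b))"
  by (simp add: sum_distrib_left sum.distrib[symmetric] add_divide_distrib algebra_simps)
 have B: "poly (pderiv R) (y i) = of_nat (Suc (Suc j)) * (nodeweight m y (Suc j) i * poly (nodepoly m y i) (y i))"
  using w[OF i, of "Suc j"] by (simp add: R_def)
 have "poly (nodepoly m y i) (y i) * (of_nat (Suc (Suc j)) * nodeweight m y (Suc j) i) = poly (pderiv R) (y i)"
  unfolding B by (simp only: mult_ac)
 also note A
 finally have "of_nat (Suc (Suc j)) * nodeweight m y (Suc j) i = (\<Sum>b\<in>{..<m} - {i}. (c i + c b) / (y i - y b))"
  using mult_left_cancel[OF nz[OF i]] by blast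
 also have "... = of_nat (j + 1) * (\<Sum>b\<in>{..<m} - {i}. (nodeweight m y j i + nodeweight m y j b) / (y i - y b))"
  by (simp add: c_def sum_distrib_left distrib_left[symmetric])
 finally show ?thesis by (simp add: algebra_simps)
qed

text \<open>Exchanging i and b in one half of the double sum combines the singular terms into (y_i^r
  - y_b^r) / (y_i - y_b), a polynomial. The poles disappear and power sums remain; the subtracted
  term with factor r accounts for the missing diagonal b = i.\<close>

lemma nodeweight_power_sum_recursion:
 assumes inj: "inj_on y {..<m}"
 defines "S \<equiv> %j r. \<Sum>i<m. y i ^ r * nodeweight m y j i"
 shows "of_nat (j + 2) * S (Suc j) r = of_nat (j + 1) * ((\<Sum>s<r. (\<Sum>b<m. y b ^ s) * S j (r - 1 - s)) - of_nat r * S j (r - 1))"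
proof -
 let ?w = "nodeweight m y j"
 have ne: "y i ~= y b" if "i < m" "b \<in> {..<m} - {i}" for i b using inj that by (auto simp: inj_on_def)
 have "of_nat (j + 2) * S (Suc j) r = (\<Sum>i<m. y i ^ r * (of_nat (j + 2) * nodeweight m y (Suc j) i))"
  by (simp add: S_def sum_distrib_left mult_ac)
 also have "... = (\<Sum>i<m. y i ^ r * (of_nat (j + 1) * (\<Sum>b\<in>{..<m} - {i}. (?w i + ?w b) / (y i - y b))))"
  by (intro sum.cong refl) (use nodeweight_recursion[OF inj] in auto)
 also have "... = of_nat (j + 1) * (\<Sum>i<m. \<Sum>b\<in>{..<m} - {i}. y i ^ r * (?w i + ?w b) / (y i - y b))"
  by (simp add: sum_distrib_left mult_ac)
 also have "(\<Sum>i<m. \<Sum>b\<in>{..<m} - {i}. y i ^ r * (?w i + ?w b) / (y i - y b))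
   = (\<Sum>i<m. \<Sum>b\<in>{..<m} - {i}. y i ^ r * ?w i / (y i - y b)) + (\<Sum>i<m. \<Sum>b\<in>{..<m} - {i}. y i ^ r * ?w b / (y i - y b))"
  by (simp add: sum.distrib[symmetric] add_divide_distrib distrib_left)
 also have "(\<Sum>i<m. \<Sum>b\<in>{..<m} - {i}. y i ^ r * ?w b / (y i - y b)) = (\<Sum>b<m. \<Sum>i\<in>{..<m} - {b}. y i ^ r * ?w b / (y i - y b))"
 proof -
  have "(\<Sum>i<m. \<Sum>b\<in>{..<m} - {i}. g i b) = (\<Sum>i<m. \<Sum>b<m. if i = b then 0 else g i b)" for g :: "nat => nat => complex"
   by (intro sum.cong refl sum.mono_neutral_cong_left) auto
  note A = this
  show ?thesis unfolding A by (subst sum.swap) (intro sum.cong refl, auto)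
 qed
 also have "(\<Sum>i<m. \<Sum>b\<in>{..<m} - {i}. y i ^ r * ?w i / (y i - y b)) + ... =
    (\<Sum>i<m. \<Sum>b\<in>{..<m} - {i}. ?w i * (\<Sum>s<r. y b ^ s * y i ^ (r - 1 - s)))"
  unfolding sum.distrib[symmetric]
 proof (intro sum.cong refl)
  fix i b assume i: "i \<in> {..<m}" and b: "b \<in> {..<m} - {i}"
  have "y i ^ r - y b ^ r = (y i - y b) * (\<Sum>s<r. y b ^ (r - Suc s) * y i ^ s)" by (rule power_diff_sumr2)
  also have "(\<Sum>s<r. y b ^ (r - Suc s) * y i ^ s) = (\<Sum>s<r. y b ^ s * y i ^ (r - 1 - s))"
   by (rule sum.reindex_bij_witness[of _ "%s. r - 1 - s" "%s. r - 1 - s"]) auto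
  finally have A: "(y i ^ r - y b ^ r) / (y i - y b) = (\<Sum>s<r. y b ^ s * y i ^ (r - 1 - s))"
   using ne[of i b] i b by simp
  have B: "y b ^ r * ?w i / (y b - y i) = - (y b ^ r * ?w i / (y i - y b))"
   by (metis minus_diff_eq minus_divide_right)
  show "y i ^ r * ?w i / (y i - y b) + y b ^ r * ?w i / (y b - y i) = ?w i * (\<Sum>s<r. y b ^ s * y i ^ (r - 1 - s))"
   unfolding B A[symmetric] by (simp add: diff_divide_distrib right_diff_distrib mult.commute)
 qed
 also have "... = (\<Sum>i<m. (\<Sum>b<m. ?w i * (\<Sum>s<r. y b ^ s * y i ^ (r - 1 - s))) - ?w i * (\<Sum>s<r. y i ^ s * y i ^ (r - 1 - s)))"
  by (intro sum.cong refl) (simp add: sum_diff1)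
 also have "... = (\<Sum>i<m. \<Sum>b<m. ?w i * (\<Sum>s<r. y b ^ s * y i ^ (r - 1 - s))) - (\<Sum>i<m. ?w i * (of_nat r * y i ^ (r - 1)))"
 proof -
  have "(\<Sum>s<r. y i ^ s * y i ^ (r - 1 - s)) = of_nat r * y i ^ (r - 1)" for i
  proof -
   have "(\<Sum>s<r. y i ^ s * y i ^ (r - 1 - s)) = (\<Sum>s<r. y i ^ (r - 1))"
    by (intro sum.cong refl) (simp add: power_add[symmetric])
   then show ?thesis by simp
  qed
  then show ?thesis by (simp add: sum_subtractf)
 qed
 also have "(\<Sum>i<m. ?w i * (of_nat r * y i ^ (r - 1))) = of_nat r * S j (r - 1)"
  by (simp add: S_def sum_distrib_left mult_ac)
 also have "(\<Sum>i<m. \<Sum>b<m. ?w i * (\<Sum>s<r. y b ^ s * y i ^ (r - 1 - s))) = (\<Sum>s<r. (\<Sum>b<m. y b ^ s) * S j (r - 1 - s))"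
 proof -
  have "(\<Sum>i<m. \<Sum>b<m. ?w i * (\<Sum>s<r. y b ^ s * y i ^ (r - 1 - s))) = (\<Sum>i<m. \<Sum>b<m. \<Sum>s<r. y b ^ s * (y i ^ (r - 1 - s) * ?w i))"
   by (simp add: sum_distrib_left mult_ac)
  also have "... = (\<Sum>i<m. \<Sum>s<r. \<Sum>b<m. y b ^ s * (y i ^ (r - 1 - s) * ?w i))"
   by (intro sum.cong refl sum.swap)
  also have "... = (\<Sum>s<r. \<Sum>i<m. \<Sum>b<m. y b ^ s * (y i ^ (r - 1 - s) * ?w i))" by (rule sum.swap)
  also have "... = (\<Sum>s<r. (\<Sum>b<m. y b ^ s) * S j (r - 1 - s))"
   unfolding S_def sum_product by (intro sum.cong refl sum.swap)
  finally show ?thesis .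
 qed
 finally show ?thesis .
qed

text \<open>The weighted power sum of order j divided by N^(j+1), as a function of the power sums v.
  The power sum of exponent 0 is the number of variables \<open>m N\<close>, which slot 0 does not
  hold, so it is substituted explicitly.\<close>

fun hsum :: "(nat => nat) => nat => nat => nat => point => complex" where
 "hsum m 0 r N v = (if r = 0 then of_nat (m N) else v r) / of_nat N"
| "hsum m (Suc j) r N v = of_nat (j + 1) / of_nat (j + 2) *
   ((\<Sum>s<r. (if s = 0 then of_nat (m N) else v s) / of_nat N * hsum m j (r - 1 - s) N v)
    - of_nat r / of_nat N * hsum m j (r - 1) N v)"

lemma hsum_eval:
 assumes inj: "inj_on y {..<m N}" and N: "N > 0" and v: "!!r. r \<ge> 1 ==> v r = (\<Sum>b<m N. y b ^ r)"
 shows "(\<Sum>i<m N. y i ^ r * nodeweight (m N) y j i) = of_nat N ^ (j + 1) * hsum m j r N v"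
proof (induction j arbitrary: r)
 case 0
 have "nodeweight (m N) y 0 i = 1" if "i < m N" for i
  using inj that by (auto simp: nodeweight_def nodepoly_def poly_prod inj_on_def)
 then have "(\<Sum>i<m N. y i ^ r * nodeweight (m N) y 0 i) = (\<Sum>i<m N. y i ^ r)" by simp
 then show ?case using v[of r] N by (cases "r = 0") auto
next
 case (Suc j)
 have p: "(\<Sum>b<m N. y b ^ s) = (if s = 0 then of_nat (m N) else v s)" for s
  using v[of s] by (cases "s = 0") auto
 have "of_nat (j + 2) * (\<Sum>i<m N. y i ^ r * nodeweight (m N) y (Suc j) i) =
   of_nat (j + 1) * ((\<Sum>s<r. (if s = 0 then of_nat (m N) else v s) * (of_nat N ^ (j + 1) * hsum m j (r - 1 - s) N v))
    - of_nat r * (of_nat N ^ (j + 1) * hsum m j (r - 1) N v))"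
  using nodeweight_power_sum_recursion[OF inj, of j r] unfolding Suc p .
 also have "... = of_nat (j + 2) * (of_nat N ^ (Suc j + 1) * hsum m (Suc j) r N v)"
 proof -
  have j2: "of_nat (j + 2) ~= (0::complex)" unfolding of_nat_eq_0_iff by simp
  have N0: "of_nat N ~= (0::complex)" using N by simp
  have 1: "(\<Sum>s<r. (if s = 0 then of_nat (m N) else v s) * (of_nat N ^ (j + 1) * hsum m j (r - 1 - s) N v)) =
    of_nat N ^ (Suc j + 1) * (\<Sum>s<r. (if s = 0 then of_nat (m N) else v s) / of_nat N * hsum m j (r - 1 - s) N v)"
   unfolding sum_distrib_left using N0 by (intro sum.cong refl) simp
  have 2: "of_nat r * (of_nat N ^ (j + 1) * hsum m j (r - 1) N v) =
    of_nat N ^ (Suc j + 1) * (of_nat r / of_nat N * hsum m j (r - 1) N v)"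
   using N0 by simp
  have "x * (K * A - K * B) = z * (K * (x / z * (A - B)))" if "z ~= 0" for x z K A B :: complex
   using that by (simp add: field_simps)
  from this[OF j2] show ?thesis unfolding 1 2 hsum.simps .
 qed
 finally have *: "of_nat (j + 2) * (\<Sum>i<m N. y i ^ r * nodeweight (m N) y (Suc j) i)
   = of_nat (j + 2) * (of_nat N ^ (Suc j + 1) * hsum m (Suc j) r N v)" .
 have "of_nat (j + 2) ~= (0::complex)" unfolding of_nat_eq_0_iff by simp
 from mult_left_cancel[OF this] * show ?case by blast
qed

text \<open>Of the factors p_s / N only p_0 / N has a nonzero limit, the others are of size 1 / N.
  Taking p_0 at every step yields a constant exactly when r = j; the ratios (i+1) / (i+2) multiply
  to 1 / (j+1). A single factor p_(r-j) among the p_0 gives the term of order 1 / N.\<close>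

lemma hsum_expansion:
 assumes a: "(%N. of_nat (m N) / of_nat N) \<longlonglongrightarrow> a"
 shows "\<exists>g l. g \<longlonglongrightarrow> (if r = j then a ^ (j + 1) / of_nat (j + 1) else 0) &
   cv (Suc r) l (%v. if j < r then a ^ j * v (r - j) else 0) & (\<forall>N. indep0 (l N)) &
   (\<forall>N v. hsum m j r N v = g N + l N v / of_nat N)"
proof (induction j arbitrary: r)
 case 0
 show ?case
 proof (cases "r = 0")
  case True
  then show ?thesis using a
   by (intro exI[of _ "%N. of_nat (m N) / of_nat N"] exI[of _ "%N v. 0"])
     (auto simp: indep0_def cv_scalar)
 next
  case False
  then show ?thesis
   by (intro exI[of _ "%N. 0"] exI[of _ "%N v. v r"]) (auto simp: indep0_def intro: cv_var)
 qed
next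
 case (Suc j)
 have "\<forall>r. \<exists>p. fst p \<longlonglongrightarrow> (if r = j then a ^ (j + 1) / of_nat (j + 1) else 0) &
   cv (Suc r) (snd p) (%v. if j < r then a ^ j * v (r - j) else 0) & (\<forall>N. indep0 (snd p N)) &
   (\<forall>N v. hsum m j r N v = fst p N + snd p N v / of_nat N)"
  using Suc by auto
 from choice[OF this] obtain p where p: "!!r. fst (p r) \<longlonglongrightarrow> (if r = j then a ^ (j + 1) / of_nat (j + 1) else 0)"
   "!!r. cv (Suc r) (snd (p r)) (%v. if j < r then a ^ j * v (r - j) else 0)" "!!r N. indep0 (snd (p r) N)"
   "!!r N v. hsum m j r N v = fst (p r) N + snd (p r) N v / of_nat N" by blast
 define g where "g = (%r. fst (p r))"
 define l where "l = (%r. snd (p r))"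
 have g: "g r \<longlonglongrightarrow> (if r = j then a ^ (j + 1) / of_nat (j + 1) else 0)" for r
  unfolding g_def by (rule p(1))
 have l: "cv (Suc r) (l r) (%v. if j < r then a ^ j * v (r - j) else 0)" "indep0 (l r N)" for r N
  unfolding l_def by (rule p(2), rule p(3))
 have h: "hsum m j r N v = g r N + l r N v / of_nat N" for r N v
  unfolding g_def l_def by (rule p(4))
 have inv0: "(%N. 1 / of_nat N :: complex) \<longlonglongrightarrow> 0" by (rule lim_1_over_n)
 define \<kappa> where "\<kappa> = (of_nat (j + 1) / of_nat (j + 2) :: complex)"
 show ?case
 proof (cases r)
  case 0
  then show ?thesis
   by (intro exI[of _ "%N. 0"] exI[of _ "%N v. 0"]) (auto simp: indep0_def cv_scalar)
 next
  case (Suc r')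
  define G where "G = (%N. \<kappa> * (of_nat (m N) / of_nat N * g r' N - of_nat r * (1 / of_nat N * g r' N)))"
  define Lf where "Lf = (%N v. \<kappa> * (of_nat (m N) / of_nat N * l r' N v
    + (\<Sum>s\<in>{1..<r}. v s * (g (r' - s) N + 1 / of_nat N * l (r' - s) N v)) - of_nat r * (1 / of_nat N * l r' N v)))"
  have "G \<longlonglongrightarrow> \<kappa> * (a * (if r' = j then a ^ (j + 1) / of_nat (j + 1) else 0) - of_nat r * (0 * (if r' = j then a ^ (j + 1) / of_nat (j + 1) else 0)))"
   unfolding G_def by (intro tendsto_intros a g inv0)
  also have "\<kappa> * (a * (if r' = j then a ^ (j + 1) / of_nat (j + 1) else 0) - of_nat r * (0 * (if r' = j then a ^ (j + 1) / of_nat (j + 1) else 0)))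
    = (if r = Suc j then a ^ (Suc j + 1) / of_nat (Suc j + 1) else 0)"
  proof (cases "r' = j")
   case True
   have "of_nat (j + 1) ~= (0::complex)" "of_nat (j + 2) ~= (0::complex)" unfolding of_nat_eq_0_iff by auto
   then show ?thesis using True Suc by (simp add: \<kappa>_def)
  qed (use Suc in auto)
  finally have G: "G \<longlonglongrightarrow> (if r = Suc j then a ^ (Suc j + 1) / of_nat (Suc j + 1) else 0)" .
  have "cv (Suc r) Lf (%v. \<kappa> * (a * (if j < r' then a ^ j * v (r' - j) else 0)
    + (\<Sum>s\<in>{1..<r}. v s * ((if r' - s = j then a ^ (j + 1) / of_nat (j + 1) else 0) + 0 * (if j < r' - s then a ^ j * v (r' - s - j) else 0)))
    - of_nat r * (0 * (if j < r' then a ^ j * v (r' - j) else 0))))"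
   unfolding Lf_def
   by (intro cv_cmult cv_diff cv_add cv_mult cv_sum cv_var cv_const[OF a] cv_const[OF inv0] cv_const[OF g] cv_mono[OF l(1)])
     (rule g | use Suc in simp)+
  then have L: "cv (Suc r) Lf (%v. if Suc j < r then a ^ Suc j * v (r - Suc j) else 0)"
  proof (rule cv_cong)
   fix v :: "nat => complex"
   have sm: "(\<Sum>s\<in>{1..<r}. v s * ((if r' - s = j then a ^ (j + 1) / of_nat (j + 1) else 0) + 0 * (if j < r' - s then a ^ j * v (r' - s - j) else 0)))
     = (if j < r' then v (r' - j) * (a ^ (j + 1) / of_nat (j + 1)) else 0)"
   proof -
    have "(\<Sum>s\<in>{1..<r}. v s * ((if r' - s = j then a ^ (j + 1) / of_nat (j + 1) else 0) + 0 * (if j < r' - s then a ^ j * v (r' - s - j) else 0)))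
      = (\<Sum>s\<in>{1..<r}. if s = r' - j & j < r' then v (r' - j) * (a ^ (j + 1) / of_nat (j + 1))
        else (if j = 0 & s = r' then v s * a else 0))"
     by (intro sum.cong refl) (use Suc in auto)
    also have "... = (if j < r' then v (r' - j) * (a ^ (j + 1) / of_nat (j + 1)) else 0)"
    proof (cases "j < r'")
     case True
     have "(\<Sum>s\<in>{1..<r}. if s = r' - j & j < r' then v (r' - j) * (a ^ (j + 1) / of_nat (j + 1))
        else (if j = 0 & s = r' then v s * a else 0)) =
        (\<Sum>s\<in>{1..<r}. if s = r' - j then v (r' - j) * (a ^ (j + 1) / of_nat (j + 1)) else 0)"
      by (intro sum.cong refl) (use True in auto)
     then show ?thesis using True Suc by (simp add: sum.delta)
    next
     case False
     then show ?thesis using Suc by (auto intro!: sum.neutral)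
    qed
    finally show ?thesis .
   qed
   have "(if Suc j < r then a ^ Suc j * v (r - Suc j) else 0) = \<kappa> * (a * (if j < r' then a ^ j * v (r' - j) else 0)
     + (if j < r' then v (r' - j) * (a ^ (j + 1) / of_nat (j + 1)) else 0))"
   proof (cases "j < r'")
    case True
    have *: "of_nat (j + 1) ~= (0::complex)" "of_nat (j + 2) ~= (0::complex)" unfolding of_nat_eq_0_iff by auto
    \<comment> \<open>The 1 / N term arises in two ways: p_0 times the earlier 1 / N term, and
      p_(r'-j) times the earlier constant a^(j+1) / (j+1). The prefactor makes their weights add up
      to 1.\<close>
    have "\<kappa> * (1 + 1 / of_nat (j + 1)) = 1"
    proof -
     have "1 + 1 / of_nat (j + 1) = (of_nat (j + 2) / of_nat (j + 1) :: complex)"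
      using *(1) by (simp add: field_simps)
     then show ?thesis using * unfolding \<kappa>_def by simp
    qed
    moreover have "\<kappa> * (a * (a ^ j * x) + x * (a ^ (j + 1) / J)) = a ^ Suc j * x" if "\<kappa> * (1 + 1 / J) = 1" for x J
    proof -
     have "\<kappa> * (a * (a ^ j * x) + x * (a ^ (j + 1) / J)) = (\<kappa> * (1 + 1 / J)) * (a ^ Suc j * x)"
      by (simp add: algebra_simps)
     then show ?thesis unfolding that by simp
    qed
    ultimately have "\<kappa> * (a * (a ^ j * v (r' - j)) + v (r' - j) * (a ^ (j + 1) / of_nat (j + 1))) = a ^ Suc j * v (r' - j)"
     by blast
    then show ?thesis using True Suc by simp
   qed (use Suc in auto)
   then show "(if Suc j < r then a ^ Suc j * v (r - Suc j) else 0) = \<kappa> * (a * (if j < r' then a ^ j * v (r' - j) else 0)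
    + (\<Sum>s\<in>{1..<r}. v s * ((if r' - s = j then a ^ (j + 1) / of_nat (j + 1) else 0) + 0 * (if j < r' - s then a ^ j * v (r' - s - j) else 0)))
    - of_nat r * (0 * (if j < r' then a ^ j * v (r' - j) else 0)))"
    unfolding sm by simp
  qed simp
  have lN: "l s N (v(0 := t)) = l s N v" for s N v t using l(2) by (simp add: indep0_def)
  have ind: "indep0 (Lf N)" for N
   unfolding Lf_def indep0_def lN by (auto intro!: sum.cong)
  have "hsum m (Suc j) r N v = G N + Lf N v / of_nat N" for N v
  proof -
   have "(\<Sum>s<r. (if s = 0 then of_nat (m N) else v s) / of_nat N * hsum m j (r - 1 - s) N v) =
     of_nat (m N) / of_nat N * hsum m j r' N v + (\<Sum>s\<in>{1..<r}. v s / of_nat N * hsum m j (r' - s) N v)"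
   proof -
    have "{..<r} = insert 0 {1..<r}" using Suc by auto
    then show ?thesis using Suc by simp
   qed
   then have "hsum m (Suc j) r N v = \<kappa> * (of_nat (m N) / of_nat N * hsum m j r' N v
      + (\<Sum>s\<in>{1..<r}. v s / of_nat N * hsum m j (r' - s) N v) - of_nat r / of_nat N * hsum m j r' N v)"
    unfolding hsum.simps(2) \<kappa>_def using Suc by simp
   also have "(\<Sum>s\<in>{1..<r}. v s / of_nat N * hsum m j (r' - s) N v)
     = (\<Sum>s\<in>{1..<r}. v s * (g (r' - s) N + 1 / of_nat N * l (r' - s) N v)) / of_nat N"
    unfolding h sum_divide_distrib by (intro sum.cong refl) simp
   finally show ?thesis
    unfolding h G_def Lf_def by (simp add: add_divide_distrib diff_divide_distrib algebra_simps)
  qed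
  then show ?thesis
   by (intro exI[of _ G] exI[of _ Lf] conjI allI G L ind)
 qed
qed

section \<open>Expansion of D_k in powers of 1 / N\<close>

subsection \<open>The operators \<open>D\<^sub>k\<close> in power sum coordinates\<close>

lemma cv_local: "cv D f g ==> (!!i. i < D ==> v i = w i) ==> f N v = f N w & g v = g w"
 by (induction rule: cv.induct) auto

definition nu :: "nat => complex" where "nu N = 1 / of_nat N"

lemma nu_tendsto: "nu \<longlonglongrightarrow> 0"
 unfolding nu_def by (rule lim_1_over_n)

lemma cv_nu: "cv D f g ==> cv D (%N v. f N v * nu N) (%v. 0)"
 by (rule cv_cong[OF cv_mult[OF _ cv_const[OF nu_tendsto]]]) auto

text \<open>Total derivative while one variable z moves: slot 0 is z itself, and the r-th power sum
  has derivative r z^(r-1).\<close>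

definition nab :: "nat => (point => complex) => point => complex" where
 "nab D h v = pderiv_at 0 h v + (\<Sum>r\<in>{1..<D}. of_nat r * v 0 ^ (r - 1) * pderiv_at r h v)"

lemma cv_nab:
 assumes "cv D f g" "0 < D" shows "cv D (%N. nab D (f N)) (nab D g)"
 unfolding nab_def
 by (intro cv_add cv_sum cv_mult cv_pderiv[OF assms(1)] cv_scalar cv_power cv_var assms(2))

lemma nab_zero [simp]: "nab D (%v. 0) = (%v. 0)"
 by (simp add: nab_def fun_eq_iff)

lemma nab_add: "cv D f f' ==> cv D g g' ==> nab D (%v. f N v + g N v) v = nab D (f N) v + nab D (g N) v"
 by (simp add: nab_def cv_pderiv_add sum.distrib algebra_simps)

lemma nab_mult: "cv D f f' ==> cv D g g' ==> nab D (%v. f N v * g N v) v = f N v * nab D (g N) v + nab D (f N) v * g N v"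
 by (simp add: nab_def cv_pderiv_mult sum.distrib sum_distrib_left sum_distrib_right distrib_left distrib_right mult_ac)

lemma nab_cmult: "cv D f f' ==> nab D (%v. f N v * c) v = nab D (f N) v * c"
 using nab_mult[OF _ cv_scalar[of D c], of f f' N v] by (simp add: nab_def)

text \<open>Coefficients in theta^k (p E \<phi>) = N^k E times the sum over j of nu^j p^(j) ucoef_j,
  where E' = E (N \<alpha> + \<beta>). Relative to N, a derivative on p raises j at the cost of one
  \<open>nu\<close>, one on E gives \<alpha> + \<beta> nu, and one on a coefficient costs
  \<open>nu\<close>.\<close>

primrec ucoef :: "nat => (nat => point => complex) => (nat => point => complex) =>
  (nat => point => complex) => nat => nat => nat => point => complex" where
 "ucoef D \<alpha> \<beta> \<phi> 0 = (%j N v. if j = 0 then \<phi> N v else 0)"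
| "ucoef D \<alpha> \<beta> \<phi> (Suc k) = (%j N v. (1 + v 0) * (\<alpha> N v * ucoef D \<alpha> \<beta> \<phi> k j N v
   + (if j = 0 then 0 else ucoef D \<alpha> \<beta> \<phi> k (j - 1) N v)
   + (\<beta> N v * ucoef D \<alpha> \<beta> \<phi> k j N v + nab D (ucoef D \<alpha> \<beta> \<phi> k j N) v) * nu N))"

text \<open>\<open>acoef\<close> is the part of \<open>ucoef\<close> that merely multiplies \<phi>
  by a function of slot 0; \<open>vcoef\<close> is the rest, which carries a factor
  \<open>nu\<close>. The sum over i amplifies both by N, so the first produces the large scalar and
  the second the first order operator.\<close>

primrec acoef :: "(nat => point => complex) => nat => nat => nat => point => complex" where
 "acoef \<alpha> 0 = (%j N v. if j = 0 then 1 else 0)"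
| "acoef \<alpha> (Suc k) = (%j N v. (1 + v 0) * (\<alpha> N v * acoef \<alpha> k j N v
   + (if j = 0 then 0 else acoef \<alpha> k (j - 1) N v) + pderiv_at 0 (acoef \<alpha> k j N) v * nu N))"

primrec vcoef :: "nat => (nat => point => complex) => (nat => point => complex) =>
  (nat => point => complex) => nat => nat => nat => point => complex" where
 "vcoef D \<alpha> \<beta> \<phi> 0 = (%j N v. 0)"
| "vcoef D \<alpha> \<beta> \<phi> (Suc k) = (%j N v. (1 + v 0) * (\<alpha> N v * vcoef D \<alpha> \<beta> \<phi> k j N v
   + (if j = 0 then 0 else vcoef D \<alpha> \<beta> \<phi> k (j - 1) N v)
   + (\<beta> N v * vcoef D \<alpha> \<beta> \<phi> k j N v + nab D (vcoef D \<alpha> \<beta> \<phi> k j N) v) * nu N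
   + acoef \<alpha> k j N v * (\<beta> N v * \<phi> N v + nab D (\<phi> N) v)))"

lemma ucoef_zero: "k < j ==> ucoef D \<alpha> \<beta> \<phi> k j = (%N v. 0)"
 by (induction k arbitrary: j) auto

text \<open>In the limit no derivative acts on coefficients, so k steps expand the k-th power of (1
  + z) times (\<alpha> plus the shift of j) binomially.\<close>

lemma cv_acoef:
 assumes \<alpha>: "cv 1 \<alpha> \<alpha>'"
 shows "cv 1 (acoef \<alpha> k j) (%v. of_nat (k choose j) * (1 + v 0) ^ k * \<alpha>' v ^ (k - j))"
proof (induction k arbitrary: j)
 case 0
 show ?case by (cases j) (auto simp: cv_scalar)
next
 case (Suc k)
 let ?L = "%j v. of_nat (k choose j) * (1 + v 0) ^ k * \<alpha>' v ^ (k - j)"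
 have "cv 1 (%N v. if j = 0 then 0 else acoef \<alpha> k (j - 1) N v) (%v. if j = 0 then 0 else ?L (j - 1) v)"
  using Suc[of "j - 1"] by (cases "j = 0") (auto simp: cv_scalar)
 moreover have "cv 1 (%N v. pderiv_at 0 (acoef \<alpha> k j N) v * nu N) (%v. 0)"
  by (rule cv_nu, rule cv_pderiv[OF Suc])
 ultimately have "cv 1 (acoef \<alpha> (Suc k) j) (%v. (1 + v 0) * (\<alpha>' v * ?L j v + (if j = 0 then 0 else ?L (j - 1) v) + 0))"
  unfolding acoef.simps
  by (intro cv_mult cv_add cv_scalar cv_var \<alpha> Suc) auto
 then show ?case
 proof (rule cv_cong)
  fix v :: "nat => complex"
  show "of_nat (Suc k choose j) * (1 + v 0) ^ Suc k * \<alpha>' v ^ (Suc k - j) =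
    (1 + v 0) * (\<alpha>' v * ?L j v + (if j = 0 then 0 else ?L (j - 1) v) + 0)"
  proof (cases j)
   case (Suc i)
   have "\<alpha>' v * (of_nat (k choose Suc i) * x * \<alpha>' v ^ (k - Suc i)) = of_nat (k choose Suc i) * x * \<alpha>' v ^ (k - i)" for x
   proof (cases "Suc i \<le> k")
    case True
    then have "k - i = Suc (k - Suc i)" by simp
    then show ?thesis by simp
   qed (simp add: binomial_eq_0)
   note pw = this
   show ?thesis unfolding Suc pw by (simp add: algebra_simps)
  qed simp
 qed simp
qed

text \<open>One of the k steps is spent on \<beta> \<phi> + nab \<phi>, the other k - 1 expand as in
  \<open>cv_acoef\<close>. Everything else carries \<open>nu\<close> and vanishes.\<close>

lemma cv_vcoef:
 assumes \<alpha>: "cv 1 \<alpha> \<alpha>'" and \<beta>: "cv D \<beta> \<beta>'" and \<phi>: "cv D \<phi> \<phi>'" and D: "0 < D"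
 shows "cv D (vcoef D \<alpha> \<beta> \<phi> k j) (%v. of_nat (k * ((k - 1) choose j)) * (1 + v 0) ^ k * \<alpha>' v ^ (k - 1 - j)
   * (\<beta>' v * \<phi>' v + nab D \<phi>' v))"
proof (induction k arbitrary: j)
 case 0
 show ?case by (auto simp: cv_scalar)
next
 case (Suc k)
 let ?B = "%v. \<beta>' v * \<phi>' v + nab D \<phi>' v"
 let ?L = "%j v. of_nat (k * ((k - 1) choose j)) * (1 + v 0) ^ k * \<alpha>' v ^ (k - 1 - j) * ?B v"
 let ?A = "%v. of_nat (k choose j) * (1 + v 0) ^ k * \<alpha>' v ^ (k - j)"
 have aD: "cv D \<alpha> \<alpha>'" by (rule cv_mono[OF \<alpha>]) (use D in simp)
 have aD': "cv D (acoef \<alpha> k j) ?A" by (rule cv_mono[OF cv_acoef[OF \<alpha>]]) (use D in simp)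
 have "cv D (%N v. if j = 0 then 0 else vcoef D \<alpha> \<beta> \<phi> k (j - 1) N v) (%v. if j = 0 then 0 else ?L (j - 1) v)"
  using Suc[of "j - 1"] by (cases "j = 0") (auto simp: cv_scalar)
 moreover have "cv D (%N v. (\<beta> N v * vcoef D \<alpha> \<beta> \<phi> k j N v + nab D (vcoef D \<alpha> \<beta> \<phi> k j N) v) * nu N) (%v. 0)"
  by (rule cv_nu, rule cv_add, rule cv_mult, rule \<beta>, rule Suc, rule cv_nab[OF Suc D])
 ultimately have "cv D (vcoef D \<alpha> \<beta> \<phi> (Suc k) j) (%v. (1 + v 0) * (\<alpha>' v * ?L j v + (if j = 0 then 0 else ?L (j - 1) v) + 0 + ?A v * ?B v))"
  unfolding vcoef.simps
  by (intro cv_mult cv_add cv_scalar cv_var aD aD' \<beta> \<phi> D Suc cv_nab[OF \<phi>])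
 then show ?case
 proof (rule cv_cong)
  fix v :: "nat => complex"
  have pw: "\<alpha>' v * (of_nat (k * ((k - 1) choose j)) * x * \<alpha>' v ^ (k - 1 - j) * y) = of_nat (k * ((k - 1) choose j)) * x * \<alpha>' v ^ (k - j) * y" for x y
  proof (cases "k = 0 \<or> k - 1 < j")
   case True then show ?thesis by (auto simp: binomial_eq_0)
  next
   case False
   then have "k - j = Suc (k - 1 - j)" by arith
   then show ?thesis by simp
  qed
  show "of_nat (Suc k * ((Suc k - 1) choose j)) * (1 + v 0) ^ Suc k * \<alpha>' v ^ (Suc k - 1 - j) * ?B v =
    (1 + v 0) * (\<alpha>' v * ?L j v + (if j = 0 then 0 else ?L (j - 1) v) + 0 + ?A v * ?B v)"
  proof (cases j)
   case 0
   then show ?thesis unfolding pw by (simp add: algebra_simps)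
  next
   case (Suc i)
   show ?thesis
   proof (cases k)
    case 0 then show ?thesis using Suc by simp
   next
    case (Suc k')
    note k = this
    have e: "k - 1 - (j - 1) = k - j" and j0: "j ~= 0" using k \<open>j = Suc i\<close> by auto
    have c: "(k choose j) = ((k - 1) choose j) + ((k - 1) choose (j - 1))"
     using k \<open>j = Suc i\<close> by simp
    have num: "(of_nat (Suc k * (k choose j)) :: complex) =
     of_nat (k * ((k - 1) choose j)) + of_nat (k * ((k - 1) choose (j - 1))) + of_nat (k choose j)"
     unfolding of_nat_add[symmetric] c by (simp add: algebra_simps)
    show ?thesis unfolding pw diff_Suc_1 e num if_not_P[OF j0]
     by (simp add: algebra_simps del: of_nat_mult)
   qed
  qed
 qed simp
qed

lemma cv_ucoef:
 assumes \<alpha>: "cv D \<alpha> \<alpha>'" and \<beta>: "cv D \<beta> \<beta>'" and \<phi>: "cv D \<phi> \<phi>'" and D: "0 < D"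
 shows "\<exists>u. cv D (ucoef D \<alpha> \<beta> \<phi> k j) u"
proof (induction k arbitrary: j)
 case 0
 show ?case using \<phi> by (cases "j = 0") (auto intro: cv_scalar)
next
 case (Suc k)
 obtain u where u: "cv D (ucoef D \<alpha> \<beta> \<phi> k j) u" using Suc by blast
 obtain u1 where u1: "cv D (ucoef D \<alpha> \<beta> \<phi> k (j - 1)) u1" using Suc by blast
 have "cv D (%N v. if j = 0 then 0 else ucoef D \<alpha> \<beta> \<phi> k (j - 1) N v) (%v. if j = 0 then 0 else u1 v)"
  using u1 by (cases "j = 0") (auto simp: cv_scalar)
 moreover have "cv D (%N v. (\<beta> N v * ucoef D \<alpha> \<beta> \<phi> k j N v + nab D (ucoef D \<alpha> \<beta> \<phi> k j N) v) * nu N) (%v. 0)"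
  by (rule cv_nu, rule cv_add, rule cv_mult, rule \<beta>, rule u, rule cv_nab[OF u D])
 ultimately have "cv D (ucoef D \<alpha> \<beta> \<phi> (Suc k) j) (%v. (1 + v 0) * (\<alpha>' v * u v + (if j = 0 then 0 else u1 v) + 0))"
  unfolding ucoef.simps
  by (intro cv_mult cv_add cv_scalar cv_var \<alpha> \<beta> D u)
 then show ?case by blast
qed

lemma ucoef_split:
 assumes \<alpha>: "cv 1 \<alpha> \<alpha>'" and \<beta>: "cv D \<beta> \<beta>'" and \<phi>: "cv D \<phi> \<phi>'" and D: "0 < D"
 shows "ucoef D \<alpha> \<beta> \<phi> k j N = (%v. acoef \<alpha> k j N v * \<phi> N v + vcoef D \<alpha> \<beta> \<phi> k j N v * nu N)"
proof (induction k arbitrary: j)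
 case 0 show ?case by auto
next
 case (Suc k)
 have a: "cv D (acoef \<alpha> k j) (%v. of_nat (k choose j) * (1 + v 0) ^ k * \<alpha>' v ^ (k - j))"
  by (rule cv_mono[OF cv_acoef[OF \<alpha>]]) (use D in simp)
 note v = cv_vcoef[OF \<alpha> \<beta> \<phi> D, of k j]
 have na: "nab D (acoef \<alpha> k j N) v = pderiv_at 0 (acoef \<alpha> k j N) v" for v
  unfolding nab_def using cv_pderiv_zero[OF cv_acoef[OF \<alpha>], of _ k j N v] by simp
 have n: "nab D (%v. acoef \<alpha> k j N v * \<phi> N v + vcoef D \<alpha> \<beta> \<phi> k j N v * nu N) v =
   acoef \<alpha> k j N v * nab D (\<phi> N) v + pderiv_at 0 (acoef \<alpha> k j N) v * \<phi> N v + nab D (vcoef D \<alpha> \<beta> \<phi> k j N) v * nu N" for v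
  using nab_add[OF cv_mult[OF a \<phi>] cv_mult[OF v cv_const[OF nu_tendsto]], of N v]
   nab_mult[OF a \<phi>, of N v] nab_cmult[OF v, of N "nu N" v] na[of v] by simp
 show ?case
  unfolding ucoef.simps acoef.simps vcoef.simps Suc n
  by (cases "j = 0") (auto simp: fun_eq_iff algebra_simps)
qed

text \<open>Along c, slot 0 follows z and the power sums follow one moving variable, so the
  derivative along c is \<open>nab\<close>. The product rule then matches the recursion of
  \<open>ucoef\<close>.\<close>

lemma theta_pow_ucoef:
 fixes c :: "complex => nat => complex" and E :: "complex => complex" and p :: "complex poly"
 assumes \<alpha>: "cv D \<alpha> \<alpha>'" and \<beta>: "cv D \<beta> \<beta>'" and \<phi>: "cv D \<phi> \<phi>'" and D: "0 < D" and N: "N > 0"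
  and c0: "!!z. c z 0 = z"
  and c: "!!z r. 1 \<le> r ==> ((%z. c z r) has_field_derivative of_nat r * z ^ (r - 1)) (at z)"
  and E: "!!z. (E has_field_derivative E z * (of_nat N * \<alpha> N (c z) + \<beta> N (c z))) (at z)"
 shows "(theta ^^ k) (%z. poly p z * (E z * \<phi> N (c z))) z =
   of_nat N ^ k * E z * (\<Sum>j\<le>k. nu N ^ j * poly ((pderiv ^^ j) p) z * ucoef D \<alpha> \<beta> \<phi> k j N (c z))"
proof (induction k arbitrary: z)
 case 0 show ?case by simp
next
 case (Suc k)
 let ?u = "%j. ucoef D \<alpha> \<beta> \<phi> k j N"
 let ?P = "%j. poly ((pderiv ^^ j) p)"
 have Nnu: "of_nat N * nu N = 1" using N by (simp add: nu_def)
 have du: "((%z. ?u j (c z)) has_field_derivative nab D (?u j) (c z)) (at z)" for j z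
 proof -
  obtain u where u: "cv D (ucoef D \<alpha> \<beta> \<phi> k j) u" using cv_ucoef[OF \<alpha> \<beta> \<phi> D] by blast
  have "((%z. ?u j (c z)) has_field_derivative
    (\<Sum>i<D. pderiv_at i (?u j) (c z) * (if i = 0 then 1 else of_nat i * z ^ (i - 1)))) (at z)"
   by (rule cv_chain[OF u]) (use c c0 in auto)
  also have "(\<Sum>i<D. pderiv_at i (?u j) (c z) * (if i = 0 then 1 else of_nat i * z ^ (i - 1))) = nab D (?u j) (c z)"
  proof -
   have "{..<D} = insert 0 {1..<D}" using D by auto
   then show ?thesis unfolding nab_def c0 by (simp add: mult_ac)
  qed
  finally show ?thesis .
 qed
 let ?T = "%z. \<Sum>j\<le>k. nu N ^ j * ?P j z * ?u j (c z)"
 let ?T' = "%z. \<Sum>j\<le>k. nu N ^ j * (?P j z * nab D (?u j) (c z) + ?P (Suc j) z * ?u j (c z))"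
 have dT: "(?T has_field_derivative ?T' z) (at z)" for z
 proof (rule DERIV_sum)
  fix j
  have "((%z. nu N ^ j * (?P j z * ?u j (c z))) has_field_derivative
    nu N ^ j * (?P (Suc j) z * ?u j (c z) + nab D (?u j) (c z) * ?P j z)) (at z)"
   using DERIV_cmult[OF DERIV_mult[OF poly_DERIV[of "(pderiv ^^ j) p" z] du[of j z]], where c = "nu N ^ j"] by simp
  then show "((%z. nu N ^ j * ?P j z * ?u j (c z)) has_field_derivative
    nu N ^ j * (?P j z * nab D (?u j) (c z) + ?P (Suc j) z * ?u j (c z))) (at z)"
   by (simp add: mult_ac add.commute)
 qed
 have "((%z. of_nat N ^ k * E z * ?T z) has_field_derivative
   of_nat N ^ k * E z * ((of_nat N * \<alpha> N (c z) + \<beta> N (c z)) * ?T z + ?T' z)) (at z)"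
  by (rule DERIV_cong[OF DERIV_mult[OF DERIV_cmult[OF E] dT]]) (simp only: distrib_left distrib_right mult_ac)
 then have "(theta ^^ Suc k) (%z. poly p z * (E z * \<phi> N (c z))) z =
   (1 + z) * (of_nat N ^ k * E z * ((of_nat N * \<alpha> N (c z) + \<beta> N (c z)) * ?T z + ?T' z))"
 proof -
  assume der: "((%z. of_nat N ^ k * E z * ?T z) has_field_derivative
   of_nat N ^ k * E z * ((of_nat N * \<alpha> N (c z) + \<beta> N (c z)) * ?T z + ?T' z)) (at z)"
  have ext: "(theta ^^ k) (%z. poly p z * (E z * \<phi> N (c z))) = (%z. of_nat N ^ k * E z * ?T z)"
   by (rule ext) (rule Suc)
  show ?thesis unfolding theta_pow_Suc ext DERIV_imp_deriv[OF der] ..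
 qed
 also have "... = of_nat N ^ Suc k * E z * (\<Sum>j\<le>Suc k. nu N ^ j * ?P j z * ucoef D \<alpha> \<beta> \<phi> (Suc k) j N (c z))"
 proof -
  let ?w = "%j. nu N ^ j * ?P j z"
  have uz: "?u (Suc k) = (%v. 0)" by (simp add: ucoef_zero)
  have "(\<Sum>j\<le>Suc k. ?w j * ucoef D \<alpha> \<beta> \<phi> (Suc k) j N (c z)) =
   (1 + z) * ((\<Sum>j\<le>Suc k. ?w j * (\<alpha> N (c z) * ?u j (c z)))
    + (\<Sum>j\<le>Suc k. ?w j * (if j = 0 then 0 else ?u (j - 1) (c z)))
    + (\<Sum>j\<le>Suc k. ?w j * ((\<beta> N (c z) * ?u j (c z) + nab D (?u j) (c z)) * nu N)))"
   unfolding ucoef.simps c0 sum.distrib[symmetric] sum_distrib_left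
   by (intro sum.cong refl) (simp add: algebra_simps)
  also have "(\<Sum>j\<le>Suc k. ?w j * (\<alpha> N (c z) * ?u j (c z))) = \<alpha> N (c z) * ?T z"
   by (simp add: uz sum_distrib_left mult_ac)
  also have "(\<Sum>j\<le>Suc k. ?w j * ((\<beta> N (c z) * ?u j (c z) + nab D (?u j) (c z)) * nu N))
    = nu N * (\<beta> N (c z) * ?T z + (\<Sum>j\<le>k. ?w j * nab D (?u j) (c z)))"
   by (simp add: uz sum_distrib_left sum.distrib distrib_left mult_ac)
  also have "(\<Sum>j\<le>Suc k. ?w j * (if j = 0 then 0 else ?u (j - 1) (c z)))
    = nu N * (\<Sum>j\<le>k. nu N ^ j * ?P (Suc j) z * ?u j (c z))"
   by (subst sum.atMost_Suc_shift) (simp add: sum_distrib_left mult_ac)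
  finally have S: "(\<Sum>j\<le>Suc k. ?w j * ucoef D \<alpha> \<beta> \<phi> (Suc k) j N (c z)) =
    (1 + z) * (\<alpha> N (c z) * ?T z + nu N * (\<Sum>j\<le>k. nu N ^ j * ?P (Suc j) z * ?u j (c z))
     + nu N * (\<beta> N (c z) * ?T z + (\<Sum>j\<le>k. ?w j * nab D (?u j) (c z))))" .
  have T': "?T' z = (\<Sum>j\<le>k. ?w j * nab D (?u j) (c z)) + (\<Sum>j\<le>k. nu N ^ j * ?P (Suc j) z * ?u j (c z))"
   by (simp add: sum.distrib[symmetric] distrib_left mult_ac)
  have "of_nat N * (\<alpha> N (c z) * t + nu N * s + nu N * (\<beta> N (c z) * t + r)) = (of_nat N * \<alpha> N (c z) + \<beta> N (c z)) * t + (r + s)" for t s r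
  proof -
   have "of_nat N * (\<alpha> N (c z) * t + nu N * s + nu N * (\<beta> N (c z) * t + r))
     = of_nat N * \<alpha> N (c z) * t + (of_nat N * nu N) * s + (of_nat N * nu N) * (\<beta> N (c z) * t + r)"
    by (simp add: algebra_simps)
   then show ?thesis unfolding Nnu by (simp add: algebra_simps)
  qed
  note key = this
  show ?thesis unfolding S T' key[symmetric, of "?T z"] by (simp only: power_Suc mult_ac)
 qed
 finally show ?case .
qed

section \<open>The symbol of the limiting operator and its coefficients\<close>

lemma poly_coeffs_unique:
 fixes p :: "complex poly"
 assumes "!!z. (\<Sum>r<R. z ^ r * c r) = poly p z"
 shows "coeff p r = (if r < R then c r else 0)"
proof -
 have "poly (\<Sum>r<R. monom (c r) r) z = poly p z" for z
  using assms[of z] by (simp add: poly_sum poly_monom mult.commute)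
 then have "poly p = poly (\<Sum>r<R. monom (c r) r)" by auto
 then have "p = (\<Sum>r<R. monom (c r) r)" by (simp only: poly_eq_poly_eq_iff)
 then show ?thesis by (simp add: coeff_sum if_distrib sum.delta cong: if_cong)
qed

text \<open>For nonzero a this is z^k a^k (1/z + 1 + (1 + z) F(z) / a)^k, the bracket of the
  covariance formula freed of its pole. Its coefficient k - 1 - n belongs to z^(-1-n) in the bracket
  power, its coefficient k + s to z^s.\<close>

definition symbol_poly :: "nat => complex => complex poly => complex poly" where
 "symbol_poly k a F = ([:1, 1:] * ([:a:] + [:0, 1:] * F)) ^ k"

lemma symbol_poly_expand:
 "symbol_poly k a F = (\<Sum>i\<le>k. smult (of_nat (k choose i) * a ^ i) (monom 1 (k - i) * ([:1, 1:] ^ k * F ^ (k - i))))"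
proof -
 have "([:a:] + [:0, 1:] * F) ^ k = (\<Sum>i\<le>k. of_nat (k choose i) * [:a:] ^ i * ([:0, 1:] * F) ^ (k - i))"
  by (rule binomial_ring)
 also have "... = (\<Sum>i\<le>k. smult (of_nat (k choose i) * a ^ i) (monom 1 (k - i) * F ^ (k - i)))"
 proof (intro sum.cong refl)
  fix i
  have "[:0, 1:] ^ n = (monom 1 n :: complex poly)" for n
   by (induction n) (auto simp: monom_altdef)
  moreover have "[:a:] ^ i = [:a ^ i:]" by (simp add: poly_const_pow)
  ultimately show "of_nat (k choose i) * [:a:] ^ i * ([:0, 1:] * F) ^ (k - i) =
    smult (of_nat (k choose i) * a ^ i) (monom 1 (k - i) * F ^ (k - i))"
   by (simp only: power_mult_distrib of_nat_poly) (simp add: mult.commute)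
 qed
 finally show ?thesis
  unfolding symbol_poly_def power_mult_distrib by (simp add: sum_distrib_left mult_ac)
qed

lemma coeff_symbol_poly_low:
 assumes "n < k"
 shows "coeff (symbol_poly k a F) (k - 1 - n) =
   (\<Sum>j\<in>{n..<k}. of_nat (k choose Suc j) * a ^ Suc j * coeff ([:1, 1:] ^ k * F ^ (k - Suc j)) (j - n))"
proof -
 have "coeff (symbol_poly k a F) (k - 1 - n) =
   (\<Sum>i\<le>k. of_nat (k choose i) * a ^ i * (if Suc n \<le> i then coeff ([:1, 1:] ^ k * F ^ (k - i)) (i - 1 - n) else 0))"
  unfolding symbol_poly_expand coeff_sum coeff_smult coeff_monom_mult
 proof (intro sum.cong refl arg_cong2[where f = "(*)"])
  fix i assume "i \<in> {..k}"
  then have "k - i \<le> k - 1 - n \<longleftrightarrow> Suc n \<le> i" "Suc n \<le> i ==> k - 1 - n - (k - i) = i - 1 - n" using assms by auto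
  then show "(if k - 1 - n < k - i then 0 else 1 * coeff ([:1, 1:] ^ k * F ^ (k - i)) (k - 1 - n - (k - i))) =
    (if Suc n \<le> i then coeff ([:1, 1:] ^ k * F ^ (k - i)) (i - 1 - n) else 0)" by auto
 qed
 also have "... = (\<Sum>i\<in>{Suc n..k}. of_nat (k choose i) * a ^ i * coeff ([:1, 1:] ^ k * F ^ (k - i)) (i - 1 - n))"
  by (rule sum.mono_neutral_cong_right) auto
 also have "... = (\<Sum>j\<in>{n..<k}. of_nat (k choose Suc j) * a ^ Suc j * coeff ([:1, 1:] ^ k * F ^ (k - Suc j)) (j - n))"
  by (rule sum.reindex_bij_witness[of _ Suc "%i. i - 1"]) auto
 finally show ?thesis .
qed

lemma coeff_symbol_poly_high:
 "coeff (symbol_poly k a F) (k + s) = (\<Sum>j\<le>k. of_nat (k choose j) * a ^ j * coeff ([:1, 1:] ^ k * F ^ (k - j)) (j + s))"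
 unfolding symbol_poly_expand coeff_sum coeff_smult coeff_monom_mult
 by (intro sum.cong refl arg_cong2[where f = "(*)"]) (auto simp: add.commute)

text \<open>Pairs the negative powers of the symbol with B, as a residue does. The identity k
  binomial(k-1, j) / (j+1) = binomial(k, j+1) turns the constants of \<open>hsum_expansion\<close>
  into binomial coefficients of the symbol.\<close>

lemma symbol_poly_residue:
 assumes "k \<ge> 1"
 shows "(\<Sum>j\<le>k. coeff (smult (of_nat (k * ((k - 1) choose j))) ([:1, 1:] ^ k * F ^ (k - 1 - j)) * B) j * (a ^ (j + 1) / of_nat (j + 1)))
   = (\<Sum>n<k. coeff (symbol_poly k a F) (k - 1 - n) * coeff B n)"
proof -
 let ?q = "%j. [:1, 1:] ^ k * F ^ (k - 1 - j)"
 obtain k' where k': "k = Suc k'" using assms by (cases k) auto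
 have w: "of_nat (k * ((k - 1) choose j)) / of_nat (j + 1) = (of_nat (k choose Suc j) :: complex)" for j
 proof -
  have "k * ((k - 1) choose j) = (k choose Suc j) * (j + 1)"
   using Suc_times_binomial_eq[of k' j] k' by simp
  then have "(of_nat (k * ((k - 1) choose j)) :: complex) = of_nat (k choose Suc j) * of_nat (j + 1)"
   by (simp only: of_nat_mult)
  moreover have "of_nat (j + 1) ~= (0::complex)" unfolding of_nat_eq_0_iff by simp
  ultimately show ?thesis using nonzero_mult_div_cancel_right by metis
 qed
 have "(\<Sum>j\<le>k. coeff (smult (of_nat (k * ((k - 1) choose j))) (?q j) * B) j * (a ^ (j + 1) / of_nat (j + 1)))
   = (\<Sum>j\<le>k. of_nat (k choose Suc j) * a ^ Suc j * coeff (B * ?q j) j)"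
 proof (intro sum.cong refl)
  fix j
  have "coeff (smult (of_nat (k * ((k - 1) choose j))) (?q j) * B) j * (a ^ (j + 1) / of_nat (j + 1))
   = (of_nat (k * ((k - 1) choose j)) / of_nat (j + 1)) * a ^ Suc j * coeff (B * ?q j) j"
   by (simp add: mult_ac)
  then show "coeff (smult (of_nat (k * ((k - 1) choose j))) (?q j) * B) j * (a ^ (j + 1) / of_nat (j + 1))
   = of_nat (k choose Suc j) * a ^ Suc j * coeff (B * ?q j) j" unfolding w .
 qed
 also have "... = (\<Sum>j<k. of_nat (k choose Suc j) * a ^ Suc j * coeff (B * ?q j) j)"
  by (rule sum.mono_neutral_right) auto
 also have "... = (\<Sum>j<k. \<Sum>n\<le>j. of_nat (k choose Suc j) * a ^ Suc j * (coeff B n * coeff (?q j) (j - n)))"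
  unfolding coeff_mult[of B] sum_distrib_left ..
 also have "... = (\<Sum>j<k. \<Sum>n<k. if n \<le> j then of_nat (k choose Suc j) * a ^ Suc j * (coeff B n * coeff (?q j) (j - n)) else 0)"
  by (intro sum.cong refl sum.mono_neutral_cong_left) auto
 also have "... = (\<Sum>n<k. \<Sum>j<k. if n \<le> j then of_nat (k choose Suc j) * a ^ Suc j * (coeff B n * coeff (?q j) (j - n)) else 0)"
  by (rule sum.swap)
 also have "... = (\<Sum>n<k. \<Sum>j\<in>{n..<k}. of_nat (k choose Suc j) * a ^ Suc j * (coeff B n * coeff (?q j) (j - n)))"
  by (intro sum.cong refl sum.mono_neutral_cong_right) auto
 also have "... = (\<Sum>n<k. coeff (symbol_poly k a F) (k - 1 - n) * coeff B n)"
 proof (intro sum.cong refl)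
  fix n assume "n \<in> {..<k}"
  then have "n < k" by simp
  note * = coeff_symbol_poly_low[OF this, of a F]
  show "(\<Sum>j\<in>{n..<k}. of_nat (k choose Suc j) * a ^ Suc j * (coeff B n * coeff (?q j) (j - n)))
    = coeff (symbol_poly k a F) (k - 1 - n) * coeff B n"
   unfolding * sum_distrib_right by (intro sum.cong refl) (simp add: mult_ac)
 qed
 finally show ?thesis .
qed

text \<open>The 0 in slot 0 is a placeholder, overwritten by the moving variable; the number of
  variables is recorded by M.\<close>

definition psum :: "nat => point => nat => complex" where
 "psum M y r = (if r = 0 then 0 else \<Sum>b<M. y b ^ r)"

text \<open>After conjugation by exp q the limiting operator multiplies by v_s with the weight of
  z^s in the symbol and applies (n+1) d/dv_(n+1) with the weight of z^(-1-n).
  \<open>multiplier\<close> contains the multiplications and the derivatives falling on q,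
  \<open>derivation\<close> those falling on the remaining factor.\<close>

definition multiplier :: "nat => complex poly => (point => complex) => point => complex" where
 "multiplier k T q v = (\<Sum>s\<in>{1..degree T}. coeff T (k + s) * v s)
   + (\<Sum>n<k. coeff T (k - 1 - n) * (of_nat (n + 1) * pderiv_at (n + 1) q v))"

definition derivation :: "nat => complex poly => (point => complex) => point => complex" where
 "derivation k T \<phi> v = (\<Sum>n<k. coeff T (k - 1 - n) * (of_nat (n + 1) * pderiv_at (n + 1) \<phi> v))"

definition linear_part :: "nat => (nat => nat => complex) => nat => point => complex" where
 "linear_part d lam N v = (\<Sum>r\<in>{1..d}. lam r N * v r)"

text \<open>With C r = c_r / r! this is F_rho(1 + z), cut off after degree d - 1.\<close>

definition limit_symbol :: "nat => point => complex poly" where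
 "limit_symbol d C = (\<Sum>r\<in>{1..d}. monom (of_nat r * C r) (r - 1))"

lemma indep0_pderiv: "indep0 f ==> indep0 (pderiv_at i f)"
 unfolding indep0_def using pderiv_at_keeps_indep[of f 0 i] by blast

lemma indep0D: "indep0 f ==> f (v(0 := t)) = f v"
 by (simp add: indep0_def)

lemma zdec_obtain:
 assumes "cv D f g"
 obtains R \<phi> \<phi>' where "zexp D R \<phi> \<phi>'" "!!N v R'. R \<le> R' ==> f N v = (\<Sum>r<R'. v 0 ^ r * \<phi> r N v)"
  "!!v R'. R \<le> R' ==> g v = (\<Sum>r<R'. v 0 ^ r * \<phi>' r v)"
proof -
 from cv_zdec[OF assms] obtain R \<phi> \<phi>' where *: "zexp D R \<phi> \<phi>'" "!!N v. f N v = (\<Sum>r<R. v 0 ^ r * \<phi> r N v)"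
  "!!v. g v = (\<Sum>r<R. v 0 ^ r * \<phi>' r v)" unfolding zdec_def by blast
 show ?thesis
 proof (rule that[OF *(1)])
  show "f N v = (\<Sum>r<R'. v 0 ^ r * \<phi> r N v)" if "R \<le> R'" for N v R'
   unfolding *(2) by (rule zexp_sum_extend(1)[OF *(1) that, symmetric])
  show "g v = (\<Sum>r<R'. v 0 ^ r * \<phi>' r v)" if "R \<le> R'" for v R'
   unfolding *(3) by (rule zexp_sum_extend(2)[OF *(1) that, symmetric])
 qed
qed

lemma Dop_in_power_sums:
 assumes \<alpha>: "cv 1 (%N v. \<Sum>r\<in>{1..d}. of_nat r * v 0 ^ (r - 1) * lam r N) \<alpha>'"
  and qd: "cv D qd qdl" "!!N. indep0 (qd N)" and \<phi>: "cv D \<phi> \<phi>'" "!!N. indep0 (\<phi> N)" and dD: "d < D"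
  and N: "N > 0" and y: "distinct_coords M y"
 shows "Dop k M (%y. exp (of_nat N * linear_part d lam N (psum M y) + qd N (psum M y)) * \<phi> N (psum M y)) y =
   of_nat N ^ k * exp (of_nat N * linear_part d lam N (psum M y) + qd N (psum M y)) *
   (\<Sum>j\<le>k. nu N ^ j * (\<Sum>i<M. nodeweight M y j i *
    ucoef D (%N v. \<Sum>r\<in>{1..d}. of_nat r * v 0 ^ (r - 1) * lam r N)
     (%N v. \<Sum>r\<in>{1..<D}. of_nat r * v 0 ^ (r - 1) * pderiv_at r (qd N) v) \<phi> k j N ((psum M y)(0 := y i))))"
proof -
 let ?\<alpha> = "%N v. \<Sum>r\<in>{1..d}. of_nat r * v 0 ^ (r - 1) * lam r N"
 let ?\<beta> = "%N v. \<Sum>r\<in>{1..<D}. of_nat r * v 0 ^ (r - 1) * pderiv_at r (qd N) v"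
 let ?f = "%v. of_nat N * linear_part d lam N v + qd N v"
 have D: "0 < D" using dD by simp
 have aD: "cv D ?\<alpha> \<alpha>'" by (rule cv_mono[OF \<alpha>]) (use D in simp)
 have bD: "cv D ?\<beta> (%v. \<Sum>r\<in>{1..<D}. of_nat r * v 0 ^ (r - 1) * pderiv_at r qdl v)"
  by (intro cv_sum cv_mult cv_scalar cv_power cv_var cv_pderiv[OF qd(1)] D)
 have "(theta ^^ k) (%z. nodeprod M y i z * (exp (?f (psum M (y(i := z)))) * \<phi> N (psum M (y(i := z))))) (y i) =
   of_nat N ^ k * exp (?f (psum M y)) * (\<Sum>j\<le>k. nu N ^ j * poly ((pderiv ^^ j) (nodepoly M y i)) (y i) *
    ucoef D ?\<alpha> ?\<beta> \<phi> k j N ((psum M y)(0 := y i)))" if i: "i < M" for i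
 proof -
  \<comment> \<open>The curve traced by the power sums when y_i is replaced by z, with z itself in
    slot 0. Neither the exponent nor \<phi> notices the change of slot 0.\<close>
  define c where "c = (%z. (psum M (y(i := z)))(0 := z))"
  have c0: "c z 0 = z" for z by (simp add: c_def)
  have cd: "((%z. c z r) has_field_derivative of_nat r * z ^ (r - 1)) (at z)" if "1 \<le> r" for z r
  proof -
   have "c z r = (\<Sum>b\<in>{..<M} - {i}. y b ^ r) + z ^ r" for z
   proof -
    have "c z r = (\<Sum>b<M. (y(i := z)) b ^ r)" using that by (simp add: c_def psum_def)
    also have "... = (y(i := z)) i ^ r + (\<Sum>b\<in>{..<M} - {i}. (y(i := z)) b ^ r)"
     by (rule sum.remove) (use i in auto)
    also have "(\<Sum>b\<in>{..<M} - {i}. (y(i := z)) b ^ r) = (\<Sum>b\<in>{..<M} - {i}. y b ^ r)"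
     by (intro sum.cong) auto
    finally show ?thesis by simp
   qed
   then show ?thesis by (auto intro!: derivative_eq_intros)
  qed
  have fc: "?f (psum M (y(i := z))) = ?f (c z)" "\<phi> N (psum M (y(i := z))) = \<phi> N (c z)" for z
   using indep0D[OF qd(2)] indep0D[OF \<phi>(2)] by (auto simp: c_def linear_part_def)
  define E where "E = (%z. exp (?f (c z)))"
  have dE: "(E has_field_derivative E z * (of_nat N * ?\<alpha> N (c z) + ?\<beta> N (c z))) (at z)" for z
  proof -
   have "((%z. linear_part d lam N (c z)) has_field_derivative ?\<alpha> N (c z)) (at z)"
    unfolding linear_part_def c0
    by (auto intro!: derivative_eq_intros cd sum.cong simp: mult_ac)
   moreover have "((%z. qd N (c z)) has_field_derivative ?\<beta> N (c z)) (at z)"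
   proof -
    have "((%z. qd N (c z)) has_field_derivative
      (\<Sum>r<D. pderiv_at r (qd N) (c z) * (if r = 0 then 1 else of_nat r * z ^ (r - 1)))) (at z)"
     by (rule cv_chain[OF qd(1)]) (use cd c0 in auto)
    also have "(\<Sum>r<D. pderiv_at r (qd N) (c z) * (if r = 0 then 1 else of_nat r * z ^ (r - 1))) = ?\<beta> N (c z)"
    proof -
     have "{..<D} = insert 0 {1..<D}" using D by auto
     moreover have "pderiv_at 0 (qd N) = (%v. 0)"
      by (rule pderiv_at_indep) (rule indep0D[OF qd(2)])
     ultimately show ?thesis by (simp add: c0 mult_ac)
    qed
    finally show ?thesis .
   qed
   ultimately have "((%z. ?f (c z)) has_field_derivative of_nat N * ?\<alpha> N (c z) + ?\<beta> N (c z)) (at z)"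
    by (intro DERIV_add DERIV_cmult)
   from DERIV_fun_exp[OF this] show ?thesis unfolding E_def .
  qed
  have np: "nodeprod M y i z = poly (nodepoly M y i) z" for z
   by (simp add: nodeprod_def nodepoly_def poly_prod)
  have "(theta ^^ k) (%z. poly (nodepoly M y i) z * (E z * \<phi> N (c z))) (y i) =
    of_nat N ^ k * E (y i) * (\<Sum>j\<le>k. nu N ^ j * poly ((pderiv ^^ j) (nodepoly M y i)) (y i) * ucoef D ?\<alpha> ?\<beta> \<phi> k j N (c (y i)))"
   by (rule theta_pow_ucoef[OF aD bD \<phi>(1) D N c0 cd dE])
  moreover have "c (y i) = (psum M y)(0 := y i)" by (simp add: c_def)
  moreover have "E (y i) = exp (?f (psum M y))" using fc(1)[of "y i"] by (simp add: E_def)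
  ultimately show ?thesis unfolding np fc E_def by simp
 qed
 then have "Dop k M (%y. exp (?f (psum M y)) * \<phi> N (psum M y)) y =
   (\<Sum>i<M. of_nat N ^ k * exp (?f (psum M y)) * (\<Sum>j\<le>k. nu N ^ j * poly ((pderiv ^^ j) (nodepoly M y i)) (y i) *
    ucoef D ?\<alpha> ?\<beta> \<phi> k j N ((psum M y)(0 := y i))) / nodeprod M y i (y i))"
  unfolding Dop_def by (intro sum.cong) auto
 also have "... = of_nat N ^ k * exp (?f (psum M y)) * (\<Sum>i<M. \<Sum>j\<le>k. nu N ^ j * (nodeweight M y j i * ucoef D ?\<alpha> ?\<beta> \<phi> k j N ((psum M y)(0 := y i))))"
  by (simp add: sum_distrib_left sum_divide_distrib nodeweight_def nodeprod_def nodepoly_def poly_prod mult_ac)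
 also have "(\<Sum>i<M. \<Sum>j\<le>k. nu N ^ j * (nodeweight M y j i * ucoef D ?\<alpha> ?\<beta> \<phi> k j N ((psum M y)(0 := y i)))) =
   (\<Sum>j\<le>k. nu N ^ j * (\<Sum>i<M. nodeweight M y j i * ucoef D ?\<alpha> ?\<beta> \<phi> k j N ((psum M y)(0 := y i))))"
  unfolding sum_distrib_left by (rule sum.swap)
 finally show ?thesis .
qed

lemma indep0_multiplier: "indep0 q ==> indep0 (multiplier k T q)"
 using indep0_pderiv[of q] by (auto simp: indep0_def multiplier_def)

lemma indep0_derivation: "indep0 \<phi> ==> indep0 (derivation k T \<phi>)"
 using indep0_pderiv[of \<phi>] by (auto simp: indep0_def derivation_def)

text \<open>The coefficients V' with r = j meet the constants of \<open>hsum_expansion\<close> and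
  give the derivatives of q and \<phi> through \<open>symbol_poly_residue\<close>. The coefficients
  A' with r > j meet its linear part and give the power sums, weighted by the symbol in degree k +
  s.\<close>

lemma op_step_limit:
 fixes a :: complex and F :: "complex poly" and A' :: "nat => nat => complex" and V' :: "nat => nat => point => complex"
 assumes k: "k \<ge> 1" and Tt: "k < Tt" "k < D"
  and A': "!!j z. j \<le> k ==> (\<Sum>r<Tt. z ^ r * A' j r) = of_nat (k choose j) * (1 + z) ^ k * poly F z ^ (k - j)"
  and V': "!!j z. j \<le> k ==> (\<Sum>r<Tt. z ^ r * V' j r v) = of_nat (k * ((k - 1) choose j)) * (1 + z) ^ k * poly F z ^ (k - 1 - j)
     * ((\<Sum>r\<in>{1..<D}. of_nat r * z ^ (r - 1) * pderiv_at r q v) * \<phi> v + (\<Sum>r\<in>{1..<D}. of_nat r * z ^ (r - 1) * pderiv_at r \<phi> v))"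
 defines "T \<equiv> symbol_poly k a F"
 shows "(\<Sum>j\<le>k. \<Sum>r<Tt. V' j r v * (if r = j then a ^ (j + 1) / of_nat (j + 1) else 0)
    + A' j r * (if j < r then a ^ j * v (r - j) else 0) * \<phi> v)
   = multiplier k T q v * \<phi> v + derivation k T \<phi> v"
proof -
 define B where "B = (\<Sum>r\<in>{1..<D}. monom (of_nat r * (pderiv_at r q v * \<phi> v + pderiv_at r \<phi> v)) (r - 1))"
 have coeffB: "coeff B n = of_nat (n + 1) * (pderiv_at (n + 1) q v * \<phi> v + pderiv_at (n + 1) \<phi> v)" if "n < k" for n
 proof -
  have "coeff B n = (\<Sum>r\<in>{1..<D}. if r = n + 1 then of_nat r * (pderiv_at r q v * \<phi> v + pderiv_at r \<phi> v) else 0)"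
   unfolding B_def coeff_sum coeff_monom by (intro sum.cong) auto
  then show ?thesis using that Tt by (simp add: sum.delta)
 qed
 let ?q = "%j. smult (of_nat (k * ((k - 1) choose j))) ([:1, 1:] ^ k * F ^ (k - 1 - j))"
 have Vc: "V' j j v = coeff (?q j * B) j" if "j \<le> k" for j
 proof -
  have "(\<Sum>r<Tt. z ^ r * V' j r v) = poly (?q j * B) z" for z
   unfolding V'[OF that]
   by (simp add: B_def poly_sum poly_monom poly_power sum.distrib sum_distrib_right sum_distrib_left algebra_simps)
  from poly_coeffs_unique[OF this, of j] show ?thesis using that Tt by simp
 qed
 let ?P = "%j. smult (of_nat (k choose j)) ([:1, 1:] ^ k * F ^ (k - j))"
 have Ac: "coeff (?P j) r = (if r < Tt then A' j r else 0)" if "j \<le> k" for j r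
 proof (rule poly_coeffs_unique[where c = "A' j" and R = Tt and p = "?P j"])
  show "(\<Sum>r<Tt. z ^ r * A' j r) = poly (?P j) z" for z
   unfolding A'[OF that] by (simp add: poly_power mult_ac)
 qed
 have "(\<Sum>j\<le>k. \<Sum>r<Tt. V' j r v * (if r = j then a ^ (j + 1) / of_nat (j + 1) else 0))
   = (\<Sum>j\<le>k. coeff (?q j * B) j * (a ^ (j + 1) / of_nat (j + 1)))"
 proof (intro sum.cong refl)
  fix j assume "j \<in> {..k}"
  then have j: "j \<le> k" by simp
  have "(\<Sum>r<Tt. V' j r v * (if r = j then a ^ (j + 1) / of_nat (j + 1) else 0))
    = (\<Sum>r<Tt. if r = j then V' j j v * (a ^ (j + 1) / of_nat (j + 1)) else 0)"
   by (intro sum.cong) auto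
  then show "(\<Sum>r<Tt. V' j r v * (if r = j then a ^ (j + 1) / of_nat (j + 1) else 0)) = coeff (?q j * B) j * (a ^ (j + 1) / of_nat (j + 1))"
   using j Tt Vc[OF j] by (simp add: sum.delta)
 qed
 also have "... = (\<Sum>n<k. coeff T (k - 1 - n) * coeff B n)"
  unfolding T_def by (rule symbol_poly_residue[OF k])
 also have "... = (\<Sum>n<k. coeff T (k - 1 - n) * (of_nat (n + 1) * pderiv_at (n + 1) q v)) * \<phi> v + derivation k T \<phi> v"
  unfolding derivation_def sum_distrib_right sum.distrib[symmetric]
  by (intro sum.cong refl) (simp add: coeffB algebra_simps)
 finally have 1: "(\<Sum>j\<le>k. \<Sum>r<Tt. V' j r v * (if r = j then a ^ (j + 1) / of_nat (j + 1) else 0)) =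
   (\<Sum>n<k. coeff T (k - 1 - n) * (of_nat (n + 1) * pderiv_at (n + 1) q v)) * \<phi> v + derivation k T \<phi> v" .
 define M where "M = max Tt (degree T)"
 have "(\<Sum>j\<le>k. \<Sum>r<Tt. A' j r * (if j < r then a ^ j * v (r - j) else 0))
   = (\<Sum>j\<le>k. \<Sum>s\<in>{1..M}. of_nat (k choose j) * a ^ j * coeff ([:1, 1:] ^ k * F ^ (k - j)) (j + s) * v s)"
 proof (rule sum.cong[OF refl])
  fix j assume "j \<in> {..k}"
  then have j: "j \<le> k" by simp
  have "(\<Sum>r<Tt. A' j r * (if j < r then a ^ j * v (r - j) else 0)) = (\<Sum>r<Tt. if j < r then coeff (?P j) r * a ^ j * v (r - j) else 0)"
   by (intro sum.cong refl) (simp add: Ac[OF j] del: coeff_smult)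
  also have "... = (\<Sum>r\<in>{j<..<M + j + 1}. coeff (?P j) r * a ^ j * v (r - j))"
   by (rule sum.mono_neutral_cong[where h = "%r. coeff (?P j) r * a ^ j * v (r - j)"])
     (auto simp: Ac[OF j] M_def simp del: coeff_smult)
  also have "... = (\<Sum>s\<in>{1..M}. coeff (?P j) (j + s) * a ^ j * v s)"
   by (rule sum.reindex_bij_witness[of _ "%s. j + s" "%r. r - j"]) auto
  finally show "(\<Sum>r<Tt. A' j r * (if j < r then a ^ j * v (r - j) else 0)) =
    (\<Sum>s\<in>{1..M}. of_nat (k choose j) * a ^ j * coeff ([:1, 1:] ^ k * F ^ (k - j)) (j + s) * v s)"
   by (simp add: mult_ac)
 qed
 also have "... = (\<Sum>s\<in>{1..M}. coeff T (k + s) * v s)"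
  unfolding T_def coeff_symbol_poly_high sum_distrib_right by (rule sum.swap)
 also have "... = (\<Sum>s\<in>{1..degree T}. coeff T (k + s) * v s)"
  by (rule sum.mono_neutral_right) (auto simp: M_def coeff_eq_0)
 finally have 2: "(\<Sum>j\<le>k. \<Sum>r<Tt. A' j r * (if j < r then a ^ j * v (r - j) else 0)) = (\<Sum>s\<in>{1..degree T}. coeff T (k + s) * v s)" .
 show ?thesis
  unfolding sum.distrib sum_distrib_right[symmetric] 1 2 multiplier_def by (simp add: algebra_simps)
qed

text \<open>\<mu> is quantified before \<phi>: the part of size N comes from \<open>acoef\<close>
  and the constants of \<open>hsum_expansion\<close> alone, so it multiplies every \<phi> by the
  same scalars. This is what allows centering to remove it.\<close>

lemma op_step:
 fixes a :: complex and C :: "nat => complex" and d k :: nat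
 assumes m_lim: "(%N. of_nat (m N) / of_nat N) \<longlonglongrightarrow> a" and lam: "!!r. lam r \<longlonglongrightarrow> C r"
  and qd: "cv D0 qd qdl" "!!N. indep0 (qd N)" "indep0 qdl" and k: "k \<ge> 1"
 defines "T \<equiv> symbol_poly k a (limit_symbol d C)"
 shows "\<exists>\<mu>. \<forall>\<phi> \<phi>' D1. cv D1 \<phi> \<phi>' --> (\<forall>N. indep0 (\<phi> N)) --> indep0 \<phi>' -->
   (\<exists>D \<psi>. cv D \<psi> (%v. multiplier k T qdl v * \<phi>' v + derivation k T \<phi>' v) & (\<forall>N. indep0 (\<psi> N)) &
   (\<forall>N y. N > 0 --> distinct_coords (m N) y -->
    Dop k (m N) (%y. exp (of_nat N * linear_part d lam N (psum (m N) y) + qd N (psum (m N) y)) * \<phi> N (psum (m N) y)) y =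
    of_nat N ^ k * exp (of_nat N * linear_part d lam N (psum (m N) y) + qd N (psum (m N) y)) *
    (\<psi> N (psum (m N) y) + \<mu> N * \<phi> N (psum (m N) y))))"
proof -
 define F where "F = limit_symbol d C"
 let ?\<alpha> = "%N v. \<Sum>r\<in>{1..d}. of_nat r * v 0 ^ (r - 1) * lam r N"
 have "cv 1 ?\<alpha> (%v. \<Sum>r\<in>{1..d}. of_nat r * v 0 ^ (r - 1) * C r)"
  by (intro cv_sum cv_mult cv_scalar cv_power cv_var cv_const[OF lam]) simp
 then have \<alpha>: "cv 1 ?\<alpha> (%v. poly F (v 0))"
  by (rule cv_cong) (auto simp: F_def limit_symbol_def poly_sum poly_monom mult_ac)
 let ?Q = "%j (p :: nat \<times> (nat => nat => complex) \<times> point).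
   (\<forall>r. fst (snd p) r \<longlonglongrightarrow> snd (snd p) r) &
   (\<forall>N v R'. fst p \<le> R' --> acoef ?\<alpha> k j N v = (\<Sum>r<R'. v 0 ^ r * fst (snd p) r N)) &
   (\<forall>z R'. fst p \<le> R' --> of_nat (k choose j) * (1 + z) ^ k * poly F z ^ (k - j) = (\<Sum>r<R'. z ^ r * snd (snd p) r)) &
   (\<forall>r\<ge>fst p. fst (snd p) r = (%N. 0))"
 have "\<forall>j. \<exists>p. ?Q j p"
 proof
  fix j
  obtain R \<phi> \<phi>' where z: "zexp 1 R \<phi> \<phi>'" "!!N v R'. R \<le> R' ==> acoef ?\<alpha> k j N v = (\<Sum>r<R'. v 0 ^ r * \<phi> r N v)"
   "!!v R'. R \<le> R' ==> of_nat (k choose j) * (1 + v 0) ^ k * poly F (v 0) ^ (k - j) = (\<Sum>r<R'. v 0 ^ r * \<phi>' r v)"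
   by (rule zdec_obtain[OF cv_acoef[OF \<alpha>, of k j]]) blast
  have cvr: "cv 1 (\<phi> r) (\<phi>' r)" "indep0 (\<phi> r N)" "indep0 (\<phi>' r)" for r N using z(1) by (auto simp: zexp_def)
  have loc: "\<phi> r N v = \<phi> r N (%_. 0) & \<phi>' r v = \<phi>' r (%_. 0)" for r N v
   using cv_local[OF cvr(1), of v "(%_. 0)(0 := v 0)" r N] indep0D[OF cvr(2), of r N "%_. 0" "v 0"]
    indep0D[OF cvr(3), of r "%_. 0" "v 0"] by simp
  show "\<exists>p. ?Q j p"
  proof (rule exI[of _ "(R, (%r N. \<phi> r N (%_. 0)), (%r. \<phi>' r (%_. 0)))"], simp only: fst_conv snd_conv, intro conjI allI impI)
   show "(%N. \<phi> r N (%_. 0)) \<longlonglongrightarrow> \<phi>' r (%_. 0)" for r by (rule cv_tendsto[OF cvr(1)])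
   show "acoef ?\<alpha> k j N v = (\<Sum>r<R'. v 0 ^ r * \<phi> r N (%_. 0))" if "R \<le> R'" for N v R'
    unfolding z(2)[OF that] by (intro sum.cong refl arg_cong2[where f = "(*)"]) (use loc in blast)
   show "of_nat (k choose j) * (1 + x) ^ k * poly F x ^ (k - j) = (\<Sum>r<R'. x ^ r * \<phi>' r (%_. 0))" if "R \<le> R'" for x R'
    using z(3)[OF that, of "%_. x"] loc[of _ undefined "%_. x"] by simp
   show "(%N. \<phi> r N (%_. 0)) = (%N. 0)" if "R \<le> r" for r
    using z(1) that by (simp add: zexp_def)
  qed
 qed
 from choice[OF this] obtain p where p: "\<forall>j. ?Q j (p j)" ..
 define R where "R = (%j. fst (p j))"
 define A where "A = (%j. fst (snd (p j)))"
 define A' where "A' = (%j. snd (snd (p j)))"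
 have A: "A j r \<longlonglongrightarrow> A' j r" for j r using p unfolding A_def A'_def by blast
 have acA: "acoef ?\<alpha> k j N v = (\<Sum>r<R'. v 0 ^ r * A j r N)" if "R j \<le> R'" for j N v R'
  using p that unfolding A_def R_def by blast
 have A'eq: "of_nat (k choose j) * (1 + z) ^ k * poly F z ^ (k - j) = (\<Sum>r<R'. z ^ r * A' j r)" if "R j \<le> R'" for j z R'
  using p that unfolding A'_def R_def by blast
 have A0: "A j r N = 0" if "R j \<le> r" for j r N
  using p that unfolding A_def R_def by simp
 let ?g' = "%j r. if r = j then a ^ (j + 1) / of_nat (j + 1) else 0"
 let ?l' = "%j r v. if j < r then a ^ j * v (r - j) else 0"
 have "\<forall>jr. \<exists>q :: point \<times> (nat => point => complex). fst q \<longlonglongrightarrow> ?g' (fst jr) (snd jr) &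
   cv (Suc (snd jr)) (snd q) (?l' (fst jr) (snd jr)) & (\<forall>N. indep0 (snd q N)) &
   (\<forall>N v. hsum m (fst jr) (snd jr) N v = fst q N + snd q N v / of_nat N)"
 proof
  fix jr :: "nat \<times> nat"
  obtain g l where "g \<longlonglongrightarrow> ?g' (fst jr) (snd jr)" "cv (Suc (snd jr)) l (?l' (fst jr) (snd jr))" "\<forall>N. indep0 (l N)"
    "\<forall>N v. hsum m (fst jr) (snd jr) N v = g N + l N v / of_nat N"
   using hsum_expansion[OF m_lim, of "snd jr" "fst jr"] by blast
  then show "\<exists>q :: point \<times> (nat => point => complex). fst q \<longlonglongrightarrow> ?g' (fst jr) (snd jr) &
   cv (Suc (snd jr)) (snd q) (?l' (fst jr) (snd jr)) & (\<forall>N. indep0 (snd q N)) &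
   (\<forall>N v. hsum m (fst jr) (snd jr) N v = fst q N + snd q N v / of_nat N)"
   by (intro exI[of _ "(g, l)"]) simp
 qed
 from choice[OF this] obtain q where q: "\<forall>jr. fst (q jr) \<longlonglongrightarrow> ?g' (fst jr) (snd jr) &
   cv (Suc (snd jr)) (snd (q jr)) (?l' (fst jr) (snd jr)) & (\<forall>N. indep0 (snd (q jr) N)) &
   (\<forall>N v. hsum m (fst jr) (snd jr) N v = fst (q jr) N + snd (q jr) N v / of_nat N)" ..
 define g where "g = (%j r. fst (q (j, r)))"
 define l where "l = (%j r. snd (q (j, r)))"
 have g: "g j r \<longlonglongrightarrow> ?g' j r" and l: "cv (Suc r) (l j r) (?l' j r)" "indep0 (l j r N)"
  and hs: "hsum m j r N v = g j r N + l j r N v * nu N" for j r N v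
  using q[rule_format, of "(j, r)", unfolded fst_conv snd_conv] unfolding g_def l_def nu_def by auto
 define Rm where "Rm = (\<Sum>j\<le>k. R j)"
 have RRm: "R j \<le> Rm" if "j \<le> k" for j unfolding Rm_def by (rule member_le_sum) (use that in auto)
 \<comment> \<open>The cutoff Rm is fixed before \<phi> is introduced. The coefficients A vanish
   beyond it, so the larger cutoff below gives the same scalar.\<close>
 define \<mu> where "\<mu> = (%N. of_nat N * (\<Sum>j\<le>k. \<Sum>r<Rm. A j r N * g j r N))"
 show ?thesis
 proof (intro exI[of _ \<mu>] allI impI)
  fix \<phi> \<phi>' D1 assume \<phi>1: "cv D1 \<phi> \<phi>'" and \<phi>2: "\<forall>N. indep0 (\<phi> N)" and \<phi>3: "indep0 \<phi>'"
  define D where "D = D1 + D0 + d + k + 2"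
  have D: "0 < D" "d < D" "k < D" by (auto simp: D_def)
  have \<phi>: "cv D \<phi> \<phi>'" by (rule cv_mono[OF \<phi>1]) (simp add: D_def)
  have qD: "cv D qd qdl" by (rule cv_mono[OF qd(1)]) (simp add: D_def)
  let ?\<beta> = "%N v. \<Sum>r\<in>{1..<D}. of_nat r * v 0 ^ (r - 1) * pderiv_at r (qd N) v"
  let ?\<beta>' = "%v. \<Sum>r\<in>{1..<D}. of_nat r * v 0 ^ (r - 1) * pderiv_at r qdl v"
  have \<beta>: "cv D ?\<beta> ?\<beta>'"
   by (intro cv_sum cv_mult cv_scalar cv_power cv_var cv_pderiv[OF qD] D)
  let ?V = "%j. vcoef D ?\<alpha> ?\<beta> \<phi> k j"
  let ?Vl = "%j v. of_nat (k * ((k - 1) choose j)) * (1 + v 0) ^ k * poly F (v 0) ^ (k - 1 - j) * (?\<beta>' v * \<phi>' v + nab D \<phi>' v)"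
  let ?W = "%j (p :: nat \<times> (nat => nat => point => complex) \<times> (nat => point => complex)).
    zexp D (fst p) (fst (snd p)) (snd (snd p)) &
    (\<forall>N v R'. fst p \<le> R' --> ?V j N v = (\<Sum>r<R'. v 0 ^ r * fst (snd p) r N v)) &
    (\<forall>v R'. fst p \<le> R' --> ?Vl j v = (\<Sum>r<R'. v 0 ^ r * snd (snd p) r v))"
  have "\<forall>j. \<exists>p. ?W j p"
  proof
   fix j
   obtain R \<xi> \<xi>' where z: "zexp D R \<xi> \<xi>'" "!!N v R'. R \<le> R' ==> ?V j N v = (\<Sum>r<R'. v 0 ^ r * \<xi> r N v)"
    "!!v R'. R \<le> R' ==> ?Vl j v = (\<Sum>r<R'. v 0 ^ r * \<xi>' r v)"
    by (rule zdec_obtain[OF cv_vcoef[OF \<alpha> \<beta> \<phi> D(1), of k j]]) blast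
   then show "\<exists>p. ?W j p"
    by (intro exI[of _ "(R, \<xi>, \<xi>')"]) simp
  qed
  from choice[OF this] obtain s where s: "\<forall>j. ?W j (s j)" ..
  define S where "S = (%j. fst (s j))"
  define V where "V = (%j. fst (snd (s j)))"
  define V' where "V' = (%j. snd (snd (s j)))"
  have "zexp D (S j) (V j) (V' j)" for j using s unfolding S_def V_def V'_def by blast
  then have V: "cv D (V j r) (V' j r)" "indep0 (V j r N)" "indep0 (V' j r)" for j r N
   unfolding zexp_def by blast+
  have Veq: "?V j N v = (\<Sum>r<R'. v 0 ^ r * V j r N v)" if "S j \<le> R'" for j N v R'
   using s[rule_format, of j] that unfolding S_def V_def by blast
  have V'eq: "?Vl j v = (\<Sum>r<R'. v 0 ^ r * V' j r v)" if "S j \<le> R'" for j v R'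
   using s[rule_format, of j] that unfolding S_def V'_def by blast
  \<comment> \<open>A common cutoff for all expansions; k + 1 is added so that the coefficient r = j
    is present for every j <= k.\<close>
  define Tt where "Tt = Rm + (\<Sum>j\<le>k. S j) + k + 1"
  have STt: "S j \<le> Tt" if "j \<le> k" for j
  proof -
   have "S j \<le> (\<Sum>j\<le>k. S j)" by (rule member_le_sum) (use that in auto)
   then show ?thesis by (simp add: Tt_def)
  qed
  have RTt: "R j \<le> Tt" if "j \<le> k" for j using RRm[OF that] by (simp add: Tt_def)
  \<comment> \<open>Everything in N (A \<phi> + V nu) (g + l nu), with N nu = 1, except N A g
    \<phi>. The summand V l keeps a factor \<open>nu\<close> and disappears in the limit.\<close>
  define \<psi> where "\<psi> = (%N v. \<Sum>j\<le>k. \<Sum>r<Tt. V j r N v * g j r N + A j r N * l j r N v * \<phi> N v + V j r N v * l j r N v * nu N)"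
  define D' where "D' = D + Tt + 1"
  have "cv D' \<psi> (%v. \<Sum>j\<le>k. \<Sum>r<Tt. V' j r v * ?g' j r + A' j r * ?l' j r v * \<phi>' v + 0)"
   unfolding \<psi>_def
  proof (intro cv_sum)
   fix j r assume r: "r \<in> {..<Tt}"
   have vD: "cv D' (V j r) (V' j r)" and pD: "cv D' \<phi> \<phi>'"
    by (rule cv_mono[OF V(1)], simp add: D'_def) (rule cv_mono[OF \<phi>], simp add: D'_def)
   have lD: "cv D' (l j r) (?l' j r)" by (rule cv_mono[OF l(1)]) (use r in \<open>simp add: D'_def\<close>)
   show "cv D' (%N v. V j r N v * g j r N + A j r N * l j r N v * \<phi> N v + V j r N v * l j r N v * nu N)
     (%v. V' j r v * ?g' j r + A' j r * ?l' j r v * \<phi>' v + 0)"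
    by (rule cv_add[OF cv_add[OF cv_mult[OF vD cv_const[OF g]] cv_mult[OF cv_mult[OF cv_const[OF A] lD] pD]]
       cv_nu[OF cv_mult[OF vD lD]]])
  qed
  then have c1: "cv D' \<psi> (%v. multiplier k T qdl v * \<phi>' v + derivation k T \<phi>' v)"
  proof (rule cv_cong)
   fix v
   show "multiplier k T qdl v * \<phi>' v + derivation k T \<phi>' v =
     (\<Sum>j\<le>k. \<Sum>r<Tt. V' j r v * ?g' j r + A' j r * ?l' j r v * \<phi>' v + 0)"
    unfolding add_0_right T_def F_def[symmetric]
   proof (rule op_step_limit[symmetric, where D = D and V' = V' and A' = A' and q = qdl and \<phi> = \<phi>' and v = v and F = F])
    show "(\<Sum>r<Tt. z ^ r * A' j r) = of_nat (k choose j) * (1 + z) ^ k * poly F z ^ (k - j)" if "j \<le> k" for j z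
     by (rule A'eq[OF RTt[OF that], symmetric])
    show "(\<Sum>r<Tt. z ^ r * V' j r v) = of_nat (k * ((k - 1) choose j)) * (1 + z) ^ k * poly F z ^ (k - 1 - j)
     * ((\<Sum>r\<in>{1..<D}. of_nat r * z ^ (r - 1) * pderiv_at r qdl v) * \<phi>' v + (\<Sum>r\<in>{1..<D}. of_nat r * z ^ (r - 1) * pderiv_at r \<phi>' v))"
     if "j \<le> k" for j z
    proof -
     have "pderiv_at 0 \<phi>' = (%v. 0)" by (rule pderiv_at_indep) (rule indep0D[OF \<phi>3])
     then show ?thesis
      using V'eq[OF STt[OF that], of "v(0 := z)"] indep0D[OF V(3)] indep0D[OF \<phi>3]
       indep0D[OF indep0_pderiv[OF \<phi>3]] indep0D[OF indep0_pderiv[OF qd(3)]]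
      by (simp add: nab_def)
    qed
   qed (use k D in \<open>auto simp: Tt_def\<close>)
  qed simp
  have c2: "indep0 (\<psi> N)" for N
   unfolding \<psi>_def indep0_def
   using indep0D[OF V(2)] indep0D[OF l(2)] indep0D[OF \<phi>2[rule_format]] by simp
  have c3: "Dop k (m N) (%y. exp (of_nat N * linear_part d lam N (psum (m N) y) + qd N (psum (m N) y)) * \<phi> N (psum (m N) y)) y =
    of_nat N ^ k * exp (of_nat N * linear_part d lam N (psum (m N) y) + qd N (psum (m N) y)) *
    (\<psi> N (psum (m N) y) + \<mu> N * \<phi> N (psum (m N) y))"
   if N: "N > 0" and y: "distinct_coords (m N) y" for N y
  proof -
   let ?P = "psum (m N) y"
   have Nnu: "of_nat N * nu N = 1" using N by (simp add: nu_def)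
   have inj: "inj_on y {..<m N}" using y by (auto simp: distinct_coords_def inj_on_def)
   \<comment> \<open>The sum over i sees y_i through its powers only, and the weighted power sums
     are N^(j+1) times \<open>hsum\<close>; against nu^j one factor N is left.\<close>
   have inner: "nu N ^ j * (\<Sum>i<m N. nodeweight (m N) y j i * ucoef D ?\<alpha> ?\<beta> \<phi> k j N (?P(0 := y i)))
     = of_nat N * (\<Sum>r<Tt. (A j r N * \<phi> N ?P + V j r N ?P * nu N) * (g j r N + l j r N ?P * nu N))" if j: "j \<le> k" for j
   proof -
    have u: "ucoef D ?\<alpha> ?\<beta> \<phi> k j N (?P(0 := t)) = (\<Sum>r<Tt. t ^ r * (A j r N * \<phi> N ?P + V j r N ?P * nu N))" for t
     unfolding ucoef_split[OF \<alpha> \<beta> \<phi> D(1)] acA[OF RTt[OF j]] Veq[OF STt[OF j]]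
      indep0D[OF V(2)] indep0D[OF \<phi>2[rule_format]]
     by (simp add: sum_distrib_right sum_distrib_left sum.distrib[symmetric] algebra_simps)
    have "(\<Sum>i<m N. nodeweight (m N) y j i * ucoef D ?\<alpha> ?\<beta> \<phi> k j N (?P(0 := y i)))
      = (\<Sum>i<m N. \<Sum>r<Tt. (A j r N * \<phi> N ?P + V j r N ?P * nu N) * (y i ^ r * nodeweight (m N) y j i))"
     unfolding u sum_distrib_left by (simp only: mult_ac)
    also have "... = (\<Sum>r<Tt. (A j r N * \<phi> N ?P + V j r N ?P * nu N) * (\<Sum>i<m N. y i ^ r * nodeweight (m N) y j i))"
     unfolding sum_distrib_left by (rule sum.swap)
    also have "... = (\<Sum>r<Tt. (A j r N * \<phi> N ?P + V j r N ?P * nu N) * (of_nat N ^ (j + 1) * (g j r N + l j r N ?P * nu N)))"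
    proof -
     have "(\<Sum>i<m N. y i ^ r * nodeweight (m N) y j i) = of_nat N ^ (j + 1) * (g j r N + l j r N ?P * nu N)" for r
      unfolding hs[symmetric]
      by (rule hsum_eval[where y = y and m = m and N = N and v = ?P and r = r and j = j])
        (use inj N in \<open>auto simp: psum_def\<close>)
     then show ?thesis by simp
    qed
    also have "... = of_nat N ^ (j + 1) * (\<Sum>r<Tt. (A j r N * \<phi> N ?P + V j r N ?P * nu N) * (g j r N + l j r N ?P * nu N))"
     unfolding sum_distrib_left by (simp only: mult_ac)
    finally have "nu N ^ j * (\<Sum>i<m N. nodeweight (m N) y j i * ucoef D ?\<alpha> ?\<beta> \<phi> k j N (?P(0 := y i)))
      = (nu N ^ j * of_nat N ^ (j + 1)) * (\<Sum>r<Tt. (A j r N * \<phi> N ?P + V j r N ?P * nu N) * (g j r N + l j r N ?P * nu N))"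
     by (simp only: mult_ac)
    also have "nu N ^ j * of_nat N ^ (j + 1) = (of_nat N * nu N) ^ j * of_nat N"
     by (simp add: power_mult_distrib mult_ac)
    finally show ?thesis unfolding Nnu by (simp only: power_one mult_1_left)
   qed
   have "(\<Sum>j\<le>k. nu N ^ j * (\<Sum>i<m N. nodeweight (m N) y j i * ucoef D ?\<alpha> ?\<beta> \<phi> k j N (?P(0 := y i)))) =
     (\<Sum>j\<le>k. of_nat N * (\<Sum>r<Tt. (A j r N * \<phi> N ?P + V j r N ?P * nu N) * (g j r N + l j r N ?P * nu N)))"
    by (intro sum.cong refl inner) simp
   also have "... = (\<Sum>j\<le>k. \<Sum>r<Tt. V j r N ?P * g j r N + A j r N * l j r N ?P * \<phi> N ?P + V j r N ?P * l j r N ?P * nu N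
     + of_nat N * (A j r N * g j r N) * \<phi> N ?P)"
    unfolding sum_distrib_left
   proof (intro sum.cong refl)
    fix j r
    have "of_nat N * ((x * f + w * nu N) * (b + c * nu N)) = (of_nat N * nu N) * (w * b) + (of_nat N * nu N) * (x * c * f)
      + (of_nat N * nu N) * (w * c * nu N) + of_nat N * (x * b) * f" for x f w b c
     by (simp add: algebra_simps)
    then show "of_nat N * ((A j r N * \<phi> N ?P + V j r N ?P * nu N) * (g j r N + l j r N ?P * nu N)) =
      V j r N ?P * g j r N + A j r N * l j r N ?P * \<phi> N ?P + V j r N ?P * l j r N ?P * nu N
     + of_nat N * (A j r N * g j r N) * \<phi> N ?P"
     unfolding Nnu by simp
   qed
   also have "... = \<psi> N ?P + of_nat N * (\<Sum>j\<le>k. \<Sum>r<Tt. A j r N * g j r N) * \<phi> N ?P"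
    unfolding \<psi>_def sum.distrib by (simp add: sum_distrib_left sum_distrib_right)
   also have "(\<Sum>j\<le>k. \<Sum>r<Tt. A j r N * g j r N) = (\<Sum>j\<le>k. \<Sum>r<Rm. A j r N * g j r N)"
   proof (rule sum.cong[OF refl])
    fix j assume "j \<in> {..k}"
    then have "R j \<le> Rm" using RRm by simp
    then show "(\<Sum>r<Tt. A j r N * g j r N) = (\<Sum>r<Rm. A j r N * g j r N)"
     by (intro sum.mono_neutral_right) (auto simp: Tt_def intro!: A0)
   qed
   finally have "(\<Sum>j\<le>k. nu N ^ j * (\<Sum>i<m N. nodeweight (m N) y j i * ucoef D ?\<alpha> ?\<beta> \<phi> k j N (?P(0 := y i)))) =
     \<psi> N ?P + \<mu> N * \<phi> N ?P" by (simp only: \<mu>_def)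
   with Dop_in_power_sums[OF \<alpha> qD qd(2) \<phi> \<phi>2[rule_format] D(2) N y, of k] show ?thesis by (simp only:)
  qed
  show "\<exists>D \<psi>. cv D \<psi> (%v. multiplier k T qdl v * \<phi>' v + derivation k T \<phi>' v) & (\<forall>N. indep0 (\<psi> N)) &
   (\<forall>N y. N > 0 --> distinct_coords (m N) y -->
    Dop k (m N) (%y. exp (of_nat N * linear_part d lam N (psum (m N) y) + qd N (psum (m N) y)) * \<phi> N (psum (m N) y)) y =
    of_nat N ^ k * exp (of_nat N * linear_part d lam N (psum (m N) y) + qd N (psum (m N) y)) *
    (\<psi> N (psum (m N) y) + \<mu> N * \<phi> N (psum (m N) y)))"
   using c1 c2 c3 by (intro exI[of _ D'] exI[of _ \<psi>] conjI allI impI)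
 qed
qed

section \<open>Symmetric Taylor polynomials and their expression in power sums\<close>

subsection \<open>Symmetric Taylor polynomials in power sums\<close>

text \<open>The augmented monomial symmetric function: elements of J are assigned to distinct
  variables among the first m, and j contributes its variable to the power \<rho> j. The recursion
  decides which element, if any, takes the last variable.\<close>

primrec dist_sum :: "nat => nat set => (nat => nat) => point => complex" where
 "dist_sum 0 J \<rho> y = (if J = {} then 1 else 0)"
| "dist_sum (Suc m) J \<rho> y = dist_sum m J \<rho> y + (\<Sum>j\<in>J. y m ^ \<rho> j * dist_sum m (J - {j}) \<rho> y)"

lemma dist_sum_cong:
 "(!!j. j \<in> J ==> \<rho> j = \<rho>' j) ==> (!!i. i < m ==> y i = y' i) ==> dist_sum m J \<rho> y = dist_sum m J \<rho>' y'"
proof (induction m arbitrary: J)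
 case (Suc m)
 have "dist_sum m (J - {j}) \<rho> y = dist_sum m (J - {j}) \<rho>' y'" for j by (rule Suc.IH) (use Suc.prems in auto)
 moreover have "dist_sum m J \<rho> y = dist_sum m J \<rho>' y'" by (rule Suc.IH) (use Suc.prems in auto)
 ultimately show ?case using Suc.prems by simp
qed simp

lemma dist_sum_image:
 "inj_on h J ==> dist_sum m (h ` J) \<rho> y = dist_sum m J (%j. \<rho> (h j)) y"
proof (induction m arbitrary: J)
 case (Suc m)
 have "dist_sum m (h ` J - {h j}) \<rho> y = dist_sum m (J - {j}) (%j. \<rho> (h j)) y" if "j \<in> J" for j
 proof -
  have "h ` J - {h j} = h ` (J - {j})" using that Suc.prems by (auto simp: inj_on_def)
  then show ?thesis using Suc.IH[of "J - {j}"] Suc.prems by (simp add: inj_on_diff)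
 qed
 then show ?case using Suc by (simp add: sum.reindex)
qed simp

text \<open>Let j0 choose its variable freely and subtract the coincidences: if it lands on the
  variable of j, the two exponents are added at j.\<close>

lemma dist_sum_insert:
 "finite J ==> j0 \<notin> J ==> dist_sum m (insert j0 J) \<rho> y =
   (\<Sum>i<m. y i ^ \<rho> j0) * dist_sum m J \<rho> y - (\<Sum>j\<in>J. dist_sum m J (\<rho>(j := \<rho> j + \<rho> j0)) y)"
proof (induction m arbitrary: J \<rho>)
 case (Suc m)
 let ?P = "\<Sum>i<m. y i ^ \<rho> j0" and ?r = "%j. \<rho>(j := \<rho> j + \<rho> j0)" and ?t = "%j. y m ^ \<rho> j"
 have "dist_sum (Suc m) (insert j0 J) \<rho> y = dist_sum m (insert j0 J) \<rho> y + ?t j0 * dist_sum m (insert j0 J - {j0}) \<rho> y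
   + (\<Sum>j\<in>J. ?t j * dist_sum m (insert j0 J - {j}) \<rho> y)"
  using Suc.prems by simp
 also have "insert j0 J - {j0} = J" using Suc.prems by auto
 also have "dist_sum m (insert j0 J) \<rho> y = ?P * dist_sum m J \<rho> y - (\<Sum>j\<in>J. dist_sum m J (?r j) y)"
  by (rule Suc.IH) (use Suc.prems in auto)
 also have "(\<Sum>j\<in>J. ?t j * dist_sum m (insert j0 J - {j}) \<rho> y)
   = (\<Sum>j\<in>J. ?t j * (?P * dist_sum m (J - {j}) \<rho> y - (\<Sum>i\<in>J - {j}. dist_sum m (J - {j}) (?r i) y)))"
 proof (rule sum.cong[OF refl])
  fix j assume "j \<in> J"
  then have "insert j0 J - {j} = insert j0 (J - {j})" using Suc.prems by auto
  moreover have "dist_sum m (insert j0 (J - {j})) \<rho> y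
   = ?P * dist_sum m (J - {j}) \<rho> y - (\<Sum>i\<in>J - {j}. dist_sum m (J - {j}) (?r i) y)"
   by (rule Suc.IH) (use Suc.prems in auto)
  ultimately show "?t j * dist_sum m (insert j0 J - {j}) \<rho> y
   = ?t j * (?P * dist_sum m (J - {j}) \<rho> y - (\<Sum>i\<in>J - {j}. dist_sum m (J - {j}) (?r i) y))" by simp
 qed
 also have "... = ?P * (\<Sum>j\<in>J. ?t j * dist_sum m (J - {j}) \<rho> y) - (\<Sum>j\<in>J. \<Sum>i\<in>J - {j}. ?t j * dist_sum m (J - {j}) (?r i) y)"
  by (simp add: algebra_simps sum_subtractf sum_distrib_left)
 also have "(\<Sum>j\<in>J. \<Sum>i\<in>J - {j}. ?t j * dist_sum m (J - {j}) (?r i) y)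
   = (\<Sum>j\<in>J. \<Sum>i\<in>J - {j}. ?t i * dist_sum m (J - {i}) (?r j) y)"
 proof -
  have *: "(\<Sum>j\<in>J. \<Sum>i\<in>J - {j}. f j i) = (\<Sum>j\<in>J. \<Sum>i\<in>J. if i ~= j then f j i else 0)" for f :: "nat => nat => complex"
   by (intro sum.cong[OF refl] sum.mono_neutral_cong_left) (use Suc.prems in auto)
  show ?thesis unfolding * by (subst sum.swap) (auto intro!: sum.cong)
 qed
 also have "(\<Sum>j\<in>J. \<Sum>i\<in>J - {j}. ?t i * dist_sum m (J - {i}) (?r j) y)
   = (\<Sum>j\<in>J. (\<Sum>i\<in>J. y m ^ ?r j i * dist_sum m (J - {i}) (?r j) y) - ?t j0 * (?t j * dist_sum m (J - {j}) \<rho> y))"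
 proof (rule sum.cong[OF refl])
  fix j assume j: "j \<in> J"
  have "(\<Sum>i\<in>J. y m ^ ?r j i * dist_sum m (J - {i}) (?r j) y) = y m ^ ?r j j * dist_sum m (J - {j}) (?r j) y
    + (\<Sum>i\<in>J - {j}. y m ^ ?r j i * dist_sum m (J - {i}) (?r j) y)"
   by (rule sum.remove) (use Suc.prems j in auto)
  moreover have "dist_sum m (J - {j}) (?r j) y = dist_sum m (J - {j}) \<rho> y" by (rule dist_sum_cong) auto
  ultimately show "(\<Sum>i\<in>J - {j}. ?t i * dist_sum m (J - {i}) (?r j) y)
   = (\<Sum>i\<in>J. y m ^ ?r j i * dist_sum m (J - {i}) (?r j) y) - ?t j0 * (?t j * dist_sum m (J - {j}) \<rho> y)"
   by (simp add: power_add)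
 qed
 also have "(\<Sum>j\<in>J. (\<Sum>i\<in>J. y m ^ ?r j i * dist_sum m (J - {i}) (?r j) y) - ?t j0 * (?t j * dist_sum m (J - {j}) \<rho> y))
   = (\<Sum>j\<in>J. \<Sum>i\<in>J. y m ^ ?r j i * dist_sum m (J - {i}) (?r j) y) - ?t j0 * (\<Sum>j\<in>J. ?t j * dist_sum m (J - {j}) \<rho> y)"
  unfolding sum_subtractf sum_distrib_left ..
 finally have *: "dist_sum (Suc m) (insert j0 J) \<rho> y =
   ?P * dist_sum m J \<rho> y - (\<Sum>j\<in>J. dist_sum m J (?r j) y) + ?t j0 * dist_sum m J \<rho> y +
   (?P * (\<Sum>j\<in>J. ?t j * dist_sum m (J - {j}) \<rho> y) -
    ((\<Sum>j\<in>J. \<Sum>i\<in>J. y m ^ ?r j i * dist_sum m (J - {i}) (?r j) y) - ?t j0 * (\<Sum>j\<in>J. ?t j * dist_sum m (J - {j}) \<rho> y)))" .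
 show ?case unfolding * unfolding sum.lessThan_Suc dist_sum.simps(2) sum.distrib by (simp only: algebra_simps)
qed simp

text \<open>Repeated use of \<open>dist_sum_insert\<close>. The polynomial does not depend on m,
  which is essential when m grows with N; exponents at least 1 keep the power sum of exponent 0,
  that is m itself, out of it.\<close>

lemma dist_sum_in_power_sums:
 assumes "finite J"
 shows "(\<forall>j\<in>J. 1 \<le> \<rho> j) ==> \<exists>g D. cv D (%N. g) g & indep0 g & (\<forall>m y. dist_sum m J \<rho> y = g (psum m y))"
 using assms
proof (induction J arbitrary: \<rho> rule: finite_induct)
 case empty
 have "dist_sum m {} \<rho> y = 1" for m y by (induction m) auto
 then show ?case by (intro exI[of _ "%v. 1"] exI[of _ 0]) (auto simp: cv_scalar indep0_def)
next
 case (insert j0 J)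
 let ?r = "%j. \<rho>(j := \<rho> j + \<rho> j0)"
 have "\<forall>j\<in>J. \<exists>gD. cv (snd gD) (%N. fst gD) (fst gD) & indep0 (fst gD) & (\<forall>m y. dist_sum m J (?r j) y = fst gD (psum m y))"
 proof
  fix j assume "j \<in> J"
  have "\<forall>i\<in>J. 1 \<le> ?r j i" using insert.prems by auto
  from insert.IH[OF this] obtain g D where "cv D (%N. g) g" "indep0 g" "\<forall>m y. dist_sum m J (?r j) y = g (psum m y)"
   by blast
  then show "\<exists>gD. cv (snd gD) (%N. fst gD) (fst gD) & indep0 (fst gD) & (\<forall>m y. dist_sum m J (?r j) y = fst gD (psum m y))"
   by (intro exI[of _ "(g, D)"]) simp
 qed
 from bchoice[OF this] obtain gD where gD: "\<forall>j\<in>J. cv (snd (gD j)) (%N. fst (gD j)) (fst (gD j)) & indep0 (fst (gD j)) &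
   (\<forall>m y. dist_sum m J (?r j) y = fst (gD j) (psum m y))" ..
 define g where "g = (%j. fst (gD j))"
 define D where "D = (%j. snd (gD j))"
 have g: "cv (D j) (%N. g j) (g j)" "indep0 (g j)" "dist_sum m J (?r j) y = g j (psum m y)" if "j \<in> J" for j m y
  using gD that unfolding g_def D_def by blast+
 obtain h E where h: "cv E (%N. h) h" "indep0 h" "!!m y. dist_sum m J \<rho> y = h (psum m y)"
  using insert.IH[of \<rho>] insert.prems by auto
 define B where "B = E + Suc (\<rho> j0) + (\<Sum>j\<in>J. D j)"
 have D: "D j \<le> B" if "j \<in> J" for j
  using member_le_sum[of j J D] that insert.hyps by (simp add: B_def)
 have r0: "1 \<le> \<rho> j0" using insert.prems by simp
 show ?case
 proof (intro exI[of _ "%v. v (\<rho> j0) * h v - (\<Sum>j\<in>J. g j v)"] exI[of _ B] conjI allI)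
  show "cv B (%N v. v (\<rho> j0) * h v - (\<Sum>j\<in>J. g j v)) (%v. v (\<rho> j0) * h v - (\<Sum>j\<in>J. g j v))"
   by (intro cv_diff cv_mult cv_var cv_sum cv_mono[OF h(1)] cv_mono[OF g(1)] D) (auto simp: B_def)
  show "indep0 (%v. v (\<rho> j0) * h v - (\<Sum>j\<in>J. g j v))"
   using r0 h(2) g(2) by (auto simp: indep0_def)
  show "dist_sum m (insert j0 J) \<rho> y = psum m y (\<rho> j0) * h (psum m y) - (\<Sum>j\<in>J. g j (psum m y))" for m y
   unfolding dist_sum_insert[OF insert.hyps] h(3)
   using r0 by (simp add: psum_def g(3))
 qed
qed

definition parts :: "nat => nat list set" where
 "parts d = {rs. (\<forall>r\<in>set rs. 1 \<le> r) & sum_list rs \<le> d}"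

lemma length_parts: "rs \<in> parts d ==> length rs \<le> d"
proof -
 have "(\<forall>r\<in>set rs. 1 \<le> r) ==> length rs \<le> sum_list rs" by (induction rs) auto
 then show "rs \<in> parts d ==> length rs \<le> d" by (auto simp: parts_def)
qed

lemma finite_parts: "finite (parts d)"
proof (rule finite_subset)
 show "parts d \<subseteq> {rs. set rs \<subseteq> {..d} & length rs \<le> d}"
  using length_parts by (auto simp: parts_def dest: member_le_sum_list)
qed (rule finite_lists_length_le, simp)

text \<open>A monomial in q distinct variables arises from each of the q! orderings of its
  variables, together with the correspondingly ordered list; the factorial compensates for
  this.\<close>

definition sympoly :: "nat => nat => (nat list => complex) => point => complex" where
 "sympoly m d c y = (\<Sum>rs\<in>parts d. c rs / fact (length rs) * dist_sum m {..<length rs} ((!) rs) y)"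

text \<open>Just enough symmetry to move an entry to the end of a list. The length is limited
  because symmetry of Taylor coefficients is available only while there are enough variables for
  distinct indices.\<close>

definition insertion_inv :: "nat => (nat list => complex) => bool" where
 "insertion_inv d c \<longleftrightarrow> (\<forall>rs t j. length rs < d --> j \<le> length rs --> c (take j rs @ t # drop j rs) = c (rs @ [t]))"

lemma insertion_inv_snoc:
 assumes "insertion_inv d c" shows "insertion_inv (d - 1) (%rs. c (rs @ [s]))"
 unfolding insertion_inv_def
proof (intro allI impI)
 fix rs :: "nat list" and t j assume *: "length rs < d - 1" "j \<le> length rs"
 have 1: "c (take j (rs @ [s]) @ t # drop j (rs @ [s])) = c ((rs @ [s]) @ [t])"
  by (rule assms[unfolded insertion_inv_def, rule_format]) (use * in auto)
 have 2: "c (take (length rs) (rs @ [s]) @ t # drop (length rs) (rs @ [s])) = c ((rs @ [s]) @ [t])"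
  by (rule assms[unfolded insertion_inv_def, rule_format]) (use * in auto)
 from 1 2 show "c ((take j rs @ t # drop j rs) @ [s]) = c ((rs @ [t]) @ [s])" using * by simp
qed

lemma sympoly_0: "sympoly 0 d c y = c []"
proof -
 have "sympoly 0 d c y = (\<Sum>rs\<in>parts d. if rs = [] then c [] else 0)"
  unfolding sympoly_def by (intro sum.cong) (auto simp: lessThan_empty_iff)
 moreover have "[] \<in> parts d" by (simp add: parts_def)
 ultimately show ?thesis by (simp add: finite_parts)
qed

lemma dist_sum_delete:
 assumes "j < length rs"
 shows "dist_sum m ({..<length rs} - {j}) ((!) rs) y = dist_sum m {..<length rs - 1} ((!) (take j rs @ drop (Suc j) rs)) y"
proof -
 let ?h = "%i. if i < j then i else Suc i"
 have "?h ` {..<length rs - 1} = {..<length rs} - {j}"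
 proof (intro equalityI subsetI)
  fix i assume i: "i \<in> {..<length rs} - {j}"
  show "i \<in> ?h ` {..<length rs - 1}"
   by (rule image_eqI[of _ _ "if i < j then i else i - 1"]) (use i assms in auto)
 qed (use assms in auto)
 moreover have "inj_on ?h {..<length rs - 1}" by (auto simp: inj_on_def split: if_splits)
 ultimately have "dist_sum m ({..<length rs} - {j}) ((!) rs) y = dist_sum m {..<length rs - 1} (%i. rs ! ?h i) y"
  using dist_sum_image[of ?h "{..<length rs - 1}" m "(!) rs" y] by simp
 also have "... = dist_sum m {..<length rs - 1} ((!) (take j rs @ drop (Suc j) rs)) y"
  by (rule dist_sum_cong) (use assms in \<open>auto simp: nth_append min_def\<close>)
 finally show ?thesis .
qed

text \<open>Expansion in the last variable: at most one entry is assigned to it, and by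
  \<open>insertion_inv\<close> the removed entry t may be recorded at the end of the list.\<close>

lemma sympoly_Suc:
 assumes c: "insertion_inv d c"
 shows "sympoly (Suc m) d c y = sympoly m d c y + (\<Sum>t\<in>{1..d}. y m ^ t * sympoly m (d - t) (%rs. c (rs @ [t])) y)"
proof -
 let ?A = "%rs. dist_sum m {..<length rs} ((!) rs) y"
 have "(\<Sum>rs\<in>parts d. c rs / fact (length rs) * (\<Sum>j<length rs. y m ^ (rs ! j) * dist_sum m ({..<length rs} - {j}) ((!) rs) y))
   = (\<Sum>(rs, j)\<in>Sigma (parts d) (%rs. {..<length rs}). c rs / fact (length rs) * (y m ^ (rs ! j) * dist_sum m ({..<length rs} - {j}) ((!) rs) y))"
  by (subst sum.Sigma[symmetric]) (auto simp: finite_parts sum_distrib_left)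
 also have "... = (\<Sum>(t, rs, j)\<in>Sigma {1..d} (%t. Sigma (parts (d - t)) (%rs. {..length rs})).
    c (rs @ [t]) / fact (Suc (length rs)) * (y m ^ t * ?A rs))"
 \<comment> \<open>A list with a marked position corresponds to the removed entry, the shortened
   list and the position, which now has length + 1 possible values.\<close>
 proof (rule sum.reindex_bij_witness[where j = "%(rs, j). (rs ! j, take j rs @ drop (Suc j) rs, j)"
    and i = "%(t, rs, j). (take j rs @ t # drop j rs, j)"], goal_cases)
  case (1 a)
  obtain rs j where a: "a = (rs, j)" "j < length rs" using 1 by auto
  then show ?case by (simp add: id_take_nth_drop[symmetric] min_def)
 next
  case (2 a)
  obtain rs j where a: "a = (rs, j)" "j < length rs" "rs \<in> parts d" using 2 by auto
  have "rs = take j rs @ rs ! j # drop (Suc j) rs" using a by (simp add: id_take_nth_drop)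
  then have "set rs = set (take j rs @ rs ! j # drop (Suc j) rs)" "sum_list rs = sum_list (take j rs @ rs ! j # drop (Suc j) rs)"
   by metis+
  then show ?case using a by (auto simp: parts_def)
 next
  case (3 b)
  then show ?case by (auto simp: min_def nth_append)
 next
  case (4 b)
  then obtain t rs j where b: "b = (t, rs, j)" "j \<le> length rs" "rs \<in> parts (d - t)" "1 \<le> t" "t \<le> d" by auto
  have "sum_list (take j rs) + sum_list (drop j rs) = sum_list rs" by (metis append_take_drop_id sum_list_append)
  moreover have "set (take j rs) \<union> set (drop j rs) = set rs" by (metis append_take_drop_id set_append)
  ultimately show ?case using b by (auto simp: parts_def)
 next
  case (5 a)
  obtain rs j where a: "a = (rs, j)" "j < length rs" "rs \<in> parts d" using 5 by auto
  define us where "us = take j rs @ drop (Suc j) rs"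
  have us: "take j us @ rs ! j # drop j us = rs" "Suc (length us) = length rs"
   using a by (auto simp: us_def min_def id_take_nth_drop[symmetric])
  have "c (take j us @ rs ! j # drop j us) = c (us @ [rs ! j])"
   using c us(2) a length_parts[OF a(3)] unfolding insertion_inv_def by auto
  then have "c (us @ [rs ! j]) = c rs" unfolding us(1) by simp
  moreover have "dist_sum m ({..<length rs} - {j}) ((!) rs) y = ?A us"
   using dist_sum_delete[OF a(2), of m y] us(2) unfolding us_def[symmetric] by (metis diff_Suc_1)
  ultimately show ?case using us(2) by (simp add: a(1) us_def[symmetric] del: fact_Suc)
 qed
 also have "... = (\<Sum>t\<in>{1..d}. \<Sum>rs\<in>parts (d - t). \<Sum>j\<le>length rs. c (rs @ [t]) / fact (Suc (length rs)) * (y m ^ t * ?A rs))"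
  by (subst sum.Sigma[symmetric] | simp add: finite_parts)+
 also have "... = (\<Sum>t\<in>{1..d}. y m ^ t * sympoly m (d - t) (%rs. c (rs @ [t])) y)"
  unfolding sympoly_def sum_distrib_left
 proof (intro sum.cong[OF refl])
  fix t and rs :: "nat list"
  \<comment> \<open>The summand does not depend on the position, and the length + 1 positions reduce
    the factorial of the longer list to that of the shorter one.\<close>
  have e: "of_nat (Suc (length rs)) * (x / fact (Suc (length rs))) = x / fact (length rs)" for x :: complex
   by (simp add: fact_Suc del: of_nat_Suc)
  show "(\<Sum>j\<le>length rs. c (rs @ [t]) / fact (Suc (length rs)) * (y m ^ t * ?A rs)) = y m ^ t * (c (rs @ [t]) / fact (length rs) * ?A rs)"
   using e[of "c (rs @ [t]) * (y m ^ t * ?A rs)"]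
   by (simp only: sum_constant card_atMost times_divide_eq_left times_divide_eq_right mult_ac)
 qed
 finally show ?thesis unfolding sympoly_def by (simp add: distrib_left sum.distrib)
qed

lemma taylor_slice_bound:
 assumes G: "sepholo m e G" and e: "0 < e" and i: "i < m"
 shows "\<exists>K\<ge>0. \<forall>y\<in>pdisc m (e / 2). cmod (G y - (\<Sum>s\<le>d. y i ^ s / fact s * pderivs (replicate s i) G (y(i := 0)))) \<le> K * cmod (y i) ^ (d + 1)"
proof -
 obtain M where M: "M \<ge> 0" "\<forall>y\<in>pdisc m e. cmod (G y) \<le> M" using sepholo_bound[OF G] by blast
 define K where "K = fact (Suc d) * M / (e / 4) ^ Suc d / fact d"
 have "cmod (G y - (\<Sum>s\<le>d. y i ^ s / fact s * pderivs (replicate s i) G (y(i := 0)))) \<le> K * cmod (y i) ^ (d + 1)"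
  if y: "y \<in> pdisc m (e / 2)" for y
 proof -
  define g where "g = (%t. G (y(i := t)))"
  let ?f = "%n. (deriv ^^ n) g"
  have ye: "y \<in> pdisc m e" using y pdisc_mono[of m m "e / 2" e] e by auto
  have hol: "g holomorphic_on ball 0 e" unfolding g_def by (rule sepholo_slice[OF G ye i])
  have yi: "cmod (y i) < e / 2" using y i by (auto simp: pdisc_def)
  have "cmod (?f 0 (y i) - (\<Sum>s\<le>d. ?f s 0 * (y i - 0) ^ s / fact s)) \<le>
    fact (Suc d) * M / (e / 4) ^ Suc d * cmod (y i - 0) ^ Suc d / fact d"
  proof (rule complex_Taylor[of "ball 0 (e / 2)"])
   fix s x assume "x \<in> ball (0::complex) (e / 2)"
   then have "cmod x < e / 2" by simp
   then have "cmod x < e" using norm_ge_zero[of x] by linarith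
   then have "x \<in> ball 0 e" by simp
   from holomorphic_derivI[OF holomorphic_higher_deriv[OF hol open_ball] open_ball this]
   show "(?f s has_field_derivative ?f (Suc s) x) (at x within ball 0 (e / 2))"
    by (auto intro: has_field_derivative_at_within)
  next
   fix x assume x: "x \<in> ball (0::complex) (e / 2)"
   have sub: "ball x (e / 2) \<subseteq> ball 0 e"
   proof
    fix w assume "w \<in> ball x (e / 2)"
    then show "w \<in> ball 0 e" using x norm_triangle_sub[of w x] by (auto simp: dist_norm norm_minus_commute)
   qed
   show "cmod (?f (Suc d) x) \<le> fact (Suc d) * M / (e / 4) ^ Suc d"
   proof (rule deriv_bound[of g x "e / 2"])
    show "g holomorphic_on ball x (e / 2)" by (rule holomorphic_on_subset[OF hol sub])
    show "cmod (g w) \<le> M" if "w \<in> ball x (e / 2)" for w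
    proof -
     have "cmod w < e" using sub that by auto
     then show ?thesis unfolding g_def using M(2) pdisc_upd[OF ye i] by blast
    qed
   qed (use e in auto)
  qed (use yi e in auto)
  moreover have "?f s 0 = pderivs (replicate s i) G (y(i := 0))" for s
   by (simp add: pderivs_replicate g_def)
  ultimately show ?thesis by (simp add: g_def K_def mult_ac)
 qed
 moreover have "K \<ge> 0" using M(1) e by (simp add: K_def)
 ultimately show ?thesis by blast
qed

lemma vanO_sum:
 assumes "finite A" "!!l. l \<in> A ==> vanO m q (F l)" shows "vanO m q (%y. \<Sum>l\<in>A. F l y)"
 using assms
proof (induction A rule: finite_induct)
 case empty
 then show ?case by (intro vanOI[of 0 1]) auto
next
 case (insert l A) then show ?case by (auto intro: vanO_add)
qed

lemma vanO_drop_coord: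
 assumes "vanO m q F" shows "vanO (Suc m) q (%y. F (y(m := 0)))"
proof -
 obtain C e where C: "C \<ge> 0" "e > 0"
  "!!\<delta> y. 0 < \<delta> ==> \<delta> < e ==> (\<forall>i<m. cmod (y i) \<le> \<delta>) ==> (\<forall>i\<ge>m. y i = 0) ==> cmod (F y) \<le> C * \<delta> ^ q"
  using vanOE[OF assms] by blast
 show ?thesis
  by (rule vanOI[OF C(1,2)]) (auto intro!: C(3))
qed

lemma vanO_coord_power: "i < m ==> vanO m s (%y. y i ^ s)"
 by (rule vanOI[of 1 1]) (auto simp: norm_power intro: power_mono)

lemma pderivs_append: "pderivs (xs @ ys) f = pderivs xs (pderivs ys f)"
 by (induction xs) auto

definition indices :: "nat list => nat list => nat list" where
 "indices rs is = concat (map2 replicate rs is)"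

text \<open>Induction on the number of variables: Taylor's formula in the last one, then the
  hypothesis for the s-th derivative at y_m = 0, whose data for s > 0 are those of lists ending in
  s, times s!. The factor y_m^s already vanishes to order s, so precision d - s suffices
  there.\<close>

lemma sepholo_sympoly_taylor:
 assumes "sepholo m e G" "0 < e" "insertion_inv d c"
  and "!!rs is. length rs = length is ==> distinct is ==> set is \<subseteq> {..<m} ==> \<forall>r\<in>set rs. 1 \<le> r ==>
    pderivs (indices rs is) G (%_. 0) = c rs * (\<Prod>r\<leftarrow>rs. fact r)"
 shows "vanO m (d + 1) (%y. G y - sympoly m d c y)"
 using assms
proof (induction m arbitrary: e G d c)
 case 0
 have "G (%_. 0) = c []" using 0(4)[of "[]" "[]"] by (simp add: indices_def)
 then have "cmod (G y - sympoly 0 d c y) \<le> 0 * \<delta> ^ (d + 1)" if "\<forall>i\<ge>0. y i = 0" for y and \<delta> :: real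
 proof -
  have "y = (%_. 0)" using that by auto
  then show ?thesis using \<open>G (%_. 0) = c []\<close> by (simp add: sympoly_0)
 qed
 then show ?case by (intro vanOI[of 0 1]) auto
next
 case (Suc m)
 let ?G = "%s. pderivs (replicate s m) G" and ?c = "%s rs. if s = 0 then c rs else c (rs @ [s]) * fact s"
 have G: "sepholo m (e / 2) (?G s)" for s
 proof -
  have "sepholo (Suc m) (e / 2) (?G s)" by (rule sepholo_pderivs[OF Suc.prems(1)]) (use Suc.prems(2) in auto)
  then show ?thesis by (rule sepholo_mono) (use Suc.prems(2) in auto)
 qed
 have "vanO m (d - s + 1) (%y. ?G s y - sympoly m (d - s) (?c s) y)" for s
 proof (rule Suc.IH[OF G])
  show "insertion_inv (d - s) (?c s)"
  proof (cases "s = 0")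
   case False
   from insertion_inv_snoc[OF Suc.prems(3), of s] False show ?thesis
    unfolding insertion_inv_def by auto
  qed (use Suc.prems(3) in simp)
  fix rs "is" :: "nat list"
  assume *: "length rs = length is" "distinct is" "set is \<subseteq> {..<m}" "\<forall>r\<in>set rs. 1 \<le> r"
  show "pderivs (indices rs is) (?G s) (%_. 0) = ?c s rs * (\<Prod>r\<leftarrow>rs. fact r)"
  proof (cases "s = 0")
   case True
   have "set is \<subseteq> {..<Suc m}" using *(3) by auto
   with True show ?thesis using Suc.prems(4)[OF *(1,2) _ *(4)] by simp
  next
   case False
   have "pderivs (indices (rs @ [s]) (is @ [m])) G (%_. 0) = c (rs @ [s]) * (\<Prod>r\<leftarrow>rs @ [s]. fact r)"
    by (rule Suc.prems(4)) (use * False in auto)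
   then show ?thesis using False *(1) by (simp add: indices_def pderivs_append mult_ac)
  qed
 qed (use Suc.prems(2) in auto)
 then have tm: "vanO (Suc m) (d + 1) (%y. y m ^ s / fact s * (?G s (y(m := 0)) - sympoly m (d - s) (?c s) (y(m := 0))))" if "s \<le> d" for s
 proof -
  have "vanO (Suc m) (0 + (s + (d - s + 1))) (%y. 1 / fact s * (y m ^ s * (?G s (y(m := 0)) - sympoly m (d - s) (?c s) (y(m := 0)))))"
  proof (rule vanO_mult)
   show "vanO (Suc m) 0 (%y. 1 / fact s)" by (rule vanO_bounded[OF sepholo_const, of 1]) simp
  qed (rule vanO_mult[OF vanO_coord_power vanO_drop_coord[OF \<open>!!s. vanO m (d - s + 1) (%y. ?G s y - sympoly m (d - s) (?c s) y)\<close>]], simp)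
  then show ?thesis using that by (simp add: mult_ac)
 qed
 obtain K where K: "K \<ge> 0" "!!y. y\<in>pdisc (Suc m) (e / 2) ==>
   cmod (G y - (\<Sum>s\<le>d. y m ^ s / fact s * ?G s (y(m := 0)))) \<le> K * cmod (y m) ^ (d + 1)"
  using taylor_slice_bound[OF Suc.prems(1,2), of m d] by blast
 have 1: "vanO (Suc m) (d + 1) (%y. G y - (\<Sum>s\<le>d. y m ^ s / fact s * ?G s (y(m := 0))))"
 proof (rule vanOI[OF K(1), of "e / 2"])
  fix \<delta> and y :: "nat => complex"
  assume *: "0 < \<delta>" "\<delta> < e / 2" "\<forall>i<Suc m. cmod (y i) \<le> \<delta>" "\<forall>i\<ge>Suc m. y i = 0"
  then have "y \<in> pdisc (Suc m) (e / 2)" by (auto simp: pdisc_def intro: le_less_trans)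
  from K(2)[OF this] show "cmod (G y - (\<Sum>s\<le>d. y m ^ s / fact s * ?G s (y(m := 0)))) \<le> K * \<delta> ^ (d + 1)"
   by (rule order_trans) (intro mult_left_mono power_mono; use * K(1) in auto)
 qed (use Suc.prems(2) in auto)
 have eq: "G y - sympoly (Suc m) d c y = (G y - (\<Sum>s\<le>d. y m ^ s / fact s * ?G s (y(m := 0)))) +
   (\<Sum>s\<le>d. y m ^ s / fact s * (?G s (y(m := 0)) - sympoly m (d - s) (?c s) (y(m := 0))))" for y
 proof -
  have cong: "sympoly m d' c' (y(m := 0)) = sympoly m d' c' y" for d' c'
   unfolding sympoly_def by (intro sum.cong[OF refl] arg_cong2[where f = "(*)"] dist_sum_cong) auto
  have "(\<Sum>s\<le>d. y m ^ s / fact s * sympoly m (d - s) (?c s) y)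
    = sympoly m d c y + (\<Sum>s\<in>{1..d}. y m ^ s / fact s * sympoly m (d - s) (?c s) y)"
  proof -
   have "{..d} = insert 0 {1..d}" by auto
   then show ?thesis by simp
  qed
  also have "(\<Sum>s\<in>{1..d}. y m ^ s / fact s * sympoly m (d - s) (?c s) y) = (\<Sum>t\<in>{1..d}. y m ^ t * sympoly m (d - t) (%rs. c (rs @ [t])) y)"
  proof (rule sum.cong[OF refl])
   fix s assume "s \<in> {1..d}"
   then have "sympoly m (d - s) (?c s) y = fact s * sympoly m (d - s) (%rs. c (rs @ [s])) y"
    by (simp add: sympoly_def sum_distrib_left mult_ac)
   then show "y m ^ s / fact s * sympoly m (d - s) (?c s) y = y m ^ s * sympoly m (d - s) (%rs. c (rs @ [s])) y"
    by simp
  qed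
  finally show ?thesis
   unfolding sympoly_Suc[OF Suc.prems(3)] cong right_diff_distrib sum_subtractf by simp
 qed
 show ?case
  unfolding eq by (rule vanO_add[OF 1 vanO_sum]) (use tm in auto)
qed

section \<open>Expansion of the logarithm of the generating function\<close>

subsection \<open>The logarithm of a Schur generating function\<close>

definition chi :: "nat => int list => point => complex" where
 "chi m lam y = sp m lam (%i. 1 + y i) / sp m lam ones"

lemma shifted_nonzero: "y \<in> pdisc m (1 / 2) ==> i < m ==> 1 + y i ~= 0"
proof
 assume y: "y \<in> pdisc m (1 / 2)" "i < m" "1 + y i = 0"
 then have "y i = - 1" by (simp add: add_eq_0_iff)
 then have "cmod (y i) = 1" by simp
 moreover have "cmod (y i) < 1 / 2" using y by (simp add: pdisc_def)
 ultimately show False by simp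
qed

lemma chi_0: "lam \<in> GT m ==> chi m lam (%_. 0) = 1"
 using sp_ones_nonzero[of lam m] by (simp add: chi_def ones_def)

lemma field_differentiable_shift:
 assumes "(g :: complex => complex) field_differentiable at (c + z)"
 shows "(%t. g (c + t)) field_differentiable at z"
 using field_differentiable_compose[of "%t. c + t" z g] assms by (auto simp: o_def intro!: derivative_intros)

lemma shift_upd: "(%j. 1 + (y(i := t)) j) = (%j. 1 + y j)(i := 1 + (t :: complex))"
 by auto

lemma sepholo_chi: "sepholo m (1 / 2) (chi m lam)"
proof -
 obtain B where B: "\<forall>x. (\<forall>i<m. 1 / 2 \<le> cmod (x i) & cmod (x i) \<le> 3 / 2) --> cmod (sp m lam x) \<le> B"
  using sp_bounded[of m lam] by blast
 show ?thesis
 proof (rule sepholoI)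
  fix y assume y: "y \<in> pdisc m (1 / 2)"
  have *: "1 / 2 \<le> cmod (1 + y i) & cmod (1 + y i) \<le> 3 / 2" if "i < m" for i
  proof -
   have "cmod (y i) < 1 / 2" using y that by (simp add: pdisc_def)
   then show ?thesis using norm_triangle_ineq[of 1 "y i"] norm_diff_ineq[of 1 "y i"] by simp
  qed
  have "cmod (sp m lam (%i. 1 + y i)) \<le> B" by (rule B[rule_format]) (rule *)
  then show "cmod (chi m lam y) \<le> B / cmod (sp m lam ones)"
   by (simp add: chi_def norm_divide divide_right_mono)
 next
  fix y i assume y: "y \<in> pdisc m (1 / 2)" and i: "i < m"
  have "(%t. sp m lam ((%j. 1 + y j)(i := t))) field_differentiable at (1 + y i)"
   using sp_differentiable[of m "%j. 1 + y j" lam i] shifted_nonzero[OF y] by simp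
  from field_differentiable_shift[OF this]
  show "(%t. chi m lam (y(i := t))) field_differentiable at (y i)"
   unfolding chi_def shift_upd divide_inverse by (intro derivative_intros)
 qed
qed

lemma chi_schur:
 assumes "lam \<in> GT m" "y \<in> pdisc m (1 / 2)"
 shows "schur m lam (%i. 1 + y i) / schur m lam ones = chi m lam y"
 using schur_eq_sp[OF assms(1), of "%i. 1 + y i"] schur_eq_sp[OF assms(1), of ones] shifted_nonzero[OF assms(2)]
 by (simp add: chi_def ones_def)

lemma sgf_usum:
 assumes "sgf_unif_conv N p"
 shows "\<exists>e>0. e \<le> 1 / 2 & usum N e (GT N) (%lam y. of_real (p lam) * chi N lam y) (%y. sgf N p (%i. 1 + y i))"
proof -
 obtain e where e: "e > 0" and ul: "uniform_limit (polydisc N e) (%A x. \<Sum>lam\<in>A. sgf_term N p lam x) (sgf N p)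
   (finite_subsets_at_top (GT N))"
  using assms unfolding sgf_unif_conv_def by blast
 define e' where "e' = min e (1 / 2)"
 have sh: "(%i. 1 + y i) \<in> polydisc N e" if "y \<in> pdisc N e'" for y
  using that by (auto simp: pdisc_def polydisc_def e'_def)
 have "uniform_limit (pdisc N e') (%A y. \<Sum>lam\<in>A. sgf_term N p lam (%i. 1 + y i)) (%y. sgf N p (%i. 1 + y i))
   (finite_subsets_at_top (GT N))"
  by (rule uniform_limit_compose'[OF ul]) (use sh in auto)
 then have "usum N e' (GT N) (%lam y. of_real (p lam) * chi N lam y) (%y. sgf N p (%i. 1 + y i))"
  unfolding usum_def
 proof (rule uniform_limit_cong[THEN iffD1, rotated -1])
  show "\<forall>\<^sub>F A in finite_subsets_at_top (GT N). \<forall>y\<in>pdisc N e'.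
    (\<Sum>lam\<in>A. sgf_term N p lam (%i. 1 + y i)) = (\<Sum>lam\<in>A. of_real (p lam) * chi N lam y)"
  proof (rule eventually_finite_subsets_at_top_weakI, intro ballI sum.cong[OF refl])
   fix A y lam assume *: "A \<subseteq> GT N" "y \<in> pdisc N e'" "lam \<in> A"
   have "y \<in> pdisc N (1 / 2)" "lam \<in> GT N" using * by (auto simp: pdisc_def e'_def)
   then show "sgf_term N p lam (%i. 1 + y i) = of_real (p lam) * chi N lam y"
    unfolding sgf_term_def by (simp only: chi_schur)
  qed
 qed simp
 then show ?thesis using e by (intro exI[of _ e']) (auto simp: e'_def)
qed

lemma sgf_1:
 assumes "prob_on_GT N p" "sgf_unif_conv N p" shows "sgf N p (%i. 1 + 0) = 1"
proof -
 obtain e where e: "e > 0" "usum N e (GT N) (%lam y. of_real (p lam) * chi N lam y) (%y. sgf N p (%i. 1 + y i))"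
  using sgf_usum[OF assms(2)] by blast
 have "((%lam. of_real (p lam) * chi N lam (%_. 0)) has_sum sgf N p (%i. 1 + 0)) (GT N)"
  using usum_has_sum[OF e(2), of "%_. 0"] e(1) by (simp add: pdisc_def)
 then have "((%lam. complex_of_real (p lam)) has_sum sgf N p (%i. 1 + 0)) (GT N)"
  by (rule has_sum_cong[THEN iffD1, rotated]) (simp add: chi_0)
 moreover have "((%lam. complex_of_real (p lam)) has_sum of_real 1) (GT N)"
  by (rule has_sum_of_real) (use assms(1) in \<open>simp add: prob_on_GT_def\<close>)
 ultimately show ?thesis using has_sum_unique by fastforce
qed

lemma sepholo_vanO_1:
 "sepholo m e G ==> 0 < e ==> vanO m 1 (%y. G y - G (%_. 0))"
proof (induction m)
 case 0
 show ?case
 proof (rule vanOI[of 0 1])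
  fix \<delta> :: real and y :: "nat => complex" assume "\<forall>i\<ge>0. y i = 0"
  then have "y = (%_. 0)" by auto
  then show "cmod (G y - G (%_. 0)) \<le> 0 * \<delta> ^ 1" by simp
 qed auto
next
 case (Suc m)
 obtain K where K: "K \<ge> 0" "!!y. y\<in>pdisc (Suc m) (e / 2) ==> cmod (G y - G (y(m := 0))) \<le> K * cmod (y m)"
  using taylor_slice_bound[OF Suc.prems, of m 0] by auto
 have 1: "vanO (Suc m) 1 (%y. G y - G (y(m := 0)))"
 proof (rule vanOI[OF K(1), of "e / 2"])
  fix \<delta> and y :: "nat => complex"
  assume *: "0 < \<delta>" "\<delta> < e / 2" "\<forall>i<Suc m. cmod (y i) \<le> \<delta>" "\<forall>i\<ge>Suc m. y i = 0"
  then have "y \<in> pdisc (Suc m) (e / 2)" by (auto simp: pdisc_def intro: le_less_trans)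
  from K(2)[OF this] show "cmod (G y - G (y(m := 0))) \<le> K * \<delta> ^ 1"
   by (rule order_trans) (use * K(1) in \<open>auto intro!: mult_left_mono\<close>)
 qed (use Suc.prems in auto)
 have "vanO m 1 (%y. G y - G (%_. 0))"
  by (rule Suc.IH) (use Suc.prems sepholo_mono[OF Suc.prems(1), of m e] in auto)
 from vanO_add[OF 1 vanO_drop_coord[OF this]] show ?case by simp
qed

text \<open>The given logarithm is controlled by comparing it with the principal one: near the
  origin the generating function is close to 1, and there the shifted L equals \<open>Ln\<close> of
  it. Boundedness and symmetry are then inherited from the generating function.\<close>

lemma log_properties:
 assumes p: "prob_on_GT N p" "sgf_unif_conv N p" and L: "holo_log N (sgf N p) L"
 defines "\<psi> \<equiv> %y. L (%i. 1 + y i) - L ones"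
 shows "\<exists>e>0. sepholo N e \<psi> & (\<forall>y\<in>pdisc N e. exp (\<psi> y) = sgf N p (%i. 1 + y i)) &
  (\<forall>s y. s permutes {..<N} --> y \<in> pdisc N e --> \<psi> (%i. y (s i)) = \<psi> y)"
proof -
 define S where "S = (%y. sgf N p (%i. 1 + y i))"
 obtain e1 where e1: "e1 > 0" "e1 \<le> 1 / 2" and us: "usum N e1 (GT N) (%lam y. of_real (p lam) * chi N lam y) S"
  using sgf_usum[OF p(2)] unfolding S_def by blast
 obtain e2 where e2: "e2 > 0" and L: "!!x. x \<in> polydisc N e2 ==> exp (L x) = sgf N p x"
  "!!x i. x \<in> polydisc N e2 ==> i < N ==> (%t. L (x(i := t))) field_differentiable at (x i)"
  using L unfolding holo_log_def by blast
 have Sh: "sepholo N e1 S"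
  by (rule usum_sepholo[OF _ us], rule sepholo_mult[OF sepholo_const])
    (rule sepholo_mono[OF sepholo_chi], use e1 in auto)
 have S0: "S (%_. 0) = 1" using sgf_1[OF p] by (simp add: S_def)
 obtain C e3 where C: "C \<ge> 0" "e3 > 0" "!!\<delta> y. 0 < \<delta> ==> \<delta> < e3 ==> (\<forall>i<N. cmod (y i) \<le> \<delta>) ==> (\<forall>i\<ge>N. y i = 0) ==> cmod (S y - 1) \<le> C * \<delta> ^ 1"
  using vanOE[OF sepholo_vanO_1[OF Sh e1(1)]] unfolding S0 by blast
 \<comment> \<open>The entry 1 / (2 (C + 1)) forces |S - 1| <= 1/2, where the principal logarithm is
   holomorphic and bounded.\<close>
 define e where "e = Min {e1, e2, e3 / 2, 1 / (2 * (C + 1))}"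
 have e: "0 < e" "e \<le> e1" "e \<le> e2" "e < e3" "C * e \<le> 1 / 2"
 proof -
  show "0 < e" "e \<le> e1" "e \<le> e2" using e1 e2 C by (auto simp: e_def)
  have "e \<le> e3 / 2" by (auto simp: e_def)
  then show "e < e3" using C by simp
  have "e \<le> 1 / (2 * (C + 1))" by (simp add: e_def)
  then have "C * e \<le> C * (1 / (2 * (C + 1)))" using C(1) by (rule mult_left_mono)
  also have "... \<le> 1 / 2" using C(1) by (simp add: field_simps)
  finally show "C * e \<le> 1 / 2" .
 qed
 have near: "S y \<in> cball 1 (1 / 2)" if "y \<in> pdisc N e" for y
  using C(3)[of e y] e that by (auto simp: pdisc_def dist_norm norm_minus_commute less_imp_le)
 have slit: "z \<notin> \<real>\<^sub>\<le>\<^sub>0" if "z \<in> cball 1 (1 / 2)" for z :: complex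
 proof
  assume "z \<in> \<real>\<^sub>\<le>\<^sub>0"
  then obtain r where "z = of_real r" "r \<le> 0" by (auto elim: nonpos_Reals_cases)
  then have "cmod (1 - z) = cmod (of_real (1 - r))" by simp
  then have "cmod (1 - z) = 1 - r" unfolding norm_of_real using \<open>r \<le> 0\<close> by simp
  then show False using that \<open>r \<le> 0\<close> by (simp add: dist_norm)
 qed
 have shift: "(%i. 1 + y i) \<in> polydisc N e2" if "y \<in> pdisc N e" for y
  using that e by (auto simp: pdisc_def polydisc_def intro: less_le_trans)
 have one: "(%i. 1 + 0) = ones" by (simp add: ones_def)
 have expL1: "exp (L ones) = 1" using L(1)[OF shift, of "%_. 0"] e(1) sgf_1[OF p] by (simp add: pdisc_def ones_def)
 have exp: "exp (\<psi> y) = S y" if "y \<in> pdisc N e" for y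
  using L(1)[OF shift[OF that]] expL1 by (simp add: \<psi>_def exp_diff S_def)
 have Lnd: "(%t. Ln (S (y(i := t)))) field_differentiable at (y i)" if y: "y \<in> pdisc N e" "i < N" for y i
 proof -
  have "y \<in> pdisc N e1" using y pdisc_mono[of N N e e1] e by auto
  from sepholo_diff_at[OF Sh this y(2)] have d: "(%t. S (y(i := t))) field_differentiable at (y i)" .
  have "Ln field_differentiable at (S (y(i := y i)))"
   by (rule field_differentiable_at_Ln) (use slit near y in auto)
  from field_differentiable_compose[OF d this] show ?thesis by (simp only: o_def)
 qed
 have \<psi>d: "(%t. \<psi> (y(i := t))) field_differentiable at (y i)" if y: "y \<in> pdisc N e" "i < N" for y i
 proof -
  have "(%t. L ((%j. 1 + y j)(i := t))) field_differentiable at (1 + y i)" using L(2)[OF shift[OF y(1)] y(2)] by simp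
  from field_differentiable_shift[OF this] show ?thesis
   unfolding \<psi>_def shift_upd by (intro derivative_intros)
 qed
 \<comment> \<open>Two logarithms of S that agree at 0. On a slice their difference has exponential
   1, so its derivative vanishes; the coordinates are switched on one after another.\<close>
 have eq: "k \<le> N ==> y \<in> pdisc k e ==> \<psi> y = Ln (S y)" for k y
 proof (induction k arbitrary: y)
  case 0
  then have "y = (%_. 0)" by (auto simp: pdisc_def)
  then show ?case by (simp add: \<psi>_def S0 ones_def)
 next
  case (Suc k)
  have yN: "y(k := t) \<in> pdisc N e" if "cmod t < e" for t
   using Suc.prems that pdisc_upd[of y "Suc k" e k t] pdisc_mono[of "Suc k" N e e] e(1) by auto
  define h where "h = (%t. \<psi> (y(k := t)) - Ln (S (y(k := t))))"
  have ex: "exp (h t) = 1" if "cmod t < e" for t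
  proof -
   have "S (y(k := t)) ~= 0" using exp[OF yN[OF that]] by (metis exp_not_eq_zero)
   then show ?thesis using exp[OF yN[OF that]] by (simp add: h_def exp_diff)
  qed
  have "\<exists>c. \<forall>t\<in>ball 0 e. h t = c"
  proof (rule has_field_derivative_zero_constant)
   fix t :: complex assume t: "t \<in> ball 0 e"
   then have "cmod t < e" by simp
   from \<psi>d[OF yN[OF this], of k] Lnd[OF yN[OF this], of k] Suc.prems(1)
   have "h field_differentiable at t" unfolding h_def by (intro derivative_intros) auto
   then obtain h' where h': "(h has_field_derivative h') (at t)" unfolding field_differentiable_def ..
   have "((%t. exp (h t)) has_field_derivative exp (h t) * h') (at t)" by (rule DERIV_fun_exp[OF h'])
   moreover have "((%t. exp (h t)) has_field_derivative 0) (at t)"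
   proof (rule has_field_derivative_transform_within_open[OF DERIV_const[of 1] open_ball t])
    show "1 = exp (h u)" if "u \<in> ball 0 e" for u using ex[of u] that by simp
   qed
   ultimately have "exp (h t) * h' = 0" by (rule DERIV_unique)
   then show "(h has_field_derivative 0) (at t within ball 0 e)" using h' by (auto intro: has_field_derivative_at_within)
  qed simp
  moreover have "h 0 = 0"
  proof -
   have "y(k := 0) \<in> pdisc k e" using Suc.prems(2) by (auto simp: pdisc_def)
   then show ?thesis using Suc.IH Suc.prems(1) by (simp add: h_def)
  qed
  moreover have "y k \<in> ball 0 e" using Suc.prems(2) by (simp add: pdisc_def)
  ultimately have "h (y k) = 0" using e(1) by (metis centre_in_ball)
  then show ?case by (simp add: h_def)
 qed
 have "compact (Ln ` cball 1 (1 / 2))"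
  by (rule compact_continuous_image[OF continuous_on_Ln compact_cball]) (use slit in auto)
 from compact_imp_bounded[OF this] obtain B where B: "!!z. z \<in> cball 1 (1 / 2) ==> cmod (Ln z) \<le> B"
  unfolding bounded_iff by blast
 have "sepholo N e \<psi>"
  by (rule sepholoI[of _ _ _ B]) (use eq[of N] B near \<psi>d in auto)
 moreover have "\<psi> (%i. y (s i)) = \<psi> y" if s: "s permutes {..<N}" and y: "y \<in> pdisc N e" for s y
 proof -
  have sN: "s i < N \<longleftrightarrow> i < N" for i using permutes_in_image[OF s, of i] by simp
  have ys: "(%i. y (s i)) \<in> pdisc N e" using y sN by (auto simp: pdisc_def not_less[symmetric])
  have "S (%i. y (s i)) = S y" unfolding S_def sgf_def
  proof (rule infsum_cong)
   fix lam assume lam: "lam \<in> GT N"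
   have h: "z \<in> pdisc N e ==> z \<in> pdisc N (1 / 2)" for z using pdisc_mono[of N N e "1/2"] e e1 by auto
   have "chi N lam (%i. y (s i)) = chi N lam y"
    unfolding chi_def using sp_symmetric[OF lam s, of "%i. 1 + y i"] shifted_nonzero[OF h[OF y]] by simp
   then show "sgf_term N p lam (%i. 1 + y (s i)) = sgf_term N p lam (%i. 1 + y i)"
    unfolding sgf_term_def chi_schur[OF lam h[OF y]] using chi_schur[OF lam h[OF ys]] by simp
  qed
  then show ?thesis using eq[of N] y ys by simp
 qed
 ultimately show ?thesis using e(1) exp unfolding S_def by blast
qed

lemma extend_to_permutation:
 assumes "distinct is" "set is \<subseteq> {..<N}"
 shows "\<exists>s. s permutes {..<N} & (\<forall>i<length is. s i = is ! i)"
proof -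
 let ?q = "length is"
 have q: "?q \<le> N" using assms card_mono[of "{..<N}" "set is"] by (simp add: distinct_card)
 have c: "card ({..<N} - {..<?q}) = card ({..<N} - set is)"
  using assms q by (subst (1 2) card_Diff_subset) (auto simp: distinct_card)
 obtain h where h: "bij_betw h ({..<N} - {..<?q}) ({..<N} - set is)"
  using finite_same_card_bij[OF _ _ c] by auto
 define s where "s = (%i. if i < ?q then is ! i else if i < N then h i else i)"
 have "bij_betw s {..<?q} (set is)"
  by (rule bij_betw_cong[THEN iffD1, OF _ bij_betw_nth[OF assms(1) refl refl]]) (simp add: s_def)
 moreover have "bij_betw s ({..<N} - {..<?q}) ({..<N} - set is)"
  by (rule bij_betw_cong[THEN iffD1, OF _ h]) (auto simp: s_def)
 ultimately have "bij_betw s ({..<?q} \<union> ({..<N} - {..<?q})) (set is \<union> ({..<N} - set is))"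
  by (rule bij_betw_combine) auto
 moreover have "{..<?q} \<union> ({..<N} - {..<?q}) = {..<N}" "set is \<union> ({..<N} - set is) = {..<N}"
  using q assms(2) by auto
 ultimately have "s permutes {..<N}"
  by (intro bij_imp_permutes) (use q in \<open>auto simp: s_def\<close>)
 then show ?thesis by (intro exI[of _ s]) (auto simp: s_def)
qed

lemma indices_append: "length rs = length is ==> indices (rs @ rs') (is @ js) = indices rs is @ indices rs' js"
 by (simp add: indices_def)

lemma set_indices: "length rs = length is ==> set (indices rs is) \<subseteq> set is"
 by (induction rs "is" rule: list_induct2) (auto simp: indices_def)

lemma set_indices_eq: "length rs = length is ==> \<forall>r\<in>set rs. 1 \<le> r ==> set (indices rs is) = set is"
 by (induction rs "is" rule: list_induct2) (auto simp: indices_def)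

lemma map_indices: "length rs = length is ==> map s (indices rs is) = indices rs (map s is)"
 by (induction rs "is" rule: list_induct2) (auto simp: indices_def)

lemma pderivs_indices_distinct:
 assumes sym: "!!s y. s permutes {..<N} ==> y \<in> pdisc N e ==> \<psi> (%i. y (s i)) = \<psi> y" and e: "0 < e"
  and "distinct is" "set is \<subseteq> {..<N}" "length rs = length is"
 shows "pderivs (indices rs is) \<psi> (%_. 0) = pderivs (indices rs [0..<length rs]) \<psi> (%_. 0)"
proof -
 obtain s where s: "s permutes {..<N}" "!!i. i < length is ==> s i = is ! i"
  using extend_to_permutation[OF assms(3,4)] by blast
 have m: "map s [0..<length rs] = is" using s(2) assms(5) by (intro nth_equalityI) auto
 have q: "length rs \<le> N" using assms card_mono[of "{..<N}" "set is"] by (simp add: distinct_card)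
 have "set (indices rs [0..<length rs]) \<subseteq> {..<N}" using set_indices[of rs "[0..<length rs]"] q by auto
 from pderivs_permute[OF s(1), of e \<psi>, OF sym[OF s(1)] this, of "%_. 0"]
 show ?thesis using e by (simp add: map_indices m pdisc_def)
qed

lemma mset_indices_insert:
 assumes "length rs = length is" "j \<le> length rs"
 shows "mset (indices (take j rs @ t # drop j rs) (take j is @ i # drop j is)) = mset (indices (rs @ [t]) (is @ [i]))"
proof -
 have "indices rs is = indices (take j rs) (take j is) @ indices (drop j rs) (drop j is)"
  using indices_append[of "take j rs" "take j is" "drop j rs" "drop j is"] assms by simp
 moreover have "indices (take j rs @ t # drop j rs) (take j is @ i # drop j is)
   = indices (take j rs) (take j is) @ replicate t i @ indices (drop j rs) (drop j is)"
  using indices_append[of "take j rs" "take j is" "t # drop j rs" "i # drop j is"] assms by (simp add: indices_def)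
 moreover have "indices (rs @ [t]) (is @ [i]) = indices rs is @ replicate t i"
  using indices_append[of rs "is" "[t]" "[i]"] assms by (simp add: indices_def)
 ultimately show ?thesis by simp
qed

definition taylor_coeff :: "(point => complex) => nat list => complex" where
 "taylor_coeff \<psi> rs = pderivs (indices rs [0..<length rs]) \<psi> (%_. 0) / (\<Prod>r\<leftarrow>rs. fact r)"

text \<open>A permutation of the variables carries distinct indices to 0, 1, ..., and derivatives
  commute, so only the multiset of orders matters. The bound d <= N provides enough distinct
  indices.\<close>

lemma taylor_coeff_insertion_inv:
 assumes G: "sepholo N e \<psi>" and sym: "!!s y. s permutes {..<N} ==> y \<in> pdisc N e ==> \<psi> (%i. y (s i)) = \<psi> y"
  and e: "0 < e" and d: "d \<le> N"
 shows "insertion_inv d (taylor_coeff \<psi>)"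
 unfolding insertion_inv_def
proof (intro allI impI)
 fix rs t j assume *: "length (rs :: nat list) < d" "j \<le> length rs"
 let ?q = "length rs" and ?is = "take j [0..<length rs] @ length rs # drop j [0..<length rs]"
 let ?rs = "take j rs @ t # drop j rs"
 have mis: "mset ?is = mset [0..<Suc ?q]"
 proof -
  have "mset (take j [0..<length rs]) + mset (drop j [0..<length rs]) = mset [0..<length rs]"
   by (metis append_take_drop_id mset_append)
  then show ?thesis by (simp add: add_ac)
 qed
 have "pderivs (indices ?rs [0..<length ?rs]) \<psi> (%_. 0) = pderivs (indices ?rs ?is) \<psi> (%_. 0)"
 proof (rule pderivs_indices_distinct[OF sym e, symmetric])
  show "distinct ?is" using mis by (metis distinct_upt mset_eq_imp_distinct_iff)
  have "set ?is = set [0..<Suc ?q]" using mis by (rule mset_eq_setD)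
  then show "set ?is \<subseteq> {..<N}" using * d by auto
 qed (use * in auto)
 also have "... = pderivs (indices (rs @ [t]) ([0..<?q] @ [?q])) \<psi> (%_. 0)"
 proof (rule pderivs_mset[OF G e])
  show "mset (indices ?rs ?is) = mset (indices (rs @ [t]) ([0..<?q] @ [?q]))"
   by (rule mset_indices_insert) (use * in auto)
  have "set (indices ?rs ?is) \<subseteq> set ?is" by (rule set_indices) (use * in auto)
  also have "set ?is = set [0..<Suc ?q]" using mis by (rule mset_eq_setD)
  finally show "set (indices ?rs ?is) \<subseteq> {..<N}" using * d by auto
 qed (use e in \<open>simp add: pdisc_def\<close>)
 finally have "pderivs (indices ?rs [0..<length ?rs]) \<psi> (%_. 0) = pderivs (indices (rs @ [t]) [0..<length (rs @ [t])]) \<psi> (%_. 0)"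
  by simp
 moreover have "(\<Prod>r\<leftarrow>?rs. fact r) = (\<Prod>r\<leftarrow>rs @ [t]. (fact r :: complex))"
 proof -
  have "(\<Prod>r\<leftarrow>rs. fact r) = (\<Prod>r\<leftarrow>take j rs. fact r) * (\<Prod>r\<leftarrow>drop j rs. (fact r :: complex))"
   by (metis append_take_drop_id map_append prod_list.append)
  then show ?thesis by (simp add: mult_ac)
 qed
 ultimately show "taylor_coeff \<psi> ?rs = taylor_coeff \<psi> (rs @ [t])"
  unfolding taylor_coeff_def by (simp only:)
qed

lemma taylor_sympoly:
 assumes G: "sepholo N e \<psi>" and sym: "!!s y. s permutes {..<N} ==> y \<in> pdisc N e ==> \<psi> (%i. y (s i)) = \<psi> y"
  and e: "0 < e" and d: "d \<le> N"
 shows "vanO N (d + 1) (%y. \<psi> y - sympoly N d (taylor_coeff \<psi>) y)"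
proof (rule sepholo_sympoly_taylor[OF G e taylor_coeff_insertion_inv[OF G sym e d]])
 fix rs "is" :: "nat list"
 assume *: "length rs = length is" "distinct is" "set is \<subseteq> {..<N}"
 have nz: "(\<Prod>r\<leftarrow>rs. fact r) ~= (0::complex)" by (induction rs) auto
 have "pderivs (indices rs is) \<psi> (%_. 0) = pderivs (indices rs [0..<length rs]) \<psi> (%_. 0)"
  by (rule pderivs_indices_distinct[where \<psi> = \<psi> and N = N and e = e]) (rule sym e * | assumption)+
 then show "pderivs (indices rs is) \<psi> (%_. 0) = taylor_coeff \<psi> rs * (\<Prod>r\<leftarrow>rs. fact r)"
  using nz by (simp add: taylor_coeff_def)
qed

lemma dist_sum_empty: "dist_sum m {} \<rho> y = 1"
 by (induction m) auto

lemma dist_sum_single: "1 \<le> r ==> dist_sum m {..<length [r]} ((!) [r]) y = psum m y r"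
 using dist_sum_insert[of "{}" 0 m "(!) [r]" y]
 by (simp add: dist_sum_empty psum_def lessThan_Suc)

lemma dist_sum_pair:
 assumes "1 \<le> r" "1 \<le> s"
 shows "dist_sum m {..<length [r, s]} ((!) [r, s]) y = psum m y r * psum m y s - psum m y (r + s)"
proof -
 have 1: "dist_sum m {1} \<rho> y = (\<Sum>i<m. y i ^ \<rho> 1)" for \<rho>
  using dist_sum_insert[of "{}" 1 m \<rho> y] by (simp add: dist_sum_empty)
 have "{..<length [r, s]} = insert 0 {1}" by auto
 then show ?thesis
  using dist_sum_insert[of "{1}" 0 m "(!) [r, s]" y] assms 1[of "(!) [r, s]"] 1[of "((!) [r, s])(1 := s + r)"]
  by (simp add: psum_def add.commute)
qed

lemma sepholo_psum: "sepholo m e (%y. psum m y r)"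
 by (cases "r = 0") (auto simp: psum_def sepholo_const intro!: sepholo_sum sepholo_power sepholo_coord)

lemma sepholo_cv: "cv D f g ==> sepholo m e (%y. f N (psum m y))"
 by (induction rule: cv.induct) (auto intro: sepholo_const sepholo_psum sepholo_add sepholo_mult)

text \<open>Lists of length two survive in the limit and enter the covariance, so their form is
  written out. For longer lists any polynomial from \<open>dist_sum_in_power_sums\<close> will do,
  as their coefficients tend to 0.\<close>

definition power_sum_form :: "nat list => point => complex" where
 "power_sum_form rs = (if length rs = 2 then (%v. v (rs ! 0) * v (rs ! 1) - v (rs ! 0 + rs ! 1))
   else SOME g. \<exists>D. cv D (%N. g) g & indep0 g & (\<forall>m y. dist_sum m {..<length rs} ((!) rs) y = g (psum m y)))"

lemma power_sum_form:
 assumes "\<forall>r\<in>set rs. 1 \<le> r"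
 shows "\<exists>D. cv D (%N. power_sum_form rs) (power_sum_form rs)" "indep0 (power_sum_form rs)"
  "dist_sum m {..<length rs} ((!) rs) y = power_sum_form rs (psum m y)"
proof -
 have "(\<exists>D. cv D (%N. power_sum_form rs) (power_sum_form rs) & indep0 (power_sum_form rs) &
   (\<forall>m y. dist_sum m {..<length rs} ((!) rs) y = power_sum_form rs (psum m y)))"
 proof (cases "length rs = 2")
  case True
  then obtain r s where rs: "rs = [r, s]" by (auto simp: numeral_2_eq_2 length_Suc_conv)
  have f: "power_sum_form rs = (%v. v r * v s - v (r + s))" by (simp add: power_sum_form_def rs)
  have r: "1 \<le> r" "1 \<le> s" using assms rs by auto
  show ?thesis unfolding f
  proof (intro exI[of _ "Suc (r + s)"] conjI allI)
   show "cv (Suc (r + s)) (%N v. v r * v s - v (r + s)) (%v. v r * v s - v (r + s))"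
    by (intro cv_diff cv_mult cv_var) auto
   show "indep0 (%v. v r * v s - v (r + s))" using r by (auto simp: indep0_def)
   show "dist_sum m {..<length rs} ((!) rs) y = psum m y r * psum m y s - psum m y (r + s)" for m y
    unfolding rs by (rule dist_sum_pair[OF r])
  qed
 next
  case False
  have "\<forall>j\<in>{..<length rs}. 1 \<le> rs ! j" using assms by auto
  from dist_sum_in_power_sums[OF finite_lessThan this]
  have ex: "\<exists>g. \<exists>D. cv D (%N. g) g & indep0 g & (\<forall>m y. dist_sum m {..<length rs} ((!) rs) y = g (psum m y))" .
  have pf: "power_sum_form rs = (SOME g. \<exists>D. cv D (%N. g) g & indep0 g & (\<forall>m y. dist_sum m {..<length rs} ((!) rs) y = g (psum m y)))"
   using False unfolding power_sum_form_def by (simp only: if_False)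
  have "\<exists>D. cv D (%N. power_sum_form rs) (power_sum_form rs) & indep0 (power_sum_form rs) &
   (\<forall>m y. dist_sum m {..<length rs} ((!) rs) y = power_sum_form rs (psum m y))"
   unfolding pf by (rule someI_ex[OF ex])
  then show ?thesis .
 qed
 then show "\<exists>D. cv D (%N. power_sum_form rs) (power_sum_form rs)" "indep0 (power_sum_form rs)"
  "dist_sum m {..<length rs} ((!) rs) y = power_sum_form rs (psum m y)" by blast+
qed

text \<open>At power sums: half of C r s times the sum of y_i^r y_j^s over i /= j, for r + s <= d.
  The subtracted v (r + s) removes the diagonal.\<close>

definition quadratic_limit :: "nat => (nat => nat => complex) => point => complex" where
 "quadratic_limit d C v = (\<Sum>r\<in>{1..d}. \<Sum>s\<in>{1..d - r}. C r s / 2 * (v r * v s - v (r + s)))"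

lemma vanO_exp_diff:
 assumes h: "vanO m q (%y. g y - f y)" and f: "sepholo m e f" "0 < e"
 shows "vanO m q (%y. exp (g y) - exp (f y))"
proof -
 obtain C \<epsilon> where C: "C \<ge> 0" "\<epsilon> > 0"
  "!!\<delta> y. 0 < \<delta> ==> \<delta> < \<epsilon> ==> (\<forall>i<m. cmod (y i) \<le> \<delta>) ==> (\<forall>i\<ge>m. y i = 0) ==> cmod (g y - f y) \<le> C * \<delta> ^ q"
  using vanOE[OF h] by blast
 have "vanO m q (%y. exp (g y - f y) - 1)"
 proof (rule vanOI[of "C * exp C" "min \<epsilon> 1"])
  fix \<delta> :: real and y :: "nat => complex"
  assume *: "0 < \<delta>" "\<delta> < min \<epsilon> 1" "\<forall>i<m. cmod (y i) \<le> \<delta>" "\<forall>i\<ge>m. y i = 0"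
  have b: "cmod (g y - f y) \<le> C * \<delta> ^ q" by (rule C(3)) (use * in auto)
  also have "C * \<delta> ^ q \<le> C * 1" by (intro mult_left_mono power_le_one) (use * C in auto)
  finally have b1: "cmod (g y - f y) \<le> C" by simp
  have "cmod (exp (g y - f y) - 1) \<le> cmod (g y - f y) * exp (cmod (g y - f y))"
  proof -
   have "cmod (exp (g y - f y) - exp 0) \<le> exp (cmod (g y - f y)) * cmod (g y - f y - 0)"
   proof (rule field_differentiable_bound[of "cball 0 (cmod (g y - f y))" exp exp])
    fix z assume "z \<in> cball (0::complex) (cmod (g y - f y))"
    then show "cmod (exp z) \<le> exp (cmod (g y - f y))"
     using norm_exp[of z] by (auto intro: order_trans)
   qed (auto intro: has_field_derivative_at_within DERIV_exp)
   then show ?thesis by (simp add: mult.commute)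
  qed
  also have "... \<le> (C * \<delta> ^ q) * exp C" by (intro mult_mono b) (use b1 C * in auto)
  finally show "cmod (exp (g y - f y) - 1) \<le> C * exp C * \<delta> ^ q" by (simp add: mult_ac)
 qed (use C in auto)
 from vanO_mult[OF vanO_bounded[OF sepholo_exp[OF f(1)] f(2)] this]
 show ?thesis by (simp add: right_diff_distrib exp_diff)
qed

text \<open>A Taylor coefficient differentiates in as many distinct directions as its list has
  entries. One entry means a coefficient normalised by N, two entries give the limits d, three or
  more tend to 0; these are the three kinds of limits in \<open>appropriate\<close>. N >= b provides
  enough distinct variables.\<close>

lemma log_expansion:
 fixes c :: "nat => real" and d :: "nat => nat => real"
 assumes prob: "!!N. prob_on_GT N (rho N)" and unif: "!!N. sgf_unif_conv N (rho N)"
  and approp: "appropriate (%N. sgf N (rho N)) c d"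
 shows "\<exists>lam qd D. (\<forall>r. lam r \<longlonglongrightarrow> (if r = 0 then 0 else of_real (c r / fact r))) &
  cv D qd (quadratic_limit b (%r s. of_real (d r s / (fact r * fact s)))) & (\<forall>N. indep0 (qd N)) &
  (\<forall>N\<ge>b. N > 0 --> vanO N (b + 1) (%y. sgf N (rho N) (%i. 1 + y i) -
    exp (of_nat N * linear_part b lam N (psum N y) + qd N (psum N y))))"
proof -
 obtain L where L: "!!N. holo_log N (sgf N (rho N)) (L N)"
  and lim1: "!!i k. k \<ge> 1 ==> (%N. pderivs (replicate k i) (L N) ones / of_nat N) \<longlonglongrightarrow> of_real (c k)"
  and lim2: "!!i j k l. i ~= j ==> k \<ge> 1 ==> l \<ge> 1 ==> (%N. pderivs (replicate k i @ replicate l j) (L N) ones) \<longlonglongrightarrow> of_real (d k l)"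
  and lim3: "!!is. card (set is) \<ge> 3 ==> (%N. pderivs is (L N) ones) \<longlonglongrightarrow> 0"
  using approp unfolding appropriate_def by blast
 define \<psi> where "\<psi> = (%N y. L N (%i. 1 + y i) - L N ones)"
 have \<psi>0: "\<psi> N (%_. 0) = 0" for N by (simp add: \<psi>_def ones_def)
 have \<psi>L: "pderivs is (\<psi> N) (%_. 0) = pderivs is (L N) ones" if "is ~= []" for "is" N
  unfolding \<psi>_def pderivs_diff_const[OF that] pderivs_shift by (simp add: ones_def)
 define tc where "tc = (%N. taylor_coeff (\<psi> N))"
 have tc_nil: "tc N [] = 0" for N by (simp add: tc_def taylor_coeff_def indices_def \<psi>0)
 define lam where "lam = (%r N. tc N [r] / of_nat N)"
 define I where "I = {rs \<in> parts b. 2 \<le> length rs}"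
 have finI: "finite I" using finite_parts by (simp add: I_def)
 have I1: "\<forall>r\<in>set rs. 1 \<le> r" if "rs \<in> I" for rs using that by (auto simp: I_def parts_def)
 define qd where "qd = (%N v. \<Sum>rs\<in>I. tc N rs / fact (length rs) * power_sum_form rs v)"
 define lt where "lt = (%rs. if length rs = 2 then complex_of_real (d (rs ! 0) (rs ! 1) / (fact (rs ! 0) * fact (rs ! 1))) else 0)"
 have lam: "lam r \<longlonglongrightarrow> (if r = 0 then 0 else of_real (c r / fact r))" for r
 proof (cases "r = 0")
  case True
  then show ?thesis by (simp add: lam_def tc_def taylor_coeff_def indices_def \<psi>0)
 next
  case False
  have "tc N [r] = pderivs (replicate r 0) (L N) ones / fact r" for N
   using \<psi>L[of "replicate r 0" N] False by (simp add: tc_def taylor_coeff_def indices_def)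
  then have e: "lam r = (%N. (pderivs (replicate r 0) (L N) ones / of_nat N) / fact r)" by (simp add: lam_def fun_eq_iff)
  have "(%N. (pderivs (replicate r 0) (L N) ones / of_nat N) / fact r) \<longlonglongrightarrow> of_real (c r) / fact r"
   by (intro tendsto_divide lim1 tendsto_const) (use False in auto)
  then show ?thesis using False unfolding e by simp
 qed
 have ltc: "(%N. tc N rs) \<longlonglongrightarrow> lt rs" if "rs \<in> I" for rs
 proof -
  have ne: "indices rs [0..<length rs] ~= []"
   using set_indices_eq[of rs "[0..<length rs]"] I1[OF that] that by (auto simp: I_def)
  have e: "(%N. tc N rs) = (%N. pderivs (indices rs [0..<length rs]) (L N) ones / (\<Prod>r\<leftarrow>rs. fact r))"
   unfolding tc_def taylor_coeff_def \<psi>L[OF ne] ..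
  have nz: "(\<Prod>r\<leftarrow>rs. fact r) ~= (0::complex)" for rs :: "nat list" by (induction rs) auto
  show ?thesis
  proof (cases "length rs = 2")
   case True
   then obtain r s where rs: "rs = [r, s]" by (auto simp: numeral_2_eq_2 length_Suc_conv)
   have "(%N. pderivs (replicate r 0 @ replicate s 1) (L N) ones / (fact r * fact s)) \<longlonglongrightarrow> of_real (d r s) / (fact r * fact s)"
    by (intro tendsto_divide lim2 tendsto_const) (use I1[OF that] rs in auto)
   then show ?thesis unfolding e by (simp add: rs indices_def lt_def upt_rec)
  next
   case False
   then have "3 \<le> length rs" using that by (simp add: I_def)
   then have "card (set (indices rs [0..<length rs])) \<ge> 3"
    using set_indices_eq[of rs "[0..<length rs]"] I1[OF that] by simp
   from tendsto_divide[OF lim3[OF this] tendsto_const nz, of rs]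
   show ?thesis unfolding e using False by (simp add: lt_def)
  qed
 qed
 have "\<forall>rs\<in>I. \<exists>D. cv D (%N. power_sum_form rs) (power_sum_form rs)" using power_sum_form(1) I1 by blast
 from bchoice[OF this] obtain D where D: "\<forall>rs\<in>I. cv (D rs) (%N. power_sum_form rs) (power_sum_form rs)" ..
 define B where "B = (\<Sum>rs\<in>I. D rs)"
 have DB: "cv B (%N. power_sum_form rs) (power_sum_form rs)" if "rs \<in> I" for rs
 proof (rule cv_mono)
  show "D rs \<le> B" unfolding B_def by (rule member_le_sum) (use that finI in auto)
 qed (use D that in blast)
 have cvq: "cv B qd (%v. \<Sum>rs\<in>I. lt rs / fact (length rs) * power_sum_form rs v)"
  unfolding qd_def
  by (intro cv_sum cv_mult DB cv_const tendsto_divide ltc tendsto_const) auto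
 have "(\<Sum>rs\<in>I. lt rs / fact (length rs) * power_sum_form rs v) =
   quadratic_limit b (%r s. of_real (d r s / (fact r * fact s))) v" for v
 proof -
  have "(\<Sum>rs\<in>I. lt rs / fact (length rs) * power_sum_form rs v)
    = (\<Sum>rs\<in>{rs \<in> parts b. length rs = 2}. lt rs / fact (length rs) * power_sum_form rs v)"
   by (rule sum.mono_neutral_right) (use finI in \<open>auto simp: I_def lt_def\<close>)
  also have "... = (\<Sum>(r, s)\<in>Sigma {1..b} (%r. {1..b - r}). lt [r, s] / fact 2 * power_sum_form [r, s] v)"
   by (rule sum.reindex_bij_witness[where j = "%rs. (rs ! 0, rs ! 1)" and i = "%(r, s). [r, s]"])
     (auto simp: parts_def numeral_2_eq_2 length_Suc_conv)
  also have "... = quadratic_limit b (%r s. of_real (d r s / (fact r * fact s))) v"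
   unfolding quadratic_limit_def by (subst sum.Sigma[symmetric]) (auto simp: lt_def power_sum_form_def)
  finally show ?thesis .
 qed
 with cvq have cvq': "cv B qd (quadratic_limit b (%r s. of_real (d r s / (fact r * fact s))))" by (simp only:)
 have ind: "indep0 (qd N)" for N
  using power_sum_form(2)[OF I1] unfolding indep0_def qd_def by (intro allI sum.cong[OF refl]) auto
 have main: "vanO N (b + 1) (%y. sgf N (rho N) (%i. 1 + y i) - exp (of_nat N * linear_part b lam N (psum N y) + qd N (psum N y)))"
  if N: "N \<ge> b" "N > 0" for N
 proof -
  have "\<exists>e>0. sepholo N e (\<psi> N) & (\<forall>y\<in>pdisc N e. exp (\<psi> N y) = sgf N (rho N) (%i. 1 + y i)) &
   (\<forall>s y. s permutes {..<N} --> y \<in> pdisc N e --> \<psi> N (%i. y (s i)) = \<psi> N y)"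
   unfolding \<psi>_def by (rule log_properties[OF prob unif L])
  then obtain e where e: "e > 0" "sepholo N e (\<psi> N)" and ex: "!!y. y\<in>pdisc N e ==> exp (\<psi> N y) = sgf N (rho N) (%i. 1 + y i)"
   and sym: "!!s y. s permutes {..<N} ==> y \<in> pdisc N e ==> \<psi> N (%i. y (s i)) = \<psi> N y" by blast
  have sp: "sympoly N b (tc N) y = of_nat N * linear_part b lam N (psum N y) + qd N (psum N y)" for y
  proof -
   \<comment> \<open>Split by length: the empty list contributes \<psi> at the origin, which is 0,
     single entries form the part multiplied by N, and longer lists form \<open>qd\<close>.\<close>
   have "parts b = insert [] ((%r. [r]) ` {1..b}) \<union> I"
   proof (intro equalityI subsetI)
    fix rs assume rs: "rs \<in> parts b"
    show "rs \<in> insert [] ((%r. [r]) ` {1..b}) \<union> I"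
    proof (cases rs)
     case (Cons r rs')
     then show ?thesis using rs by (cases rs') (auto simp: I_def parts_def)
    qed simp
   qed (auto simp: parts_def I_def)
   then have "sympoly N b (tc N) y = (\<Sum>rs\<in>insert [] ((%r. [r]) ` {1..b}). tc N rs / fact (length rs) * dist_sum N {..<length rs} ((!) rs) y)
     + (\<Sum>rs\<in>I. tc N rs / fact (length rs) * dist_sum N {..<length rs} ((!) rs) y)"
    unfolding sympoly_def by (simp only:) (rule sum.union_disjoint, auto simp: finI, auto simp: I_def)
   also have "(\<Sum>rs\<in>insert [] ((%r. [r]) ` {1..b}). tc N rs / fact (length rs) * dist_sum N {..<length rs} ((!) rs) y)
     = (\<Sum>rs\<in>(%r. [r]) ` {1..b}. tc N rs / fact (length rs) * dist_sum N {..<length rs} ((!) rs) y)"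
    by (subst sum.insert) (auto simp: tc_nil)
   also have "... = (\<Sum>r\<in>{1..b}. tc N [r] * psum N y r)"
    by (subst sum.reindex) (auto simp: inj_on_def dist_sum_single[simplified] intro!: sum.cong)
   also have "... = of_nat N * linear_part b lam N (psum N y)"
    using N by (simp add: linear_part_def lam_def sum_distrib_left)
   also have "(\<Sum>rs\<in>I. tc N rs / fact (length rs) * dist_sum N {..<length rs} ((!) rs) y) = qd N (psum N y)"
    unfolding qd_def by (rule sum.cong[OF refl]) (simp only: power_sum_form(3)[OF I1])
   finally show ?thesis .
  qed
  let ?f = "%y. of_nat N * linear_part b lam N (psum N y) + qd N (psum N y)"
  have "sepholo N e (%y. of_nat N * linear_part b lam N (psum N y))"
   unfolding linear_part_def by (intro sepholo_mult sepholo_const sepholo_sum sepholo_psum)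
  then have fh: "sepholo N e ?f" by (intro sepholo_add sepholo_cv[OF cvq'])
  have "vanO N (b + 1) (%y. \<psi> N y - sympoly N b (taylor_coeff (\<psi> N)) y)"
   by (rule taylor_sympoly[OF e(2) _ e(1) N(1)]) (rule sym; assumption)
  moreover have "taylor_coeff (\<psi> N) = tc N" by (simp add: tc_def)
  ultimately have "vanO N (b + 1) (%y. \<psi> N y - ?f y)" by (simp only: sp)
  from vanO_exp_diff[OF this fh e(1)]
  have v: "vanO N (b + 1) (%y. exp (\<psi> N y) - exp (?f y))" .
  obtain C \<epsilon> where C: "C \<ge> 0" "\<epsilon> > 0"
   "!!\<delta> y. 0 < \<delta> ==> \<delta> < \<epsilon> ==> (\<forall>i<N. cmod (y i) \<le> \<delta>) ==> (\<forall>i\<ge>N. y i = 0) ==> cmod (exp (\<psi> N y) - exp (?f y)) \<le> C * \<delta> ^ (b + 1)"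
   using vanOE[OF v] by blast
  show ?thesis
  proof (rule vanOI[OF C(1), of "min \<epsilon> e"])
   fix \<delta> :: real and y :: "nat => complex"
   assume *: "0 < \<delta>" "\<delta> < min \<epsilon> e" "\<forall>i<N. cmod (y i) \<le> \<delta>" "\<forall>i\<ge>N. y i = 0"
   then have "y \<in> pdisc N e" by (auto simp: pdisc_def intro: le_less_trans)
   from ex[OF this] C(3)[of \<delta> y] *
   show "cmod (sgf N (rho N) (%i. 1 + y i) - exp (?f y)) \<le> C * \<delta> ^ (b + 1)" by simp
  qed (use C e in auto)
 qed
 show ?thesis
  by (rule exI[of _ lam], rule exI[of _ qd], rule exI[of _ B]) (use lam cvq' ind main in blast)
qed

text \<open>Inherited from commuting partial derivatives in the variables 0 and 1, both of which are
  present once N >= 2.\<close>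

lemma second_order_symmetric:
 assumes prob: "!!N. prob_on_GT N (rho N)" and unif: "!!N. sgf_unif_conv N (rho N)"
  and approp: "appropriate (%N. sgf N (rho N)) c d" and rs: "1 \<le> r" "1 \<le> s"
 shows "d r s = d s r"
proof -
 obtain L where L: "!!N. holo_log N (sgf N (rho N)) (L N)"
  and lim2: "!!i j k l. i ~= j ==> k \<ge> 1 ==> l \<ge> 1 ==> (%N. pderivs (replicate k i @ replicate l j) (L N) ones) \<longlonglongrightarrow> of_real (d k l)"
  using approp unfolding appropriate_def by blast
 have "\<forall>\<^sub>F N in sequentially. pderivs (replicate r 0 @ replicate s 1) (L N) ones = pderivs (replicate s 1 @ replicate r 0) (L N) ones"
  using eventually_ge_at_top[of 2]
 proof eventually_elim
  case (elim N)
  define \<psi> where "\<psi> = (%y. L N (%i. 1 + y i) - L N ones)"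
  have "\<exists>e>0. sepholo N e \<psi>" using log_properties[OF prob unif L, of N] unfolding \<psi>_def by blast
  then obtain e where e: "e > 0" "sepholo N e \<psi>" by blast
  have "pderivs (replicate r 0 @ replicate s 1) \<psi> (%_. 0) = pderivs (replicate s 1 @ replicate r 0) \<psi> (%_. 0)"
   by (rule pderivs_mset[OF e(2,1)]) (use elim e in \<open>auto simp: pdisc_def\<close>)
  moreover have "pderivs is \<psi> (%_. 0) = pderivs is (L N) ones" if "is ~= []" for "is"
   unfolding \<psi>_def pderivs_diff_const[OF that] pderivs_shift by (simp add: ones_def)
  ultimately show ?case using rs by simp
 qed
 from Lim_transform_eventually[OF lim2[of 0 1 r s] this]
 have "(%N. pderivs (replicate s 1 @ replicate r 0) (L N) ones) \<longlonglongrightarrow> of_real (d r s)" using rs by simp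
 from LIMSEQ_unique[OF this lim2[of 1 0 s r]] rs show ?thesis by simp
qed

section \<open>The eigenvalue equation for D_k and its compatibility with branching\<close>

subsection \<open>Schur functions as eigenfunctions\<close>

lemma vander_upd: "i < m ==> \<exists>c. \<forall>z. vander m (x(i := z)) = c * (\<Prod>a\<in>{..<m} - {i}. (z - x a))"
proof (induction m)
 case (Suc m)
 show ?case
 proof (cases "i = m")
  case True
  have v: "vander m (x(m := z)) = vander m x" for z
   unfolding vander_def by (intro prod.cong refl) auto
  have "(\<Prod>a<m. ((x(m := z)) a - (x(m := z)) m)) = (-1) ^ m * (\<Prod>a<m. (z - x a))" for z
  proof -
   have "(\<Prod>a<m. ((x(m := z)) a - (x(m := z)) m)) = (\<Prod>a<m. (-1) * (z - x a))"
    by (intro prod.cong refl) auto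
   then show ?thesis by (simp only: prod.distrib prod_constant card_lessThan)
  qed
  then show ?thesis
   unfolding True vander_Suc v by (intro exI[of _ "vander m x * (-1) ^ m"]) (simp add: lessThan_Suc)
 next
  case False
  then have i: "i < m" using Suc.prems by simp
  obtain c where c: "!!z. vander m (x(i := z)) = c * (\<Prod>a\<in>{..<m} - {i}. (z - x a))" using Suc.IH[OF i] by blast
  have "(\<Prod>a<m. ((x(i := z)) a - (x(i := z)) m)) = (z - x m) * (\<Prod>a\<in>{..<m} - {i}. (x a - x m))" for z
  proof -
   have "(\<Prod>a<m. ((x(i := z)) a - (x(i := z)) m)) = ((x(i := z)) i - (x(i := z)) m) * (\<Prod>a\<in>{..<m} - {i}. ((x(i := z)) a - (x(i := z)) m))"
    by (rule prod.remove) (use i in auto)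
   also have "(\<Prod>a\<in>{..<m} - {i}. ((x(i := z)) a - (x(i := z)) m)) = (\<Prod>a\<in>{..<m} - {i}. (x a - x m))"
    by (intro prod.cong refl) (use False in auto)
   finally show ?thesis using False by simp
  qed
  moreover have "(\<Prod>a\<in>{..<Suc m} - {i}. (z - x a)) = (z - x m) * (\<Prod>a\<in>{..<m} - {i}. (z - x a))" for z
  proof -
   have "{..<Suc m} - {i} = insert m ({..<m} - {i})" using False by auto
   then show ?thesis by simp
  qed
  ultimately show ?thesis
   unfolding vander_Suc c by (intro exI[of _ "c * (\<Prod>a\<in>{..<m} - {i}. (x a - x m))"]) (simp add: mult_ac)
 qed
qed simp

definition shifted_psum :: "nat => nat => int list => complex" where
 "shifted_psum m k lam = (\<Sum>i<m. of_int (expo m lam i) ^ k)"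

lemma theta_powi: "1 + z ~= 0 ==> (theta ^^ k) (%z. (1 + z) powi e) z = of_int e ^ k * (1 + z) powi e"
proof (induction k arbitrary: z)
 case (Suc k)
 have "eventually (%t. (theta ^^ k) (%z. (1 + z) powi e) t = of_int e ^ k * (1 + t) powi e) (nhds z)"
 proof (rule eventually_nhds_in_open[THEN eventually_mono, of "- {- 1}"])
  show "z \<in> - {- 1}" using Suc.prems by auto
  show "(theta ^^ k) (%z. (1 + z) powi e) t = of_int e ^ k * (1 + t) powi e" if "t \<in> - {- 1}" for t
   by (rule Suc.IH) (use that in \<open>auto simp: add_eq_0_iff\<close>)
 qed auto
 then have "deriv ((theta ^^ k) (%z. (1 + z) powi e)) z = deriv (%t. of_int e ^ k * (1 + t) powi e) z"
  by (rule deriv_cong_ev) simp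
 also have "... = of_int e ^ k * (of_int e * (1 + z) powi (e - 1))"
  by (rule DERIV_imp_deriv) (use Suc.prems in \<open>auto intro!: derivative_eq_intros\<close>)
 finally have *: "deriv ((theta ^^ k) (%z. (1 + z) powi e)) z = of_int e ^ k * (of_int e * (1 + z) powi (e - 1))" .
 show ?case
  unfolding theta_pow_Suc * using Suc.prems by (simp add: power_int_diff)
qed simp

text \<open>Up to a factor constant in z, \<open>nodeprod\<close> times \<open>chi\<close> is the
  numerator determinant, whose terms are powers of 1 + z and hence eigenfunctions of
  \<open>theta\<close>. Each permutation contributes the k-th powers of the exponents it assigns to
  the rows, and their sum over the rows is the same for all permutations.\<close>

lemma chi_eigen:
 assumes lam: "lam \<in> GT m" and y: "y \<in> pdisc m (1 / 2)" and dist: "distinct_coords m y"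
 shows "Dop k m (chi m lam) y = shifted_psum m k lam * chi m lam y"
proof -
 define x where "x = (%i. 1 + y i)"
 let ?P = "{p. p permutes {..<m}}" and ?s1 = "sp m lam ones"
 have finP: "finite ?P" by (simp add: finite_permutations)
 define t where "t = (%p. of_int (sign p) * (\<Prod>l<m. x l powi expo m lam (p l)))"
 have nz: "x i ~= 0" if "i < m" for i using shifted_nonzero[OF y that] by (simp add: x_def)
 have sl: "1 + z ~= 0" if "z \<in> ball 0 (1 / 2)" for z :: complex
 proof
  assume "1 + z = 0"
  then have "z = - 1" by (simp add: add_eq_0_iff)
  then show False using that by simp
 qed
 have V: "vander m x ~= 0"
 proof (rule vander_nonzero)
  show "x \<in> generic_pts m" using nz dist by (auto simp: generic_pts_def x_def distinct_coords_def)
 qed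
 have chi: "?s1 * vander m x * chi m lam y = (\<Sum>p\<in>?P. t p)"
 proof -
  have "(\<Sum>p\<in>?P. t p) = detN m (%i j. x i powi expo m lam j)" by (simp add: detN_def t_def)
  also have "... = vander m x * sp m lam x" by (rule det_eq_vander_sp[OF lam nz])
  finally show ?thesis using sp_ones_nonzero[OF lam] by (simp add: chi_def x_def)
 qed
 have main: "(theta ^^ k) (%z. nodeprod m y i z * chi m lam (y(i := z))) (y i) / nodeprod m y i (y i)
   = (\<Sum>p\<in>?P. of_int (expo m lam (p i)) ^ k * t p) / (?s1 * vander m x)" if i: "i < m" for i
 proof -
  obtain c where c: "!!z. vander m (x(i := z)) = c * (\<Prod>a\<in>{..<m} - {i}. (z - x a))" using vander_upd[OF i] by blast
  have np: "vander m (x(i := 1 + z)) = c * nodeprod m y i z" for z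
   unfolding c nodeprod_def by (simp add: x_def)
  have cv: "c * nodeprod m y i (y i) = vander m x" using np[of "y i"] by (simp add: x_def fun_upd_idem)
  then have c0: "c ~= 0" "nodeprod m y i (y i) ~= 0" using V by auto
  define w where "w = (%p. of_int (sign p) * (\<Prod>l\<in>{..<m} - {i}. x l powi expo m lam (p l)))"
  have tw: "t p = w p * x i powi expo m lam (p i)" for p
   unfolding t_def w_def using i by (subst prod.remove[of _ i]) auto
  have eq: "nodeprod m y i z * chi m lam (y(i := z)) = (\<Sum>p\<in>?P. 1 / (c * ?s1) * w p * (1 + z) powi expo m lam (p i))"
   if z: "z \<in> ball 0 (1 / 2)" for z
  proof -
   have xz: "(%j. 1 + (y(i := z)) j) = x(i := 1 + z)" by (auto simp: x_def)
   have "vander m (x(i := 1 + z)) * sp m lam (x(i := 1 + z)) = detN m (%l j. (x(i := 1 + z)) l powi expo m lam j)"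
    by (rule det_eq_vander_sp[OF lam, symmetric]) (use nz sl[OF z] in auto)
   also have "... = (\<Sum>p\<in>?P. w p * (1 + z) powi expo m lam (p i))"
    unfolding detN_def
   proof (rule sum.cong[OF refl])
    fix p
    have "(\<Prod>l<m. (x(i := 1 + z)) l powi expo m lam (p l)) = (1 + z) powi expo m lam (p i) *
      (\<Prod>l\<in>{..<m} - {i}. (x(i := 1 + z)) l powi expo m lam (p l))"
     using i by (subst prod.remove[of _ i]) auto
    also have "(\<Prod>l\<in>{..<m} - {i}. (x(i := 1 + z)) l powi expo m lam (p l)) = (\<Prod>l\<in>{..<m} - {i}. x l powi expo m lam (p l))"
     by (intro prod.cong refl) auto
    finally show "of_int (sign p) * (\<Prod>l<m. (x(i := 1 + z)) l powi expo m lam (p l)) = w p * (1 + z) powi expo m lam (p i)"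
     by (simp add: w_def mult_ac)
   qed
   finally have "c * nodeprod m y i z * sp m lam (x(i := 1 + z)) = (\<Sum>p\<in>?P. w p * (1 + z) powi expo m lam (p i))" by (simp add: np)
   then have "c * ?s1 * (nodeprod m y i z * chi m lam (y(i := z))) = (\<Sum>p\<in>?P. w p * (1 + z) powi expo m lam (p i))"
    using sp_ones_nonzero[OF lam] by (simp add: chi_def xz[unfolded fun_upd_def] fun_upd_def mult_ac)
   then have "nodeprod m y i z * chi m lam (y(i := z)) = 1 / (c * ?s1) * (\<Sum>p\<in>?P. w p * (1 + z) powi expo m lam (p i))"
    using c0 sp_ones_nonzero[OF lam] by (simp add: field_simps)
   then show ?thesis by (simp add: sum_distrib_left mult_ac)
  qed
  have yi: "y i \<in> ball 0 (1 / 2)" using y i by (simp add: pdisc_def)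
  have hol: "(%z. (1 + z) powi e) holomorphic_on ball 0 (1 / 2)" for e
   by (intro holomorphic_intros) (use sl in auto)
  have thsum: "(theta ^^ k) (%z. \<Sum>p\<in>A. 1 / (c * ?s1) * w p * (1 + z) powi expo m lam (p i)) (y i)
    = (\<Sum>p\<in>A. 1 / (c * ?s1) * w p * (of_int (expo m lam (p i)) ^ k * (1 + y i) powi expo m lam (p i)))" if "finite A" for A
   using that
  proof (induction A rule: finite_induct)
   case empty
   have "(theta ^^ k) (%z. 0 * (0::complex)) (y i) = 0 * (theta ^^ k) (%z. 0) (y i)"
    by (rule theta_pow_cmult[OF open_ball _ yi]) (intro holomorphic_intros)
   then show ?case by simp
  next
   case (insert p A)
   have "(theta ^^ k) (%z. \<Sum>p\<in>insert p A. 1 / (c * ?s1) * w p * (1 + z) powi expo m lam (p i)) (y i) =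
     (theta ^^ k) (%z. 1 / (c * ?s1) * w p * (1 + z) powi expo m lam (p i) + (\<Sum>p\<in>A. 1 / (c * ?s1) * w p * (1 + z) powi expo m lam (p i))) (y i)"
    using insert.hyps by simp
   also have "... = (theta ^^ k) (%z. 1 / (c * ?s1) * w p * (1 + z) powi expo m lam (p i)) (y i) +
     (theta ^^ k) (%z. \<Sum>p\<in>A. 1 / (c * ?s1) * w p * (1 + z) powi expo m lam (p i)) (y i)"
    by (rule theta_pow_add[OF open_ball _ _ yi]) (intro holomorphic_on_mult holomorphic_on_const holomorphic_on_sum hol)+
   also have "(theta ^^ k) (%z. 1 / (c * ?s1) * w p * (1 + z) powi expo m lam (p i)) (y i)
     = 1 / (c * ?s1) * w p * (theta ^^ k) (%z. (1 + z) powi expo m lam (p i)) (y i)"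
    by (rule theta_pow_cmult[OF open_ball hol yi])
   also have "(theta ^^ k) (%z. (1 + z) powi expo m lam (p i)) (y i) = of_int (expo m lam (p i)) ^ k * (1 + y i) powi expo m lam (p i)"
    by (rule theta_powi[OF sl[OF yi]])
   finally show ?case using insert by simp
  qed
  have "(theta ^^ k) (%z. nodeprod m y i z * chi m lam (y(i := z))) (y i)
   = (theta ^^ k) (%z. \<Sum>p\<in>?P. 1 / (c * ?s1) * w p * (1 + z) powi expo m lam (p i)) (y i)"
   by (rule theta_pow_cong[OF open_ball eq yi])
  also have "... = (\<Sum>p\<in>?P. 1 / (c * ?s1) * (of_int (expo m lam (p i)) ^ k * t p))"
   unfolding thsum[OF finP] tw by (intro sum.cong refl) (simp add: x_def)
  also have "... = 1 / (c * ?s1) * (\<Sum>p\<in>?P. of_int (expo m lam (p i)) ^ k * t p)"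
   unfolding sum_distrib_left ..
  finally show ?thesis using c0 cv[symmetric] by simp
 qed
 have "Dop k m (chi m lam) y = (\<Sum>i<m. \<Sum>p\<in>?P. of_int (expo m lam (p i)) ^ k * t p) / (?s1 * vander m x)"
  unfolding Dop_def sum_divide_distrib by (rule sum.cong[OF refl]) (use main in \<open>simp add: sum_divide_distrib\<close>)
 also have "(\<Sum>i<m. \<Sum>p\<in>?P. of_int (expo m lam (p i)) ^ k * t p) = (\<Sum>p\<in>?P. (\<Sum>i<m. of_int (expo m lam (p i)) ^ k) * t p)"
  unfolding sum_distrib_right by (rule sum.swap)
 also have "... = (\<Sum>p\<in>?P. shifted_psum m k lam * t p)"
 proof (rule sum.cong[OF refl])
  fix p assume "p \<in> ?P"
  then have "p permutes {..<m}" by simp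
  from sum.permute[OF this, of "%j. complex_of_int (expo m lam j) ^ k"]
  show "(\<Sum>i<m. of_int (expo m lam (p i)) ^ k) * t p = shifted_psum m k lam * t p"
   by (simp add: shifted_psum_def o_def)
 qed
 also have "... = shifted_psum m k lam * (?s1 * vander m x * chi m lam y)" unfolding chi sum_distrib_left ..
 finally show ?thesis using V sp_ones_nonzero[OF lam] by simp
qed

lemma chi_branch:
 assumes lam: "lam \<in> GT m" and m: "m' \<le> m" and y: "y \<in> pdisc m' (1 / 2)"
 shows "chi m lam y = (\<Sum>mu | prc m m' lam mu ~= 0. of_real (prc m m' lam mu) * chi m' mu y)"
proof -
 have "sp m lam (%i. 1 + y i) = sp m lam (%i. if i < m' then 1 + y i else 1)"
  by (rule sp_cong) (use y in \<open>auto simp: pdisc_def\<close>)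
 then show ?thesis
  unfolding chi_def using prc_properties(4)[OF lam m, of "%i. 1 + y i"] shifted_nonzero[OF y] by simp
qed

lemma prc_sum: "lam \<in> GT m ==> m' \<le> m ==> (\<Sum>mu | prc m m' lam mu ~= 0. of_real (prc m m' lam mu)) = (1::complex)"
proof -
 assume *: "lam \<in> GT m" "m' \<le> m"
 have "(%_. 0) \<in> pdisc m' (1 / 2)" by (simp add: pdisc_def)
 from chi_branch[OF * this] chi_0[OF *(1)]
 have "1 = (\<Sum>mu | prc m m' lam mu ~= 0. of_real (prc m m' lam mu) * chi m' mu (%_. 0))" by simp
 also have "... = (\<Sum>mu | prc m m' lam mu ~= 0. of_real (prc m m' lam mu))"
  by (rule sum.cong[OF refl]) (use prc_properties(2)[OF *] chi_0 in auto)
 finally show ?thesis ..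
qed

section \<open>Operators under the expectation and their generating functions\<close>

subsection \<open>Applying operators to uniformly convergent Schur expansions\<close>

text \<open>Kernels of finite support. Later \<T> g lam is the contribution of the top signature lam
  to the expectation of g at the current lower signature, with the collected factors included.
  Finiteness lets D_k act on it term by term.\<close>

definition finop :: "nat => ((int list => complex) => int list => complex) => bool" where
 "finop m \<T> \<longleftrightarrow> (\<exists>M Q. \<forall>lam. finite (M lam) & M lam \<subseteq> GT m & (\<forall>g. \<T> g lam = (\<Sum>mu\<in>M lam. Q lam mu * g mu)))"

text \<open>\<T> stays outermost: new factors and transitions are placed next to its argument,
  because the chain is built from the top level downwards.\<close>

definition insert_factor :: "(int list => complex) => ((int list => complex) => int list => complex) => (int list => complex) => int list => complex" where
 "insert_factor x \<T> g = \<T> (%mu. x mu * g mu)"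

definition transition :: "nat => nat => (int list => complex) => int list => complex" where
 "transition m m' g lam = (\<Sum>mu | prc m m' lam mu ~= 0. of_real (prc m m' lam mu) * g mu)"

lemma finop_cong: "finop m \<T> ==> (!!mu. mu \<in> GT m ==> g mu = h mu) ==> \<T> g lam = \<T> h lam"
proof -
 assume "finop m \<T>" and eq: "!!mu. mu \<in> GT m ==> g mu = h mu"
 then obtain M Q where M: "!!lam. M lam \<subseteq> GT m" and Q: "!!g lam. \<T> g lam = (\<Sum>mu\<in>M lam. Q lam mu * g mu)"
  unfolding finop_def by blast
 have "g mu = h mu" if "mu \<in> M lam" for mu using M eq that by blast
 then show ?thesis unfolding Q by simp
qed

lemma finop_linear:
 assumes "finop m \<T>" shows "\<T> (%mu. a * g mu + b * h mu) lam = a * \<T> g lam + b * \<T> h lam"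
proof -
 obtain M Q where MQ: "!!g lam. \<T> g lam = (\<Sum>mu\<in>M lam. Q lam mu * g mu)" using assms unfolding finop_def by blast
 show ?thesis unfolding MQ by (simp add: sum_distrib_left sum.distrib[symmetric] algebra_simps)
qed

lemma finop_insert_factor: "finop m \<T> ==> finop m (insert_factor x \<T>)"
proof -
 assume "finop m \<T>"
 then obtain M Q where MQ: "\<forall>lam. finite (M lam) & M lam \<subseteq> GT m & (\<forall>g. \<T> g lam = (\<Sum>mu\<in>M lam. Q lam mu * g mu))"
  unfolding finop_def by blast
 show "finop m (insert_factor x \<T>)"
  unfolding finop_def insert_factor_def
  by (rule exI[of _ M], rule exI[of _ "%lam mu. Q lam mu * x mu"]) (use MQ in \<open>simp add: mult_ac\<close>)
qed

lemma finop_transition: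
 assumes "finop m \<T>" "m' \<le> m" shows "finop m' (%g. \<T> (transition m m' g))"
proof -
 obtain M Q where M: "!!lam. finite (M lam)" "!!lam. M lam \<subseteq> GT m" and Q: "!!g lam. \<T> g lam = (\<Sum>mu\<in>M lam. Q lam mu * g mu)"
  using assms(1) unfolding finop_def by blast
 define M' where "M' = (%lam. \<Union>mu\<in>M lam. {nu. prc m m' mu nu ~= 0})"
 have fin: "finite {nu. prc m m' mu nu ~= 0}" "{nu. prc m m' mu nu ~= 0} \<subseteq> GT m'" if "mu \<in> M lam" for lam mu
  using prc_properties(2,3)[of mu m m'] M(2) that assms(2) by blast+
 have finM': "finite (M' lam)" for lam unfolding M'_def using M(1) fin(1) by blast
 show ?thesis
  unfolding finop_def
 proof (rule exI[of _ M'], rule exI[of _ "%lam nu. \<Sum>mu\<in>M lam. Q lam mu * of_real (prc m m' mu nu)"], intro allI conjI)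
  show "M' lam \<subseteq> GT m'" for lam unfolding M'_def using fin(2) by blast
  show "\<T> (transition m m' g) lam = (\<Sum>nu\<in>M' lam. (\<Sum>mu\<in>M lam. Q lam mu * of_real (prc m m' mu nu)) * g nu)" for lam g
  proof -
   have "\<T> (transition m m' g) lam = (\<Sum>mu\<in>M lam. \<Sum>nu\<in>M' lam. Q lam mu * of_real (prc m m' mu nu) * g nu)"
    unfolding Q
   proof (rule sum.cong[OF refl])
    fix mu assume "mu \<in> M lam"
    then have "transition m m' g mu = (\<Sum>nu\<in>M' lam. of_real (prc m m' mu nu) * g nu)"
     unfolding transition_def by (intro sum.mono_neutral_left[OF finM']) (auto simp: M'_def)
    then show "Q lam mu * transition m m' g mu = (\<Sum>nu\<in>M' lam. Q lam mu * of_real (prc m m' mu nu) * g nu)"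
     by (simp add: sum_distrib_left mult_ac)
   qed
   then show ?thesis by (subst (asm) sum.swap) (simp add: sum_distrib_right)
  qed
 qed (rule finM')
qed

definition expands :: "int list set => nat => ((int list => complex) => int list => complex) => real => (point => complex) => bool" where
 "expands I m \<T> e F \<longleftrightarrow> finop m \<T> & 0 < e & e \<le> 1 / 2 & usum m e I (%lam y. \<T> (%mu. chi m mu y) lam) F"

lemma sepholo_finop:
 assumes "finop m \<T>" "0 < e" "e \<le> 1 / 2" shows "sepholo m e (%y. \<T> (%mu. chi m mu y) lam)"
proof -
 obtain M Q where Q: "!!g lam. \<T> g lam = (\<Sum>mu\<in>M lam. Q lam mu * g mu)" using assms(1) unfolding finop_def by blast
 show ?thesis unfolding Q
  by (intro sepholo_sum sepholo_mult sepholo_const sepholo_mono[OF sepholo_chi]) (use assms in auto)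
qed

lemma expands_sepholo: "expands I m \<T> e F ==> sepholo m e F"
 unfolding expands_def using usum_sepholo[where \<Psi> = "%lam y. \<T> (%mu. chi m mu y) lam"] sepholo_finop by blast

lemma expands_has_sum: "expands I m \<T> e F ==> ((%lam. \<T> (%mu. 1) lam) has_sum F (%_. 0)) I"
proof -
 assume *: "expands I m \<T> e F"
 have "((%lam. \<T> (%mu. chi m mu (%_. 0)) lam) has_sum F (%_. 0)) I"
  by (rule usum_has_sum[where \<Psi> = "%lam y. \<T> (%mu. chi m mu y) lam"]) (use * in \<open>auto simp: expands_def pdisc_def\<close>)
 moreover have "\<T> (%mu. chi m mu (%_. 0)) lam = \<T> (%mu. 1) lam" for lam
  by (rule finop_cong[of m]) (use * in \<open>auto simp: expands_def chi_0\<close>)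
 ultimately show ?thesis by simp
qed

text \<open>\<open>chi\<close> is an eigenfunction with the power sum as eigenvalue, so inserting
  the factor means applying \<alpha> D_k - \<beta> to the generating function.
  \<open>usum_Dop\<close> justifies the exchange with the infinite sum, at the price of a smaller
  polydisc.\<close>

lemma expands_factor:
 assumes ex: "expands I m \<T> e F"
 shows "\<exists>e' F1. 0 < e' & e' \<le> e & sepholo m e' F1 & (\<forall>y\<in>pdisc m e'. distinct_coords m y --> F1 y = Dop k m F y) &
   expands I m (insert_factor (%mu. \<alpha> * shifted_psum m k mu - \<beta>) \<T>) e' (%y. \<alpha> * F1 y - \<beta> * F y)"
proof -
 have f: "finop m \<T>" and e: "0 < e" "e \<le> 1 / 2" and us: "usum m e I (%lam y. \<T> (%mu. chi m mu y) lam) F"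
  using ex by (auto simp: expands_def)
 let ?T = "insert_factor (shifted_psum m k) \<T>"
 have f': "finop m ?T" by (rule finop_insert_factor[OF f])
 obtain M Q where M: "!!lam. finite (M lam)" "!!lam. M lam \<subseteq> GT m" and Q: "!!g lam. \<T> g lam = (\<Sum>mu\<in>M lam. Q lam mu * g mu)"
  using f unfolding finop_def by blast
 have D: "?T (%mu. chi m mu y) lam = Dop k m (%y. \<T> (%mu. chi m mu y) lam) y"
  if y: "y \<in> pdisc m e" and d: "distinct_coords m y" for y lam
 proof -
  have y2: "y \<in> pdisc m (1 / 2)" using y pdisc_mono[of m m e "1/2"] e by auto
  have "Dop k m (%y. \<Sum>mu\<in>M lam. Q lam mu * chi m mu y) y = (\<Sum>mu\<in>M lam. Dop k m (%y. Q lam mu * chi m mu y) y)"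
   by (rule Dop_sum[OF _ y2]) (intro sepholo_mult sepholo_const sepholo_chi)
  also have "... = (\<Sum>mu\<in>M lam. Q lam mu * (shifted_psum m k mu * chi m mu y))"
  proof (rule sum.cong[OF refl])
   fix mu assume "mu \<in> M lam"
   then have "mu \<in> GT m" using M(2) by blast
   then show "Dop k m (%y. Q lam mu * chi m mu y) y = Q lam mu * (shifted_psum m k mu * chi m mu y)"
    using Dop_cmult[OF sepholo_chi y2] chi_eigen[OF _ y2 d] by simp
  qed
  finally show ?thesis unfolding insert_factor_def Q by simp
 qed
 obtain e' F1 where e': "0 < e'" "e' \<le> e" and us1: "usum m e' I (%lam y. ?T (%mu. chi m mu y) lam) F1"
  and F1: "\<forall>y\<in>pdisc m e'. distinct_coords m y --> F1 y = Dop k m F y"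
  using usum_Dop[OF e(1) sepholo_finop[OF f e] sepholo_finop[OF f' e] D us] by blast
 have us': "usum m e' I (%lam y. \<T> (%mu. chi m mu y) lam) F"
  by (rule usum_subset[OF us]) (rule pdisc_mono, use e' in auto)
 have "usum m e' I (%lam y. \<alpha> * ?T (%mu. chi m mu y) lam - \<beta> * \<T> (%mu. chi m mu y) lam) (%y. \<alpha> * F1 y - \<beta> * F y)"
  using us1 us' unfolding usum_def sum_subtractf sum_distrib_left[symmetric]
  by (intro uniform_limit_minus bounded_linear.uniform_limit[OF bounded_linear_mult_right])
 moreover have "insert_factor (%mu. \<alpha> * shifted_psum m k mu - \<beta>) \<T> g lam = \<alpha> * ?T g lam - \<beta> * \<T> g lam" for g lam
  unfolding insert_factor_def using finop_linear[OF f, of \<alpha> "%mu. shifted_psum m k mu * g mu" "- \<beta>" g lam]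
  by (simp add: algebra_simps)
 ultimately have "expands I m (insert_factor (%mu. \<alpha> * shifted_psum m k mu - \<beta>) \<T>) e' (%y. \<alpha> * F1 y - \<beta> * F y)"
  using finop_insert_factor[OF f, of "%mu. \<alpha> * shifted_psum m k mu - \<beta>"] e e' by (simp add: expands_def)
 moreover have "sepholo m e' F1"
  by (rule usum_sepholo[OF _ us1]) (rule sepholo_finop[OF f'], use e e' in auto)
 ultimately show ?thesis using e' F1 by blast
qed

text \<open>\<open>pdisc m'\<close> lies in \<open>pdisc m\<close>, so setting the surplus variables
  to 0 is a restriction, under which the normalised Schur functions split by
  \<open>chi_branch\<close>.\<close>

lemma expands_transition:
 assumes ex: "expands I m \<T> e F" and m: "m' \<le> m"
 shows "expands I m' (%g. \<T> (transition m m' g)) e F"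
proof -
 have f: "finop m \<T>" and e: "0 < e" "e \<le> 1 / 2" and us: "usum m e I (%lam y. \<T> (%mu. chi m mu y) lam) F"
  using ex by (auto simp: expands_def)
 have "usum m' e I (%lam y. \<T> (%mu. chi m mu y) lam) F"
  by (rule usum_subset[OF us pdisc_mono]) (use e m in auto)
 then have "usum m' e I (%lam y. \<T> (transition m m' (%nu. chi m' nu y)) lam) F"
  unfolding usum_def
 proof (rule uniform_limit_cong[THEN iffD1, rotated -1])
  show "\<forall>\<^sub>F A in finite_subsets_at_top I. \<forall>y\<in>pdisc m' e.
    (\<Sum>lam\<in>A. \<T> (%mu. chi m mu y) lam) = (\<Sum>lam\<in>A. \<T> (transition m m' (%nu. chi m' nu y)) lam)"
  proof (intro always_eventually allI ballI sum.cong[OF refl] finop_cong[OF f])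
   fix y mu assume "y \<in> pdisc m' e" "mu \<in> GT m"
   then show "chi m mu y = transition m m' (%nu. chi m' nu y) mu"
    unfolding transition_def using pdisc_mono[of m' m' e "1/2"] e by (intro chi_branch[OF _ m]) auto
  qed
 qed simp
 then show ?thesis using finop_transition[OF f m] e by (simp add: expands_def)
qed

text \<open>F is the exact generating function after the operations done so far, E \<phi> its model
  in power sums, and q the remaining budget of vanishing orders.\<close>

definition tracks :: "int list set => nat => nat => ((int list => complex) => int list => complex) =>
  (point => complex) => (point => complex) => bool" where
 "tracks I m q \<T> E \<phi> \<longleftrightarrow> (\<exists>e F. expands I m \<T> e F & vanO m q (%y. F y - E (psum m y) * \<phi> (psum m y)))"

lemma vanO_cmult: "vanO m q F ==> vanO m q (%y. c * F y)"
 using vanO_mult[OF vanO_bounded[OF sepholo_const, of 1 m c], of q F] by simp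

text \<open>D_k costs the error k orders by \<open>vanO_Dop\<close> and acts on the model as
  prescribed. In the application A is N^k and \<beta> is the centering.\<close>

lemma tracks_factor:
 assumes tr: "tracks I m q \<T> E \<phi>" and k: "k \<le> q" and A: "A ~= 0"
  and E: "!!e. sepholo m e (%y. E (psum m y))" and \<phi>: "!!e. sepholo m e (%y. \<phi> (psum m y))"
  and \<psi>: "!!e. sepholo m e (%y. \<psi> (psum m y))"
  and D: "!!y. distinct_coords m y ==> Dop k m (%y. E (psum m y) * \<phi> (psum m y)) y =
    A * E (psum m y) * (\<psi> (psum m y) + \<mu> * \<phi> (psum m y))"
 shows "tracks I m (q - k) (insert_factor (%mu. 1 / A * shifted_psum m k mu - \<beta>) \<T>) E (%v. \<psi> v + (\<mu> - \<beta>) * \<phi> v)"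
proof -
 obtain e F where ex: "expands I m \<T> e F" and van: "vanO m q (%y. F y - E (psum m y) * \<phi> (psum m y))"
  using tr unfolding tracks_def by blast
 obtain e' F1 where e': "0 < e'" "e' \<le> e" and F1: "sepholo m e' F1" "\<forall>y\<in>pdisc m e'. distinct_coords m y --> F1 y = Dop k m F y"
  and ex': "expands I m (insert_factor (%mu. 1 / A * shifted_psum m k mu - \<beta>) \<T>) e' (%y. 1 / A * F1 y - \<beta> * F y)"
  using expands_factor[OF ex, where k = k and \<alpha> = "1 / A" and \<beta> = \<beta>] by blast
 let ?g = "%y. F y - E (psum m y) * \<phi> (psum m y)"
 let ?G = "%y. F1 y - A * E (psum m y) * (\<psi> (psum m y) + \<mu> * \<phi> (psum m y))"
 have Fh: "sepholo m e' F" by (rule sepholo_mono[OF expands_sepholo[OF ex]]) (use e' in auto)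
 have E\<phi>: "sepholo m e' (%y. E (psum m y) * \<phi> (psum m y))" by (intro sepholo_mult E \<phi>)
 have gh: "sepholo m e' ?g" by (intro sepholo_diff Fh E\<phi>)
 have Gh: "sepholo m e' ?G" by (intro sepholo_diff F1 sepholo_mult sepholo_add sepholo_const E \<phi> \<psi>)
 have "vanO m (q - k) ?G"
 proof (rule vanO_Dop[OF gh Gh e'(1) _ van k])
  fix y assume y: "y \<in> pdisc m e'" "distinct_coords m y"
  show "?G y = Dop k m ?g y"
   unfolding Dop_diff[OF Fh E\<phi> y(1)] D[OF y(2)] using F1(2) y by simp
 qed
 then have "vanO m (q - k) (%y. 1 / A * ?G y + (- \<beta>) * ?g y)"
  by (intro vanO_add vanO_cmult vanO_mono[OF van]) auto
 moreover have "1 / A * ?G y + (- \<beta>) * ?g y = 1 / A * F1 y - \<beta> * F y - E (psum m y) * (\<psi> (psum m y) + (\<mu> - \<beta>) * \<phi> (psum m y))" for y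
  using A by (simp add: field_simps)
 ultimately have "vanO m (q - k) (%y. 1 / A * F1 y - \<beta> * F y - E (psum m y) * (\<psi> (psum m y) + (\<mu> - \<beta>) * \<phi> (psum m y)))"
  by (simp only:)
 then show ?thesis using ex' unfolding tracks_def by blast
qed

lemma psum_restrict: "m' \<le> m ==> (!!i. m' \<le> i ==> y i = 0) ==> psum m y = psum m' y"
 by (rule ext) (auto simp: psum_def intro!: sum.mono_neutral_right, meson not_le_imp_less)

lemma tracks_transition:
 assumes tr: "tracks I m q \<T> E \<phi>" and m: "m' \<le> m"
 shows "tracks I m' q (%g. \<T> (transition m m' g)) E \<phi>"
proof -
 obtain e F where ex: "expands I m \<T> e F" and van: "vanO m q (%y. F y - E (psum m y) * \<phi> (psum m y))"
  using tr unfolding tracks_def by blast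
 obtain C \<epsilon> where C: "C \<ge> 0" "\<epsilon> > 0" "!!\<delta> y. 0 < \<delta> ==> \<delta> < \<epsilon> ==> (\<forall>i<m'. cmod (y i) \<le> \<delta>) ==> (\<forall>i\<ge>m'. y i = 0) ==>
   cmod (F y - E (psum m y) * \<phi> (psum m y)) \<le> C * \<delta> ^ q"
  using vanOE[OF vanO_restrict[OF van m]] by blast
 have "vanO m' q (%y. F y - E (psum m' y) * \<phi> (psum m' y))"
 proof (rule vanOI[OF C(1,2)])
  fix \<delta> and y :: "nat => complex"
  assume *: "0 < \<delta>" "\<delta> < \<epsilon>" "\<forall>i<m'. cmod (y i) \<le> \<delta>" "\<forall>i\<ge>m'. y i = 0"
  have "psum m y = psum m' y" by (rule psum_restrict[OF m]) (use *(4) in blast)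
  with C(3)[OF *] show "cmod (F y - E (psum m' y) * \<phi> (psum m' y)) \<le> C * \<delta> ^ q" by (simp only:)
 qed
 then show ?thesis using expands_transition[OF ex m] unfolding tracks_def by blast
qed

lemma tracks_value:
 assumes "tracks I m q \<T> E \<phi>" "1 \<le> q" "E (%_. 0) = 1"
 shows "((%lam. \<T> (%mu. 1) lam) has_sum \<phi> (%_. 0)) I"
proof -
 obtain e F where ex: "expands I m \<T> e F" and van: "vanO m q (%y. F y - E (psum m y) * \<phi> (psum m y))"
  using assms(1) unfolding tracks_def by blast
 have "psum m (%_. 0) = (%_. 0)" by (auto simp: psum_def fun_eq_iff)
 then have "F (%_. 0) = \<phi> (%_. 0)" using vanO_zero[OF van assms(2)] assms(3) by simp
 then show ?thesis using expands_has_sum[OF ex] by simp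
qed

section \<open>Conditional expectations along the chain and their limits\<close>

subsection \<open>Random chains of signatures\<close>

text \<open>Chains from level 1 up to level t, top signature last, all of whose transition
  coefficients are nonzero. There are finitely many over a given signature of the top level, so
  conditioning on the top leaves finite sums.\<close>

fun trees :: "(nat => nat) => nat => int list => int list list set" where
 "trees m 0 lam = {}"
| "trees m (Suc 0) lam = {[lam]}"
| "trees m (Suc (Suc t)) lam = (\<Union>mu\<in>{mu. prc (m (Suc (Suc t))) (m (Suc t)) lam mu ~= 0}. (%L. L @ [lam]) ` trees m (Suc t) mu)"

definition weight :: "(nat => nat) => nat => int list list => real" where
 "weight m t L = (\<Prod>i\<in>{1..<t}. prc (m (i + 1)) (m i) (L ! i) (L ! (i - 1)))"

text \<open>The conditional expectation of a product of observables, given the signature at level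
  t.\<close>

definition cexp :: "(nat => nat) => (nat \<times> nat => int list => complex) => nat => (nat \<times> nat) list => int list => complex" where
 "cexp m X t xs lam = (\<Sum>L\<in>trees m t lam. of_real (weight m t L) * (\<Prod>x\<leftarrow>xs. X x (L ! (fst x - 1))))"

lemma trees_props:
 "(!!t. 1 \<le> t ==> t < n ==> m t \<le> m (t + 1)) ==>
   1 \<le> t ==> t \<le> n ==> lam \<in> GT (m t) ==> finite (trees m t lam) &
   (\<forall>L\<in>trees m t lam. length L = t & L ! (t - 1) = lam & (\<forall>i\<in>{1..t}. L ! (i - 1) \<in> GT (m i)))"
proof (induction m t lam rule: trees.induct)
 case (3 m t lam)
 have mn: "m (Suc t) \<le> m (Suc (Suc t))" using "3.prems"(1)[of "Suc t"] "3.prems"(3) by simp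
 note p = prc_properties(2,3)[OF "3.prems"(4) mn]
 have IH: "finite (trees m (Suc t) mu)" "!!L. L \<in> trees m (Suc t) mu ==> length L = Suc t & L ! t = mu & (\<forall>i\<in>{1..Suc t}. L ! (i - 1) \<in> GT (m i))"
  if "prc (m (Suc (Suc t))) (m (Suc t)) lam mu ~= 0" for mu
  using "3.IH"[of mu, OF _ "3.prems"(1)] that p(1) "3.prems"(3) by auto
 show ?case
 proof (intro conjI ballI)
  show "finite (trees m (Suc (Suc t)) lam)" using p(2) IH(1) by auto
  fix L i assume L: "L \<in> trees m (Suc (Suc t)) lam"
  then obtain mu L' where L': "prc (m (Suc (Suc t))) (m (Suc t)) lam mu ~= 0" "L' \<in> trees m (Suc t) mu" "L = L' @ [lam]" by auto
  note IH = IH(2)[OF L'(1,2)]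
  show "length L = Suc (Suc t)" "L ! (Suc (Suc t) - 1) = lam" using IH L' by (auto simp: nth_append)
  assume i: "i \<in> {1..Suc (Suc t)}"
  show "L ! (i - 1) \<in> GT (m i)"
  proof (cases "i = Suc (Suc t)")
   case False
   then show ?thesis using IH L' i by (auto simp: nth_append)
  qed (use IH L' "3.prems"(4) in \<open>auto simp: nth_append\<close>)
 qed
qed auto

lemma cexp_factor:
 assumes mono: "!!t. 1 \<le> t ==> t < n ==> m t \<le> m (t + 1)" and t: "1 \<le> t" "t \<le> n" and lam: "lam \<in> GT (m t)"
 shows "cexp m X t ((t, k) # xs) lam = X (t, k) lam * cexp m X t xs lam"
 unfolding cexp_def sum_distrib_left
 by (intro sum.cong refl) (use trees_props[where n = n and m = m, OF mono t lam] in \<open>auto simp: mult_ac\<close>)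

text \<open>The Markov property: the product involves levels up to t only, so the step from t + 1 to
  t can be averaged separately.\<close>

lemma cexp_transition:
 assumes mono: "!!t. 1 \<le> t ==> t < n ==> m t \<le> m (t + 1)" and t: "1 \<le> t" "t < n" and lam: "lam \<in> GT (m (t + 1))"
  and xs: "!!x. x \<in> set xs ==> 1 \<le> fst x & fst x \<le> t"
 shows "cexp m X (t + 1) xs lam = transition (m (t + 1)) (m t) (cexp m X t xs) lam"
proof -
 obtain s where s: "t = Suc s" using t(1) by (cases t) auto
 let ?S = "{mu. prc (m (t + 1)) (m t) lam mu ~= 0}"
 have mn: "m t \<le> m (t + 1)" using mono t by simp
 note p = prc_properties(2,3)[OF lam mn]
 have tp: "finite (trees m t mu)" "!!L. L \<in> trees m t mu ==> length L = t & L ! (t - 1) = mu" if "mu \<in> ?S" for mu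
  using trees_props[where n = n and m = m, OF mono, of t mu] that p(1) t by auto
 have "cexp m X (t + 1) xs lam = (\<Sum>L\<in>(\<Union>mu\<in>?S. (%L. L @ [lam]) ` trees m t mu). of_real (weight m (t + 1) L) * (\<Prod>x\<leftarrow>xs. X x (L ! (fst x - 1))))"
  by (simp add: cexp_def s)
 also have "... = (\<Sum>mu\<in>?S. \<Sum>L\<in>(%L. L @ [lam]) ` trees m t mu. of_real (weight m (t + 1) L) * (\<Prod>x\<leftarrow>xs. X x (L ! (fst x - 1))))"
 proof (rule sum.UNION_disjoint)
  show "\<forall>mu\<in>?S. \<forall>nu\<in>?S. mu ~= nu --> (%L. L @ [lam]) ` trees m t mu \<inter> (%L. L @ [lam]) ` trees m t nu = {}"
  proof (intro ballI impI)
   fix mu nu assume *: "mu \<in> ?S" "nu \<in> ?S" "mu ~= nu"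
   have False if "L \<in> trees m t mu" "L \<in> trees m t nu" for L
    using tp(2)[OF *(1) that(1)] tp(2)[OF *(2) that(2)] *(3) by simp
   then show "(%L. L @ [lam]) ` trees m t mu \<inter> (%L. L @ [lam]) ` trees m t nu = {}" by auto
  qed
 qed (use p(2) tp(1) in auto)
 also have "... = (\<Sum>mu\<in>?S. of_real (prc (m (t + 1)) (m t) lam mu) * cexp m X t xs mu)"
 proof (rule sum.cong[OF refl])
  fix mu assume mu: "mu \<in> ?S"
  have "(\<Sum>L\<in>(%L. L @ [lam]) ` trees m t mu. of_real (weight m (t + 1) L) * (\<Prod>x\<leftarrow>xs. X x (L ! (fst x - 1))))
    = (\<Sum>L\<in>trees m t mu. of_real (weight m (t + 1) (L @ [lam])) * (\<Prod>x\<leftarrow>xs. X x ((L @ [lam]) ! (fst x - 1))))"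
   by (subst sum.reindex) (auto simp: inj_on_def)
  also have "... = (\<Sum>L\<in>trees m t mu. of_real (prc (m (t + 1)) (m t) lam mu) * (of_real (weight m t L) * (\<Prod>x\<leftarrow>xs. X x (L ! (fst x - 1)))))"
  proof (rule sum.cong[OF refl])
   fix L assume "L \<in> trees m t mu"
   from tp(2)[OF mu this] have L: "length L = t" "L ! (t - 1) = mu" by auto
   have "{1..<t + 1} = insert t {1..<t}" using t by auto
   moreover have "(\<Prod>i\<in>{1..<t}. prc (m (i + 1)) (m i) ((L @ [lam]) ! i) ((L @ [lam]) ! (i - 1))) = weight m t L"
    unfolding weight_def by (intro prod.cong refl) (use L in \<open>auto simp: nth_append\<close>)
   ultimately have "weight m (t + 1) (L @ [lam]) = prc (m (t + 1)) (m t) lam mu * weight m t L"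
    unfolding weight_def[of m "t + 1"] using L t by (auto simp: nth_append)
   moreover have "(\<Prod>x\<leftarrow>xs. X x ((L @ [lam]) ! (fst x - 1))) = (\<Prod>x\<leftarrow>xs. X x (L ! (fst x - 1)))"
   proof -
    have "fst x - 1 < length L" if "x \<in> set xs" for x using xs[OF that] L t by linarith
    then have "map (%x. X x ((L @ [lam]) ! (fst x - 1))) xs = map (%x. X x (L ! (fst x - 1))) xs"
     by (simp add: nth_append)
    then show ?thesis by (simp only:)
   qed
   ultimately show "of_real (weight m (t + 1) (L @ [lam])) * (\<Prod>x\<leftarrow>xs. X x ((L @ [lam]) ! (fst x - 1))) =
    of_real (prc (m (t + 1)) (m t) lam mu) * (of_real (weight m t L) * (\<Prod>x\<leftarrow>xs. X x (L ! (fst x - 1))))" by simp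
  qed
  finally show "(\<Sum>L\<in>(%L. L @ [lam]) ` trees m t mu. of_real (weight m (t + 1) L) * (\<Prod>x\<leftarrow>xs. X x (L ! (fst x - 1))))
    = of_real (prc (m (t + 1)) (m t) lam mu) * cexp m X t xs mu"
   unfolding cexp_def sum_distrib_left .
 qed
 finally show ?thesis unfolding transition_def .
qed

lemma cexp_nil:
 assumes mono: "!!t. 1 \<le> t ==> t < n ==> m t \<le> m (t + 1)"
 shows "1 \<le> t ==> t \<le> n ==> lam \<in> GT (m t) ==> cexp m X t [] lam = 1"
proof (induction t arbitrary: lam)
 case (Suc t)
 show ?case
 proof (cases "t = 0")
  case True then show ?thesis by (simp add: cexp_def weight_def)
 next
  case False
  then have t: "1 \<le> t" "t < n" using Suc.prems by auto
  have mn: "m t \<le> m (t + 1)" using mono t by simp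
  have "cexp m X (t + 1) [] lam = transition (m (t + 1)) (m t) (cexp m X t []) lam"
   by (rule cexp_transition[where n = n and m = m, OF mono t]) (use Suc.prems in auto)
  also have "... = (\<Sum>mu | prc (m (t + 1)) (m t) lam mu ~= 0. of_real (prc (m (t + 1)) (m t) lam mu))"
   unfolding transition_def
   by (rule sum.cong[OF refl]) (use Suc prc_properties(2)[of lam "m (t + 1)" "m t"] mn t in auto)
  also have "... = 1" by (rule prc_sum) (use Suc.prems mn in auto)
  finally show ?thesis by simp
 qed
qed simp

text \<open>Higher levels come first, since D_k must act before the variables of its level are
  dropped.\<close>

definition descending :: "(nat \<times> nat) list => bool" where
 "descending xs \<longleftrightarrow> sorted_wrt (%x y. fst y \<le> fst x) xs"

text \<open>Every step consumes a factor of the current level or descends one level, whence the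
  measure t + length. The result feeds the summability conditions of
  \<open>infsum_tuples\<close>.\<close>

lemma chain_summable:
 fixes \<alpha> \<beta> :: "nat \<times> nat => complex"
 assumes mono: "!!t. 1 \<le> t ==> t < n ==> m t \<le> m (t + 1)"
 defines "X \<equiv> %x mu. \<alpha> x * shifted_psum (m (fst x)) (snd x) mu - \<beta> x"
 shows "1 \<le> t ==> t \<le> n ==> descending xs ==> (!!x. x \<in> set xs ==> 1 \<le> fst x & fst x \<le> t) ==>
   expands I (m t) \<T> e F ==> (%lam. \<T> (cexp m X t xs) lam) summable_on I"
proof (induction "t + length xs" arbitrary: t xs \<T> e F rule: less_induct)
 case less
 note fin = less.prems(5)[unfolded expands_def, THEN conjunct1]
 show ?case
 proof (cases xs)
  case Nil
  have e: "\<T> (cexp m X t []) = \<T> (%mu. 1)"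
   by (rule ext, rule finop_cong[OF fin]) (rule cexp_nil[where n = n and m = m, OF mono less.prems(1,2)])
  then show ?thesis using expands_has_sum[OF less.prems(5)] unfolding Nil e summable_on_def by blast
 next
  case (Cons x xs')
  show ?thesis
  proof (cases "fst x = t")
   case True
   then obtain k where x: "x = (t, k)" by (cases x) auto
   have "\<T> (cexp m X t xs) = insert_factor (X (t, k)) \<T> (cexp m X t xs')"
    unfolding insert_factor_def Cons x
    by (rule ext, rule finop_cong[OF fin]) (rule cexp_factor[where n = n and m = m, OF mono less.prems(1,2)])
   moreover obtain e' F' where "expands I (m t) (insert_factor (X (t, k)) \<T>) e' F'"
    unfolding X_def using expands_factor[OF less.prems(5), where k = k and \<alpha> = "\<alpha> (t, k)" and \<beta> = "\<beta> (t, k)"] by auto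
   then have "(%lam. insert_factor (X (t, k)) \<T> (cexp m X t xs') lam) summable_on I"
    using less.prems Cons by (intro less.hyps) (auto simp: descending_def)
   ultimately show ?thesis by simp
  next
   case False
   then have "fst x < t" using less.prems(4)[of x] Cons by auto
   then have lt: "1 \<le> fst z & fst z \<le> t - 1" if "z \<in> set xs" for z
    using that less.prems(3,4) Cons by (auto simp: descending_def)
   have t: "1 \<le> t - 1" "t - 1 < n" "t - 1 + 1 = t" using lt[of x] Cons less.prems(1,2) by auto
   have mn: "m (t - 1) \<le> m t" using mono[OF t(1,2)] t(3) by simp
   have "\<T> (cexp m X t xs) = \<T> (transition (m t) (m (t - 1)) (cexp m X (t - 1) xs))"
    by (rule ext, rule finop_cong[OF fin]) (use cexp_transition[where n = n and m = m, OF mono t(1,2), unfolded t(3)] lt in blast)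
   moreover have "(%lam. \<T> (transition (m t) (m (t - 1)) (cexp m X (t - 1) xs)) lam) summable_on I"
    by (rule less.hyps[OF _ _ _ less.prems(3) lt expands_transition[OF less.prems(5) mn]]) (use t in auto)
   ultimately show ?thesis by simp
  qed
 qed
qed

primrec limit_chain :: "(nat \<times> nat => (point => complex) => point => complex) => (nat \<times> nat) list =>
  (point => complex) => point => complex" where
 "limit_chain \<Lambda> [] \<phi> = \<phi>"
| "limit_chain \<Lambda> (x # xs) \<phi> = limit_chain \<Lambda> xs (\<Lambda> x \<phi>)"

text \<open>The recursion of \<open>chain_summable\<close> with the power sum model carried along.
  The budget b exceeds the sum of all k, so at the end the error still vanishes at the origin, and
  the expectation is the value of the model there.\<close>

lemma chain_limit:
 fixes m :: "nat => nat => nat" and E :: "nat => point => complex"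
  and \<beta> \<mu> :: "nat \<times> nat => nat => complex"
 assumes mono: "!!N t. 1 \<le> t ==> t < n ==> m N t \<le> m N (t + 1)" and N0: "N0 > 0"
  and E: "!!N M e. sepholo M e (%y. E N (psum M y))" and E0: "!!N. N \<ge> N0 ==> E N (%_. 0) = 1"
  and step: "!!x \<phi> \<phi>' D. fst x \<in> {1..n} ==> 1 \<le> snd x ==> cv D \<phi> \<phi>' ==> (\<forall>N. indep0 (\<phi> N)) ==> indep0 \<phi>' ==>
   \<exists>D' \<psi>. cv D' \<psi> (%v. multiplier (snd x) (S x) qdl v * \<phi>' v + derivation (snd x) (S x) \<phi>' v) & (\<forall>N. indep0 (\<psi> N)) &
    (\<forall>N y. N > 0 --> distinct_coords (m N (fst x)) y -->
     Dop (snd x) (m N (fst x)) (%y. E N (psum (m N (fst x)) y) * \<phi> N (psum (m N (fst x)) y)) y =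
     of_nat N ^ snd x * E N (psum (m N (fst x)) y) * (\<psi> N (psum (m N (fst x)) y) + \<mu> x N * \<phi> N (psum (m N (fst x)) y)))"
  and q: "indep0 qdl" and lim: "!!x. fst x \<in> {1..n} ==> 1 \<le> snd x ==> (%N. \<mu> x N - \<beta> x N) \<longlonglongrightarrow> - \<kappa> x"
 defines "\<Lambda> \<equiv> %x \<phi> v. multiplier (snd x) (S x) qdl v * \<phi> v + derivation (snd x) (S x) \<phi> v + (- \<kappa> x) * \<phi> v"
  and "X \<equiv> %N x mu. 1 / of_nat N ^ snd x * shifted_psum (m N (fst x)) (snd x) mu - \<beta> x N"
 shows "1 \<le> t ==> t \<le> n ==> descending xs ==> (!!x. x \<in> set xs ==> 1 \<le> fst x & fst x \<le> t & 1 \<le> snd x) ==>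
   cv D \<phi> \<phi>' ==> (\<forall>N. indep0 (\<phi> N)) ==> indep0 \<phi>' ==>
   (!!N. N \<ge> N0 ==> tracks (GT N) (m N t) b (\<T> N) (E N) (\<phi> N)) ==> sum_list (map snd xs) < b ==>
   \<exists>D \<psi>. cv D \<psi> (limit_chain \<Lambda> xs \<phi>') & (\<forall>N\<ge>N0. ((%lam. \<T> N (cexp (m N) (X N) t xs) lam) has_sum \<psi> N (%_. 0)) (GT N))"
proof (induction "t + length xs" arbitrary: t xs \<T> D \<phi> \<phi>' b rule: less_induct)
 case less
 have fin: "finop (m N t) (\<T> N)" if "N \<ge> N0" for N
  using less.prems(8)[OF that] unfolding tracks_def expands_def by blast
 show ?case
 proof (cases xs)
  case Nil
  have "\<T> N (cexp (m N) (X N) t []) lam = \<T> N (%mu. 1) lam" if "N \<ge> N0" for lam N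
   by (rule finop_cong[OF fin[OF that]]) (rule cexp_nil[where n = n and m = "m N", OF mono less.prems(1,2)])
  then have "\<forall>N\<ge>N0. ((%lam. \<T> N (cexp (m N) (X N) t xs) lam) has_sum \<phi> N (%_. 0)) (GT N)"
   unfolding Nil using tracks_value[OF less.prems(8) _ E0] less.prems(9) by simp
  then show ?thesis using less.prems(5) Nil by auto
 next
  case (Cons x xs')
  show ?thesis
  proof (cases "fst x = t")
   case True
   then obtain k where x: "x = (t, k)" by (cases x) auto
   have xk: "fst x \<in> {1..n}" "1 \<le> snd x" using less.prems(1,2) less.prems(4)[of x] Cons True by auto
   obtain D' \<psi> where \<psi>: "cv D' \<psi> (%v. multiplier (snd x) (S x) qdl v * \<phi>' v + derivation (snd x) (S x) \<phi>' v)" "\<forall>N. indep0 (\<psi> N)"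
    and Dp: "!!N y. N > 0 ==> distinct_coords (m N t) y ==> Dop k (m N t) (%y. E N (psum (m N t) y) * \<phi> N (psum (m N t) y)) y =
      of_nat N ^ k * E N (psum (m N t) y) * (\<psi> N (psum (m N t) y) + \<mu> x N * \<phi> N (psum (m N t) y))"
    using step[OF xk less.prems(5-7)] unfolding x fst_conv snd_conv by blast
   \<comment> \<open>Only the difference of \<mu> and the centering \<beta> enters; it has a limit,
     while \<mu> itself need not converge.\<close>
   let ?\<phi> = "%N v. \<psi> N v + (\<mu> x N - \<beta> x N) * \<phi> N v"
   let ?B = "D' + D"
   have c\<phi>: "cv ?B ?\<phi> (\<Lambda> x \<phi>')"
    unfolding \<Lambda>_def
    by (intro cv_add cv_mult cv_const[OF lim[OF xk]] cv_mono[OF \<psi>(1)] cv_mono[OF less.prems(5)]) auto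
   have i1: "\<forall>N. indep0 (?\<phi> N)" using \<psi>(2) less.prems(6) by (auto simp: indep0_def)
   have i2: "indep0 (\<Lambda> x \<phi>')"
    using indep0_multiplier[OF q] indep0_derivation[OF less.prems(7)] less.prems(7) by (auto simp: indep0_def \<Lambda>_def)
   have tr: "tracks (GT N) (m N t) (b - k) (insert_factor (X N (t, k)) (\<T> N)) (E N) (?\<phi> N)" if N: "N \<ge> N0" for N
    unfolding X_def fst_conv snd_conv x
   proof (rule tracks_factor[OF less.prems(8)[OF N] _ _ E sepholo_cv[OF less.prems(5)] sepholo_cv[OF \<psi>(1)]])
    show "k \<le> b" using less.prems(9) Cons x by simp
    show "of_nat N ^ k ~= (0::complex)" using N N0 by simp
   qed (use Dp N N0 x in auto)
   have "\<exists>D \<psi>. cv D \<psi> (limit_chain \<Lambda> xs' (\<Lambda> x \<phi>')) &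
     (\<forall>N\<ge>N0. ((%lam. insert_factor (X N (t, k)) (\<T> N) (cexp (m N) (X N) t xs') lam) has_sum \<psi> N (%_. 0)) (GT N))"
    using less.prems Cons x by (intro less.hyps[OF _ _ _ _ _ c\<phi> i1 i2 tr]) (auto simp: descending_def)
   moreover have "\<T> N (cexp (m N) (X N) t xs) lam = insert_factor (X N (t, k)) (\<T> N) (cexp (m N) (X N) t xs') lam" if "N \<ge> N0" for lam N
    unfolding insert_factor_def Cons x
    by (rule finop_cong[OF fin[OF that]]) (rule cexp_factor[where n = n and m = "m N", OF mono less.prems(1,2)])
   then have "\<T> N (cexp (m N) (X N) t xs) = insert_factor (X N (t, k)) (\<T> N) (cexp (m N) (X N) t xs')" if "N \<ge> N0" for N
    using that by blast
   ultimately show ?thesis unfolding Cons limit_chain.simps by simp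
  next
   case False
   then have "fst x < t" using less.prems(4)[of x] Cons by auto
   then have lt: "1 \<le> fst z & fst z \<le> t - 1 & 1 \<le> snd z" if "z \<in> set xs" for z
    using that less.prems(3,4) Cons by (auto simp: descending_def)
   have t: "1 \<le> t - 1" "t - 1 < n" "t - 1 + 1 = t" "t - 1 \<le> n" "t - 1 < t" using lt[of x] Cons less.prems(1,2) by auto
   have mn: "m N (t - 1) \<le> m N t" for N using mono[OF t(1,2)] t(3) by simp
   have "\<T> N (cexp (m N) (X N) t xs) = \<T> N (transition (m N t) (m N (t - 1)) (cexp (m N) (X N) (t - 1) xs))" if "N \<ge> N0" for N
    by (rule ext, rule finop_cong[OF fin[OF that]]) (use cexp_transition[where n = n and m = "m N", OF mono t(1,2), unfolded t(3)] lt in blast)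
   moreover have "\<exists>D \<psi>. cv D \<psi> (limit_chain \<Lambda> xs \<phi>') &
     (\<forall>N\<ge>N0. ((%lam. \<T> N (transition (m N t) (m N (t - 1)) (cexp (m N) (X N) (t - 1) xs)) lam) has_sum \<psi> N (%_. 0)) (GT N))"
    by (rule less.hyps[OF _ t(1,4) less.prems(3) lt less.prems(5-7) tracks_transition[OF less.prems(8) mn] less.prems(9)])
      (use t in auto)
   ultimately show ?thesis by simp
  qed
 qed
qed

lemma trees_complete:
 assumes mono: "!!t. 1 \<le> t ==> t < n ==> m t \<le> m (t + 1)"
 shows "1 \<le> t ==> t \<le> n ==> length L = t ==> weight m t L ~= 0 ==> L \<in> trees m t (L ! (t - 1))"
proof (induction t arbitrary: L)
 case (Suc t)
 show ?case
 proof (cases "t = 0")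
  case True
  then show ?thesis using Suc.prems by (cases L) auto
 next
  case False
  then obtain s where s: "t = Suc s" by (cases t) auto
  obtain L' lam where L: "L = L' @ [lam]" "length L' = t"
   using Suc.prems(3) by (cases L rule: rev_cases) auto
  have "{1..<Suc t} = insert t {1..<t}" using s by auto
  moreover have "(\<Prod>i\<in>{1..<t}. prc (m (i + 1)) (m i) (L ! i) (L ! (i - 1))) = weight m t L'"
   unfolding weight_def by (intro prod.cong refl) (use L in \<open>auto simp: nth_append\<close>)
  ultimately have w: "weight m (Suc t) L = prc (m (t + 1)) (m t) lam (L' ! (t - 1)) * weight m t L'"
   unfolding weight_def[of m "Suc t"] using L s by (auto simp: nth_append)
  then have "L' \<in> trees m t (L' ! (t - 1))" using Suc.IH[of L'] Suc.prems L s by auto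
  then show ?thesis using w Suc.prems(4) L s by (auto simp: nth_append)
 qed
qed simp

text \<open>The unordered sum over tuples requires absolute convergence, whereas the chain computes
  sums over the top signature of finite signed sums. The list zs, whose product is the square P^2 of
  the given one, supplies the domination |P| <= 1 + P^2.\<close>

lemma infsum_tuples:
 fixes p :: "int list => real" and X :: "nat \<times> nat => int list => real"
 assumes mono: "!!t. 1 \<le> t ==> t < n ==> m t \<le> m (t + 1)" and n: "1 \<le> n"
  and p: "!!lam. 0 \<le> p lam"
  and xs: "!!x. x \<in> set xs ==> fst x \<in> {1..n}"
  and V: "((%lam. of_real (p lam) * cexp m (%x mu. of_real (X x mu)) n xs lam) has_sum V) (GT (m n))"
  and s0: "(%lam. of_real (p lam) * cexp m (%x mu. of_real (X x mu)) n [] lam) summable_on (GT (m n))"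
  and s2: "(%lam. of_real (p lam) * cexp m (%x mu. of_real (X x mu)) n zs lam) summable_on (GT (m n))"
  and zs: "!!L. (\<Prod>x\<leftarrow>zs. X x (L ! (fst x - 1))) = (\<Prod>x\<leftarrow>xs. X x (L ! (fst x - 1))) ^ 2"
 shows "complex_of_real (\<Sum>\<^sub>\<infinity>L\<in>{L. length L = n & (\<forall>t\<in>{1..n}. L ! (t - 1) \<in> GT (m t))}.
   p (L ! (n - 1)) * weight m n L * (\<Prod>x\<leftarrow>xs. X x (L ! (fst x - 1)))) = V"
proof -
 let ?U = "{L. length L = n & (\<forall>t\<in>{1..n}. L ! (t - 1) \<in> GT (m t))}"
 let ?P = "%ys L. \<Prod>x\<leftarrow>ys. X x (L ! (fst x - 1))"
 define S where "S = Sigma (GT (m n)) (trees m n)"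
 define w where "w = (%(lam, L). p lam * weight m n L)"
 have tp: "finite (trees m n lam) & (\<forall>L\<in>trees m n lam. length L = n & L ! (n - 1) = lam & (\<forall>i\<in>{1..n}. L ! (i - 1) \<in> GT (m i)))"
  if "lam \<in> GT (m n)" for lam
  by (rule trees_props[where n = n]) (use mono n that in auto)
 have tf: "finite (trees m n lam)" if "lam \<in> GT (m n)" for lam using tp[OF that] by blast
 have w0: "0 \<le> w (lam, L)" if "lam \<in> GT (m n)" "L \<in> trees m n lam" for lam L
 proof -
  have g: "L ! (i - 1) \<in> GT (m i)" if "i \<in> {1..n}" for i using tp[OF \<open>lam \<in> _\<close>] \<open>L \<in> _\<close> that by blast
  have "0 \<le> weight m n L" unfolding weight_def
  proof (rule prod_nonneg)
   fix i assume i: "i \<in> {1..<n}"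
   have "L ! i \<in> GT (m (i + 1))" using g[of "i + 1"] i by simp
   then show "0 \<le> prc (m (i + 1)) (m i) (L ! i) (L ! (i - 1))"
    by (rule prc_properties(1)) (use mono i in auto)
  qed
  then show ?thesis using p by (simp add: w_def)
 qed
 have ce: "of_real (p lam) * cexp m (%x mu. of_real (X x mu)) n ys lam = complex_of_real (\<Sum>L\<in>trees m n lam. w (lam, L) * ?P ys L)" for ys lam
 proof -
  have pl: "(\<Prod>x\<leftarrow>ys. complex_of_real (X x (L ! (fst x - 1)))) = of_real (?P ys L)" for L
   by (induction ys) auto
  show ?thesis unfolding cexp_def pl w_def by (simp add: sum_distrib_left mult_ac)
 qed
 have sr: "(%lam. \<Sum>L\<in>trees m n lam. w (lam, L) * ?P ys L) summable_on GT (m n)"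
  if "(%lam. of_real (p lam) * cexp m (%x mu. of_real (X x mu)) n ys lam) summable_on (GT (m n))" for ys
 proof -
  from that[unfolded ce summable_on_def] obtain V' where
   "((%lam. complex_of_real (\<Sum>L\<in>trees m n lam. w (lam, L) * ?P ys L)) has_sum V') (GT (m n))" ..
  from has_sum_Re[OF this] have "((%lam. \<Sum>L\<in>trees m n lam. w (lam, L) * ?P ys L) has_sum Re V') (GT (m n))" by simp
  then show ?thesis unfolding summable_on_def ..
 qed
 \<comment> \<open>The dominating terms are nonnegative, so summability over pairs reduces to that
   of the row sums, which come from the chains for the empty list and for zs.\<close>
 have "(%z. norm (case z of (lam, L) => w (lam, L) * (1 + ?P xs L ^ 2))) summable_on S"
  unfolding S_def Infinite_Sum.abs_summable_on_Sigma_iff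
 proof (intro conjI ballI)
  fix lam assume "lam \<in> GT (m n)"
  then show "(%L. norm (case (lam, L) of (lam, L) => w (lam, L) * (1 + ?P xs L ^ 2))) summable_on trees m n lam"
   by (intro summable_on_finite tf)
 next
  have "(%lam. (\<Sum>L\<in>trees m n lam. w (lam, L) * ?P [] L) + (\<Sum>L\<in>trees m n lam. w (lam, L) * ?P zs L)) summable_on GT (m n)"
   by (intro summable_on_add sr s0 s2)
  then have "(%lam. \<Sum>\<^sub>\<infinity>L\<in>trees m n lam. norm (case (lam, L) of (lam, L) => w (lam, L) * (1 + ?P xs L ^ 2))) summable_on GT (m n)"
  proof (rule summable_on_cong[THEN iffD1, rotated])
   fix lam assume lam: "lam \<in> GT (m n)"
   have "(\<Sum>\<^sub>\<infinity>L\<in>trees m n lam. norm (case (lam, L) of (lam, L) => w (lam, L) * (1 + ?P xs L ^ 2))) = (\<Sum>L\<in>trees m n lam. w (lam, L) * (1 + ?P xs L ^ 2))"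
    unfolding infsum_finite[OF tf[OF lam]]
    by (rule sum.cong[OF refl]) (use w0[OF lam] in \<open>simp add: abs_mult\<close>)
   then show "(\<Sum>L\<in>trees m n lam. w (lam, L) * ?P [] L) + (\<Sum>L\<in>trees m n lam. w (lam, L) * ?P zs L) =
    (\<Sum>\<^sub>\<infinity>L\<in>trees m n lam. norm (case (lam, L) of (lam, L) => w (lam, L) * (1 + ?P xs L ^ 2)))"
    unfolding zs by (simp add: sum.distrib[symmetric] distrib_left)
  qed
  then show "(%lam. norm (\<Sum>\<^sub>\<infinity>L\<in>trees m n lam. norm (case (lam, L) of (lam, L) => w (lam, L) * (1 + ?P xs L ^ 2)))) summable_on GT (m n)"
   by (subst (asm) summable_on_iff_abs_summable_on_real)
 qed
 then have "(%z. norm (case z of (lam, L) => w (lam, L) * ?P xs L)) summable_on S"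
 proof (rule Infinite_Sum.abs_summable_on_comparison_test)
  fix z assume "z \<in> S"
  then obtain lam L where z: "z = (lam, L)" "lam \<in> GT (m n)" "L \<in> trees m n lam" by (auto simp: S_def)
  have "\<bar>a\<bar> \<le> 1 + a ^ 2" for a :: real
   using sum_squares_bound[of "\<bar>a\<bar>" 1] by simp
  from mult_left_mono[OF this w0[OF z(2,3)], of "?P xs L"]
  show "norm (case z of (lam, L) => w (lam, L) * ?P xs L) \<le> norm (case z of (lam, L) => w (lam, L) * (1 + ?P xs L ^ 2))"
   using w0[OF z(2,3)] by (simp add: z(1) abs_mult)
 qed
 then have sS: "(%(lam, L). w (lam, L) * ?P xs L) summable_on S"
  by (subst summable_on_iff_abs_summable_on_real)
 have hV: "((%lam. complex_of_real (\<Sum>L\<in>trees m n lam. w (lam, L) * ?P xs L)) has_sum V) (GT (m n))"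
  using V unfolding ce .
 from has_sum_Re[OF this] have h1: "((%lam. \<Sum>L\<in>trees m n lam. w (lam, L) * ?P xs L) has_sum Re V) (GT (m n))" by simp
 have VR: "V = of_real (Re V)" by (rule has_sum_unique[OF hV has_sum_of_real[OF h1]])
 have hS: "((%(lam, L). w (lam, L) * ?P xs L) has_sum Re V) S"
  unfolding S_def
 proof (rule has_sum_SigmaI[OF _ h1 sS[unfolded S_def]])
  fix lam assume "lam \<in> GT (m n)"
  from has_sum_finite[OF tf[OF this], of "%L. case (lam, L) of (lam, L) => w (lam, L) * ?P xs L"]
  show "((%L. case (lam, L) of (lam, L) => w (lam, L) * ?P xs L) has_sum (\<Sum>L\<in>trees m n lam. w (lam, L) * ?P xs L)) (trees m n lam)" by simp
 qed
 have zz: "z = (snd z ! (n - 1), snd z)" if z: "z \<in> S" for z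
 proof -
  obtain lam L where z: "z = (lam, L)" "lam \<in> GT (m n)" "L \<in> trees m n lam" using z by (auto simp: S_def)
  have "L ! (n - 1) = lam" using tp[OF z(2)] z(3) by blast
  then show ?thesis by (simp add: z(1))
 qed
 have "inj_on snd S"
 proof (rule inj_onI)
  fix z z' assume a: "z \<in> S" "z' \<in> S" "snd z = snd z'"
  show "z = z'" by (rule trans[OF zz[OF a(1)]], rule trans[OF _ zz[OF a(2), symmetric]]) (simp add: a(3))
 qed
 moreover have "((%L. p (L ! (n - 1)) * weight m n L * ?P xs L) \<circ> snd has_sum Re V) S"
 proof (rule has_sum_cong[THEN iffD1, OF _ hS])
  fix z assume "z \<in> S"
  from zz[OF this] have "fst z = snd z ! (n - 1)" by (metis fst_conv)
  then show "(case z of (lam, L) => w (lam, L) * ?P xs L) = ((%L. p (L ! (n - 1)) * weight m n L * ?P xs L) \<circ> snd) z"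
   by (cases z) (simp add: w_def)
 qed
 ultimately have "((%L. p (L ! (n - 1)) * weight m n L * ?P xs L) has_sum Re V) (snd ` S)"
  by (subst has_sum_reindex)
 then have "((%L. p (L ! (n - 1)) * weight m n L * ?P xs L) has_sum Re V) ?U"
 proof (rule has_sum_cong_neutral[THEN iffD1, rotated -1])
  fix L assume L: "L \<in> ?U - snd ` S"
  have "weight m n L = 0"
  proof (rule ccontr)
   assume "weight m n L ~= 0"
   then have "L \<in> trees m n (L ! (n - 1))" using L n mono by (intro trees_complete[where n = n]) auto
   moreover have "L ! (n - 1) \<in> GT (m n)" using L n by auto
   ultimately have "(L ! (n - 1), L) \<in> S" by (simp add: S_def)
   then have "L \<in> snd ` S" by force
   then show False using L by blast
  qed
  then show "p (L ! (n - 1)) * weight m n L * ?P xs L = 0" by simp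
 next
  fix L assume L: "L \<in> snd ` S - ?U"
  then obtain lam where "lam \<in> GT (m n)" "L \<in> trees m n lam" by (auto simp: S_def)
  with tp[OF this(1)] L show "p (L ! (n - 1)) * weight m n L * ?P xs L = 0" by blast
 qed simp
 from infsumI[OF this] VR show ?thesis by simp
qed

section \<open>Combinatorics of Wick's formula\<close>

subsection \<open>Wick's formula\<close>

lemma sum_nth_mset: "(\<Sum>j<length xs. g (xs ! j)) = (\<Sum>x\<in>#mset xs. g x)" for g :: "_ => complex"
proof -
 have "(\<Sum>j<length xs. g (xs ! j)) = sum_list (map g xs)"
  by (simp add: sum_list_sum_nth atLeast0LessThan)
 then show ?thesis by (metis mset_map sum_mset_sum_list)
qed

lemma mset_delete_nth: "j < length xs ==> mset (take j xs @ drop (Suc j) xs) = mset xs - {#xs ! j#}"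
proof -
 assume "j < length xs"
 then have "mset xs = mset (take j xs @ xs ! j # drop (Suc j) xs)" by (simp add: id_take_nth_drop[symmetric])
 then show ?thesis by simp
qed

lemma sum_mset_remove_swap:
 fixes h :: "'a => 'a => complex"
 shows "(\<Sum>y\<in>#M. \<Sum>z\<in>#M - {#y#}. h y z) = (\<Sum>y\<in>#M. \<Sum>z\<in>#M - {#y#}. h z y)"
proof -
 have *: "(\<Sum>y\<in>#M. \<Sum>z\<in>#M - {#y#}. h y z) = (\<Sum>y\<in>#M. \<Sum>z\<in>#M. h y z) - (\<Sum>y\<in>#M. h y y)" for h :: "'a => 'a => complex"
 proof -
  have "(\<Sum>z\<in>#M - {#y#}. h y z) = (\<Sum>z\<in>#M. h y z) - h y y" if "y \<in># M" for y
  proof -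
   have "M = add_mset y (M - {#y#})" using that by simp
   then have "(\<Sum>z\<in>#M. h y z) = h y y + (\<Sum>z\<in>#M - {#y#}. h y z)" by (metis image_mset_add_mset sum_mset.add_mset)
   then show ?thesis by simp
  qed
  then have "(\<Sum>y\<in>#M. \<Sum>z\<in>#M - {#y#}. h y z) = (\<Sum>y\<in>#M. (\<Sum>z\<in>#M. h y z) - h y y)"
   by (intro arg_cong[where f = sum_mset] image_mset_cong) simp
  also have "... = (\<Sum>y\<in>#M. \<Sum>z\<in>#M. h y z) - (\<Sum>y\<in>#M. h y y)"
  proof -
   have "(\<Sum>y\<in>#M'. f y - g y) = (\<Sum>y\<in>#M'. f y) - (\<Sum>y\<in>#M'. g y)" for f g :: "'a => complex" and M'
    by (induction M') auto
   then show ?thesis .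
  qed
  finally show ?thesis .
 qed
 show ?thesis unfolding *[of h] *[of "%y z. h z y"] by (subst sum_mset.swap) simp
qed

lemma wick_Cons_mset:
 assumes "!!ys. length ys < length xs ==> wick C ys = W (mset ys)"
 shows "wick C (x # xs) = (\<Sum>y\<in>#mset xs. C x y * W (mset xs - {#y#}))"
proof -
 have "wick C (x # xs) = (\<Sum>j<length xs. C x (xs ! j) * W (mset xs - {#xs ! j#}))"
  unfolding wick.simps
  by (intro sum.cong refl, subst assms) (auto simp: mset_delete_nth[symmetric] simp del: mset_append)
 then show ?thesis using sum_nth_mset[of "%y. C x y * W (mset xs - {#y#})" xs] by simp
qed

text \<open>The essential case is the exchange of the first two entries. Expanding both gives a
  double sum over ordered pairs of partners, which is invariant under exchanging the partners;
  symmetry of C is used when the two entries are paired with each other.\<close>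

lemma wick_perm:
 fixes C :: "'a => 'a => complex"
 assumes sym: "!!x y. C x y = C y x"
 shows "mset xs = mset ys ==> wick C xs = wick C ys"
proof (induction "length xs" arbitrary: xs ys rule: less_induct)
 case less
 \<comment> \<open>By the induction hypothesis the value on shorter lists depends on the multiset
   alone; W is that function of multisets, so the choice of a list is immaterial.\<close>
 define W where "W = (%M. wick C (SOME zs. mset zs = M))"
 have W: "wick C zs = W (mset zs)" if "length zs < length xs" for zs
  unfolding W_def
 proof (rule less.hyps[OF that])
  show "mset zs = mset (SOME us. mset us = mset zs)" by (rule someI[of "%us. mset us = mset zs" zs, symmetric]) simp
 qed
 have same: "wick C (x # us) = wick C (x # vs)" if "mset us = mset vs" "Suc (length us) = length xs" for x us vs
 proof -
  have "length vs = length us" using that(1) by (metis size_mset)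
  then have W': "wick C zs = W (mset zs)" if "length zs < length us \<or> length zs < length vs" for zs
   using W[of zs] that \<open>Suc (length us) = length xs\<close> by auto
  show ?thesis
   using wick_Cons_mset[of us C W x] wick_Cons_mset[of vs C W x] W' that(1) by simp
 qed
 have swap: "wick C (x # y # us) = wick C (y # x # us)" if len: "Suc (Suc (length us)) = length xs" for x y us
 proof -
  have W2: "W (add_mset b M) = (\<Sum>z\<in>#M. C b z * W (M - {#z#}))" if "Suc (size M) < length xs" for b M
  proof -
   obtain zs where zs: "mset zs = M" using ex_mset by blast
   then have l: "length zs = size M" by auto
   have "W (add_mset b M) = wick C (b # zs)" using W[of "b # zs"] l that zs by simp
   also have "... = (\<Sum>z\<in>#M. C b z * W (M - {#z#}))"
    unfolding zs[symmetric] by (rule wick_Cons_mset) (use W l that in auto)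
   finally show ?thesis .
  qed
  have dl: "c * (\<Sum>z\<in>#M. f z) = (\<Sum>z\<in>#M. c * f z)" for c :: complex and f :: "'a => complex" and M
   by (induction M) (auto simp: distrib_left)
  have e: "wick C (a # b # us) = C a b * W (mset us) + (\<Sum>y\<in>#mset us. \<Sum>z\<in>#mset us - {#y#}. C a y * C b z * W (mset us - {#y#} - {#z#}))" for a b
  proof -
   have "wick C (a # b # us) = (\<Sum>y\<in>#mset (b # us). C a y * W (mset (b # us) - {#y#}))"
    by (rule wick_Cons_mset) (use W len in auto)
   also have "... = C a b * W (mset us) + (\<Sum>y\<in>#mset us. C a y * W (add_mset b (mset us) - {#y#}))" by simp
   also have "(\<Sum>y\<in>#mset us. C a y * W (add_mset b (mset us) - {#y#})) =
     (\<Sum>y\<in>#mset us. \<Sum>z\<in>#mset us - {#y#}. C a y * C b z * W (mset us - {#y#} - {#z#}))"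
   proof (intro arg_cong[where f = sum_mset] image_mset_cong)
    fix y assume y: "y \<in># mset us"
    then have 1: "add_mset b (mset us) - {#y#} = add_mset b (mset us - {#y#})" by (simp add: multiset_eq_iff)
    have "Suc (size (mset us - {#y#})) < length xs" using y len by (simp add: size_Diff_singleton)
    from W2[OF this, of b]
    show "C a y * W (add_mset b (mset us) - {#y#}) = (\<Sum>z\<in>#mset us - {#y#}. C a y * C b z * W (mset us - {#y#} - {#z#}))"
     unfolding 1 using dl[of "C a y"] by (simp only: mult.assoc)
   qed
   finally show ?thesis .
  qed
  have "(\<Sum>y'\<in>#mset us. \<Sum>z\<in>#mset us - {#y'#}. C x y' * C y z * W (mset us - {#y'#} - {#z#}))
   = (\<Sum>y'\<in>#mset us. \<Sum>z\<in>#mset us - {#y'#}. C x z * C y y' * W (mset us - {#z#} - {#y'#}))"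
   by (rule sum_mset_remove_swap)
  then show ?thesis unfolding e sym[of x y] by (simp add: mult_ac add_mset_commute)
 qed
 show ?case
 proof (cases xs)
  case Nil then show ?thesis using less.prems by simp
 next
  case (Cons x us)
  then obtain y vs where ys: "ys = y # vs" using less.prems by (cases ys) auto
  show ?thesis
  proof (cases "x = y")
   case True
   then show ?thesis using same[of us vs x] less.prems Cons ys by simp
  next
   case False
   have "y \<in># mset us" using less.prems Cons ys False by (metis insert_iff list.set(2) set_mset_mset set_mset_add_mset_insert mset.simps(2) union_single_eq_member)
   then obtain zs where zs: "mset us = mset (y # zs)"
    by (metis ex_mset insert_DiffM mset.simps(2))
   then have l: "Suc (Suc (length zs)) = length xs" using Cons by (metis length_Cons size_mset)
   have vs: "mset (x # zs) = mset vs" using less.prems Cons ys zs by (simp add: add_mset_commute)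
   have "wick C xs = wick C (x # y # zs)" unfolding Cons by (rule same[OF zs]) (simp add: Cons)
   also have "... = wick C (y # x # zs)" by (rule swap[OF l])
   also have "... = wick C ys" unfolding ys by (rule same[OF vs]) (use l in simp)
   finally show ?thesis .
  qed
 qed
qed

text \<open>The recursion evaluates C on pairs in list order only, and deletion keeps that order.
  Covariances may thus be exchanged when they agree on pairs ordered by level.\<close>

lemma wick_cong_ascending:
 assumes "!!x y. R x y ==> x \<in> A ==> y \<in> A ==> C x y = C' x y"
 shows "sorted_wrt R xs ==> set xs \<subseteq> A ==> wick C xs = wick C' xs"
proof (induction "length xs" arbitrary: xs rule: less_induct)
 case less
 show ?case
 proof (cases xs)
  case (Cons x us)
  have "C x (us ! j) * wick C (take j us @ drop (Suc j) us) = C' x (us ! j) * wick C' (take j us @ drop (Suc j) us)" if j: "j < length us" for j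
  proof (intro arg_cong2[where f = "(*)"])
   show "C x (us ! j) = C' x (us ! j)" using less.prems Cons j by (intro assms) auto
   have us: "sorted_wrt R us" using less.prems Cons by simp
   then have "sorted_wrt R (take j us @ us ! j # drop (Suc j) us)" using j by (simp add: id_take_nth_drop[symmetric])
   then have "sorted_wrt R (take j us @ drop (Suc j) us)" by (auto simp: sorted_wrt_append)
   moreover have "set (take j us @ drop (Suc j) us) \<subseteq> A" using less.prems Cons by (auto dest: in_set_takeD in_set_dropD)
   ultimately show "wick C (take j us @ drop (Suc j) us) = wick C' (take j us @ drop (Suc j) us)"
    using Cons j by (intro less.hyps) auto
  qed
  then show ?thesis unfolding Cons wick.simps by (intro sum.cong) auto
 qed simp
qed

section \<open>Derivations of polynomial functions and moments of boson fields\<close>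

definition polyn :: "(point => complex) => bool" where
 "polyn \<phi> \<longleftrightarrow> (\<exists>D. cv D (%N. \<phi>) \<phi>)"

lemma polyn_common:
 assumes "polyn f" "polyn g" obtains D where "cv D (%N. f) f" "cv D (%N. g) g"
proof -
 obtain D1 D2 where "cv D1 (%N. f) f" "cv D2 (%N. g) g" using assms unfolding polyn_def by blast
 then have "cv (D1 + D2) (%N. f) f" "cv (D1 + D2) (%N. g) g" by (auto intro: cv_mono)
 then show thesis by (rule that)
qed

lemma polyn_add: "polyn f ==> polyn g ==> polyn (%v. f v + g v)"
 by (erule polyn_common, assumption) (auto simp: polyn_def intro: cv_add)

lemma polyn_mult: "polyn f ==> polyn g ==> polyn (%v. f v * g v)"
 by (erule polyn_common, assumption) (auto simp: polyn_def intro: cv.cv_mult)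

lemma polyn_pderiv: "polyn f ==> polyn (pderiv_at i f)"
 unfolding polyn_def using cv_pderiv by blast

lemma polyn_const: "polyn (%v. c)"
 unfolding polyn_def using cv_scalar by blast

lemma polyn_sum: "(!!l. l \<in> A ==> polyn (f l)) ==> polyn (%v. \<Sum>l\<in>A. f l v)"
 by (induction A rule: infinite_finite_induct) (auto intro: polyn_const polyn_add)

lemma polyn_derivation: "polyn f ==> polyn (derivation k T f)"
 unfolding derivation_def[abs_def] by (intro polyn_sum polyn_mult polyn_const polyn_pderiv)

lemma derivation_add:
 assumes "polyn f" "polyn g" shows "derivation k T (%v. f v + g v) v = derivation k T f v + derivation k T g v"
proof -
 obtain D where "cv D (%N. f) f" "cv D (%N. g) g" using polyn_common[OF assms] .
 from cv_pderiv_add[OF this] show ?thesis by (simp add: derivation_def algebra_simps sum.distrib)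
qed

lemma derivation_mult:
 assumes "polyn f" "polyn g" shows "derivation k T (%v. f v * g v) v = f v * derivation k T g v + derivation k T f v * g v"
proof -
 obtain D where "cv D (%N. f) f" "cv D (%N. g) g" using polyn_common[OF assms] .
 from cv_pderiv_mult[OF this] show ?thesis
  by (simp add: derivation_def algebra_simps sum.distrib sum_distrib_left)
qed

lemma derivation_const: "derivation k T (%v. c) = (%v. 0)"
 by (simp add: derivation_def fun_eq_iff)

lemma derivation_pderiv:
 assumes "polyn f" shows "pderiv_at i (derivation k T f) v = derivation k T (pderiv_at i f) v"
proof -
 obtain D where D: "cv D (%N. f) f" using assms unfolding polyn_def by blast
 have "pderiv_at i (derivation k T f) v = (\<Sum>n<k. pderiv_at i (%v. (coeff T (k - 1 - n) * of_nat (n + 1)) * pderiv_at (n + 1) f v) v)"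
 proof -
  have "pderiv_at i (%v. \<Sum>n<k. (coeff T (k - 1 - n) * of_nat (n + 1)) * pderiv_at (n + 1) f v) v
   = (\<Sum>n<k. pderiv_at i (%v. (coeff T (k - 1 - n) * of_nat (n + 1)) * pderiv_at (n + 1) f v) v)"
   by (rule cv_pderiv_sum[where f = "%n N v. (coeff T (k - 1 - n) * of_nat (n + 1)) * pderiv_at (n + 1) f v" and N = 0])
     (rule cv_cmult[OF cv_pderiv[OF D]])
  then show ?thesis by (simp add: derivation_def[abs_def] mult.assoc)
 qed
 also have "... = (\<Sum>n<k. (coeff T (k - 1 - n) * of_nat (n + 1)) * pderiv_at (n + 1) (pderiv_at i f) v)"
  by (intro sum.cong refl) (simp only: cv_pderiv_cmult[where f = "%N. pderiv_at _ f" and N = 0, OF cv_pderiv[OF D]] cv_pderiv_commute[OF D, of i])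
 finally show ?thesis by (simp add: derivation_def mult.assoc)
qed

lemma derivation_cmult: "polyn f ==> derivation k T (%v. c * f v) v = c * derivation k T f v"
 using derivation_mult[OF polyn_const[of c], of f k T v] by (simp add: derivation_const)

lemma derivation_sum:
 "(!!l. l \<in> A ==> polyn (f l)) ==> derivation k T (%v. \<Sum>l\<in>A. f l v) v = (\<Sum>l\<in>A. derivation k T (f l) v)"
proof (induction A rule: infinite_finite_induct)
 case (insert x A)
 then show ?case using derivation_add[of "f x" "%v. \<Sum>l\<in>A. f l v"] polyn_sum[of A f] by simp
qed (auto simp: derivation_const)

lemma derivation_commute:
 assumes "polyn f" shows "derivation k T (derivation k' T' f) v = derivation k' T' (derivation k T f) v"
proof -
 have "derivation k T (derivation k' T' f) v = (\<Sum>n<k'. coeff T' (k' - 1 - n) * (of_nat (n + 1) * derivation k T (pderiv_at (n + 1) f) v))"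
  unfolding derivation_def[of k' T' f, abs_def]
  by (subst derivation_sum) (auto intro!: polyn_mult polyn_const polyn_pderiv assms sum.cong simp: derivation_cmult polyn_mult polyn_const polyn_pderiv assms)
 then show ?thesis by (simp only: derivation_def[of k' T' "derivation k T f"] derivation_pderiv[OF assms])
qed

text \<open>The operators \<open>L\<^sub>x + \<Gamma>\<^sub>x\<close> satisfy the canonical commutation relations of a free boson field, with
 the constant function \<open>1\<close> as vacuum.\<close>

definition boson :: "('x => point => complex) => ('x => nat) => ('x => complex poly) => 'x =>
  (point => complex) => point => complex" where
 "boson L K T x \<phi> v = L x v * \<phi> v + derivation (K x) (T x) \<phi> v"

text \<open>The x-derivation of L y is the constant C x y, so its commutator with the operator of y
  is a scalar. Moving it through all operators until it meets the constant 1, which it kills, leaves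
  the sum.\<close>

lemma boson_commutator:
 assumes L: "!!x. polyn (L x)" and C: "!!x y v. derivation (K x) (T x) (L y) v = C x y"
 shows "polyn (foldr (boson L K T) ys (%v. 1)) & derivation (K x) (T x) (foldr (boson L K T) ys (%v. 1)) v =
   (\<Sum>j<length ys. C x (ys ! j) * foldr (boson L K T) (take j ys @ drop (Suc j) ys) (%v. 1) v)"
proof (induction ys arbitrary: x v)
 case Nil then show ?case by (simp add: polyn_const derivation_const)
next
 case (Cons y ys)
 let ?F = "%ys. foldr (boson L K T) ys (%v. 1)"
 let ?d = "%x. derivation (K x) (T x)"
 have P: "polyn (?F ys)" using Cons by blast
 have F: "polyn (?F zs)" for zs
  by (induction zs) (auto simp: boson_def[abs_def] intro!: polyn_const polyn_add polyn_mult L polyn_derivation)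
 have dx: "?d x (?F ys) v = (\<Sum>j<length ys. C x (ys ! j) * ?F (take j ys @ drop (Suc j) ys) v)" for x v using Cons by blast
 have 1: "?F (y # ys) = (%v. L y v * ?F ys v + ?d y (?F ys) v)" by (simp add: boson_def[abs_def])
 have "?d x (?F (y # ys)) v = L y v * ?d x (?F ys) v + C x y * ?F ys v + ?d y (?d x (?F ys)) v"
  unfolding 1 using P derivation_add[OF polyn_mult[OF L P] polyn_derivation[OF P]] derivation_mult[OF L P]
  by (simp add: C derivation_commute[OF P, of "K x" "T x"])
 also have "?d x (?F ys) = (%v. \<Sum>j<length ys. C x (ys ! j) * ?F (take j ys @ drop (Suc j) ys) v)" by (rule ext) (rule dx)
 also have "?d y (%v. \<Sum>j<length ys. C x (ys ! j) * ?F (take j ys @ drop (Suc j) ys) v) v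
   = (\<Sum>j<length ys. C x (ys ! j) * ?d y (?F (take j ys @ drop (Suc j) ys)) v)"
  by (subst derivation_sum) (intro polyn_mult polyn_const F sum.cong[OF refl] derivation_cmult[OF F])+
 finally have e0: "?d x (?F (y # ys)) v = L y v * (\<Sum>j<length ys. C x (ys ! j) * ?F (take j ys @ drop (Suc j) ys) v) + C x y * ?F ys v
   + (\<Sum>j<length ys. C x (ys ! j) * ?d y (?F (take j ys @ drop (Suc j) ys)) v)" .
 have bx: "?F (y # zs) v = L y v * ?F zs v + ?d y (?F zs) v" for zs by (simp add: boson_def)
 have "(\<Sum>j<length ys. C x (ys ! j) * ?F (y # take j ys @ drop (Suc j) ys) v) =
   L y v * (\<Sum>j<length ys. C x (ys ! j) * ?F (take j ys @ drop (Suc j) ys) v) +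
   (\<Sum>j<length ys. C x (ys ! j) * ?d y (?F (take j ys @ drop (Suc j) ys)) v)"
  by (simp only: bx distrib_left sum.distrib sum_distrib_left mult.left_commute)
 with e0 have "?d x (?F (y # ys)) v = C x y * ?F ys v + (\<Sum>j<length ys. C x (ys ! j) * ?F (y # take j ys @ drop (Suc j) ys) v)"
  by (simp only: add_ac)
 then have "?d x (?F (y # ys)) v = (\<Sum>j<length (y # ys). C x ((y # ys) ! j) * ?F (take j (y # ys) @ drop (Suc j) (y # ys)) v)"
  by (simp only: length_Cons sum.lessThan_Suc_shift) simp
 then show ?case using F by blast
qed

text \<open>At the origin all L x vanish, so the outermost operator acts there by its derivation
  alone, and \<open>boson_commutator\<close> becomes the recursion of \<open>wick\<close>.\<close>

lemma boson_wick:
 assumes L: "!!x. polyn (L x)" and C: "!!x y v. derivation (K x) (T x) (L y) v = C x y" and L0: "!!x. L x (%_. 0) = 0"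
 shows "foldr (boson L K T) ys (%v. 1) (%_. 0) = wick C ys"
proof (induction "length ys" arbitrary: ys rule: less_induct)
 case less
 show ?case
 proof (cases ys)
  case (Cons x zs)
  have "foldr (boson L K T) ys (%v. 1) (%_. 0) = (\<Sum>j<length zs. C x (zs ! j) * foldr (boson L K T) (take j zs @ drop (Suc j) zs) (%v. 1) (%_. 0))"
  proof -
   have "derivation (K x) (T x) (foldr (boson L K T) zs (%v. 1)) (%_. 0) =
     (\<Sum>j<length zs. C x (zs ! j) * foldr (boson L K T) (take j zs @ drop (Suc j) zs) (%v. 1) (%_. 0))"
    using boson_commutator[where L = L and K = K and T = T and C = C and ys = zs and x = x and v = "%_. 0"] L C by blast
   then show ?thesis by (simp add: Cons boson_def L0 del: foldr_append)
  qed
  also have "... = wick C ys" unfolding Cons wick.simps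
   by (intro sum.cong refl arg_cong2[where f = "(*)"] less.hyps) (auto simp: Cons)
  finally show ?thesis .
 qed simp
qed

section \<open>The double contour integral as a finite sum of coefficients\<close>

subsection \<open>Evaluating the covariance integral\<close>

lemma circle_coefficient:
 assumes f: "f holomorphic_on ball 0 R" "f has_fps_expansion F" and r: "0 < r" "r < R"
 shows "((%s. f (circ r s) / circ r s ^ Suc j * circ' r s) has_integral 2 * of_real pi * \<i> * fps_nth F j) {0..1}"
proof -
 have "continuous_on (cball 0 r) f"
  by (rule holomorphic_on_imp_continuous_on[OF holomorphic_on_subset[OF f(1)]]) (use r in auto)
 moreover have "f holomorphic_on ball 0 r" by (rule holomorphic_on_subset[OF f(1)]) (use r in auto)
 ultimately have "((%u. f u / (u - 0) ^ Suc j) has_contour_integral (2 * pi * \<i>) / fact j * (deriv ^^ j) f 0) (circlepath 0 r)"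
  by (rule Cauchy_has_contour_integral_higher_derivative_circlepath) (use r in simp)
 then show ?thesis
  unfolding has_contour_integral vector_derivative_circlepath fps_nth_fps_expansion[OF f(2)]
  by (simp add: circlepath circ_def circ'_def)
qed

definition limit_fps :: "(nat => real) => complex fps" where
 "limit_fps c = Abs_fps (%k. of_real (c (k + 1) / fact k))"

definition symbol_fps :: "nat => complex => (nat => real) => complex fps" where
 "symbol_fps k a c = ((1 + fps_X) * (fps_const a + fps_X * limit_fps c)) ^ k"

lemma nhds_0_ball: "0 < r ==> (!!z. cmod z < r ==> P z) ==> eventually P (nhds (0::complex))"
 by (rule eventually_mono[OF eventually_nhds_in_open[of "ball 0 r"]]) auto

lemma pull_out:
 fixes A B P :: complex
 shows "1 / A * B * (P * (\<Sum>p\<in>I. f p * g p)) = P / A * (\<Sum>p\<in>I. f p * (B * g p))"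
proof -
 have "(\<Sum>p\<in>I. f p * (B * g p)) = B * (\<Sum>p\<in>I. f p * g p)" by (simp add: sum_distrib_left mult_ac)
 then show ?thesis by simp
qed

lemma pull_out_square:
 fixes A P :: complex
 shows "P / A * (\<Sum>p\<in>I. f p * (P * x p + m p * (P * y p))) = P ^ 2 / A * (\<Sum>p\<in>I. f p * (m p * y p + x p))"
proof -
 have "(\<Sum>p\<in>I. f p * (P * x p + m p * (P * y p))) = P * (\<Sum>p\<in>I. f p * (m p * y p + x p))"
  by (simp add: sum_distrib_left algebra_simps)
 then show ?thesis by (simp add: power2_eq_square)
qed

text \<open>For |z| < |w| the double pole is the sum of (p+1) z^p / w^(p+2). The inner integral
  therefore extracts negative powers of the first symbol, and the outer one, meeting w^(-p-2),
  positive powers of the second. The regular part G pairs negative powers with negative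
  powers.\<close>

lemma cov_formula_eq:
 assumes r: "r > 0"
  and sF: "!!x::complex. cmod (x - 1) < r ==> summable (%k. of_real (c (k + 1) / fact k) * (x - 1) ^ k)"
  and sG: "!!x y::complex. cmod (x - 1) < r ==> cmod (y - 1) < r ==>
     (%(k, l). of_real (d (k + 1) (l + 1) / (fact k * fact l)) * (x - 1) ^ k * (y - 1) ^ l) summable_on UNIV"
  and a: "a t1 > 0" "a t2 > 0" and eps: "0 < eps" "3 * eps < r" and k: "1 \<le> k1" "1 \<le> k2"
 shows "cov_formula c d a eps t1 k1 t2 k2 =
   (\<Sum>p<k1. fps_nth (symbol_fps k1 (of_real (a t1)) c) (k1 - 1 - p) *
    (of_nat (p + 1) * fps_nth (symbol_fps k2 (of_real (a t2)) c) (k2 + p + 1) +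
     (\<Sum>n<k2. fps_nth (symbol_fps k2 (of_real (a t2)) c) (k2 - 1 - n) * of_real (d (p + 1) (n + 1) / (fact p * fact n)))))"
proof -
 \<comment> \<open>The k-th power of \<alpha> z times the bracket, which has no pole.\<close>
 define \<psi> where "\<psi> = (%k (\<alpha>::real) z. ((1 + z) * (of_real \<alpha> + z * F_lim c (1 + z))) ^ k)"
 let ?\<Psi> = "%k (\<alpha>::real). symbol_fps k (of_real \<alpha>) c"
 \<comment> \<open>The coefficient of z^p in G(1 + z, 1 + w), a power series in w.\<close>
 define \<gamma> where "\<gamma> = (%p w. \<Sum>l. of_real (d (p + 1) (l + 1) / (fact p * fact l)) * w ^ l :: complex)"
 define gf where "gf = (%p. Abs_fps (%l. complex_of_real (d (p + 1) (l + 1) / (fact p * fact l))))"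
 have Fs: "(%k. of_real (c (k + 1) / fact k) * z ^ k) sums F_lim c (1 + z)" if "cmod z < r" for z
  using summable_sums[OF sF[of "1 + z"]] that by (simp add: F_lim_def)
 have Fh: "(%z. F_lim c (1 + z)) holomorphic_on ball 0 r"
  by (rule power_series_holomorphic[where a = "%k. of_real (c (k + 1) / fact k)"]) (use Fs in auto)
 have Fe: "(%z. F_lim c (1 + z)) has_fps_expansion limit_fps c"
  by (rule has_fps_expansionI, rule nhds_0_ball[OF r]) (use Fs in \<open>simp add: limit_fps_def\<close>)
 have \<psi>h: "\<psi> k \<alpha> holomorphic_on ball 0 r" for k \<alpha>
  unfolding \<psi>_def by (intro holomorphic_intros Fh)
 have \<psi>e: "\<psi> k \<alpha> has_fps_expansion ?\<Psi> k \<alpha>" for k \<alpha>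
  unfolding \<psi>_def symbol_fps_def
  by (intro has_fps_expansion_power has_fps_expansion_mult has_fps_expansion_add has_fps_expansion_const has_fps_expansion_fps_X Fe has_fps_expansion_1)
 let ?t = "%z w (k, l). of_real (d (k + 1) (l + 1) / (fact k * fact l)) * z ^ k * w ^ l :: complex"
 have sG': "?t z w summable_on UNIV \<times> UNIV" if "cmod z < r" "cmod w < r" for z w
  using sG[of "1 + z" "1 + w"] that by simp
 have inner: "(%l. of_real (d (k + 1) (l + 1) / (fact k * fact l)) * w ^ l) summable_on UNIV" if "cmod w < r" for k w
 proof -
  \<comment> \<open>Any nonzero point of the disc serves: a row of the double series is recovered at
    ?z by dividing by ?z^k.\<close>
  let ?z = "complex_of_real (r / 2)"
  have z: "?z ~= 0" "cmod ?z < r" using r by (auto simp: norm_divide)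
  have "(%l. ?t ?z w (k, l)) summable_on UNIV"
   using summable_on_SigmaD1[of "%k l. ?t ?z w (k, l)" UNIV "%_. UNIV" k] sG'[OF z(2) that] by (simp add: case_prod_unfold)
  then have "(%l. inverse (?z ^ k) * ?t ?z w (k, l)) summable_on UNIV" by (rule summable_on_cmult_right)
  then show ?thesis using z(1) by (simp add: field_simps)
 qed
 have \<gamma>s: "(%l. of_real (d (k + 1) (l + 1) / (fact k * fact l)) * w ^ l) sums \<gamma> k w" if "cmod w < r" for k w
  unfolding \<gamma>_def by (intro summable_sums summable_on_imp_summable inner that)
 have \<gamma>h: "\<gamma> p holomorphic_on ball 0 r" for p
  by (rule power_series_holomorphic[where a = "%l. of_real (d (p + 1) (l + 1) / (fact p * fact l))"]) (use \<gamma>s in auto)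
 have \<gamma>e: "\<gamma> p has_fps_expansion gf p" for p
  by (rule has_fps_expansionI, rule nhds_0_ball[OF r]) (use \<gamma>s in \<open>simp add: gf_def\<close>)
 have Gs: "(%p. \<gamma> p w * z ^ p) sums G_lim d (1 + z) (1 + w)" if "cmod z < r" "cmod w < r" for z w
 proof -
  have "(?t z w has_sum G_lim d (1 + z) (1 + w)) (UNIV \<times> UNIV)"
   using has_sum_infsum[OF sG'[OF that]] by (simp add: G_lim_def)
  moreover have "((%l. ?t z w (p, l)) has_sum (\<gamma> p w * z ^ p)) UNIV" for p
  proof -
   have "(\<Sum>\<^sub>\<infinity>l. of_real (d (p + 1) (l + 1) / (fact p * fact l)) * w ^ l) = \<gamma> p w"
    using has_sum_imp_sums[OF has_sum_infsum[OF inner[OF that(2), of p]]] \<gamma>s[OF that(2), of p] by (rule sums_unique2)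
   then have "((%l. of_real (d (p + 1) (l + 1) / (fact p * fact l)) * w ^ l) has_sum \<gamma> p w) UNIV"
    using has_sum_infsum[OF inner[OF that(2), of p]] by simp
   from has_sum_cmult_right[OF this, of "z ^ p"] show ?thesis by (simp add: mult_ac)
  qed
  ultimately have "((%p. \<gamma> p w * z ^ p) has_sum G_lim d (1 + z) (1 + w)) UNIV"
   by (rule has_sum_SigmaD)
  then show ?thesis by (rule has_sum_imp_sums)
 qed
 have inner_int: "integral {0..1} (%u. \<psi> k1 (a t1) (circ eps u) / circ eps u ^ k1 * Q_lim d (circ eps u) w * circ' eps u)
   = 2 * of_real pi * \<i> * (\<Sum>p<k1. fps_nth (?\<Psi> k1 (a t1)) (k1 - 1 - p) * (\<gamma> p w + of_nat (p + 1) / w ^ (p + 2)))"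
  if w: "cmod w = 2 * eps" for w
 proof -
  have wr: "cmod w < r" and w0: "w ~= 0" using w eps by auto
  \<comment> \<open>The expansion of Q in z at fixed w, valid for |z| < 2 eps = |w|, hence on the
    inner circle.\<close>
  define H where "H = Abs_fps (%p. \<gamma> p w + of_nat (p + 1) / w ^ (p + 2))"
  have Qs: "(%p. fps_nth H p * z ^ p) sums Q_lim d z w" if z: "cmod z < 2 * eps" for z
  proof -
   have "cmod (z / w) < 1" using z w eps by (simp add: norm_divide)
   from sums_mult[OF geometric_deriv_sums[OF this], of "1 / w ^ 2"]
   have "(%p. of_nat (p + 1) / w ^ (p + 2) * z ^ p) sums (1 / w ^ 2 * (1 / (1 - z / w) ^ 2))"
    by (simp add: power_divide power_add field_simps power2_eq_square)
   moreover have "1 / w ^ 2 * (1 / (1 - z / w) ^ 2) = 1 / (z - w) ^ 2"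
   proof -
    have "w * (1 - z / w) = w - z" using w0 by (simp add: field_simps)
    then have "w ^ 2 * (1 - z / w) ^ 2 = (z - w) ^ 2" by (metis power2_commute power_mult_distrib)
    then show ?thesis by (metis mult.right_neutral times_divide_times_eq)
   qed
   ultimately have "(%p. of_nat (p + 1) / w ^ (p + 2) * z ^ p) sums (1 / (z - w) ^ 2)" by simp
   from sums_add[OF Gs[of z w] this] show ?thesis using z wr eps
    by (simp add: H_def Q_lim_def distrib_right)
  qed
  have Qh: "(%z. Q_lim d z w) holomorphic_on ball 0 (2 * eps)"
   by (rule power_series_holomorphic[where a = "fps_nth H"]) (use Qs in auto)
  have Qe: "(%z. Q_lim d z w) has_fps_expansion H"
   by (rule has_fps_expansionI, rule nhds_0_ball[of "2 * eps"]) (use Qs eps in auto)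
  have "((%u. \<psi> k1 (a t1) (circ eps u) * Q_lim d (circ eps u) w / circ eps u ^ Suc (k1 - 1) * circ' eps u) has_integral
    2 * of_real pi * \<i> * fps_nth (?\<Psi> k1 (a t1) * H) (k1 - 1)) {0..1}"
  proof (rule circle_coefficient[where R = "2 * eps" and f = "%z. \<psi> k1 (a t1) z * Q_lim d z w"])
   have "\<psi> k1 (a t1) holomorphic_on ball 0 (2 * eps)" by (rule holomorphic_on_subset[OF \<psi>h]) (use eps in auto)
   then show "(%z. \<psi> k1 (a t1) z * Q_lim d z w) holomorphic_on ball 0 (2 * eps)" by (intro holomorphic_intros Qh)
   show "(%z. \<psi> k1 (a t1) z * Q_lim d z w) has_fps_expansion ?\<Psi> k1 (a t1) * H"
    by (intro has_fps_expansion_mult \<psi>e Qe)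
  qed (use eps in auto)
  moreover have "fps_nth (?\<Psi> k1 (a t1) * H) (k1 - 1) = (\<Sum>p<k1. fps_nth (?\<Psi> k1 (a t1)) (k1 - 1 - p) * (\<gamma> p w + of_nat (p + 1) / w ^ (p + 2)))"
  proof -
   have "fps_nth (H * ?\<Psi> k1 (a t1)) (k1 - 1) = (\<Sum>p<k1. fps_nth H p * fps_nth (?\<Psi> k1 (a t1)) (k1 - 1 - p))"
    unfolding fps_mult_nth by (rule sum.cong) (use k in auto)
   then show ?thesis by (simp add: mult.commute H_def)
  qed
  ultimately show ?thesis using k by (simp add: integral_unique)
 qed
 define z where "z = circ eps"
 define W where "W = circ (2 * eps)"
 have nz: "cmod (circ \<rho> u) = \<rho>" if "0 < \<rho>" for \<rho> u using that by (simp add: circ_def norm_mult)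
 have z0: "z u ~= 0" for u using nz[OF eps(1), of u] eps unfolding z_def by (metis norm_zero less_irrefl)
 have Wn: "cmod (W s) = 2 * eps" for s using nz[of "2 * eps" s] eps by (simp add: W_def)
 have W0: "W s ~= 0" for s using Wn[of s] eps by auto
 have base: "(1 / x + 1 + (1 + x) * F_lim c (1 + x) / of_real \<alpha>) ^ k = \<psi> k \<alpha> x / (of_real \<alpha> ^ k * x ^ k)" if "x ~= 0" "\<alpha> > 0" for x k and \<alpha> :: real
 proof -
  have "1 / x + 1 + (1 + x) * F_lim c (1 + x) / of_real \<alpha> = (1 + x) * (of_real \<alpha> + x * F_lim c (1 + x)) / (of_real \<alpha> * x)"
   using that by (simp add: field_simps)
  then show ?thesis by (simp add: \<psi>_def power_divide power_mult_distrib)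
 qed
 let ?a1 = "complex_of_real (a t1) ^ k1" and ?a2 = "complex_of_real (a t2) ^ k2"
 have "integral {0..1} (%s. integral {0..1} (%u.
    (let z = circ eps u; w = circ (2 * eps) s in
     (1 / z + 1 + (1 + z) * F_lim c (1 + z) / of_real (a t1)) ^ k1 *
     (1 / w + 1 + (1 + w) * F_lim c (1 + w) / of_real (a t2)) ^ k2 *
     Q_lim d z w * circ' eps u * circ' (2 * eps) s)))
  = integral {0..1} (%s. (1 / (?a1 * ?a2) * (\<psi> k2 (a t2) (W s) / W s ^ k2 * circ' (2 * eps) s)) *
    integral {0..1} (%u. \<psi> k1 (a t1) (circ eps u) / circ eps u ^ k1 * Q_lim d (circ eps u) (W s) * circ' eps u))"
  unfolding Let_def integral_mult_right[symmetric] W_def[symmetric] z_def[symmetric]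
  by (intro integral_cong) (simp add: base[OF z0 a(1)] base[OF W0 a(2)] mult_ac)
 also have "... = integral {0..1} (%s. 2 * of_real pi * \<i> / (?a1 * ?a2) * (\<Sum>p<k1. fps_nth (?\<Psi> k1 (a t1)) (k1 - 1 - p) *
   (\<psi> k2 (a t2) (W s) * \<gamma> p (W s) / W s ^ Suc (k2 - 1) * circ' (2 * eps) s +
    of_nat (p + 1) * (\<psi> k2 (a t2) (W s) / W s ^ Suc (k2 + p + 1) * circ' (2 * eps) s))))"
  unfolding inner_int[OF Wn]
 proof (rule integral_cong)
  fix s
  have *: "\<psi> k2 (a t2) (W s) / W s ^ k2 * circ' (2 * eps) s * (\<gamma> p (W s) + of_nat (p + 1) / W s ^ (p + 2)) =
    \<psi> k2 (a t2) (W s) * \<gamma> p (W s) / W s ^ Suc (k2 - 1) * circ' (2 * eps) s +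
    of_nat (p + 1) * (\<psi> k2 (a t2) (W s) / W s ^ Suc (k2 + p + 1) * circ' (2 * eps) s)" for p
  proof -
   have "Suc (k2 - 1) = k2" "W s ^ Suc (k2 + p + 1) = W s ^ k2 * W s ^ (p + 2)" using k by (auto simp: power_add[symmetric] simp del: power_Suc)
   then show ?thesis using W0[of s] by (simp add: field_simps del: power_Suc of_nat_add)
  qed
  show "1 / (?a1 * ?a2) * (\<psi> k2 (a t2) (W s) / W s ^ k2 * circ' (2 * eps) s) *
     (2 * of_real pi * \<i> * (\<Sum>p<k1. fps_nth (?\<Psi> k1 (a t1)) (k1 - 1 - p) * (\<gamma> p (W s) + of_nat (p + 1) / W s ^ (p + 2))))
   = 2 * of_real pi * \<i> / (?a1 * ?a2) * (\<Sum>p<k1. fps_nth (?\<Psi> k1 (a t1)) (k1 - 1 - p) *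
   (\<psi> k2 (a t2) (W s) * \<gamma> p (W s) / W s ^ Suc (k2 - 1) * circ' (2 * eps) s +
    of_nat (p + 1) * (\<psi> k2 (a t2) (W s) / W s ^ Suc (k2 + p + 1) * circ' (2 * eps) s)))"
   unfolding *[symmetric] by (rule pull_out)
 qed
 also have "... = 2 * of_real pi * \<i> / (?a1 * ?a2) * (\<Sum>p<k1. fps_nth (?\<Psi> k1 (a t1)) (k1 - 1 - p) *
   (2 * of_real pi * \<i> * fps_nth (?\<Psi> k2 (a t2) * gf p) (k2 - 1) + of_nat (p + 1) * (2 * of_real pi * \<i> * fps_nth (?\<Psi> k2 (a t2)) (k2 + p + 1))))"
 proof (rule integral_unique, rule has_integral_mult_right, rule has_integral_sum, simp, rule has_integral_mult_right, rule has_integral_add)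
  fix p
  show "((%s. \<psi> k2 (a t2) (W s) * \<gamma> p (W s) / W s ^ Suc (k2 - 1) * circ' (2 * eps) s) has_integral
    2 * of_real pi * \<i> * fps_nth (?\<Psi> k2 (a t2) * gf p) (k2 - 1)) {0..1}"
   unfolding W_def
   by (rule circle_coefficient[where R = r and f = "%w. \<psi> k2 (a t2) w * \<gamma> p w"])
     (use eps in \<open>auto intro!: holomorphic_intros \<psi>h \<gamma>h has_fps_expansion_mult \<psi>e \<gamma>e\<close>)
  show "((%s. of_nat (p + 1) * (\<psi> k2 (a t2) (W s) / W s ^ Suc (k2 + p + 1) * circ' (2 * eps) s)) has_integral
    of_nat (p + 1) * (2 * of_real pi * \<i> * fps_nth (?\<Psi> k2 (a t2)) (k2 + p + 1))) {0..1}"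
   unfolding W_def
   by (rule has_integral_mult_right, rule circle_coefficient[OF \<psi>h \<psi>e]) (use eps in auto)
 qed
 also have "... = (2 * of_real pi * \<i>) ^ 2 / (?a1 * ?a2) * (\<Sum>p<k1. fps_nth (?\<Psi> k1 (a t1)) (k1 - 1 - p) *
   (of_nat (p + 1) * fps_nth (?\<Psi> k2 (a t2)) (k2 + p + 1) + fps_nth (?\<Psi> k2 (a t2) * gf p) (k2 - 1)))"
  by (rule pull_out_square)
 also have "(\<Sum>p<k1. fps_nth (?\<Psi> k1 (a t1)) (k1 - 1 - p) *
   (of_nat (p + 1) * fps_nth (?\<Psi> k2 (a t2)) (k2 + p + 1) + fps_nth (?\<Psi> k2 (a t2) * gf p) (k2 - 1))) =
  (\<Sum>p<k1. fps_nth (?\<Psi> k1 (a t1)) (k1 - 1 - p) * (of_nat (p + 1) * fps_nth (?\<Psi> k2 (a t2)) (k2 + p + 1) +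
     (\<Sum>n<k2. fps_nth (?\<Psi> k2 (a t2)) (k2 - 1 - n) * of_real (d (p + 1) (n + 1) / (fact p * fact n)))))"
 proof -
  have gm: "fps_nth (gf p * ?\<Psi> k2 (a t2)) (k2 - 1) = (\<Sum>n<k2. fps_nth (gf p) n * fps_nth (?\<Psi> k2 (a t2)) (k2 - 1 - n))" for p
   unfolding fps_mult_nth by (rule sum.cong) (use k in auto)
  have "fps_nth (?\<Psi> k2 (a t2) * gf p) (k2 - 1) = (\<Sum>n<k2. fps_nth (?\<Psi> k2 (a t2)) (k2 - 1 - n) * of_real (d (p + 1) (n + 1) / (fact p * fact n)))" for p
   unfolding mult.commute[of "?\<Psi> k2 (a t2)" "gf p"] gm
   by (rule sum.cong[OF refl]) (simp only: gf_def fps_nth_Abs_fps mult.commute)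
  then show ?thesis by simp
 qed
 finally show ?thesis
  using a unfolding cov_formula_def by simp
qed

text \<open>Up to degree b the symbol involves F only below degree b, because F is multiplied by z;
  truncation leaves these coefficients intact.\<close>

lemma coeff_symbol_poly_fps:
 assumes "j \<le> b"
 shows "coeff (symbol_poly k a (limit_symbol b (%r. if r = 0 then 0 else of_real (c r / fact r)))) j = fps_nth (symbol_fps k a c) j"
proof -
 let ?F = "limit_symbol b (%r. if r = 0 then 0 else of_real (c r / fact r))"
 have F: "coeff ?F i = of_real (c (i + 1) / fact i)" if "i < b" for i
 proof -
  have "coeff ?F i = (\<Sum>r\<in>{1..b}. if r = i + 1 then of_nat r * of_real (c r / fact r) else 0)"
   unfolding limit_symbol_def coeff_sum coeff_monom by (intro sum.cong) auto
  also have "... = of_nat (i + 1) * of_real (c (i + 1) / fact (i + 1))" using that by (simp add: sum.delta)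
  also have "... = of_real (real (i + 1) * (c (i + 1) / fact (i + 1)))" by (simp only: of_real_mult of_real_of_nat_eq)
  also have "real (i + 1) * (c (i + 1) / fact (i + 1)) = c (i + 1) / fact i"
   by (simp add: divide_simps)
  finally show ?thesis .
 qed
 have mult: "\<forall>i\<le>b. fps_nth (f * g) i = fps_nth (f' * g') i"
  if "\<forall>i\<le>b. fps_nth f i = fps_nth f' i" "\<forall>i\<le>b. fps_nth g i = fps_nth g' i" for f g f' g' :: "complex fps"
  unfolding fps_mult_nth using that by (auto intro!: sum.cong)
 have pow: "\<forall>i\<le>b. fps_nth (f ^ k) i = fps_nth (f' ^ k) i" if "\<forall>i\<le>b. fps_nth f i = fps_nth f' i" for f f' :: "complex fps"
  by (induction k) (use mult[OF that] in auto)
 have "\<forall>i\<le>b. fps_nth (fps_const a + fps_X * fps_of_poly ?F) i = fps_nth (fps_const a + fps_X * limit_fps c) i"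
  by (auto simp: limit_fps_def F)
 then have "\<forall>i\<le>b. fps_nth (((1 + fps_X) * (fps_const a + fps_X * fps_of_poly ?F)) ^ k) i = fps_nth (symbol_fps k a c) i"
  unfolding symbol_fps_def by (intro pow mult) auto
 moreover have "fps_of_poly (symbol_poly k a ?F) = ((1 + fps_X) * (fps_const a + fps_X * fps_of_poly ?F)) ^ k"
  unfolding symbol_poly_def by (simp add: fps_of_poly_power fps_of_poly_mult fps_of_poly_add fps_of_poly_pCons fps_of_poly_const mult.commute)
 ultimately show ?thesis using assms by (metis fps_of_poly_nth)
qed

section \<open>Commutators of the limiting operators and the covariance\<close>

subsection \<open>The limiting covariance\<close>

lemma polyn_var: "polyn (%v. v i)"
 unfolding polyn_def by (rule exI[of _ "Suc i"], rule cv_var) simp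

lemma polyn_diff: "polyn f ==> polyn g ==> polyn (%v. f v - g v)"
 by (erule polyn_common, assumption) (auto simp: polyn_def intro: cv_diff)

lemma polyn_quadratic_limit: "polyn (quadratic_limit b C)"
 unfolding quadratic_limit_def[abs_def] by (intro polyn_sum polyn_mult polyn_const polyn_diff polyn_var)

lemma polyn_multiplier: "polyn q ==> polyn (multiplier k T q)"
 unfolding multiplier_def[abs_def]
 by (intro polyn_add polyn_sum polyn_mult polyn_const polyn_var polyn_pderiv)

lemma indep0_quadratic_limit: "indep0 (quadratic_limit b C)"
 by (auto simp: indep0_def quadratic_limit_def intro!: sum.cong)

lemma DERIV_upd: "((%t. (v(j := t)) s) has_field_derivative (if s = j then 1 else 0)) (at (z::complex))"
 by auto

text \<open>The final double sum is a constant coming from the terms v (r + s); only the linear part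
  survives another derivative.\<close>

lemma pderiv_quadratic_limit:
 assumes sym: "!!r s. 1 \<le> r ==> 1 \<le> s ==> C r s = C s r" and i: "1 \<le> i"
 shows "pderiv_at i (quadratic_limit b C) v = (\<Sum>s\<in>{1..b - i}. C i s * v s)
   - (\<Sum>r\<in>{1..b}. \<Sum>s\<in>{1..b - r}. C r s / 2 * (if r + s = i then 1 else 0))"
proof -
 let ?\<delta> = "%s. if s = i then 1 else (0::complex)"
 have "((%t. quadratic_limit b C (v(i := t))) has_field_derivative
   (\<Sum>r\<in>{1..b}. \<Sum>s\<in>{1..b - r}. C r s / 2 * (?\<delta> r * v s + ?\<delta> s * v r - ?\<delta> (r + s)))) (at (v i))"
  unfolding quadratic_limit_def
 proof (intro DERIV_sum DERIV_cmult DERIV_diff DERIV_upd)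
  fix r s
  show "((%t. (v(i := t)) r * (v(i := t)) s) has_field_derivative ?\<delta> r * v s + ?\<delta> s * v r) (at (v i))"
   using DERIV_mult[OF DERIV_upd[of v i r "v i"] DERIV_upd[of v i s "v i"]] by simp
 qed
 then have "pderiv_at i (quadratic_limit b C) v =
   (\<Sum>r\<in>{1..b}. \<Sum>s\<in>{1..b - r}. C r s / 2 * (?\<delta> r * v s + ?\<delta> s * v r - ?\<delta> (r + s)))"
  unfolding pderiv_at_def by (rule DERIV_imp_deriv)
 also have "... = (\<Sum>r\<in>{1..b}. \<Sum>s\<in>{1..b - r}. C r s / 2 * (?\<delta> r * v s)) + (\<Sum>r\<in>{1..b}. \<Sum>s\<in>{1..b - r}. C r s / 2 * (?\<delta> s * v r))
   - (\<Sum>r\<in>{1..b}. \<Sum>s\<in>{1..b - r}. C r s / 2 * ?\<delta> (r + s))"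
  by (simp only: distrib_left right_diff_distrib sum.distrib sum_subtractf)
 also have "(\<Sum>r\<in>{1..b}. \<Sum>s\<in>{1..b - r}. C r s / 2 * (?\<delta> r * v s)) = (\<Sum>s\<in>{1..b - i}. C i s / 2 * v s)"
 proof -
  have "(\<Sum>r\<in>{1..b}. \<Sum>s\<in>{1..b - r}. C r s / 2 * (?\<delta> r * v s)) = (\<Sum>r\<in>{1..b}. if r = i then (\<Sum>s\<in>{1..b - i}. C i s / 2 * v s) else 0)"
   by (intro sum.cong refl) auto
  then show ?thesis using i by (auto simp: sum.delta)
 qed
 also have "(\<Sum>r\<in>{1..b}. \<Sum>s\<in>{1..b - r}. C r s / 2 * (?\<delta> s * v r)) = (\<Sum>r\<in>{1..b - i}. C i r / 2 * v r)"
 proof -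
  have "(\<Sum>r\<in>{1..b}. \<Sum>s\<in>{1..b - r}. C r s / 2 * (?\<delta> s * v r)) = (\<Sum>r\<in>{1..b}. if i \<le> b - r then C i r / 2 * v r else 0)"
  proof (rule sum.cong[OF refl])
   fix r assume r: "r \<in> {1..b}"
   have "(\<Sum>s\<in>{1..b - r}. C r s / 2 * (?\<delta> s * v r)) = (\<Sum>s\<in>{1..b - r}. if s = i then C r i / 2 * v r else 0)"
    by (intro sum.cong refl) auto
   then show "(\<Sum>s\<in>{1..b - r}. C r s / 2 * (?\<delta> s * v r)) = (if i \<le> b - r then C i r / 2 * v r else 0)"
    using i r sym[of r i] by (auto simp: sum.delta)
  qed
  also have "... = (\<Sum>r\<in>{1..b - i}. C i r / 2 * v r)"
   by (rule sum.mono_neutral_cong_right) (use i in auto)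
  finally show ?thesis .
 qed
 also have "(\<Sum>s\<in>{1..b - i}. C i s / 2 * v s) + (\<Sum>r\<in>{1..b - i}. C i r / 2 * v r) = (\<Sum>s\<in>{1..b - i}. C i s * v s)"
  unfolding sum.distrib[symmetric] by (intro sum.cong refl) simp
 finally show ?thesis .
qed

text \<open>For quadratic q the multiplier is affine in v, so its derivatives are constants. This
  makes the commutators scalar.\<close>

lemma pderiv_multiplier_quadratic:
 assumes sym: "!!r s. 1 \<le> r ==> 1 \<le> s ==> C r s = C s r" and j: "1 \<le> j"
 shows "pderiv_at j (multiplier k T (quadratic_limit b C)) v =
   coeff T (k + j) + (\<Sum>n<k. coeff T (k - 1 - n) * (of_nat (n + 1) * (if j \<le> b - (n + 1) then C (n + 1) j else 0)))"
proof -
 let ?\<delta> = "%s. if s = j then 1 else (0::complex)"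
 let ?c = "%i. \<Sum>r\<in>{1..b}. \<Sum>s\<in>{1..b - r}. C r s / 2 * (if r + s = i then 1 else 0)"
 have q: "pderiv_at (n + 1) (quadratic_limit b C) v = (\<Sum>s\<in>{1..b - (n + 1)}. C (n + 1) s * v s) - ?c (n + 1)" for n v
  by (rule pderiv_quadratic_limit[OF sym]) simp_all
 have m: "multiplier k T (quadratic_limit b C) = (%v. (\<Sum>s\<in>{1..degree T}. coeff T (k + s) * v s)
   + (\<Sum>n<k. coeff T (k - 1 - n) * (of_nat (n + 1) * ((\<Sum>s\<in>{1..b - (n + 1)}. C (n + 1) s * v s) - ?c (n + 1)))))"
  unfolding multiplier_def[abs_def] q ..
 have "((%t. multiplier k T (quadratic_limit b C) (v(j := t))) has_field_derivative
   (\<Sum>s\<in>{1..degree T}. coeff T (k + s) * ?\<delta> s)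
   + (\<Sum>n<k. coeff T (k - 1 - n) * (of_nat (n + 1) * ((\<Sum>s\<in>{1..b - (n + 1)}. C (n + 1) s * ?\<delta> s) - 0)))) (at (v j))"
  unfolding m by (intro DERIV_add DERIV_sum DERIV_cmult DERIV_diff DERIV_upd DERIV_const)
 then have "pderiv_at j (multiplier k T (quadratic_limit b C)) v =
   (\<Sum>s\<in>{1..degree T}. coeff T (k + s) * ?\<delta> s)
   + (\<Sum>n<k. coeff T (k - 1 - n) * (of_nat (n + 1) * ((\<Sum>s\<in>{1..b - (n + 1)}. C (n + 1) s * ?\<delta> s) - 0)))"
  unfolding pderiv_at_def by (rule DERIV_imp_deriv)
 moreover have "(\<Sum>s\<in>A. f s * ?\<delta> s) = (if j \<in> A then f j else 0)" if "finite A" for A f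
 proof -
  have "(\<Sum>s\<in>A. f s * ?\<delta> s) = (\<Sum>s\<in>A. if s = j then f j else 0)" by (intro sum.cong) auto
  then show ?thesis using that by simp
 qed
 moreover have "coeff T (k + j) = 0" if "\<not> j \<le> degree T" using that by (intro coeff_eq_0) auto
 ultimately show ?thesis using j by (simp cong: if_cong)
qed

lemma derivation_multiplier_quadratic:
 assumes sym: "!!r s. 1 \<le> r ==> 1 \<le> s ==> C r s = C s r"
 shows "derivation k1 T1 (%v. multiplier k2 T2 (quadratic_limit b C) v - c) v =
  (\<Sum>p<k1. coeff T1 (k1 - 1 - p) * (of_nat (p + 1) * (coeff T2 (k2 + (p + 1)) +
   (\<Sum>n<k2. coeff T2 (k2 - 1 - n) * (of_nat (n + 1) * (if p + 1 \<le> b - (n + 1) then C (n + 1) (p + 1) else 0))))))"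
proof -
 have "derivation k1 T1 (%v. multiplier k2 T2 (quadratic_limit b C) v - c) v
   = derivation k1 T1 (multiplier k2 T2 (quadratic_limit b C)) v"
  using derivation_add[OF polyn_multiplier[OF polyn_quadratic_limit] polyn_const[of "- c"]]
  by (simp add: derivation_const)
 also have "... = (\<Sum>p<k1. coeff T1 (k1 - 1 - p) * (of_nat (p + 1) * (coeff T2 (k2 + (p + 1)) +
   (\<Sum>n<k2. coeff T2 (k2 - 1 - n) * (of_nat (n + 1) * (if p + 1 \<le> b - (n + 1) then C (n + 1) (p + 1) else 0))))))"
  unfolding derivation_def
 proof (rule sum.cong[OF refl])
  fix p
  show "coeff T1 (k1 - 1 - p) * (of_nat (p + 1) * pderiv_at (p + 1) (multiplier k2 T2 (quadratic_limit b C)) v) =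
   coeff T1 (k1 - 1 - p) * (of_nat (p + 1) * (coeff T2 (k2 + (p + 1)) +
   (\<Sum>n<k2. coeff T2 (k2 - 1 - n) * (of_nat (n + 1) * (if p + 1 \<le> b - (n + 1) then C (n + 1) (p + 1) else 0)))))"
   by (subst pderiv_multiplier_quadratic[OF sym]) simp_all
 qed
 finally show ?thesis .
qed

lemma limit_chain_foldr: "limit_chain \<Lambda> xs \<phi> = foldr \<Lambda> (rev xs) \<phi>"
 by (induction xs arbitrary: \<phi>) simp_all

text \<open>k1 + k2 <= b makes both truncations invisible: the symbols are used up to degree k1 +
  k2, and d only at indices with (p + 1) + (n + 1) <= k1 + k2.\<close>

lemma covariance_coefficients:
 fixes c :: "nat => real" and d :: "nat => nat => real"
 assumes dsym: "!!r s. 1 \<le> r ==> 1 \<le> s ==> d r s = d s r" and b: "k1 + k2 \<le> b"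
 defines "F \<equiv> limit_symbol b (%r. if r = 0 then 0 else of_real (c r / fact r))"
 shows "derivation k1 (symbol_poly k1 a1 F) (%v. multiplier k2 (symbol_poly k2 a2 F)
   (quadratic_limit b (%r s. of_real (d r s / (fact r * fact s)))) v - \<kappa>) v =
  (\<Sum>p<k1. fps_nth (symbol_fps k1 a1 c) (k1 - 1 - p) *
    (of_nat (p + 1) * fps_nth (symbol_fps k2 a2 c) (k2 + p + 1) +
     (\<Sum>n<k2. fps_nth (symbol_fps k2 a2 c) (k2 - 1 - n) * of_real (d (p + 1) (n + 1) / (fact p * fact n)))))"
proof -
 let ?C = "%r s. complex_of_real (d r s / (fact r * fact s))"
 have sym: "?C r s = ?C s r" if "1 \<le> r" "1 \<le> s" for r s using dsym[OF that] by (simp add: mult.commute)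
 have co: "coeff (symbol_poly k a F) j = fps_nth (symbol_fps k a c) j" if "j \<le> b" for k a j
  unfolding F_def by (rule coeff_symbol_poly_fps[OF that])
 have e: "of_nat (p + 1) * (of_nat (n + 1) * ?C (n + 1) (p + 1)) = of_real (d (p + 1) (n + 1) / (fact p * fact n))" for p n
 proof -
  have "of_nat (p + 1) * (of_nat (n + 1) * ?C (n + 1) (p + 1)) = of_real (real (p + 1) * (real (n + 1) * (d (n + 1) (p + 1) / (fact (n + 1) * fact (p + 1)))))"
   by (simp only: of_real_mult of_real_of_nat_eq)
  also have "real (p + 1) * (real (n + 1) * (d (n + 1) (p + 1) / (fact (n + 1) * fact (p + 1)))) = d (p + 1) (n + 1) / (fact p * fact n)"
   using dsym[of "n + 1" "p + 1"] by (simp add: divide_simps)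
  finally show ?thesis .
 qed
 have D: "derivation k1 (symbol_poly k1 a1 F) (%v. multiplier k2 (symbol_poly k2 a2 F) (quadratic_limit b ?C) v - \<kappa>) v =
  (\<Sum>p<k1. coeff (symbol_poly k1 a1 F) (k1 - 1 - p) * (of_nat (p + 1) * (coeff (symbol_poly k2 a2 F) (k2 + (p + 1)) +
   (\<Sum>n<k2. coeff (symbol_poly k2 a2 F) (k2 - 1 - n) * (of_nat (n + 1) * (if p + 1 \<le> b - (n + 1) then ?C (n + 1) (p + 1) else 0))))))"
  by (rule derivation_multiplier_quadratic[where C = ?C]) (rule sym)
 show ?thesis
  unfolding D
 proof (rule sum.cong[OF refl])
  fix p assume p: "p \<in> {..<k1}"
  have "(\<Sum>n<k2. coeff (symbol_poly k2 a2 F) (k2 - 1 - n) * (of_nat (n + 1) * (if p + 1 \<le> b - (n + 1) then ?C (n + 1) (p + 1) else 0)))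
   = (\<Sum>n<k2. fps_nth (symbol_fps k2 a2 c) (k2 - 1 - n) * (of_nat (n + 1) * ?C (n + 1) (p + 1)))"
   by (rule sum.cong[OF refl]) (use p b in \<open>auto simp: co simp del: of_nat_add of_real_divide of_real_mult\<close>)
  then have "of_nat (p + 1) * (\<Sum>n<k2. coeff (symbol_poly k2 a2 F) (k2 - 1 - n) * (of_nat (n + 1) * (if p + 1 \<le> b - (n + 1) then ?C (n + 1) (p + 1) else 0)))
   = (\<Sum>n<k2. fps_nth (symbol_fps k2 a2 c) (k2 - 1 - n) * of_real (d (p + 1) (n + 1) / (fact p * fact n)))"
   unfolding e[symmetric] by (simp only: sum_distrib_left mult.left_commute)
  moreover have "coeff (symbol_poly k1 a1 F) (k1 - 1 - p) = fps_nth (symbol_fps k1 a1 c) (k1 - 1 - p)"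
   "coeff (symbol_poly k2 a2 F) (k2 + (p + 1)) = fps_nth (symbol_fps k2 a2 c) (k2 + p + 1)"
   using co p b by auto
  ultimately show "coeff (symbol_poly k1 a1 F) (k1 - 1 - p) * (of_nat (p + 1) * (coeff (symbol_poly k2 a2 F) (k2 + (p + 1)) +
    (\<Sum>n<k2. coeff (symbol_poly k2 a2 F) (k2 - 1 - n) * (of_nat (n + 1) * (if p + 1 \<le> b - (n + 1) then ?C (n + 1) (p + 1) else 0))))) =
   fps_nth (symbol_fps k1 a1 c) (k1 - 1 - p) *
    (of_nat (p + 1) * fps_nth (symbol_fps k2 a2 c) (k2 + p + 1) +
     (\<Sum>n<k2. fps_nth (symbol_fps k2 a2 c) (k2 - 1 - n) * of_real (d (p + 1) (n + 1) / (fact p * fact n))))"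
   by (simp only: distrib_left)
 qed
qed

section \<open>Centering, joint moments and the final statement\<close>

subsection \<open>Convergence of moments\<close>

definition shifted_rsum :: "nat => nat => int list => real" where
 "shifted_rsum m k mu = (\<Sum>i<m. real_of_int (expo m mu i) ^ k)"

lemma shifted_psum_of_real: "shifted_psum m k mu = of_real (shifted_rsum m k mu)"
 by (simp add: shifted_psum_def shifted_rsum_def)

definition scaled_psum :: "(nat => real) => nat => (nat \<times> nat => real) => nat \<times> nat => int list => real" where
 "scaled_psum a N \<epsilon> x mu = shifted_rsum (lvl a N (fst x)) (snd x) mu / real N ^ snd x - \<epsilon> x"

lemma pk_eq: "pk a N t k Lam = shifted_rsum (lvl a N t) k (Lam ! (t - 1))"
 by (simp add: pk_def shifted_rsum_def expo_def Let_def)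

lemma Xvar_eq: "Xvar rho n a N x Lam =
  scaled_psum a N (%x. expect rho n a N (pk a N (fst x) (snd x)) / real N ^ snd x) x (Lam ! (fst x - 1))"
 by (simp add: Xvar_def scaled_psum_def pk_eq diff_divide_distrib)

text \<open>Residue form of the covariance, free of eps. It is not visibly symmetric in x and
  y.\<close>

definition cov_coeff :: "(nat => real) => (nat => nat => real) => (nat => real) => nat \<times> nat => nat \<times> nat => complex" where
 "cov_coeff c d a x y = (\<Sum>p<snd x. fps_nth (symbol_fps (snd x) (of_real (a (fst x))) c) (snd x - 1 - p) *
    (of_nat (p + 1) * fps_nth (symbol_fps (snd y) (of_real (a (fst y))) c) (snd y + p + 1) +
     (\<Sum>n<snd y. fps_nth (symbol_fps (snd y) (of_real (a (fst y))) c) (snd y - 1 - n) * of_real (d (p + 1) (n + 1) / (fact p * fact n)))))"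

text \<open>Squares the product while preserving a descending order; used for the domination in
  \<open>infsum_tuples\<close>.\<close>

definition doubled :: "'a list => 'a list" where "doubled xs = concat (map (%x. [x, x]) xs)"

lemma set_doubled: "set (doubled xs) = set xs"
 by (induction xs) (auto simp: doubled_def)

lemma prod_list_doubled: "(\<Prod>x\<leftarrow>doubled xs. f x) = (\<Prod>x\<leftarrow>xs. f x) ^ 2" for f :: "_ => real"
 by (induction xs) (auto simp: doubled_def power2_eq_square)

lemma descending_doubled: "descending xs ==> descending (doubled xs)"
proof (induction xs)
 case (Cons x xs)
 then show ?case using set_doubled[of xs] by (auto simp: descending_def doubled_def)
qed (simp add: descending_def doubled_def)

lemma lvl_limit:
 assumes "0 < a t" shows "(%N. of_nat (lvl a N t) / of_nat N :: complex) \<longlonglongrightarrow> of_real (a t)"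
proof -
 have "(%N. real (lvl a N t) / real N) \<longlonglongrightarrow> a t"
 proof (rule real_tendsto_sandwich)
  show "\<forall>\<^sub>F N in sequentially. a t - 1 / real N \<le> real (lvl a N t) / real N"
   using eventually_gt_at_top[of 0]
  proof eventually_elim
   case (elim N)
   have "a t * real N - 1 \<le> real (lvl a N t)" unfolding lvl_def by linarith
   then have "(a t * real N - 1) / real N \<le> real (lvl a N t) / real N" by (rule divide_right_mono) simp
   then show ?case using elim by (simp add: diff_divide_distrib)
  qed
  show "\<forall>\<^sub>F N in sequentially. real (lvl a N t) / real N \<le> a t"
   using eventually_gt_at_top[of 0]
  proof eventually_elim
   case (elim N)
   have "0 \<le> a t * real N" using assms by simp
   then have "real (lvl a N t) \<le> a t * real N" unfolding lvl_def by linarith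
   then have "real (lvl a N t) / real N \<le> a t * real N / real N" by (rule divide_right_mono) simp
   then show ?case using elim by simp
  qed
  show "(%N. a t - 1 / real N) \<longlonglongrightarrow> a t"
   using tendsto_diff[OF tendsto_const lim_1_over_n] by simp
 qed simp
 then have "(%N. complex_of_real (real (lvl a N t) / real N)) \<longlonglongrightarrow> of_real (a t)" by (rule tendsto_of_real)
 then show ?thesis by simp
qed

text \<open>The expectations used for centering are themselves unknown, so the chain is run twice. A
  single factor centred by \<mu> shows that its expectation is \<mu> + \<kappa> + o(1); then the
  whole list, centred by the true expectations, leads to boson operators whose linear forms vanish
  at the origin.\<close>

lemma moments_descending:
 fixes c :: "nat => real" and d :: "nat => nat => real" and xs :: "(nat \<times> nat) list"
 assumes prob: "!!N. prob_on_GT N (rho N)" and unif: "!!N. sgf_unif_conv N (rho N)"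
  and approp: "appropriate (%N. sgf N (rho N)) c d" and n: "1 \<le> n"
  and a_pos: "!!t. t \<in> {1..n} ==> 0 < a t" and a_mono: "!!t. 1 \<le> t ==> t < n ==> a t \<le> a (t + 1)" and a_last: "a n = 1"
  and xs: "descending xs" "!!x. x \<in> set xs ==> fst x \<in> {1..n} & 1 \<le> snd x"
 shows "(%N. of_real (expect rho n a N (%Lam. \<Prod>x\<leftarrow>xs. Xvar rho n a N x Lam))) \<longlonglongrightarrow> wick (cov_coeff c d a) (rev xs)"
proof -
 have mono: "lvl a N t \<le> lvl a N (t + 1)" if "1 \<le> t" "t < n" for N t
  unfolding lvl_def using a_mono[OF that] by (intro nat_mono floor_mono mult_right_mono) auto
 have mn: "lvl a N n = N" for N by (simp add: lvl_def a_last)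
 \<comment> \<open>The order of vanishing must cover the sum of all k, and the covariance needs snd
   x + snd y <= b even for x = y; twice the sum does both, and the 1 keeps b positive for the empty
   list.\<close>
 define b where "b = 2 * sum_list (map snd xs) + 1"
 define C0 where "C0 = (%r. if r = 0 then 0 else complex_of_real (c r / fact r))"
 define qdl where "qdl = quadratic_limit b (%r s. complex_of_real (d r s / (fact r * fact s)))"
 obtain lam qd D0 where lam: "!!r. lam r \<longlonglongrightarrow> C0 r" and qd: "cv D0 qd qdl" "!!N. indep0 (qd N)"
  and van: "!!N. N \<ge> b ==> N > 0 ==> vanO N (b + 1) (%y. sgf N (rho N) (%i. 1 + y i) -
    exp (of_nat N * linear_part b lam N (psum N y) + qd N (psum N y)))"
  using log_expansion[OF prob unif approp, where b = b] unfolding C0_def qdl_def by blast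
 define E where "E = (%N v. exp (of_nat N * linear_part b lam N v + qd N v))"
 define S where "S = (%x :: nat \<times> nat. symbol_poly (snd x) (of_real (a (fst x))) (limit_symbol b C0))"
 have iq: "indep0 qdl" unfolding qdl_def by (rule indep0_quadratic_limit)
 have Eh: "sepholo M e (%y. E N (psum M y))" for N M e
  unfolding E_def linear_part_def
  by (intro sepholo_exp sepholo_add sepholo_mult sepholo_const sepholo_sum sepholo_psum sepholo_cv[OF qd(1)])
 have p0: "psum M (%_. 0) = (%_. 0)" for M by (auto simp: psum_def fun_eq_iff)
 have E0: "E N (%_. 0) = 1" if "N \<ge> b" for N
 proof -
  have "N > 0" using that by (simp add: b_def)
  from vanO_zero[OF van[OF that this]] show ?thesis using sgf_1[OF prob unif, of N] by (simp add: E_def p0)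
 qed
 let ?ok = "%x :: nat \<times> nat. fst x \<in> {1..n} & 1 \<le> snd x"
 let ?P = "%x \<mu>. \<forall>\<phi> \<phi>' D1. cv D1 \<phi> \<phi>' --> (\<forall>N. indep0 (\<phi> N)) --> indep0 \<phi>' -->
   (\<exists>D \<psi>. cv D \<psi> (%v. multiplier (snd x) (S x) qdl v * \<phi>' v + derivation (snd x) (S x) \<phi>' v) & (\<forall>N. indep0 (\<psi> N)) &
   (\<forall>N y. N > 0 --> distinct_coords (lvl a N (fst x)) y -->
    Dop (snd x) (lvl a N (fst x)) (%y. E N (psum (lvl a N (fst x)) y) * \<phi> N (psum (lvl a N (fst x)) y)) y =
    of_nat N ^ snd x * E N (psum (lvl a N (fst x)) y) *
    (\<psi> N (psum (lvl a N (fst x)) y) + \<mu> N * \<phi> N (psum (lvl a N (fst x)) y))))"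
 have "\<forall>x\<in>{x. ?ok x}. \<exists>\<mu>. ?P x \<mu>"
 proof
  fix x assume "x \<in> {x. ?ok x}"
  then have x: "fst x \<in> {1..n}" "1 \<le> snd x" by auto
  show "\<exists>\<mu>. ?P x \<mu>"
   unfolding E_def S_def by (rule op_step[where m = "%N. lvl a N (fst x)", OF lvl_limit[where a = a and t = "fst x", OF a_pos[OF x(1)]] lam qd iq x(2)])
 qed
 from bchoice[OF this] obtain \<mu> where \<mu>: "\<forall>x\<in>{x. ?ok x}. ?P x (\<mu> x)" ..
 have step: "\<exists>D' \<psi>. cv D' \<psi> (%v. multiplier (snd x) (S x) qdl v * \<phi>' v + derivation (snd x) (S x) \<phi>' v) & (\<forall>N. indep0 (\<psi> N)) &
    (\<forall>N y. N > 0 --> distinct_coords (lvl a N (fst x)) y -->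
     Dop (snd x) (lvl a N (fst x)) (%y. E N (psum (lvl a N (fst x)) y) * \<phi> N (psum (lvl a N (fst x)) y)) y =
     of_nat N ^ snd x * E N (psum (lvl a N (fst x)) y) * (\<psi> N (psum (lvl a N (fst x)) y) + \<mu> x N * \<phi> N (psum (lvl a N (fst x)) y)))"
  if "fst x \<in> {1..n}" "1 \<le> snd x" "cv D \<phi> \<phi>'" "\<forall>N. indep0 (\<phi> N)" "indep0 \<phi>'" for x \<phi> \<phi>' D
 proof -
  have "x \<in> {x. ?ok x}" using that(1,2) by simp
  from \<mu>[THEN bspec, OF this] have "?P x (\<mu> x)" .
  from this[THEN spec, THEN spec, THEN spec, THEN mp, THEN mp, THEN mp, OF that(3-5)] show ?thesis .
 qed
 define T where "T = (%N (g :: int list => complex) lam. of_real (rho N lam) * g lam)"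
 have fT: "finop N (T N)" for N
  unfolding finop_def
 \<comment> \<open>\<open>rho N\<close> vanishes off \<open>GT N\<close>, so dropping signatures of
   weight 0 keeps the support inside \<open>GT N\<close> for every argument.\<close>
 proof (rule exI[of _ "%lam. if rho N lam = 0 then {} else {lam}"], rule exI[of _ "%lam mu. of_real (rho N lam)"], intro allI conjI)
  fix lam
  show "(if rho N lam = 0 then {} else {lam}) \<subseteq> GT N" using prob[of N] by (auto simp: prob_on_GT_def)
 qed (auto simp: T_def)
 have ex: "\<exists>e. expands (GT N) N (T N) e (%y. sgf N (rho N) (%i. 1 + y i))" for N
  using sgf_usum[OF unif, of N] fT[of N] unfolding expands_def T_def by blast
 have tr: "tracks (GT N) (lvl a N n) (b + 1) (T N) (E N) (%v. 1)" if N: "N \<ge> b" for N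
 proof -
  have "N > 0" using N by (simp add: b_def)
  from van[OF N this] have "vanO N (b + 1) (%y. sgf N (rho N) (%i. 1 + y i) - E N (psum N y) * 1)"
   by (simp only: E_def mult_1_right)
  then show ?thesis unfolding tracks_def mn using ex[of N] by blast
 qed
 have sm: "(%lam. T N (cexp (lvl a N) (%x mu. of_real (scaled_psum a N \<epsilon> x mu)) n ys) lam) summable_on GT N"
  if "descending ys" "!!x. x \<in> set ys ==> ?ok x" for N \<epsilon> ys
 proof -
  obtain e where e: "expands (GT N) (lvl a N n) (T N) e (%y. sgf N (rho N) (%i. 1 + y i))"
   using ex[of N] unfolding mn by blast
  have X: "(%x mu. complex_of_real (scaled_psum a N \<epsilon> x mu)) =
    (%x mu. (1 / of_nat N ^ snd x) * shifted_psum (lvl a N (fst x)) (snd x) mu - of_real (\<epsilon> x))"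
   by (simp add: fun_eq_iff scaled_psum_def shifted_psum_of_real)
  show ?thesis unfolding X
   by (rule chain_summable[where m = "lvl a N" and n = n and t = n, OF mono n le_refl that(1) _ e]) (use that(2) in auto)
 qed
 have tup: "complex_of_real (expect rho n a N (%Lam. \<Prod>x\<leftarrow>ys. scaled_psum a N \<epsilon> x (Lam ! (fst x - 1)))) = V"
  if ys: "descending ys" "!!x. x \<in> set ys ==> ?ok x"
   and V: "((%lam. T N (cexp (lvl a N) (%x mu. of_real (scaled_psum a N \<epsilon> x mu)) n ys) lam) has_sum V) (GT N)" for N \<epsilon> ys V
 proof -
  have "complex_of_real (\<Sum>\<^sub>\<infinity>L\<in>{L. length L = n & (\<forall>t\<in>{1..n}. L ! (t - 1) \<in> GT (lvl a N t))}.
    rho N (L ! (n - 1)) * weight (lvl a N) n L * (\<Prod>x\<leftarrow>ys. scaled_psum a N \<epsilon> x (L ! (fst x - 1)))) = V"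
  proof (rule infsum_tuples[where m = "lvl a N" and zs = "doubled ys"])
   show "0 \<le> rho N lam" for lam using prob[of N] by (simp add: prob_on_GT_def)
   show "((%lam. of_real (rho N lam) * cexp (lvl a N) (%x mu. of_real (scaled_psum a N \<epsilon> x mu)) n ys lam) has_sum V) (GT (lvl a N n))"
    using V by (simp add: mn T_def)
   show "(%lam. of_real (rho N lam) * cexp (lvl a N) (%x mu. of_real (scaled_psum a N \<epsilon> x mu)) n [] lam) summable_on (GT (lvl a N n))"
    using sm[of "[]" N \<epsilon>] by (simp add: mn T_def descending_def)
   show "(%lam. of_real (rho N lam) * cexp (lvl a N) (%x mu. of_real (scaled_psum a N \<epsilon> x mu)) n (doubled ys) lam) summable_on (GT (lvl a N n))"
    using sm[OF descending_doubled[OF ys(1)], of N \<epsilon>] ys(2) by (simp add: mn T_def set_doubled)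
   show "fst x \<in> {1..n}" if "x \<in> set ys" for x using ys(2)[OF that] ..
  qed (assumption | rule mono n prod_list_doubled)+
  then show ?thesis by (simp add: expect_def tuples_def tuple_prob_def weight_def)
 qed
 define \<kappa> where "\<kappa> = (%x. multiplier (snd x) (S x) qdl (%_. 0))"
 \<comment> \<open>The first run, with one factor: the limiting operator applied to 1 has the value
   \<kappa> at the origin.\<close>
 have single: "\<exists>\<psi>. \<psi> \<longlonglongrightarrow> \<kappa> x & (\<forall>N\<ge>b. of_real (expect rho n a N (pk a N (fst x) (snd x)) / real N ^ snd x) = \<psi> N + \<mu> x N)"
  if x: "x \<in> set xs" for x
 proof -
  have xok: "?ok x" using xs(2)[OF x] .
  have xb: "sum_list (map snd [x]) < b + 1" using member_le_sum_list[of "snd x" "map snd xs"] x by (simp add: b_def)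
  let ?X = "%N x mu. 1 / of_nat N ^ snd x * shifted_psum (lvl a N (fst x)) (snd x) mu - \<mu> x N"
  let ?L = "%x \<phi> v. multiplier (snd x) (S x) qdl v * \<phi> v + derivation (snd x) (S x) \<phi> v + (- 0) * \<phi> v"
  have "\<exists>D \<psi>. cv D \<psi> (limit_chain ?L [x] (%v. 1)) &
    (\<forall>N\<ge>b. ((%lam. T N (cexp (lvl a N) (?X N) n [x]) lam) has_sum \<psi> N (%_. 0)) (GT N))"
  proof (rule chain_limit[where n = n and ?N0.0 = b and E = E and t = n and b = "b + 1" and \<phi> = "%N v. 1" and D = 0
     and m = "lvl a" and \<beta> = \<mu> and \<mu> = \<mu> and \<kappa> = "%_. 0" and S = S and qdl = qdl])
   show "0 < b" by (simp add: b_def)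
   show "(%N. \<mu> x N - \<mu> x N) \<longlonglongrightarrow> - 0" for x by simp
   show "cv 0 (%N v. 1) (%v. 1)" by (rule cv_scalar)
   show "tracks (GT N) (lvl a N n) (b + 1) (T N) (E N) (%v. 1)" if "b \<le> N" for N by (rule tr[OF that])
   show "descending [x]" by (simp add: descending_def)
   show "1 \<le> fst y & fst y \<le> n & 1 \<le> snd y" if "y \<in> set [x]" for y using that xok by auto
   show "\<forall>N. indep0 (%v. 1)" "indep0 (%v. 1)" by (simp_all add: indep0_def)
  qed (assumption | rule mono Eh E0 step iq n le_refl xb)+
  then obtain D \<psi> where \<psi>: "cv D \<psi> (limit_chain ?L [x] (%v. 1))"
   and hs: "!!N. N\<ge>b ==> ((%lam. T N (cexp (lvl a N) (?X N) n [x]) lam) has_sum \<psi> N (%_. 0)) (GT N)" by blast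
  have "(%N. \<psi> N (%_. 0)) \<longlonglongrightarrow> \<kappa> x"
   using cv_tendsto[OF \<psi>, of "%_. 0"] by (simp add: \<kappa>_def derivation_const)
  moreover have "of_real (expect rho n a N (pk a N (fst x) (snd x)) / real N ^ snd x) = \<psi> N (%_. 0) + \<mu> x N" if N: "N \<ge> b" for N
  proof -
   let ?Y = "%x mu. complex_of_real (scaled_psum a N (%_. 0) x mu)"
   have "((%lam. complex_of_real (rho N lam)) has_sum of_real 1) (GT N)"
    by (rule has_sum_of_real) (use prob[of N] in \<open>simp add: prob_on_GT_def\<close>)
   from has_sum_add[OF hs[OF N] has_sum_cmult_right[OF this, of "\<mu> x N"]]
   have "((%lam. T N (cexp (lvl a N) (?X N) n [x]) lam + \<mu> x N * of_real (rho N lam)) has_sum (\<psi> N (%_. 0) + \<mu> x N)) (GT N)" by simp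
   then have "((%lam. T N (cexp (lvl a N) ?Y n [x]) lam) has_sum (\<psi> N (%_. 0) + \<mu> x N)) (GT N)"
   proof (rule has_sum_cong[THEN iffD1, rotated])
    fix lam assume "lam \<in> GT N"
    then have c1: "cexp (lvl a N) ?Y n [] lam = 1"
     by (intro cexp_nil[where n = n and m = "lvl a N"]) (use mono n mn in auto)
    have "cexp (lvl a N) ?Y n [x] lam = cexp (lvl a N) (?X N) n [x] lam + \<mu> x N * cexp (lvl a N) ?Y n [] lam"
     by (simp add: cexp_def scaled_psum_def shifted_psum_of_real algebra_simps sum.distrib sum_distrib_left sum_subtractf)
    then show "T N (cexp (lvl a N) (?X N) n [x]) lam + \<mu> x N * of_real (rho N lam) = T N (cexp (lvl a N) ?Y n [x]) lam"
     unfolding c1 by (simp add: T_def algebra_simps)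
   qed
   from tup[OF _ _ this] xok
   have "complex_of_real (expect rho n a N (%Lam. scaled_psum a N (%_. 0) x (Lam ! (fst x - 1)))) = \<psi> N (%_. 0) + \<mu> x N"
    by (simp add: descending_def)
   moreover have "expect rho n a N (%Lam. scaled_psum a N (%_. 0) x (Lam ! (fst x - 1))) = expect rho n a N (pk a N (fst x) (snd x)) / real N ^ snd x"
    unfolding expect_def divide_inverse infsum_cmult_left'[symmetric] by (simp add: scaled_psum_def pk_eq divide_inverse mult.assoc)
   ultimately show ?thesis by simp
  qed
  ultimately show ?thesis by blast
 qed
 \<comment> \<open>Off the list any centering with the right limit will do; \<mu> + \<kappa> makes
   the hypothesis of \<open>chain_limit\<close> hold at every index.\<close>
 define \<beta> where "\<beta> = (%x N. if x \<in> set xs then complex_of_real (expect rho n a N (pk a N (fst x) (snd x)) / real N ^ snd x) else \<mu> x N + \<kappa> x)"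
 have lim: "(%N. \<mu> x N - \<beta> x N) \<longlonglongrightarrow> - \<kappa> x" for x
 proof (cases "x \<in> set xs")
  case True
  then obtain \<psi> where \<psi>: "\<psi> \<longlonglongrightarrow> \<kappa> x" "!!N. N\<ge>b ==> of_real (expect rho n a N (pk a N (fst x) (snd x)) / real N ^ snd x) = \<psi> N + \<mu> x N"
   using single by blast
  have "\<forall>\<^sub>F N in sequentially. - \<psi> N = \<mu> x N - \<beta> x N"
   using eventually_ge_at_top[of b] by eventually_elim (use \<psi>(2) True in \<open>simp add: \<beta>_def\<close>)
  from Lim_transform_eventually[OF tendsto_minus[OF \<psi>(1)] this] show ?thesis .
 qed (simp add: \<beta>_def)
 let ?L = "%x \<phi> v. multiplier (snd x) (S x) qdl v * \<phi> v + derivation (snd x) (S x) \<phi> v + (- \<kappa> x) * \<phi> v"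
 let ?X = "%N x mu. 1 / of_nat N ^ snd x * shifted_psum (lvl a N (fst x)) (snd x) mu - \<beta> x N"
 have "\<exists>D \<psi>. cv D \<psi> (limit_chain ?L xs (%v. 1)) &
   (\<forall>N\<ge>b. ((%lam. T N (cexp (lvl a N) (?X N) n xs) lam) has_sum \<psi> N (%_. 0)) (GT N))"
 proof (rule chain_limit[where n = n and ?N0.0 = b and E = E and t = n and b = "b + 1" and \<phi> = "%N v. 1" and D = 0
    and m = "lvl a" and \<beta> = \<beta> and \<mu> = \<mu> and \<kappa> = \<kappa> and S = S and qdl = qdl])
  show "0 < b" by (simp add: b_def)
  show "cv 0 (%N v. 1) (%v. 1)" by (rule cv_scalar)
  show "tracks (GT N) (lvl a N n) (b + 1) (T N) (E N) (%v. 1)" if "b \<le> N" for N by (rule tr[OF that])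
  show "1 \<le> fst x & fst x \<le> n & 1 \<le> snd x" if "x \<in> set xs" for x using xs(2)[OF that] by auto
  show "\<forall>N. indep0 (%v. 1)" "indep0 (%v. 1)" by (simp_all add: indep0_def)
  show "sum_list (map snd xs) < b + 1" by (simp add: b_def)
 qed (assumption | rule mono Eh E0 step iq n le_refl lim xs(1))+
 then obtain D \<psi> where \<psi>: "cv D \<psi> (limit_chain ?L xs (%v. 1))"
  and hs: "!!N. N\<ge>b ==> ((%lam. T N (cexp (lvl a N) (?X N) n xs) lam) has_sum \<psi> N (%_. 0)) (GT N)" by blast
 have val: "\<psi> N (%_. 0) = of_real (expect rho n a N (%Lam. \<Prod>x\<leftarrow>xs. Xvar rho n a N x Lam))" if N: "N \<ge> b" for N
 proof -
  let ?\<epsilon> = "%x. expect rho n a N (pk a N (fst x) (snd x)) / real N ^ snd x"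
  have "cexp (lvl a N) (?X N) n xs = cexp (lvl a N) (%x mu. of_real (scaled_psum a N ?\<epsilon> x mu)) n xs"
  proof (rule ext)
   fix lam
   have "map (%x. ?X N x (L ! (fst x - 1))) xs = map (%x. of_real (scaled_psum a N ?\<epsilon> x (L ! (fst x - 1)))) xs" for L
    by (rule map_cong[OF refl]) (simp add: \<beta>_def scaled_psum_def shifted_psum_of_real)
   then show "cexp (lvl a N) (?X N) n xs lam = cexp (lvl a N) (%x mu. of_real (scaled_psum a N ?\<epsilon> x mu)) n xs lam"
    unfolding cexp_def by (simp only:)
  qed
  with hs[OF N] have "((%lam. T N (cexp (lvl a N) (%x mu. of_real (scaled_psum a N ?\<epsilon> x mu)) n xs) lam) has_sum \<psi> N (%_. 0)) (GT N)"
   by (simp only:)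
  from tup[OF xs this] show ?thesis by (simp only: Xvar_eq)
 qed
 let ?M = "%x v. multiplier (snd x) (S x) qdl v - \<kappa> x"
 let ?K = "%x y. derivation (snd x) (S x) (?M y) (%_. 0)"
 have dsym: "d r s = d s r" if "1 \<le> r" "1 \<le> s" for r s by (rule second_order_symmetric[OF prob unif approp that])
 \<comment> \<open>\<open>?M y\<close> is affine in v, so its derivation does not depend on v and
   may be read off at the origin.\<close>
 have const: "derivation (snd x) (S x) (?M y) v = ?K x y" for x y v
 proof -
  have sym: "complex_of_real (d r s / (fact r * fact s)) = of_real (d s r / (fact s * fact r))" if "1 \<le> r" "1 \<le> s" for r s
   using dsym[OF that] by (simp add: mult.commute)
  show ?thesis unfolding qdl_def
   using derivation_multiplier_quadratic[where C = "%r s. complex_of_real (d r s / (fact r * fact s))", OF sym] by presburger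
 qed
 have "limit_chain ?L xs (%v. 1) = foldr (boson ?M snd S) (rev xs) (%v. 1)"
 proof -
  have "?L = boson ?M snd S" by (simp add: fun_eq_iff boson_def algebra_simps)
  then show ?thesis by (simp only: limit_chain_foldr)
 qed
 moreover have "foldr (boson ?M snd S) (rev xs) (%v. 1) (%_. 0) = wick ?K (rev xs)"
 proof (rule boson_wick)
  show "polyn (?M x)" for x unfolding qdl_def by (intro polyn_diff polyn_const polyn_multiplier polyn_quadratic_limit)
  show "?M x (%_. 0) = 0" for x by (simp add: \<kappa>_def)
  show "derivation (snd x) (S x) (?M y) v = ?K x y" for x y v by (rule const)
 qed
 moreover have "wick ?K (rev xs) = wick (cov_coeff c d a) (rev xs)"
 proof (rule wick_cong_ascending[where R = "%_ _. True" and A = "set xs"])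
  fix x y assume "x \<in> set xs" "y \<in> set xs"
  then have "snd x \<le> sum_list (map snd xs)" "snd y \<le> sum_list (map snd xs)" by (auto intro!: member_le_sum_list)
  then have "snd x + snd y \<le> b" by (simp add: b_def)
  from covariance_coefficients[OF dsym this, where c = c and ?a1.0 = "of_real (a (fst x))" and ?a2.0 = "of_real (a (fst y))" and \<kappa> = "\<kappa> y" and v = "%_. 0"]
  show "?K x y = cov_coeff c d a x y" unfolding S_def qdl_def C0_def cov_coeff_def .
 qed (auto simp: sorted_wrt_iff_nth_less)
 ultimately have "(%N. \<psi> N (%_. 0)) \<longlonglongrightarrow> wick (cov_coeff c d a) (rev xs)"
  using cv_tendsto[OF \<psi>, of "%_. 0"] by (simp only:)
 then show ?thesis
  by (rule Lim_transform_eventually) (rule eventually_mono[OF eventually_ge_at_top[of b]], rule val)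
qed

theorem mainTheorem2:
  fixes rho :: "nat \<Rightarrow> int list \<Rightarrow> real"
    and c :: "nat \<Rightarrow> real" and d :: "nat \<Rightarrow> nat \<Rightarrow> real"
    and n :: nat and a :: "nat \<Rightarrow> real"
  assumes prob: "\<And>N. prob_on_GT N (rho N)"
    and unif: "\<And>N. sgf_unif_conv N (rho N)"
    and approp: "appropriate (\<lambda>N. sgf N (rho N)) c d"
    and n_pos: "n \<ge> 1"
    and a_pos: "0 < a 1"
    and a_mono: "\<And>t. 1 \<le> t \<Longrightarrow> t < n \<Longrightarrow> a t \<le> a (t + 1)"
    and a_last: "a n = 1"
  shows "\<exists>eps0>0. \<forall>eps. 0 < eps \<and> eps < eps0 \<longrightarrow>
           (\<forall>idx :: (nat \<times> nat) list. (\<forall>tk\<in>set idx. fst tk \<in> {1..n} \<and> snd tk \<ge> 1) \<longrightarrow>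
              (\<lambda>N. of_real (expect rho n a N (\<lambda>Lam. \<Prod>tk\<leftarrow>idx. Xvar rho n a N tk Lam)))
                \<longlonglongrightarrow> wick (cov_lim c d a eps) idx)"
proof -
 have ap: "0 < a t" if "t \<in> {1..n}" for t
 proof -
  have "1 \<le> t" "t \<le> n" using that by auto
  then show ?thesis
  proof (induction t rule: dec_induct)
   case base show ?case by (rule a_pos)
  next
   case (step t)
   then show ?case using a_mono[of t] by simp
  qed
 qed
 note moments = moments_descending[OF prob unif approp n_pos ap a_mono a_last]
 obtain r1 r2 where r1: "r1 > 0" "!!x::complex. cmod (x - 1) < r1 ==> summable (%k. of_real (c (k + 1) / fact k) * (x - 1) ^ k)"
  and r2: "r2 > 0" "!!x y::complex. cmod (x - 1) < r2 ==> cmod (y - 1) < r2 ==>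
     (%(k, l). of_real (d (k + 1) (l + 1) / (fact k * fact l)) * (x - 1) ^ k * (y - 1) ^ l) summable_on UNIV"
  using approp unfolding appropriate_def by blast
 let ?ok = "%x :: nat \<times> nat. fst x \<in> {1..n} & 1 \<le> snd x"
 \<comment> \<open>At equal levels both orders of the two factors are descending, and the product is
   the same, so both residue expressions are the limit of the same moments.\<close>
 have sym: "cov_coeff c d a x y = cov_coeff c d a y x" if ok: "?ok x" "?ok y" and eq: "fst x = fst y" for x y
 proof -
  have "(%N. of_real (expect rho n a N (%Lam. \<Prod>z\<leftarrow>[x, y]. Xvar rho n a N z Lam))) \<longlonglongrightarrow> wick (cov_coeff c d a) (rev [x, y])"
   by (rule moments) (use ok eq in \<open>auto simp: descending_def\<close>)
  moreover have "(%N. of_real (expect rho n a N (%Lam. \<Prod>z\<leftarrow>[y, x]. Xvar rho n a N z Lam))) \<longlonglongrightarrow> wick (cov_coeff c d a) (rev [y, x])"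
   by (rule moments) (use ok eq in \<open>auto simp: descending_def\<close>)
  ultimately have "wick (cov_coeff c d a) (rev [x, y]) = wick (cov_coeff c d a) (rev [y, x])"
   by (intro LIMSEQ_unique) (auto simp: mult.commute)
  then show ?thesis by simp
 qed
 show ?thesis
 \<comment> \<open>The outer circle has radius 2 eps; a third of the common radius of convergence
   leaves room for both circles.\<close>
 proof (intro exI[of _ "min r1 r2 / 3"] conjI allI impI)
  show "0 < min r1 r2 / 3" using r1 r2 by simp
  fix eps idx assume eps: "0 < eps & eps < min r1 r2 / 3" and idx: "\<forall>tk\<in>set (idx :: (nat \<times> nat) list). fst tk \<in> {1..n} & snd tk \<ge> 1"
  have cf: "cov_formula c d a eps (fst x) (snd x) (fst y) (snd y) = cov_coeff c d a x y" if "?ok x" "?ok y" for x y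
   unfolding cov_coeff_def
   by (rule cov_formula_eq[where r = "min r1 r2"]) (use r1 r2 eps that ap in auto)
  \<comment> \<open>Zero outside the admissible indices, because \<open>wick_perm\<close> asks for
    symmetry at all pairs.\<close>
  define C where "C = (%x y. if ?ok x & ?ok y then cov_lim c d a eps x y else 0)"
  have Csym: "C x y = C y x" for x y
   unfolding C_def cov_lim_def using sym[of x y] cf[of x y] cf[of y x] by auto
  have CA: "wick C ys = wick (cov_lim c d a eps) ys" if "set ys \<subseteq> {x. ?ok x}" for ys
   by (rule wick_cong_ascending[where R = "%_ _. True" and A = "{x. ?ok x}"]) (use that in \<open>auto simp: C_def sorted_wrt_iff_nth_less\<close>)
  \<comment> \<open>\<open>moments_descending\<close> takes the factors from the top level down and
    returns \<open>wick\<close> of the reversed list, hence an ascending sort that is reversed. In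
    ascending order \<open>cov_lim\<close> always takes its first branch.\<close>
  let ?ys = "sort_key fst idx"
  have ys: "sorted_wrt (%x y. fst x \<le> fst y) ?ys" "set ?ys = set idx" "mset ?ys = mset idx"
   using sorted_sort_key[of fst idx] by (auto simp: sorted_map)
  have "(%N. of_real (expect rho n a N (%Lam. \<Prod>tk\<leftarrow>rev ?ys. Xvar rho n a N tk Lam))) \<longlonglongrightarrow> wick (cov_coeff c d a) (rev (rev ?ys))"
   by (rule moments) (use ys idx in \<open>auto simp: descending_def sorted_wrt_rev\<close>)
  moreover have "(\<Prod>tk\<leftarrow>rev ?ys. f tk) = (\<Prod>tk\<leftarrow>idx. f tk)" for f :: "nat \<times> nat => real"
  proof -
   have "mset (map f (rev ?ys)) = mset (map f idx)" using ys(3) by simp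
   then show ?thesis by (metis prod_mset_prod_list)
  qed
  moreover have "wick (cov_coeff c d a) ?ys = wick (cov_lim c d a eps) ?ys"
   by (rule wick_cong_ascending[OF _ ys(1), where A = "set idx"]) (use idx cf ys(2) in \<open>auto simp: cov_lim_def\<close>)
  moreover have "wick (cov_lim c d a eps) ?ys = wick (cov_lim c d a eps) idx"
  proof -
   have sub: "set idx \<subseteq> {x. ?ok x}" "set ?ys \<subseteq> {x. ?ok x}" using idx ys(2) by auto
   have "wick C ?ys = wick C idx" by (rule wick_perm[where C = C]) (rule Csym, rule ys(3))
   then show ?thesis unfolding CA[OF sub(1)] CA[OF sub(2)] .
  qed
  ultimately show "(%N. of_real (expect rho n a N (%Lam. \<Prod>tk\<leftarrow>idx. Xvar rho n a N tk Lam))) \<longlonglongrightarrow> wick (cov_lim c d a eps) idx"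
   by simp
 qed
qed

end
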